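(* Let $k$ be a field and let $H$ be a finite dimensional Hopf algebra over $k$. Then any two lower subnormal series of $H$ admit equivalent refinements (that is, each of the two series has a refinement such that the two refinements are equivalent).
   Context: A Hopf subalgebra $K$ of a Hopf algebra $L$ is normal in $L$ if it is stable under both adjoint actions of $L$: $h_{(1)}a\mathcal S(h_{(2)})\in K$ and $\mathcal S(h_{(1)})ah_{(2)}\in K$ for all $a\in K$, $h\in L$; then, with $K^+=K\cap\ker\epsilon$, $L/LK^+$ is a quotient Hopf algebra of $L$. A lower subnormal series of $H$ is a series of Hopf subalgebras $k = H_{n} \subseteq H_{n-1}\subseteq \dots\subseteq H_1 \subseteq H_0 = H$ (repetitions allowed) with $H_{i+1}$ normal in $H_i$ for all $i$. Its factors are the quotient Hopf algebras $H_i/H_iH_{i+1}^+$, $i = 0, \dots, n-1$. A refinement of this series is a lower subnormal series $k = H'_{m} \subseteq H'_{m-1} \subseteq \dots\subseteq H'_0 = H$ such that for all $0<i<n$ there exists $0<N_i<m$ with $N_1<N_2<\dots<N_{n-1}$ and $H_i=H'_{N_i}$. Two lower subnormal series $k = H_{n} \subseteq \dots\subseteq H_0 = H$ and $k = H'_{m} \subseteq\dots\subseteq H'_0 = H$ are equivalent if there exists a bijection $f: \{0, \dots, n-1\} \to \{0, \dots, m-1\}$ such that $H_{i}/H_{i}H_{i+1}^+ \cong H'_{f(i)}/H'_{f(i)}(H'_{f(i)+1})^+$ as Hopf algebras for all $i$. *)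

theory Defs
  imports
    "HOL-Algebra.Free_Abelian_Groups"
    "HOL-Algebra.Ideal_Product"
    "HOL-Algebra.QuotRing"
    "Jordan_Normal_Form.Missing_VectorSpace"
begin

section \<open>Tensor products\<close>

text \<open>
  The tensor product of two \<open>K\<close>-modules is the quotient of the free abelian group on
  \<open>carrier V \<times> carrier W\<close> by the subgroup generated by the biadditivity and balancing relations.
  Its elements are cosets of that subgroup.
\<close>

type_synonym ('v, 'w) tensor = "(('v \<times> 'w) \<Rightarrow>\<^sub>0 int) set"

definition tensor_relators ::
    "('k, 'r) ring_scheme \<Rightarrow> ('k, 'v, 'x) module_scheme \<Rightarrow> ('k, 'w, 'y) module_scheme
      \<Rightarrow> (('v \<times> 'w) \<Rightarrow>\<^sub>0 int) set" where
  "tensor_relators K V W =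
     {frag_of (v \<oplus>\<^bsub>V\<^esub> v', w) - frag_of (v, w) - frag_of (v', w) | v v' w.
        v \<in> carrier V \<and> v' \<in> carrier V \<and> w \<in> carrier W} \<union>
     {frag_of (v, w \<oplus>\<^bsub>W\<^esub> w') - frag_of (v, w) - frag_of (v, w') | v w w'.
        v \<in> carrier V \<and> w \<in> carrier W \<and> w' \<in> carrier W} \<union>
     {frag_of (c \<odot>\<^bsub>V\<^esub> v, w) - frag_of (v, c \<odot>\<^bsub>W\<^esub> w) | c v w.
        c \<in> carrier K \<and> v \<in> carrier V \<and> w \<in> carrier W}"

definition tensor_relations ::
    "('k, 'r) ring_scheme \<Rightarrow> ('k, 'v, 'x) module_scheme \<Rightarrow> ('k, 'w, 'y) module_scheme
      \<Rightarrow> (('v \<times> 'w) \<Rightarrow>\<^sub>0 int) set" where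
  "tensor_relations K V W =
     generate (free_Abelian_group (carrier V \<times> carrier W)) (tensor_relators K V W)"

definition tensor_group ::
    "('k, 'r) ring_scheme \<Rightarrow> ('k, 'v, 'x) module_scheme \<Rightarrow> ('k, 'w, 'y) module_scheme
      \<Rightarrow> ('v, 'w) tensor monoid" where
  "tensor_group K V W =
     free_Abelian_group (carrier V \<times> carrier W) Mod tensor_relations K V W"

definition pure_tensor ::
    "('k, 'r) ring_scheme \<Rightarrow> ('k, 'v, 'x) module_scheme \<Rightarrow> ('k, 'w, 'y) module_scheme
      \<Rightarrow> 'v \<Rightarrow> 'w \<Rightarrow> ('v, 'w) tensor" where
  "pure_tensor K V W v w =
     tensor_relations K V W #>\<^bsub>free_Abelian_group (carrier V \<times> carrier W)\<^esub> frag_of (v, w)"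

text \<open>
  The homomorphism \<open>v \<otimes> w \<mapsto> \<beta> v w\<close> induced by a biadditive balanced map \<open>\<beta>\<close> into an abelian
  group \<open>G\<close>, written multiplicatively; for such \<open>\<beta>\<close> the choice of the representative \<open>z\<close> of the
  coset \<open>t\<close> is irrelevant.  If \<open>t\<close> is a value \<open>\<Delta> h\<close> of a comultiplication, then
  \<open>tensor_lift G \<beta> t\<close> is the Sweedler sum written \<open>\<beta> h\<^bsub>(1)\<^esub> h\<^bsub>(2)\<^esub>\<close>, taken in \<open>G\<close>.
\<close>

definition tensor_lift ::
    "('g, 'm) monoid_scheme \<Rightarrow> ('v \<Rightarrow> 'w \<Rightarrow> 'g) \<Rightarrow> ('v, 'w) tensor \<Rightarrow> 'g" where
  "tensor_lift G \<beta> t =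
     (let z = (SOME z. z \<in> t)
      in finprod G (\<lambda>(v, w). \<beta> v w [^]\<^bsub>G\<^esub> Poly_Mapping.lookup z (v, w)) (Poly_Mapping.keys z))"

text \<open>
  The multiplication and unit below are those of the tensor product of two algebras; they are
  meaningful only if \<open>V\<close> and \<open>W\<close> are algebras.
\<close>

definition tensor ::
    "('k, 'r) ring_scheme \<Rightarrow> ('k, 'v, 'x) module_scheme \<Rightarrow> ('k, 'w, 'y) module_scheme
      \<Rightarrow> ('k, ('v, 'w) tensor) module" where
  "tensor K V W =
     \<lparr>carrier = carrier (tensor_group K V W),
      mult = (\<lambda>s t. tensor_lift (tensor_group K V W)
                (\<lambda>a b. tensor_lift (tensor_group K V W)
                   (\<lambda>c d. pure_tensor K V W (a \<otimes>\<^bsub>V\<^esub> c) (b \<otimes>\<^bsub>W\<^esub> d)) t) s),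
      one = pure_tensor K V W \<one>\<^bsub>V\<^esub> \<one>\<^bsub>W\<^esub>,
      zero = \<one>\<^bsub>tensor_group K V W\<^esub>,
      add = mult (tensor_group K V W),
      smult = (\<lambda>c. tensor_lift (tensor_group K V W) (\<lambda>v w. pure_tensor K V W (c \<odot>\<^bsub>V\<^esub> v) w))\<rparr>"

definition tensor_map ::
    "('k, 'r) ring_scheme \<Rightarrow> ('k, 'v, 'x) module_scheme \<Rightarrow> ('k, 'w, 'y) module_scheme
      \<Rightarrow> ('a \<Rightarrow> 'v) \<Rightarrow> ('b \<Rightarrow> 'w) \<Rightarrow> ('a, 'b) tensor \<Rightarrow> ('v, 'w) tensor" where
  \<comment> \<open>\<open>f \<otimes> g\<close>, with values in \<open>V \<otimes> W\<close>\<close>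
  "tensor_map K V W f g =
     tensor_lift (add_monoid (tensor K V W)) (\<lambda>a b. pure_tensor K V W (f a) (g b))"

definition tensor_assoc ::
    "('k, 'r) ring_scheme \<Rightarrow> ('k, 'u, 'x) module_scheme \<Rightarrow> ('k, 'v, 'y) module_scheme
      \<Rightarrow> ('k, 'w, 'z) module_scheme
      \<Rightarrow> (('u, 'v) tensor, 'w) tensor \<Rightarrow> ('u, ('v, 'w) tensor) tensor" where
  \<comment> \<open>the canonical map \<open>(U \<otimes> V) \<otimes> W \<rightarrow> U \<otimes> (V \<otimes> W)\<close>\<close>
  "tensor_assoc K U V W =
     tensor_lift (add_monoid (tensor K U (tensor K V W)))
       (\<lambda>t w. tensor_lift (add_monoid (tensor K U (tensor K V W)))
          (\<lambda>u v. pure_tensor K U (tensor K V W) u (pure_tensor K V W v w)) t)"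


section \<open>Hopf algebras\<close>

record ('k, 'h) hopf = "('k, 'h) module" +
  comult :: "'h \<Rightarrow> ('h, 'h) tensor"
  counit :: "'h \<Rightarrow> 'k"
  antipode :: "'h \<Rightarrow> 'h"

locale hopf_algebra = vectorspace K H + H?: ring H
  for K :: "('k, 'r) ring_scheme" and H :: "('k, 'h, 's) hopf_scheme" +
  assumes smult_mult_left:
      "\<lbrakk>c \<in> carrier K; x \<in> carrier H; y \<in> carrier H\<rbrakk> \<Longrightarrow>
        (c \<odot>\<^bsub>H\<^esub> x) \<otimes>\<^bsub>H\<^esub> y = c \<odot>\<^bsub>H\<^esub> (x \<otimes>\<^bsub>H\<^esub> y)"
    and smult_mult_right:
      "\<lbrakk>c \<in> carrier K; x \<in> carrier H; y \<in> carrier H\<rbrakk> \<Longrightarrow>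
        x \<otimes>\<^bsub>H\<^esub> (c \<odot>\<^bsub>H\<^esub> y) = c \<odot>\<^bsub>H\<^esub> (x \<otimes>\<^bsub>H\<^esub> y)"
    and comult_linear: "comult H \<in> module_hom K H (tensor K H H)"
    and comult_ring_hom: "comult H \<in> ring_hom H (tensor K H H)"
    and counit_ring_hom: "counit H \<in> ring_hom H K"
    and counit_smult:
      "\<lbrakk>c \<in> carrier K; x \<in> carrier H\<rbrakk> \<Longrightarrow> counit H (c \<odot>\<^bsub>H\<^esub> x) = c \<otimes>\<^bsub>K\<^esub> counit H x"
    and antipode_linear: "antipode H \<in> module_hom K H H"
    and coassoc:
      "h \<in> carrier H \<Longrightarrow>
        tensor_assoc K H H H (tensor_map K (tensor K H H) H (comult H) (\<lambda>x. x) (comult H h)) =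
        tensor_map K H (tensor K H H) (\<lambda>x. x) (comult H) (comult H h)"
    and counit_left:
      "h \<in> carrier H \<Longrightarrow>
        tensor_lift (add_monoid H) (\<lambda>x y. counit H x \<odot>\<^bsub>H\<^esub> y) (comult H h) = h"
    and counit_right:
      "h \<in> carrier H \<Longrightarrow>
        tensor_lift (add_monoid H) (\<lambda>x y. counit H y \<odot>\<^bsub>H\<^esub> x) (comult H h) = h"
    and antipode_left:
      "h \<in> carrier H \<Longrightarrow>
        tensor_lift (add_monoid H) (\<lambda>x y. antipode H x \<otimes>\<^bsub>H\<^esub> y) (comult H h) =
        counit H h \<odot>\<^bsub>H\<^esub> \<one>\<^bsub>H\<^esub>"
    and antipode_right:
      "h \<in> carrier H \<Longrightarrow>
        tensor_lift (add_monoid H) (\<lambda>x y. x \<otimes>\<^bsub>H\<^esub> antipode H y) (comult H h) =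
        counit H h \<odot>\<^bsub>H\<^esub> \<one>\<^bsub>H\<^esub>"

definition hopf_hom ::
    "('k, 'r) ring_scheme \<Rightarrow> ('k, 'a, 's) hopf_scheme \<Rightarrow> ('k, 'b, 't) hopf_scheme
      \<Rightarrow> ('a \<Rightarrow> 'b) set" where
  "hopf_hom K A B =
     {f. f \<in> ring_hom A B \<and> f \<in> module_hom K A B \<and>
         (\<forall>x\<in>carrier A. comult B (f x) = tensor_map K B B f f (comult A x) \<and>
                        counit B (f x) = counit A x \<and>
                        antipode B (f x) = f (antipode A x))}"

definition hopf_isomorphic ::
    "('k, 'r) ring_scheme \<Rightarrow> ('k, 'a, 's) hopf_scheme \<Rightarrow> ('k, 'b, 't) hopf_scheme \<Rightarrow> bool" where
  "hopf_isomorphic K A B \<longleftrightarrow> (\<exists>f\<in>hopf_hom K A B. bij_betw f (carrier A) (carrier B))"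


section \<open>Hopf subalgebras and quotients\<close>

text \<open>
  The condition \<open>\<Delta> A \<subseteq> A \<otimes> A\<close> refers to the image of \<open>A \<otimes> A\<close> in \<open>H \<otimes> H\<close>.  Over a field the
  canonical map \<open>A \<otimes> A \<rightarrow> H \<otimes> H\<close> is injective, so its inverse gives the comultiplication of \<open>A\<close>.
\<close>

definition sub_tensor_incl ::
    "('k, 'r) ring_scheme \<Rightarrow> ('k, 'h, 's) hopf_scheme \<Rightarrow> ('h, 'h) tensor \<Rightarrow> ('h, 'h) tensor" where
  "sub_tensor_incl K H = tensor_map K H H (\<lambda>x. x) (\<lambda>x. x)"

definition hopf_subalgebra ::
    "('k, 'r) ring_scheme \<Rightarrow> 'h set \<Rightarrow> ('k, 'h, 's) hopf_scheme \<Rightarrow> bool" where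
  "hopf_subalgebra K A H \<longleftrightarrow>
     submodule K A H \<and> submonoid A H \<and>
     (\<forall>a\<in>A. comult H a \<in>
        sub_tensor_incl K H ` carrier (tensor K (H\<lparr>carrier := A\<rparr>) (H\<lparr>carrier := A\<rparr>))) \<and>
     (\<forall>a\<in>A. antipode H a \<in> A)"

definition sub_hopf ::
    "('k, 'r) ring_scheme \<Rightarrow> ('k, 'h, 's) hopf_scheme \<Rightarrow> 'h set \<Rightarrow> ('k, 'h, 's) hopf_scheme" where
  "sub_hopf K H A =
     H\<lparr>carrier := A,
       comult := (\<lambda>a. inv_into (carrier (tensor K (H\<lparr>carrier := A\<rparr>) (H\<lparr>carrier := A\<rparr>)))
                        (sub_tensor_incl K H) (comult H a))\<rparr>"

definition normal_hopf_subalgebra ::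
    "('k, 'r) ring_scheme \<Rightarrow> 'h set \<Rightarrow> ('k, 'h, 's) hopf_scheme \<Rightarrow> bool" where
  "normal_hopf_subalgebra K A L \<longleftrightarrow>
     hopf_subalgebra K A L \<and>
     (\<forall>a\<in>A. \<forall>h\<in>carrier L.
        tensor_lift (add_monoid L) (\<lambda>x y. x \<otimes>\<^bsub>L\<^esub> a \<otimes>\<^bsub>L\<^esub> antipode L y) (comult L h) \<in> A \<and>
        tensor_lift (add_monoid L) (\<lambda>x y. antipode L x \<otimes>\<^bsub>L\<^esub> a \<otimes>\<^bsub>L\<^esub> y) (comult L h) \<in> A)"

definition augmentation ::
    "('k, 'r) ring_scheme \<Rightarrow> ('k, 'h, 's) hopf_scheme \<Rightarrow> 'h set \<Rightarrow> 'h set" where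
  "augmentation K L A = {a \<in> A. counit L a = \<zero>\<^bsub>K\<^esub>}"

definition quotient_module ::
    "('k, 'h, 's) module_scheme \<Rightarrow> 'h set \<Rightarrow> ('k, 'h set) module" where
  "quotient_module L I =
     ring.extend (L Quot I) (module.fields (\<lambda>c X. I +>\<^bsub>L\<^esub> (c \<odot>\<^bsub>L\<^esub> (SOME x. x \<in> X))))"

text \<open>
  The structure maps induced on cosets, which for a Hopf ideal \<open>I\<close> do not depend on the chosen
  representatives.
\<close>

definition quotient_hopf ::
    "('k, 'r) ring_scheme \<Rightarrow> ('k, 'h, 's) hopf_scheme \<Rightarrow> 'h set \<Rightarrow> ('k, 'h set) hopf" where
  "quotient_hopf K L I =
     module.extend (quotient_module L I)
       (hopf.fields
          (\<lambda>X. tensor_map K (quotient_module L I) (quotient_module L I)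
                 (\<lambda>x. I +>\<^bsub>L\<^esub> x) (\<lambda>x. I +>\<^bsub>L\<^esub> x) (comult L (SOME x. x \<in> X)))
          (\<lambda>X. counit L (SOME x. x \<in> X))
          (\<lambda>X. I +>\<^bsub>L\<^esub> antipode L (SOME x. x \<in> X)))"

text \<open>\<open>L / L A\<^sup>+\<close>, where \<open>L A\<^sup>+\<close> consists of the finite sums of products \<open>x a\<close>.\<close>

definition hopf_factor ::
    "('k, 'r) ring_scheme \<Rightarrow> ('k, 'h, 's) hopf_scheme \<Rightarrow> 'h set \<Rightarrow> ('k, 'h set) hopf" where
  "hopf_factor K L A = quotient_hopf K L (ideal_prod L (carrier L) (augmentation K L A))"


section \<open>Lower subnormal series\<close>

text \<open>
  A series of length \<open>n\<close> is a function on \<open>nat\<close> of which only the values at \<open>0, \<dots>, n\<close> matter.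
\<close>

definition lower_subnormal_series ::
    "('k, 'r) ring_scheme \<Rightarrow> ('k, 'h, 's) hopf_scheme \<Rightarrow> nat \<Rightarrow> (nat \<Rightarrow> 'h set) \<Rightarrow> bool" where
  "lower_subnormal_series K H n A \<longleftrightarrow>
     A 0 = carrier H \<and>
     A n = {c \<odot>\<^bsub>H\<^esub> \<one>\<^bsub>H\<^esub> | c. c \<in> carrier K} \<and>
     (\<forall>i\<le>n. hopf_subalgebra K (A i) H) \<and>
     (\<forall>i<n. A (Suc i) \<subseteq> A i \<and> normal_hopf_subalgebra K (A (Suc i)) (sub_hopf K H (A i)))"

definition series_factor ::
    "('k, 'r) ring_scheme \<Rightarrow> ('k, 'h, 's) hopf_scheme \<Rightarrow> (nat \<Rightarrow> 'h set) \<Rightarrow> nat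
      \<Rightarrow> ('k, 'h set) hopf" where
  "series_factor K H A i = hopf_factor K (sub_hopf K H (A i)) (A (Suc i))"

definition series_refinement ::
    "('k, 'r) ring_scheme \<Rightarrow> ('k, 'h, 's) hopf_scheme
      \<Rightarrow> nat \<Rightarrow> (nat \<Rightarrow> 'h set) \<Rightarrow> nat \<Rightarrow> (nat \<Rightarrow> 'h set) \<Rightarrow> bool" where
  \<comment> \<open>the series \<open>A'\<close> of length \<open>m\<close> is a refinement of the series \<open>A\<close> of length \<open>n\<close>\<close>
  "series_refinement K H n A m A' \<longleftrightarrow>
     lower_subnormal_series K H m A' \<and>
     (\<exists>N::nat \<Rightarrow> nat.
        (\<forall>i. 0 < i \<and> i < n \<longrightarrow> 0 < N i \<and> N i < m \<and> A i = A' (N i)) \<and>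
        strict_mono_on {0<..<n} N)"

definition series_equivalent ::
    "('k, 'r) ring_scheme \<Rightarrow> ('k, 'h, 's) hopf_scheme
      \<Rightarrow> nat \<Rightarrow> (nat \<Rightarrow> 'h set) \<Rightarrow> nat \<Rightarrow> (nat \<Rightarrow> 'h set) \<Rightarrow> bool" where
  "series_equivalent K H n A m B \<longleftrightarrow>
     (\<exists>f. bij_betw f {..<n} {..<m} \<and>
          (\<forall>i<n. hopf_isomorphic K (series_factor K H A i) (series_factor K H B (f i))))"

end

(* The factors of a Schreier refinement are compared as in the Zassenhaus lemma: for consecutive
   terms N1 of L1 and N2 of L2 and D = L1 \<inter> L2, both N1 D / N1 (L1 \<inter> N2) and N2 D / N2 (L2 \<inter> N1)
   are quotients of D, and it suffices that the two kernels coincide.  The modular law of subspaces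
   identifies each of them with D (L2 \<inter> N1)\<^sup>+ + D (L1 \<inter> N2)\<^sup>+, which is symmetric, once one knows
   that D \<inter> P N\<^sup>+ = D (D \<inter> N)\<^sup>+ whenever P = D N with N normal in P.

   This last equality replaces the second isomorphism theorem and is proved with integrals.  A trace
   formula produces a nonzero left integral functional on every finite-dimensional Hopf algebra, and
   from it come nondegeneracy, the bijectivity of the antipode, and integral elements.  With E = D \<inter> N
   and \<Gamma> a right integral of E, an element d of D lies in D E\<^sup>+ as soon as \<Gamma> d = 0; and for d in P N\<^sup>+
   this annihilation is tested against an integral functional on D, which is assembled from one on E
   and the one on P / P N\<^sup>+ given by x \<mapsto> f(x \<Lambda>), \<Lambda> a left integral of N. *)

theory Submission
  imports Defs
begin


subsection \<open>Balanced maps and sums over pairs\<close>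

text \<open>The equality \<open>D \<inter> P N\<^sup>+ = D (D \<inter> N)\<^sup>+\<close> is usually
  drawn from freeness or faithful flatness over Hopf subalgebras; integrals reduce it to linear
  algebra, at the price of finite dimension. All Hopf subalgebras stay inside the fixed
  \<open>H\<close>, with its comultiplication and antipode, so one calculus of
  \<open>H\<close>-valued Sweedler sums serves them all. Scalar identities are proved as identities
  between multiples of the unit and read off with the counit. The intrinsic comultiplication of a
  subalgebra, a chosen inverse of the map \<open>A \<otimes> A \<rightarrow> H \<otimes> H\<close>,
  enters only where normality and factors are translated. Since tensors are cosets in a free abelian
  group, every evaluation is reduced to a finite list of pairs; and a tensor is located in
  \<open>W \<otimes> W\<close> by testing its slices with functionals, which gives intersections and
  products of subalgebras their comultiplication. The Zassenhaus isomorphism is defined on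
  representatives in \<open>D\<close>, so equality of the two kernels is all that well-definedness
  and injectivity ask for.\<close>

definition pair_sum ::
    "('g, 'm) monoid_scheme \<Rightarrow> ('v \<Rightarrow> 'w \<Rightarrow> 'g) \<Rightarrow> ('v \<times> 'w) list \<Rightarrow> 'g" where
  "pair_sum G \<beta> xs = foldr (\<lambda>(v, w) s. \<beta> v w \<otimes>\<^bsub>G\<^esub> s) xs \<one>\<^bsub>G\<^esub>"

lemma pair_sum_Nil [simp]: "pair_sum G \<beta> [] = \<one>\<^bsub>G\<^esub>"
  and pair_sum_Cons [simp]: "pair_sum G \<beta> ((v, w) # xs) = \<beta> v w \<otimes>\<^bsub>G\<^esub> pair_sum G \<beta> xs"
  by (simp_all add: pair_sum_def)

lemma pair_sum_cong:
  "(\<And>v w. (v, w) \<in> set xs \<Longrightarrow> \<beta> v w = \<gamma> v w) \<Longrightarrow> pair_sum G \<beta> xs = pair_sum G \<gamma> xs"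
  by (induction xs) (auto simp: pair_sum_def)

lemma pair_sum_map:
  "pair_sum G \<beta> (map (\<lambda>(v, w). (f v, g w)) xs) = pair_sum G (\<lambda>v w. \<beta> (f v) (g w)) xs"
  by (induction xs) auto

context comm_group
begin

lemma pair_sum_closed:
  "(\<And>v w. (v, w) \<in> set xs \<Longrightarrow> \<beta> v w \<in> carrier G) \<Longrightarrow> pair_sum G \<beta> xs \<in> carrier G"
  by (induction xs) auto

lemma pair_sum_append:
  assumes "\<And>v w. (v, w) \<in> set xs \<union> set ys \<Longrightarrow> \<beta> v w \<in> carrier G"
  shows "pair_sum G \<beta> (xs @ ys) = pair_sum G \<beta> xs \<otimes> pair_sum G \<beta> ys"
  using assms
proof (induction xs)
  case Nil
  then show ?case by (simp add: pair_sum_closed)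
next
  case (Cons p xs)
  obtain v w where p: "p = (v, w)" by (cases p)
  have "\<beta> v w \<in> carrier G" "pair_sum G \<beta> xs \<in> carrier G" "pair_sum G \<beta> ys \<in> carrier G"
    using Cons.prems p by (auto intro!: pair_sum_closed)
  with Cons p show ?case by (simp add: m_assoc)
qed

lemma pair_sum_mult:
  assumes "\<And>v w. (v, w) \<in> set xs \<Longrightarrow> \<beta> v w \<in> carrier G"
    and "\<And>v w. (v, w) \<in> set xs \<Longrightarrow> \<gamma> v w \<in> carrier G"
  shows "pair_sum G (\<lambda>v w. \<beta> v w \<otimes> \<gamma> v w) xs = pair_sum G \<beta> xs \<otimes> pair_sum G \<gamma> xs"
  using assms
proof (induction xs)
  case (Cons p xs)
  obtain v w where p: "p = (v, w)" by (cases p)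
  have "\<beta> v w \<in> carrier G" "\<gamma> v w \<in> carrier G"
     "pair_sum G \<beta> xs \<in> carrier G" "pair_sum G \<gamma> xs \<in> carrier G"
    using Cons.prems p by (auto intro!: pair_sum_closed)
  with Cons p show ?case by (simp add: m_ac)
qed simp

lemma pair_sum_hom:
  assumes "comm_group G'" "h \<in> hom G G'"
    and "\<And>v w. (v, w) \<in> set xs \<Longrightarrow> \<beta> v w \<in> carrier G"
  shows "h (pair_sum G \<beta> xs) = pair_sum G' (\<lambda>v w. h (\<beta> v w)) xs"
proof -
  interpret G': comm_group G' by fact
  interpret h: group_hom G G' h by unfold_locales (fact assms)
  show ?thesis
    using assms(3)
  proof (induction xs)
    case (Cons p xs)
    obtain v w where p: "p = (v, w)" by (cases p)
    have "\<beta> v w \<in> carrier G" "pair_sum G \<beta> xs \<in> carrier G"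
      using Cons.prems p by (auto intro!: pair_sum_closed)
    with Cons p show ?case by simp
  qed simp
qed

end

text \<open>The three families of relators, turned into equations for \<beta>. The target is
  multiplicative because that of \<open>tensor_lift\<close> is; additive groups enter as
  \<open>add_monoid\<close>.\<close>

definition balanced ::
    "('k, 'r) ring_scheme \<Rightarrow> ('k, 'v, 'x) module_scheme \<Rightarrow> ('k, 'w, 'y) module_scheme
      \<Rightarrow> ('g, 'm) monoid_scheme \<Rightarrow> ('v \<Rightarrow> 'w \<Rightarrow> 'g) \<Rightarrow> bool" where
  "balanced K V W G \<beta> \<longleftrightarrow>
     (\<forall>v\<in>carrier V. \<forall>w\<in>carrier W. \<beta> v w \<in> carrier G) \<and>
     (\<forall>v\<in>carrier V. \<forall>v'\<in>carrier V. \<forall>w\<in>carrier W. \<beta> (v \<oplus>\<^bsub>V\<^esub> v') w = \<beta> v w \<otimes>\<^bsub>G\<^esub> \<beta> v' w) \<and>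
     (\<forall>v\<in>carrier V. \<forall>w\<in>carrier W. \<forall>w'\<in>carrier W. \<beta> v (w \<oplus>\<^bsub>W\<^esub> w') = \<beta> v w \<otimes>\<^bsub>G\<^esub> \<beta> v w') \<and>
     (\<forall>c\<in>carrier K. \<forall>v\<in>carrier V. \<forall>w\<in>carrier W. \<beta> (c \<odot>\<^bsub>V\<^esub> v) w = \<beta> v (c \<odot>\<^bsub>W\<^esub> w))"

lemma balancedI:
  assumes "\<And>v w. v \<in> carrier V \<Longrightarrow> w \<in> carrier W \<Longrightarrow> \<beta> v w \<in> carrier G"
    and "\<And>v v' w. v \<in> carrier V \<Longrightarrow> v' \<in> carrier V \<Longrightarrow> w \<in> carrier W \<Longrightarrow>
      \<beta> (v \<oplus>\<^bsub>V\<^esub> v') w = \<beta> v w \<otimes>\<^bsub>G\<^esub> \<beta> v' w"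
    and "\<And>v w w'. v \<in> carrier V \<Longrightarrow> w \<in> carrier W \<Longrightarrow> w' \<in> carrier W \<Longrightarrow>
      \<beta> v (w \<oplus>\<^bsub>W\<^esub> w') = \<beta> v w \<otimes>\<^bsub>G\<^esub> \<beta> v w'"
    and "\<And>c v w. c \<in> carrier K \<Longrightarrow> v \<in> carrier V \<Longrightarrow> w \<in> carrier W \<Longrightarrow>
      \<beta> (c \<odot>\<^bsub>V\<^esub> v) w = \<beta> v (c \<odot>\<^bsub>W\<^esub> w)"
  shows "balanced K V W G \<beta>"
  using assms unfolding balanced_def by blast

locale two_modules = V: module K V + W: module K W
  for K :: "('k, 'r) ring_scheme" (structure)
    and V :: "('k, 'v, 'x) module_scheme" and W :: "('k, 'w, 'y) module_scheme"
begin

abbreviation "F \<equiv> free_Abelian_group (carrier V \<times> carrier W)"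
abbreviation "R \<equiv> tensor_relations K V W"
abbreviation "T \<equiv> tensor_group K V W"
abbreviation "pt \<equiv> pure_tensor K V W"

sublocale F: comm_group F
  by (rule abelian_free_Abelian_group)

lemma relators_in: "tensor_relators K V W \<subseteq> carrier F"
  unfolding tensor_relators_def by (fastforce dest!: keys_diff[THEN subsetD])

lemma relations_subgroup: "subgroup R F"
  unfolding tensor_relations_def by (rule F.generate_is_subgroup[OF relators_in])

sublocale R: subgroup R F
  by (rule relations_subgroup)

lemma relators_relations: "x \<in> tensor_relators K V W \<Longrightarrow> x \<in> R"
  unfolding tensor_relations_def by (rule generate.incl)

sublocale RN: normal R F
  by (rule F.subgroup_imp_normal[OF relations_subgroup])

sublocale T: comm_group T
  unfolding tensor_group_def by (rule F.abelian_FactGroup[OF relations_subgroup])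

lemma carrier_T: "carrier T = {R #>\<^bsub>F\<^esub> z | z. z \<in> carrier F}"
  by (auto simp: tensor_group_def FactGroup_def RCOSETS_def)

lemma mult_T: "x \<in> carrier F \<Longrightarrow> y \<in> carrier F \<Longrightarrow>
    (R #>\<^bsub>F\<^esub> x) \<otimes>\<^bsub>T\<^esub> (R #>\<^bsub>F\<^esub> y) = R #>\<^bsub>F\<^esub> (x + y)"
  by (simp add: tensor_group_def FactGroup_def RN.rcos_sum)

lemma one_T: "\<one>\<^bsub>T\<^esub> = R #>\<^bsub>F\<^esub> 0"
proof -
  have "R #>\<^bsub>F\<^esub> \<one>\<^bsub>F\<^esub> = R" using F.coset_mult_one[OF R.subset] .
  then show ?thesis by (simp add: tensor_group_def FactGroup_def)
qed

lemma coset_eqI: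
  assumes "x \<in> carrier F" "y \<in> carrier F" "x - y \<in> R"
  shows "R #>\<^bsub>F\<^esub> x = R #>\<^bsub>F\<^esub> y"
proof -
  have "x = (x - y) \<otimes>\<^bsub>F\<^esub> y" by simp
  then have "x \<in> R #>\<^bsub>F\<^esub> y" using assms(3) unfolding r_coset_def by blast
  then show ?thesis using F.repr_independence[OF _ assms(2) relations_subgroup] by simp
qed

lemma coset_memD:
  assumes "x \<in> R #>\<^bsub>F\<^esub> y"
  obtains r where "r \<in> R" "x = r + y"
  using assms unfolding r_coset_def by auto

lemma pt_closed [simp]: "v \<in> carrier V \<Longrightarrow> w \<in> carrier W \<Longrightarrow> pt v w \<in> carrier T"
  unfolding carrier_T pure_tensor_def by auto

lemma balanced_pt: "balanced K V W T pt"
proof (rule balancedI, goal_cases)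
  case (2 v v' w)
  have "frag_of (v \<oplus>\<^bsub>V\<^esub> v', w) - frag_of (v, w) - frag_of (v', w) \<in> R"
    using 2 by (intro relators_relations) (auto simp: tensor_relators_def)
  then have "R #>\<^bsub>F\<^esub> (frag_of (v \<oplus>\<^bsub>V\<^esub> v', w)) = R #>\<^bsub>F\<^esub> (frag_of (v, w) + frag_of (v', w))"
    using 2 F.m_closed[of "frag_of (v, w)" "frag_of (v', w)"]
    by (intro coset_eqI) (simp_all add: diff_diff_add)
  then show ?case using 2 by (simp add: pure_tensor_def mult_T)
next
  case (3 v w w')
  have "frag_of (v, w \<oplus>\<^bsub>W\<^esub> w') - frag_of (v, w) - frag_of (v, w') \<in> R"
    using 3 by (intro relators_relations) (auto simp: tensor_relators_def)
  then have "R #>\<^bsub>F\<^esub> (frag_of (v, w \<oplus>\<^bsub>W\<^esub> w')) = R #>\<^bsub>F\<^esub> (frag_of (v, w) + frag_of (v, w'))"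
    using 3 F.m_closed[of "frag_of (v, w)" "frag_of (v, w')"]
    by (intro coset_eqI) (simp_all add: diff_diff_add)
  then show ?case using 3 by (simp add: pure_tensor_def mult_T)
next
  case (4 c v w)
  have "frag_of (c \<odot>\<^bsub>V\<^esub> v, w) - frag_of (v, c \<odot>\<^bsub>W\<^esub> w) \<in> R"
    using 4 by (intro relators_relations) (auto simp: tensor_relators_def)
  then show ?case using 4 unfolding pure_tensor_def by (intro coset_eqI) simp_all
qed simp

context
  fixes G :: "('g, 'm) monoid_scheme" and \<beta>
  assumes G: "comm_group G" and \<beta>: "balanced K V W G \<beta>"
begin

interpretation G: comm_group G by (rule G)

lemma \<beta>_closed: "v \<in> carrier V \<Longrightarrow> w \<in> carrier W \<Longrightarrow> \<beta> v w \<in> carrier G"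
  using \<beta> by (auto simp: balanced_def)

private definition ev :: "('v \<times> 'w \<Rightarrow>\<^sub>0 int) \<Rightarrow> 'g" where
  "ev z = finprod G (\<lambda>(v, w). \<beta> v w [^]\<^bsub>G\<^esub> Poly_Mapping.lookup z (v, w)) (Poly_Mapping.keys z)"

text \<open>Cancellation may make the support of a sum smaller than the union of the supports; over
  a common finite superset the additional factors are powers with exponent 0.\<close>

private lemma ev_superset:
  assumes "finite S" "Poly_Mapping.keys z \<subseteq> S" "S \<subseteq> carrier V \<times> carrier W"
  shows "ev z = finprod G (\<lambda>p. \<beta> (fst p) (snd p) [^]\<^bsub>G\<^esub> Poly_Mapping.lookup z p) S"
  unfolding ev_def
  by (rule G.finprod_mono_neutral_cong_left)
    (use assms in \<open>auto simp: in_keys_iff subset_iff G.int_pow_closed \<beta>_closed\<close>)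

private lemma ev_hom: "ev \<in> hom F G"
proof (rule homI)
  fix x assume "x \<in> carrier F"
  then show "ev x \<in> carrier G"
    unfolding ev_def using \<beta>_closed by (intro G.finprod_closed) auto
next
  fix x y assume x: "x \<in> carrier F" and y: "y \<in> carrier F"
  let ?S = "Poly_Mapping.keys x \<union> Poly_Mapping.keys y"
  have S: "finite ?S" "?S \<subseteq> carrier V \<times> carrier W" using x y by auto
  have "ev (x + y) = finprod G (\<lambda>p. \<beta> (fst p) (snd p) [^]\<^bsub>G\<^esub> Poly_Mapping.lookup (x + y) p) ?S"
    using S keys_add[of x y] by (intro ev_superset) auto
  also have "\<dots> = finprod G (\<lambda>p. \<beta> (fst p) (snd p) [^]\<^bsub>G\<^esub> Poly_Mapping.lookup x p \<otimes>\<^bsub>G\<^esub>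
      \<beta> (fst p) (snd p) [^]\<^bsub>G\<^esub> Poly_Mapping.lookup y p) ?S"
    using S \<beta>_closed
    by (intro G.finprod_cong) (auto simp: lookup_add G.int_pow_mult subset_iff simp_implies_def)
  also have "\<dots> = ev x \<otimes>\<^bsub>G\<^esub> ev y"
    using S \<beta>_closed by (subst G.finprod_multf) (auto simp: ev_superset[OF S(1) _ S(2)] subset_iff)
  finally show "ev (x \<otimes>\<^bsub>F\<^esub> y) = ev x \<otimes>\<^bsub>G\<^esub> ev y" by simp
qed

interpretation ev: group_hom F G ev
  by unfold_locales (rule ev_hom)

private lemma ev_frag_of: "v \<in> carrier V \<Longrightarrow> w \<in> carrier W \<Longrightarrow> ev (frag_of (v, w)) = \<beta> v w"
  using \<beta>_closed[of v w] by (simp add: ev_def)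

private lemma ev_diff: "x \<in> carrier F \<Longrightarrow> y \<in> carrier F \<Longrightarrow> ev (x - y) = ev x \<otimes>\<^bsub>G\<^esub> inv\<^bsub>G\<^esub> ev y"
  using ev.hom_mult[of x "inv\<^bsub>F\<^esub> y"] ev.hom_inv[of y] F.inv_closed[of y] by simp

private lemma ev_relators: "x \<in> tensor_relators K V W \<Longrightarrow> ev x = \<one>\<^bsub>G\<^esub>"
proof -
  have *: "Poly_Mapping.keys x \<subseteq> S \<Longrightarrow> Poly_Mapping.keys y \<subseteq> S \<Longrightarrow> Poly_Mapping.keys (x - y) \<subseteq> S"
    for x y :: "('v \<times> 'w) \<Rightarrow>\<^sub>0 int" and S
    using keys_diff[of x y] by blast
  assume "x \<in> tensor_relators K V W"
  then show ?thesis
    unfolding tensor_relators_def Un_iff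
  proof (elim disjE CollectE exE conjE, goal_cases)
    case (1 v v' w)
    then have "\<beta> (v \<oplus>\<^bsub>V\<^esub> v') w = \<beta> v w \<otimes>\<^bsub>G\<^esub> \<beta> v' w" using \<beta> by (auto simp: balanced_def)
    with 1 show ?case
      using \<beta>_closed[of v w] \<beta>_closed[of v' w]
      by (simp add: ev_diff ev_frag_of * G.m_ac G.inv_mult)
  next
    case (2 v w w')
    then have "\<beta> v (w \<oplus>\<^bsub>W\<^esub> w') = \<beta> v w \<otimes>\<^bsub>G\<^esub> \<beta> v w'" using \<beta> by (auto simp: balanced_def)
    with 2 show ?case
      using \<beta>_closed[of v w] \<beta>_closed[of v w']
      by (simp add: ev_diff ev_frag_of * G.m_ac G.inv_mult)
  next
    case (3 c v w)
    then have "\<beta> (c \<odot>\<^bsub>V\<^esub> v) w = \<beta> v (c \<odot>\<^bsub>W\<^esub> w)" using \<beta> by (auto simp: balanced_def)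
    with 3 show ?case
      using \<beta>_closed[of v "c \<odot>\<^bsub>W\<^esub> w"] by (simp add: ev_diff ev_frag_of)
  qed
qed

private lemma ev_relations: "x \<in> R \<Longrightarrow> ev x = \<one>\<^bsub>G\<^esub>"
proof -
  have "tensor_relators K V W \<subseteq> kernel F G ev"
    using relators_in ev_relators unfolding kernel_def by blast
  then have "R \<subseteq> kernel F G ev"
    unfolding tensor_relations_def by (rule F.generate_subgroup_incl) (rule ev.subgroup_kernel)
  then show "x \<in> R \<Longrightarrow> ev x = \<one>\<^bsub>G\<^esub>" by (auto simp: kernel_def)
qed

text \<open>The representative picked by \<open>SOME\<close> differs from \<open>z\<close> by a
  relation, and \<open>ev\<close> sends relations to the unit, so \<open>tensor_lift\<close> agrees
  with the homomorphism \<open>ev\<close> at any representative.\<close>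

private lemma tensor_lift_coset:
  assumes z: "z \<in> carrier F"
  shows "tensor_lift G \<beta> (R #>\<^bsub>F\<^esub> z) = ev z"
proof -
  have "z \<in> R #>\<^bsub>F\<^esub> z" using F.rcos_self[OF z relations_subgroup] .
  then have "(SOME y. y \<in> R #>\<^bsub>F\<^esub> z) \<in> R #>\<^bsub>F\<^esub> z" by (rule someI)
  then obtain r where r: "r \<in> R" "(SOME y. y \<in> R #>\<^bsub>F\<^esub> z) = r + z" by (rule coset_memD)
  have "ev (r \<otimes>\<^bsub>F\<^esub> z) = ev z"
    using r z ev_relations[OF r(1)] R.mem_carrier[OF r(1)] ev.hom_mult[of r z] by simp
  then show ?thesis
    unfolding tensor_lift_def Let_def r(2) by (simp add: ev_def)
qed

lemma tensor_lift_hom: "tensor_lift G \<beta> \<in> hom T G"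
proof (rule homI)
  fix X assume "X \<in> carrier T"
  then show "tensor_lift G \<beta> X \<in> carrier G"
    using ev.hom_closed by (auto simp: carrier_T tensor_lift_coset)
next
  fix X Y assume "X \<in> carrier T" "Y \<in> carrier T"
  then obtain x y where xy: "x \<in> carrier F" "y \<in> carrier F" "X = R #>\<^bsub>F\<^esub> x" "Y = R #>\<^bsub>F\<^esub> y"
    by (auto simp: carrier_T)
  then show "tensor_lift G \<beta> (X \<otimes>\<^bsub>T\<^esub> Y) = tensor_lift G \<beta> X \<otimes>\<^bsub>G\<^esub> tensor_lift G \<beta> Y"
    using F.m_closed[of x y] ev.hom_mult[of x y] by (simp add: mult_T tensor_lift_coset)
qed

lemma tensor_lift_pt:
  "v \<in> carrier V \<Longrightarrow> w \<in> carrier W \<Longrightarrow> tensor_lift G \<beta> (pt v w) = \<beta> v w"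
  unfolding pure_tensor_def by (simp add: tensor_lift_coset ev_frag_of)

lemma tensor_lift_pair_sum:
  assumes "set xs \<subseteq> carrier V \<times> carrier W"
  shows "tensor_lift G \<beta> (pair_sum T pt xs) = pair_sum G \<beta> xs"
proof -
  have "tensor_lift G \<beta> (pair_sum T pt xs) = pair_sum G (\<lambda>v w. tensor_lift G \<beta> (pt v w)) xs"
    using assms by (intro T.pair_sum_hom[OF G tensor_lift_hom]) auto
  also have "\<dots> = pair_sum G \<beta> xs"
    using assms by (intro pair_sum_cong tensor_lift_pt) auto
  finally show ?thesis .
qed

text \<open>The universal property in the form used throughout: a Sweedler sum may be computed from
  any list that presents the comultiplication, in particular from one with entries in a
  subalgebra.\<close>

lemma pair_sum_eq:
  assumes "set xs \<subseteq> carrier V \<times> carrier W" "set ys \<subseteq> carrier V \<times> carrier W"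
    and "pair_sum T pt xs = pair_sum T pt ys"
  shows "pair_sum G \<beta> xs = pair_sum G \<beta> ys"
  using assms(3) tensor_lift_pair_sum[OF assms(1)] tensor_lift_pair_sum[OF assms(2)] by simp

lemma balanced_minus:
  assumes v: "v \<in> carrier V" and w: "w \<in> carrier W"
  shows "\<beta> (\<ominus>\<^bsub>V\<^esub> v) w = inv\<^bsub>G\<^esub> \<beta> v w"
proof -
  have c: "\<beta> (\<ominus>\<^bsub>V\<^esub> v) w \<in> carrier G" "\<beta> v w \<in> carrier G" "\<beta> \<zero>\<^bsub>V\<^esub> w \<in> carrier G"
    using v w by (auto intro: \<beta>_closed)
  have add: "\<beta> (a \<oplus>\<^bsub>V\<^esub> b) w = \<beta> a w \<otimes>\<^bsub>G\<^esub> \<beta> b w" if "a \<in> carrier V" "b \<in> carrier V" for a b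
    using \<beta> w that by (auto simp: balanced_def)
  have "\<beta> \<zero>\<^bsub>V\<^esub> w \<otimes>\<^bsub>G\<^esub> \<beta> \<zero>\<^bsub>V\<^esub> w = \<beta> \<zero>\<^bsub>V\<^esub> w"
    using add[of "\<zero>\<^bsub>V\<^esub>" "\<zero>\<^bsub>V\<^esub>"] by simp
  then have "\<beta> \<zero>\<^bsub>V\<^esub> w = \<one>\<^bsub>G\<^esub>" using c(3) G.l_cancel_one by blast
  then have "\<beta> (\<ominus>\<^bsub>V\<^esub> v) w \<otimes>\<^bsub>G\<^esub> \<beta> v w = \<one>\<^bsub>G\<^esub>"
    using add[of "\<ominus>\<^bsub>V\<^esub> v" v] v by (simp add: V.l_neg)
  then show ?thesis using c G.inv_equality by auto
qed

end

text \<open>Coefficients in the free abelian group are integers, but signs can be absorbed by a leg,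
  since the inverse of a pure tensor is \<open>pt (\<ominus> v) w\<close>. Induction over
  differences of generators therefore leaves an unweighted list.\<close>

lemma tensor_as_pair_sum:
  assumes "t \<in> carrier T"
  obtains xs where "set xs \<subseteq> carrier V \<times> carrier W" "t = pair_sum T pt xs"
proof -
  have "\<exists>xs. set xs \<subseteq> carrier V \<times> carrier W \<and> R #>\<^bsub>F\<^esub> z = pair_sum T pt xs"
    if "Poly_Mapping.keys z \<subseteq> carrier V \<times> carrier W" for z
    using that
  proof (induction rule: free_Abelian_group_induct[consumes 1, case_names zero diff of])
    case zero
    then show ?case by (intro exI[of _ "[]"]) (simp add: one_T)
  next
    case (diff x y)
    then obtain xs ys where xs: "set xs \<subseteq> carrier V \<times> carrier W" "R #>\<^bsub>F\<^esub> x = pair_sum T pt xs"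
      and ys: "set ys \<subseteq> carrier V \<times> carrier W" "R #>\<^bsub>F\<^esub> y = pair_sum T pt ys" by auto
    let ?n = "map (\<lambda>(v, w). (\<ominus>\<^bsub>V\<^esub> v, w)) ys"
    have n: "set ?n \<subseteq> carrier V \<times> carrier W" using ys by auto
    have "pair_sum T pt ?n = pair_sum T (\<lambda>v w. inv\<^bsub>T\<^esub> pt v w) ys"
      unfolding pair_sum_map[of T pt "\<lambda>v. \<ominus>\<^bsub>V\<^esub> v" "\<lambda>w. w"]
      using ys by (intro pair_sum_cong balanced_minus[OF T.comm_group_axioms balanced_pt]) auto
    also have "\<dots> = inv\<^bsub>T\<^esub> pair_sum T pt ys"
      using ys by (intro T.pair_sum_hom[symmetric, OF T.comm_group_axioms]) (auto simp: hom_def T.inv_mult)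
    finally have inv: "pair_sum T pt ?n = inv\<^bsub>T\<^esub> (R #>\<^bsub>F\<^esub> y)" by (simp add: ys(2))
    have "(R #>\<^bsub>F\<^esub> (x - y)) \<otimes>\<^bsub>T\<^esub> (R #>\<^bsub>F\<^esub> y) = R #>\<^bsub>F\<^esub> x"
      using diff F.m_closed[of x "inv\<^bsub>F\<^esub> y"] F.inv_closed[of y] by (subst mult_T) auto
    moreover have "R #>\<^bsub>F\<^esub> (x - y) \<in> carrier T" "R #>\<^bsub>F\<^esub> y \<in> carrier T"
      using diff F.m_closed[of x "inv\<^bsub>F\<^esub> y"] F.inv_closed[of y] unfolding carrier_T by auto
    ultimately have "R #>\<^bsub>F\<^esub> (x - y) = (R #>\<^bsub>F\<^esub> x) \<otimes>\<^bsub>T\<^esub> inv\<^bsub>T\<^esub> (R #>\<^bsub>F\<^esub> y)"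
      by (metis T.inv_closed T.m_assoc T.r_inv T.r_one)
    also have "\<dots> = pair_sum T pt (xs @ ?n)"
      using xs ys n by (subst T.pair_sum_append) (auto simp: inv simp flip: xs(2))
    finally show ?case using xs n by (intro exI[of _ "xs @ ?n"]) auto
  next
    case (of a)
    then show ?case
      by (cases a) (auto intro!: exI[of _ "[a]"] simp: pure_tensor_def[symmetric])
  qed
  moreover obtain z where "Poly_Mapping.keys z \<subseteq> carrier V \<times> carrier W" "t = R #>\<^bsub>F\<^esub> z"
    using assms by (auto simp: carrier_T)
  ultimately show thesis using that by blast
qed

lemma carrier_tensor [simp]: "carrier (tensor K V W) = carrier T"
  and zero_tensor [simp]: "\<zero>\<^bsub>tensor K V W\<^esub> = \<one>\<^bsub>T\<^esub>"
  and add_tensor [simp]: "x \<oplus>\<^bsub>tensor K V W\<^esub> y = x \<otimes>\<^bsub>T\<^esub> y"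
  by (simp_all add: tensor_def)

lemma comm_group_tensor: "comm_group (add_monoid (tensor K V W))"
  by (rule comm_groupI) (auto simp: T.m_ac intro: T.l_inv_ex)

lemma pair_sum_tensor [simp]: "pair_sum (add_monoid (tensor K V W)) \<beta> xs = pair_sum T \<beta> xs"
  by (simp add: pair_sum_def)

lemma balanced_smult:
  assumes "balanced K V W G \<beta>" "c \<in> carrier K"
  shows "balanced K V W G (\<lambda>v w. \<beta> (c \<odot>\<^bsub>V\<^esub> v) w)"
proof (rule balancedI, goal_cases)
  case (4 d v w)
  then have "c \<odot>\<^bsub>V\<^esub> (d \<odot>\<^bsub>V\<^esub> v) = d \<odot>\<^bsub>V\<^esub> (c \<odot>\<^bsub>V\<^esub> v)"
    using assms(2) by (metis V.smult_assoc1 V.R.m_comm)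
  then show ?case using 4 assms by (auto simp: balanced_def)
qed (use assms in \<open>auto simp: balanced_def V.smult_r_distr\<close>)

lemma smult_tensor_hom: "c \<in> carrier K \<Longrightarrow> smult (tensor K V W) c \<in> hom T T"
  using tensor_lift_hom[OF T.comm_group_axioms balanced_smult[OF balanced_pt]]
  by (simp add: tensor_def)

lemma smult_tensor_pair_sum:
  assumes "c \<in> carrier K" "set xs \<subseteq> carrier V \<times> carrier W"
  shows "c \<odot>\<^bsub>tensor K V W\<^esub> pair_sum T pt xs = pair_sum T (\<lambda>v w. pt (c \<odot>\<^bsub>V\<^esub> v) w) xs"
  using tensor_lift_pair_sum[OF T.comm_group_axioms balanced_smult[OF balanced_pt] assms(2)] assms(1)
  by (simp add: tensor_def)

text \<open>The scalar acts on the first leg. Writing a tensor as a list turns the axioms that do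
  not follow from additivity into the corresponding axioms of \<open>V\<close>.\<close>

lemma module_tensor: "module K (tensor K V W)"
proof -
  have ab: "abelian_group (tensor K V W)"
    by (intro abelian_group.intro abelian_monoid.intro abelian_group_axioms.intro)
      (simp_all only: comm_group_tensor comm_group.axioms(1)[OF comm_group_tensor])
  have pt_add: "pt (v \<oplus>\<^bsub>V\<^esub> v') w = pt v w \<otimes>\<^bsub>T\<^esub> pt v' w"
    if "v \<in> carrier V" "v' \<in> carrier V" "w \<in> carrier W" for v v' w
    using balanced_pt that by (auto simp: balanced_def)
  show ?thesis
  proof (rule moduleI[OF V.R.cring_axioms ab], goal_cases)
    case (1 a x)
    then show ?case using hom_in_carrier[OF smult_tensor_hom] by simp
  next
    case (2 a b x)
    then obtain xs where xs: "set xs \<subseteq> carrier V \<times> carrier W" "x = pair_sum T pt xs"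
      using tensor_as_pair_sum by (auto simp: tensor_def)
    have "pair_sum T (\<lambda>v w. pt ((a \<oplus>\<^bsub>K\<^esub> b) \<odot>\<^bsub>V\<^esub> v) w) xs =
      pair_sum T (\<lambda>v w. pt (a \<odot>\<^bsub>V\<^esub> v) w \<otimes>\<^bsub>T\<^esub> pt (b \<odot>\<^bsub>V\<^esub> v) w) xs"
      using xs(1) 2 by (intro pair_sum_cong) (auto simp: V.smult_l_distr pt_add)
    with 2 xs show ?case
      by (simp add: smult_tensor_pair_sum add_tensor) (subst T.pair_sum_mult, auto)
  next
    case (3 a x y)
    then show ?case using smult_tensor_hom[of a] by (auto simp: add_tensor hom_def)
  next
    case (4 a b x)
    then obtain xs where xs: "set xs \<subseteq> carrier V \<times> carrier W" "x = pair_sum T pt xs"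
      using tensor_as_pair_sum by (auto simp: tensor_def)
    let ?ys = "map (\<lambda>(v, w). (b \<odot>\<^bsub>V\<^esub> v, w)) xs"
    have ys: "set ?ys \<subseteq> carrier V \<times> carrier W" using xs(1) 4 by auto
    have "b \<odot>\<^bsub>tensor K V W\<^esub> x = pair_sum T pt ?ys"
      using 4 xs pair_sum_map[of T pt "\<lambda>v. b \<odot>\<^bsub>V\<^esub> v" "\<lambda>w. w" xs] by (simp add: smult_tensor_pair_sum)
    then have "a \<odot>\<^bsub>tensor K V W\<^esub> (b \<odot>\<^bsub>tensor K V W\<^esub> x) =
        pair_sum T (\<lambda>v w. pt (a \<odot>\<^bsub>V\<^esub> v) w) ?ys"
      using 4 smult_tensor_pair_sum[OF _ ys, of a] by simp
    also have "\<dots> = pair_sum T (\<lambda>v w. pt (a \<odot>\<^bsub>V\<^esub> (b \<odot>\<^bsub>V\<^esub> v)) w) xs"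
      using pair_sum_map[of T "\<lambda>v w. pt (a \<odot>\<^bsub>V\<^esub> v) w" "\<lambda>v. b \<odot>\<^bsub>V\<^esub> v" "\<lambda>w. w" xs] by simp
    also have "\<dots> = (a \<otimes>\<^bsub>K\<^esub> b) \<odot>\<^bsub>tensor K V W\<^esub> x"
      using 4 xs by (auto simp: smult_tensor_pair_sum V.smult_assoc1 intro!: pair_sum_cong)
    finally show ?case by simp
  next
    case (5 x)
    then obtain xs where xs: "set xs \<subseteq> carrier V \<times> carrier W" "x = pair_sum T pt xs"
      using tensor_as_pair_sum by (auto simp: tensor_def)
    then show ?case
      by (auto simp: smult_tensor_pair_sum intro!: pair_sum_cong)
  qed
qed

lemma tensor_lift_smult:
  assumes "module K M" "balanced K V W (add_monoid M) \<beta>"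
    and "\<And>c v w. c \<in> carrier K \<Longrightarrow> v \<in> carrier V \<Longrightarrow> w \<in> carrier W \<Longrightarrow>
      \<beta> (c \<odot>\<^bsub>V\<^esub> v) w = c \<odot>\<^bsub>M\<^esub> \<beta> v w"
    and c: "c \<in> carrier K" and t: "t \<in> carrier T"
  shows "tensor_lift (add_monoid M) \<beta> (c \<odot>\<^bsub>tensor K V W\<^esub> t) = c \<odot>\<^bsub>M\<^esub> tensor_lift (add_monoid M) \<beta> t"
proof -
  interpret M: module K M by fact
  have G: "comm_group (add_monoid M)" by (rule M.a_comm_group)
  obtain xs where xs: "set xs \<subseteq> carrier V \<times> carrier W" "t = pair_sum T pt xs"
    using tensor_as_pair_sum[OF t] .
  have \<beta>: "\<beta> v w \<in> carrier M" if "v \<in> carrier V" "w \<in> carrier W" for v w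
    using assms(2) that by (auto simp: balanced_def)
  have "tensor_lift (add_monoid M) \<beta> (c \<odot>\<^bsub>tensor K V W\<^esub> t) =
      pair_sum (add_monoid M) (\<lambda>v w. tensor_lift (add_monoid M) \<beta> (pt (c \<odot>\<^bsub>V\<^esub> v) w)) xs"
    unfolding xs(2) smult_tensor_pair_sum[OF c xs(1)]
    using xs(1) c by (intro T.pair_sum_hom[OF G tensor_lift_hom[OF G assms(2)]]) auto
  also have "\<dots> = pair_sum (add_monoid M) (\<lambda>v w. c \<odot>\<^bsub>M\<^esub> \<beta> v w) xs"
    using xs(1) c by (intro pair_sum_cong) (auto simp: tensor_lift_pt[OF G assms(2)] assms(3))
  also have "\<dots> = c \<odot>\<^bsub>M\<^esub> pair_sum (add_monoid M) \<beta> xs"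
    using xs(1) c \<beta> M.smult_closed M.smult_r_distr
    by (intro comm_group.pair_sum_hom[symmetric, OF G G]) (auto simp: hom_def)
  finally show ?thesis
    using tensor_lift_pair_sum[OF G assms(2) xs(1)] xs(2) by simp
qed

text \<open>Lifting two of three variables to a tensor leaves a map that is balanced in that tensor
  and the remaining variable. Both bracketings are recorded because coassociativity compares
  them.\<close>

lemma tensor_lift_balanced:
  assumes G: "comm_group G" and U: "module K U"
    and bal: "\<And>u. u \<in> carrier U \<Longrightarrow> balanced K V W G (\<beta> u)"
    and add: "\<And>u u' v w. u \<in> carrier U \<Longrightarrow> u' \<in> carrier U \<Longrightarrow> v \<in> carrier V \<Longrightarrow> w \<in> carrier W \<Longrightarrow>
      \<beta> (u \<oplus>\<^bsub>U\<^esub> u') v w = \<beta> u v w \<otimes>\<^bsub>G\<^esub> \<beta> u' v w"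
    and smult: "\<And>c u v w. c \<in> carrier K \<Longrightarrow> u \<in> carrier U \<Longrightarrow> v \<in> carrier V \<Longrightarrow> w \<in> carrier W \<Longrightarrow>
      \<beta> (c \<odot>\<^bsub>U\<^esub> u) v w = \<beta> u (c \<odot>\<^bsub>V\<^esub> v) w"
  shows "balanced K (tensor K V W) U G (\<lambda>t u. tensor_lift G (\<beta> u) t)"
    and "balanced K U (tensor K V W) G (\<lambda>u t. tensor_lift G (\<beta> u) t)"
proof -
  interpret G: comm_group G by fact
  interpret U: module K U by fact
  have closed: "tensor_lift G (\<beta> u) t \<in> carrier G" if "u \<in> carrier U" "t \<in> carrier T" for u t
    using hom_in_carrier[OF tensor_lift_hom[OF G bal]] that by auto
  have \<beta>: "\<beta> u v w \<in> carrier G" if "u \<in> carrier U" "v \<in> carrier V" "w \<in> carrier W" for u v w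
    using bal[of u] that by (auto simp: balanced_def)
  have t_add: "tensor_lift G (\<beta> u) (t \<oplus>\<^bsub>tensor K V W\<^esub> t') = tensor_lift G (\<beta> u) t \<otimes>\<^bsub>G\<^esub> tensor_lift G (\<beta> u) t'"
    if "u \<in> carrier U" "t \<in> carrier T" "t' \<in> carrier T" for u t t'
    using tensor_lift_hom[OF G bal] that by (auto simp: hom_def)
  have u_add: "tensor_lift G (\<beta> (u \<oplus>\<^bsub>U\<^esub> u')) t = tensor_lift G (\<beta> u) t \<otimes>\<^bsub>G\<^esub> tensor_lift G (\<beta> u') t"
    if u: "u \<in> carrier U" "u' \<in> carrier U" and t: "t \<in> carrier T" for u u' t
  proof -
    obtain xs where xs: "set xs \<subseteq> carrier V \<times> carrier W" "t = pair_sum T pt xs"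
      using tensor_as_pair_sum[OF t] .
    have "pair_sum G (\<beta> (u \<oplus>\<^bsub>U\<^esub> u')) xs = pair_sum G (\<lambda>v w. \<beta> u v w \<otimes>\<^bsub>G\<^esub> \<beta> u' v w) xs"
      using xs(1) u by (intro pair_sum_cong) (auto simp: add)
    also have "\<dots> = pair_sum G (\<beta> u) xs \<otimes>\<^bsub>G\<^esub> pair_sum G (\<beta> u') xs"
      using xs(1) u by (intro G.pair_sum_mult) (auto intro: \<beta>)
    finally show ?thesis using xs u by (simp add: tensor_lift_pair_sum[OF G bal])
  qed
  have smult': "tensor_lift G (\<beta> u) (c \<odot>\<^bsub>tensor K V W\<^esub> t) = tensor_lift G (\<beta> (c \<odot>\<^bsub>U\<^esub> u)) t"
    if u: "u \<in> carrier U" "c \<in> carrier K" and t: "t \<in> carrier T" for u c t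
  proof -
    obtain xs where xs: "set xs \<subseteq> carrier V \<times> carrier W" "t = pair_sum T pt xs"
      using tensor_as_pair_sum[OF t] .
    let ?ys = "map (\<lambda>(v, w). (c \<odot>\<^bsub>V\<^esub> v, w)) xs"
    have ys: "set ?ys \<subseteq> carrier V \<times> carrier W" using xs(1) u by auto
    have "c \<odot>\<^bsub>tensor K V W\<^esub> t = pair_sum T pt ?ys"
      using u xs pair_sum_map[of T pt "\<lambda>v. c \<odot>\<^bsub>V\<^esub> v" "\<lambda>w. w" xs] by (simp add: smult_tensor_pair_sum)
    then have "tensor_lift G (\<beta> u) (c \<odot>\<^bsub>tensor K V W\<^esub> t) = pair_sum G (\<beta> u) ?ys"
      using tensor_lift_pair_sum[OF G bal ys] u by simp
    also have "\<dots> = pair_sum G (\<beta> (c \<odot>\<^bsub>U\<^esub> u)) xs"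
      unfolding pair_sum_map[of G "\<beta> u" "\<lambda>v. c \<odot>\<^bsub>V\<^esub> v" "\<lambda>w. w"]
      using xs u by (intro pair_sum_cong) (auto simp: smult)
    also have "\<dots> = tensor_lift G (\<beta> (c \<odot>\<^bsub>U\<^esub> u)) t"
      using tensor_lift_pair_sum[OF G bal xs(1)] u xs by simp
    finally show ?thesis .
  qed
  show "balanced K (tensor K V W) U G (\<lambda>t u. tensor_lift G (\<beta> u) t)"
    by (rule balancedI) (use closed t_add u_add smult' in auto)
  show "balanced K U (tensor K V W) G (\<lambda>u t. tensor_lift G (\<beta> u) t)"
    by (rule balancedI) (use closed t_add u_add smult' in auto)
qed

lemma tensor_map_pair_sum:
  assumes "two_modules K V' W'" and f: "f \<in> module_hom K V V'" and g: "g \<in> module_hom K W W'"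
    and xs: "set xs \<subseteq> carrier V \<times> carrier W"
  shows "tensor_map K V' W' f g (pair_sum T pt xs) =
    pair_sum (tensor_group K V' W') (\<lambda>v w. pure_tensor K V' W' (f v) (g w)) xs"
    and tensor_map_balanced: "balanced K V W (add_monoid (tensor K V' W')) (\<lambda>v w. pure_tensor K V' W' (f v) (g w))"
proof -
  interpret T': two_modules K V' W' by fact
  show bal: "balanced K V W (add_monoid (tensor K V' W')) (\<lambda>v w. pure_tensor K V' W' (f v) (g w))"
    by (rule balancedI) (use f g T'.balanced_pt in \<open>auto simp: module_hom_def balanced_def Pi_iff\<close>)
  show "tensor_map K V' W' f g (pair_sum T pt xs) =
    pair_sum (tensor_group K V' W') (\<lambda>v w. pure_tensor K V' W' (f v) (g w)) xs"
    unfolding tensor_map_def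
    using tensor_lift_pair_sum[OF T'.comm_group_tensor bal xs] unfolding T'.pair_sum_tensor .
qed

end

subsection \<open>Linear maps and functionals\<close>

context vectorspace
begin

text \<open>A predicate on bare functions, with no condition outside the carrier, so that linearity
  of a nested lambda term can be derived from that of its parts.\<close>

definition lin :: "('c \<Rightarrow> 'c) \<Rightarrow> bool" where
  "lin f \<longleftrightarrow> (\<forall>x\<in>carrier V. f x \<in> carrier V) \<and>
     (\<forall>x\<in>carrier V. \<forall>y\<in>carrier V. f (x \<oplus>\<^bsub>V\<^esub> y) = f x \<oplus>\<^bsub>V\<^esub> f y) \<and>
     (\<forall>c\<in>carrier K. \<forall>x\<in>carrier V. f (c \<odot>\<^bsub>V\<^esub> x) = c \<odot>\<^bsub>V\<^esub> f x)"

definition fnl :: "('c \<Rightarrow> 'a) \<Rightarrow> bool" where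
  "fnl f \<longleftrightarrow> (\<forall>x\<in>carrier V. f x \<in> carrier K) \<and>
     (\<forall>x\<in>carrier V. \<forall>y\<in>carrier V. f (x \<oplus>\<^bsub>V\<^esub> y) = f x \<oplus>\<^bsub>K\<^esub> f y) \<and>
     (\<forall>c\<in>carrier K. \<forall>x\<in>carrier V. f (c \<odot>\<^bsub>V\<^esub> x) = c \<otimes>\<^bsub>K\<^esub> f x)"

lemma linI:
  assumes "\<And>x. x \<in> carrier V \<Longrightarrow> f x \<in> carrier V"
    and "\<And>x y. x \<in> carrier V \<Longrightarrow> y \<in> carrier V \<Longrightarrow> f (x \<oplus>\<^bsub>V\<^esub> y) = f x \<oplus>\<^bsub>V\<^esub> f y"
    and "\<And>c x. c \<in> carrier K \<Longrightarrow> x \<in> carrier V \<Longrightarrow> f (c \<odot>\<^bsub>V\<^esub> x) = c \<odot>\<^bsub>V\<^esub> f x"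
  shows "lin f"
  using assms by (auto simp: lin_def)

lemma lin_closed: "lin f \<Longrightarrow> x \<in> carrier V \<Longrightarrow> f x \<in> carrier V"
  and lin_add: "lin f \<Longrightarrow> x \<in> carrier V \<Longrightarrow> y \<in> carrier V \<Longrightarrow> f (x \<oplus>\<^bsub>V\<^esub> y) = f x \<oplus>\<^bsub>V\<^esub> f y"
  and lin_smult: "lin f \<Longrightarrow> c \<in> carrier K \<Longrightarrow> x \<in> carrier V \<Longrightarrow> f (c \<odot>\<^bsub>V\<^esub> x) = c \<odot>\<^bsub>V\<^esub> f x"
  by (auto simp: lin_def)

lemma fnlI:
  assumes "\<And>x. x \<in> carrier V \<Longrightarrow> f x \<in> carrier K"
    and "\<And>x y. x \<in> carrier V \<Longrightarrow> y \<in> carrier V \<Longrightarrow> f (x \<oplus>\<^bsub>V\<^esub> y) = f x \<oplus>\<^bsub>K\<^esub> f y"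
    and "\<And>c x. c \<in> carrier K \<Longrightarrow> x \<in> carrier V \<Longrightarrow> f (c \<odot>\<^bsub>V\<^esub> x) = c \<otimes>\<^bsub>K\<^esub> f x"
  shows "fnl f"
  using assms by (auto simp: fnl_def)

lemma fnl_closed: "fnl f \<Longrightarrow> x \<in> carrier V \<Longrightarrow> f x \<in> carrier K"
  and fnl_add: "fnl f \<Longrightarrow> x \<in> carrier V \<Longrightarrow> y \<in> carrier V \<Longrightarrow> f (x \<oplus>\<^bsub>V\<^esub> y) = f x \<oplus>\<^bsub>K\<^esub> f y"
  and fnl_smult: "fnl f \<Longrightarrow> c \<in> carrier K \<Longrightarrow> x \<in> carrier V \<Longrightarrow> f (c \<odot>\<^bsub>V\<^esub> x) = c \<otimes>\<^bsub>K\<^esub> f x"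
  by (auto simp: fnl_def)

lemma lin_zero: "lin f \<Longrightarrow> f \<zero>\<^bsub>V\<^esub> = \<zero>\<^bsub>V\<^esub>"
  using lin_smult[of f "\<zero>\<^bsub>K\<^esub>" "\<zero>\<^bsub>V\<^esub>"] lin_closed[of f "\<zero>\<^bsub>V\<^esub>"] by simp

lemma lin_minus: "lin f \<Longrightarrow> x \<in> carrier V \<Longrightarrow> f (\<ominus>\<^bsub>V\<^esub> x) = \<ominus>\<^bsub>V\<^esub> f x"
  using lin_smult[of f "\<ominus>\<^bsub>K\<^esub> \<one>\<^bsub>K\<^esub>" x] lin_closed[of f x] by (simp add: smult_minus_1)

lemma lin_diff: "lin f \<Longrightarrow> x \<in> carrier V \<Longrightarrow> y \<in> carrier V \<Longrightarrow> f (x \<ominus>\<^bsub>V\<^esub> y) = f x \<ominus>\<^bsub>V\<^esub> f y"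
  by (simp add: a_minus_def lin_add lin_minus)

lemma fnl_zero: "fnl f \<Longrightarrow> f \<zero>\<^bsub>V\<^esub> = \<zero>\<^bsub>K\<^esub>"
  using fnl_smult[of f "\<zero>\<^bsub>K\<^esub>" "\<zero>\<^bsub>V\<^esub>"] fnl_closed[of f "\<zero>\<^bsub>V\<^esub>"] by simp

lemma lin_finsum:
  assumes "lin f" "\<And>b. b \<in> B \<Longrightarrow> g b \<in> carrier V"
  shows "f (\<Oplus>\<^bsub>V\<^esub>b\<in>B. g b) = (\<Oplus>\<^bsub>V\<^esub>b\<in>B. f (g b))"
proof (cases "finite B")
  case True
  then show ?thesis
    using assms(2)
  proof (induction B)
    case empty
    then show ?case by (simp add: lin_zero assms(1))
  next
    case (insert b B)
    then have "g b \<in> carrier V" "\<And>b. b \<in> B \<Longrightarrow> g b \<in> carrier V" by auto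
    with insert lin_closed[OF assms(1)] show ?case
      by (subst (1 2) M.finsum_insert) (auto simp: lin_add assms(1))
  qed
qed (simp add: M.add.finprod_infinite lin_zero assms(1))

text \<open>A basis of \<open>W\<close> is extended to a basis of the whole space. The extension
  makes the coordinate functionals linear everywhere, so they may stand inside Sweedler sums whose
  legs are only known to lie in the ambient space.\<close>

lemma coefficient_functionals:
  assumes fd: fin_dim and W: "LinearCombinations.submodule K W V"
  obtains B c where "finite B" "B \<subseteq> W" "\<And>b. b \<in> B \<Longrightarrow> fnl (c b)"
    "\<And>x. x \<in> W \<Longrightarrow> (\<Oplus>\<^bsub>V\<^esub>b\<in>B. c b x \<odot>\<^bsub>V\<^esub> b) = x"
    "\<And>b b'. b \<in> B \<Longrightarrow> b' \<in> B \<Longrightarrow> c b b' = (if b = b' then \<one>\<^bsub>K\<^esub> else \<zero>\<^bsub>K\<^esub>)"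
proof -
  have WV: "W \<subseteq> carrier V" using W by (simp add: LinearCombinations.submodule_def)
  have empty: "lin_indpt {}" by (auto simp: lin_dep_def)
  \<comment> \<open>The dimension bounds the size of independent sets, so a maximal one exists
    inside \<open>W\<close>; starting again from it gives a maximal one \<open>C\<close> of the
    whole space.\<close>
  have "\<exists>A. finite A \<and> maximal A (\<lambda>S. S \<subseteq> W \<and> lin_indpt S)"
    by (rule maximal_exists[of _ dim "{}"]) (use WV empty li_le_dim[OF fd] in auto)
  then obtain B where B: "finite B" "maximal B (\<lambda>S. S \<subseteq> W \<and> lin_indpt S)" by auto
  then have BW: "B \<subseteq> W" and Bi: "lin_indpt B" by (auto simp: maximal_def)
  have "\<exists>A. finite A \<and> maximal A (\<lambda>S. B \<subseteq> S \<and> S \<subseteq> carrier V \<and> lin_indpt S)"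
    by (rule maximal_exists[of _ dim B]) (use BW WV Bi li_le_dim[OF fd] in auto)
  then obtain C where C: "finite C" "maximal C (\<lambda>S. B \<subseteq> S \<and> S \<subseteq> carrier V \<and> lin_indpt S)" by auto
  then have BC: "B \<subseteq> C" and CV: "C \<subseteq> carrier V" by (auto simp: maximal_def)
  have "maximal C (\<lambda>S. S \<subseteq> carrier V \<and> lin_indpt S)"
    using C(2) unfolding maximal_def by blast
  then have "basis C" by (rule max_li_is_basis)
  then have ex1: "\<exists>!a. a \<in> C \<rightarrow>\<^sub>E carrier K \<and> lincomb a C = v" if "v \<in> carrier V" for v
    using basis_criterion[OF C(1) CV] that by blast
  define co where "co v = (THE a. a \<in> C \<rightarrow>\<^sub>E carrier K \<and> lincomb a C = v)" for v
  have co: "co v \<in> C \<rightarrow>\<^sub>E carrier K" "lincomb (co v) C = v" if "v \<in> carrier V" for v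
    using theI'[OF ex1[OF that]] by (auto simp: co_def)
  have co_eq: "co v b = a b" if "v \<in> carrier V" "a \<in> C \<rightarrow> carrier K" "lincomb a C = v" "b \<in> C" for v a b
  proof -
    have "lincomb (restrict a C) C = lincomb a C"
      using that(2) CV by (intro lincomb_cong) auto
    then have "co v = restrict a C"
      unfolding co_def using that by (intro the1_equality[OF ex1[OF that(1)]]) auto
    then show ?thesis using that(4) by simp
  qed
  have in_span: "x \<in> span B" if "x \<in> W" for x
  proof (rule ccontr)
    assume x: "x \<notin> span B"
    then have "x \<notin> B" using in_own_span[of B] BW WV by auto
    then have "lin_indpt (B \<union> {x})"
      using lin_dep_iff_in_span[of B x] x Bi BW WV that by auto
    then have "B \<union> {x} = B" using B(2) BW that unfolding maximal_def by blast
    then show False using \<open>x \<notin> B\<close> by auto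
  qed
  show thesis
  proof (rule that[of B "\<lambda>b v. co v b"])
    fix b assume b: "b \<in> B"
    show "fnl (\<lambda>v. co v b)"
    proof (rule fnlI)
      fix x assume "x \<in> carrier V"
      then show "co x b \<in> carrier K" using co(1) b BC by auto
    next
      fix x y assume xy: "x \<in> carrier V" "y \<in> carrier V"
      have "co x \<in> C \<rightarrow> carrier K" "co y \<in> C \<rightarrow> carrier K" using co(1) xy by auto
      then show "co (x \<oplus>\<^bsub>V\<^esub> y) b = co x b \<oplus>\<^bsub>K\<^esub> co y b"
        using xy co b BC lincomb_sum[OF C(1) CV, of "co x" "co y"] by (intro co_eq) auto
    next
      fix a x assume ax: "a \<in> carrier K" "x \<in> carrier V"
      then have "co x \<in> C \<rightarrow> carrier K" using co(1) by auto
      then show "co (a \<odot>\<^bsub>V\<^esub> x) b = a \<otimes>\<^bsub>K\<^esub> co x b"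
        using ax co b BC lincomb_smult[OF CV, of "co x" a] by (intro co_eq) auto
    qed
  next
    fix x assume x: "x \<in> W"
    then obtain a where a: "a \<in> B \<rightarrow> carrier K" "lincomb a B = x"
      using finite_in_span[OF B(1), of x] in_span BW WV by auto
    \<comment> \<open>Coordinates in \<open>B\<close> padded by zero are coordinates in
      \<open>C\<close>. Uniqueness identifies them with \<open>co x\<close>, so basis vectors
      outside \<open>B\<close> contribute nothing to an element of \<open>W\<close>.\<close>
    let ?a = "\<lambda>b. if b \<in> B then a b else \<zero>\<^bsub>K\<^esub>"
    have "lincomb ?a C = lincomb ?a B \<oplus>\<^bsub>V\<^esub> lincomb ?a (C - B)"
    proof -
      have "B \<union> (C - B) = C" "B \<subseteq> carrier V" using BC CV by auto
      then show ?thesis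
        using a(1) CV C(1) B(1) lincomb_union[of "B" "C - B" ?a] by fastforce
    qed
    also have "lincomb ?a (C - B) = \<zero>\<^bsub>V\<^esub>" using CV by (intro lincomb_zero) auto
    also have "lincomb ?a B = x"
      using a BW WV lincomb_cong[of B B ?a a] by auto
    finally have "lincomb ?a C = x" using x WV by auto
    moreover have "?a \<in> C \<rightarrow> carrier K" using a(1) by auto
    ultimately have "co x b = a b" if "b \<in> B" for b
      using co_eq[of x ?a b] that BC x WV by auto
    then have "lincomb (co x) B = lincomb a B"
      using a BW WV by (intro lincomb_cong) auto
    then show "(\<Oplus>\<^bsub>V\<^esub>b\<in>B. co x b \<odot>\<^bsub>V\<^esub> b) = x" using a(2) by (simp add: lincomb_def)
  next
    fix b b' assume b: "b \<in> B" "b' \<in> B"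
    let ?a = "\<lambda>b. if b = b' then \<one>\<^bsub>K\<^esub> else \<zero>\<^bsub>K\<^esub>"
    have b'C: "b' \<in> C" "b' \<in> carrier V" using b BC CV by auto
    have "lincomb ?a C = (?a b' \<odot>\<^bsub>V\<^esub> b') \<oplus>\<^bsub>V\<^esub> lincomb ?a (C - {b'})"
      using b'C C(1) CV by (intro lincomb_del2) auto
    also have "lincomb ?a (C - {b'}) = \<zero>\<^bsub>V\<^esub>" using CV by (intro lincomb_zero) auto
    finally have "lincomb ?a C = b'" using b'C by simp
    then show "co b' b = (if b = b' then \<one>\<^bsub>K\<^esub> else \<zero>\<^bsub>K\<^esub>)"
      using b'C b BC by (intro co_eq) auto
  qed (use B BW in auto)
qed

text \<open>An injective map carries a basis of \<open>W\<close> to an independent set of the same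
  cardinality \<open>W.dim\<close>, which is therefore again a basis.\<close>

lemma inj_endo_surj:
  assumes fd: fin_dim and W: "LinearCombinations.submodule K W V"
    and f: "lin f" "\<And>x. x \<in> W \<Longrightarrow> f x \<in> W"
    and inj: "\<And>x. x \<in> W \<Longrightarrow> f x = \<zero>\<^bsub>V\<^esub> \<Longrightarrow> x = \<zero>\<^bsub>V\<^esub>"
  shows "f ` W = W"
proof -
  have WV: "W \<subseteq> carrier V" using W by (simp add: LinearCombinations.submodule_def)
  have sub: "subspace K W V" using W vectorspace_axioms by (simp add: subspace_def)
  interpret W: vectorspace K "vs W" by (rule subspace_is_vs[OF sub])
  have empty: "lin_indpt {}" by (auto simp: lin_dep_def)
  have "\<exists>A. finite A \<and> maximal A (\<lambda>S. S \<subseteq> W \<and> lin_indpt S)"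
    by (rule maximal_exists[of _ dim "{}"]) (use WV empty li_le_dim[OF fd] in auto)
  then obtain B where B: "finite B" "maximal B (\<lambda>S. S \<subseteq> W \<and> lin_indpt S)" by auto
  then have BW: "B \<subseteq> W" by (auto simp: maximal_def)
  have "maximal B (\<lambda>S. S \<subseteq> carrier (vs W) \<and> W.lin_indpt S)"
    using B(2) span_li_not_depend(2)[OF _ W] unfolding maximal_def by auto
  then have basis: "W.basis B" by (rule W.max_li_is_basis)
  then have fdW: "W.fin_dim" using B(1) by (auto simp: W.basis_def W.fin_dim_def)
  interpret f: linear_map K "vs W" "vs W" f
    by unfold_locales (use f WV in \<open>auto simp: module_hom_def lin_def subset_iff\<close>)
  have inj': "inj_on f W"
    using f.Ke0_imp_inj inj W.M.zero_closed lin_zero[OF f(1)] by (auto simp: f.ker_def)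
  have li: "W.lin_indpt (f ` B)"
  proof (rule W.finite_lin_indpt2)
    show "finite (f ` B)" using B(1) by simp
    show "f ` B \<subseteq> carrier (vs W)" using BW f(2) by auto
    fix a assume a: "a \<in> f ` B \<rightarrow> carrier K" and z: "W.lincomb a (f ` B) = \<zero>\<^bsub>vs W\<^esub>"
    have "W.lincomb a (f ` B) = f (W.lincomb (a \<circ> f) B)"
      using f.lincomb_linear_image[of B a] inj' BW a B(1) by simp
    moreover have af: "a \<circ> f \<in> B \<rightarrow> carrier K" using a by auto
    moreover have "W.lincomb (a \<circ> f) B \<in> W" using W.lincomb_closed[of B "a \<circ> f"] BW af by simp
    ultimately have "W.lincomb (a \<circ> f) B = \<zero>\<^bsub>vs W\<^esub>" using z inj by simp
    then have "a \<circ> f \<in> B \<rightarrow> {\<zero>\<^bsub>K\<^esub>}"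
      using W.not_lindepD[of B B "a \<circ> f"] basis B(1) af by (auto simp: W.basis_def)
    then show "\<forall>v\<in>f ` B. a v = \<zero>\<^bsub>K\<^esub>" by auto
  qed
  have "card (f ` B) = W.dim"
    using W.dim_basis[OF B(1) basis] inj' BW by (simp add: card_image inj_on_subset)
  then have "W.basis (f ` B)"
    using li B(1) BW f(2) fdW by (intro W.dim_li_is_basis) auto
  then have "W.span (f ` B) = W" by (simp add: W.basis_def)
  moreover have "W.span (f ` B) \<subseteq> f.im"
    using f.im_is_submodule BW by (intro W.span_is_subset) (auto simp: f.im_def)
  ultimately have "W \<subseteq> f ` W" by (simp add: f.im_def)
  then show ?thesis using f(2) by auto
qed

end

subsection \<open>Sweedler sums\<close>

context hopf_algebra
begin

sublocale HH: two_modules K H H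
  by unfold_locales

sublocale TH: two_modules K "tensor K H H" H
  by (rule two_modules.intro[OF HH.module_tensor module_axioms])

sublocale HT: two_modules K H "tensor K H H"
  by (rule two_modules.intro[OF module_axioms HH.module_tensor])

abbreviation "\<Delta> \<equiv> comult H"
abbreviation "\<epsilon> \<equiv> counit H"
abbreviation "S \<equiv> antipode H"

lemma comult_closed [simp]: "h \<in> carrier H \<Longrightarrow> \<Delta> h \<in> carrier HH.T"
  using comult_linear by (auto simp: module_hom_def)

text \<open>\<open>sw \<beta> h\<close> is the Sweedler sum \<open>\<beta>(h\<^sub>1, h\<^sub>2)\<close>.  Outside the carrier the list of summands is
  empty, so that congruence rules need no membership condition.\<close>

definition legs :: "'h \<Rightarrow> ('h \<times> 'h) list" where
  "legs h = (if h \<in> carrier H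
     then SOME xs. set xs \<subseteq> carrier H \<times> carrier H \<and> \<Delta> h = pair_sum HH.T HH.pt xs else [])"

definition sw :: "('h \<Rightarrow> 'h \<Rightarrow> 'h) \<Rightarrow> 'h \<Rightarrow> 'h" where
  "sw \<beta> h = pair_sum (add_monoid H) \<beta> (legs h)"

lemma legs: "h \<in> carrier H \<Longrightarrow> set (legs h) \<subseteq> carrier H \<times> carrier H \<and> \<Delta> h = pair_sum HH.T HH.pt (legs h)"
  unfolding legs_def
  by (simp, rule someI_ex) (metis HH.tensor_as_pair_sum comult_closed)

lemma legs_closed: "set (legs h) \<subseteq> carrier H \<times> carrier H"
  using legs[of h] by (cases "h \<in> carrier H") (auto simp: legs_def)

lemma legs_mem: "(x, y) \<in> set (legs h) \<Longrightarrow> x \<in> carrier H \<and> y \<in> carrier H"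
  using legs_closed[of h] by auto

text \<open>As a congruence rule this lets the simplifier rewrite under nested Sweedler sums while
  knowing that both legs lie in the carrier; most of the later computations rest on it.\<close>

lemma sw_cong [cong]:
  "h = h' \<Longrightarrow> (\<And>x y. x \<in> carrier H \<Longrightarrow> y \<in> carrier H \<Longrightarrow> \<beta> x y = \<gamma> x y) \<Longrightarrow> sw \<beta> h = sw \<gamma> h'"
  unfolding sw_def using legs_closed[of h] by (auto intro!: pair_sum_cong)

definition bilin :: "('h \<Rightarrow> 'h \<Rightarrow> 'h) \<Rightarrow> bool" where
  "bilin \<beta> \<longleftrightarrow> (\<forall>x\<in>carrier H. lin (\<beta> x)) \<and> (\<forall>y\<in>carrier H. lin (\<lambda>x. \<beta> x y))"

lemma bilinI:
  "(\<And>x. x \<in> carrier H \<Longrightarrow> lin (\<beta> x)) \<Longrightarrow> (\<And>y. y \<in> carrier H \<Longrightarrow> lin (\<lambda>x. \<beta> x y)) \<Longrightarrow> bilin \<beta>"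
  by (simp add: bilin_def)

lemma bilinD1: "bilin \<beta> \<Longrightarrow> x \<in> carrier H \<Longrightarrow> lin (\<beta> x)"
  and bilinD2: "bilin \<beta> \<Longrightarrow> y \<in> carrier H \<Longrightarrow> lin (\<lambda>x. \<beta> x y)"
  by (auto simp: bilin_def)

lemma bilin_closed: "bilin \<beta> \<Longrightarrow> x \<in> carrier H \<Longrightarrow> y \<in> carrier H \<Longrightarrow> \<beta> x y \<in> carrier H"
  using bilinD1 lin_closed by blast

lemma bilin_balanced: "bilin \<beta> \<Longrightarrow> balanced K H H (add_monoid H) \<beta>"
  by (rule balancedI) (auto simp: bilin_def lin_def)

lemma comm_group_H: "comm_group (add_monoid H)"
  by (rule a_comm_group)

lemma sw_list:
  assumes "h \<in> carrier H" "bilin \<beta>"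
    and "set xs \<subseteq> carrier H \<times> carrier H" "\<Delta> h = pair_sum HH.T HH.pt xs"
  shows "sw \<beta> h = pair_sum (add_monoid H) \<beta> xs"
  unfolding sw_def using legs[OF assms(1)] assms
  by (intro HH.pair_sum_eq[OF comm_group_H bilin_balanced]) auto

lemma sw_tensor_lift:
  assumes "h \<in> carrier H" "bilin \<beta>"
  shows "tensor_lift (add_monoid H) \<beta> (\<Delta> h) = sw \<beta> h"
  unfolding sw_def using legs[OF assms(1)]
  by (simp add: HH.tensor_lift_pair_sum[OF comm_group_H bilin_balanced[OF assms(2)]])

lemma sw_closed [simp]:
  "(\<And>x y. x \<in> carrier H \<Longrightarrow> y \<in> carrier H \<Longrightarrow> \<beta> x y \<in> carrier H) \<Longrightarrow> sw \<beta> h \<in> carrier H"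
  unfolding sw_def using legs_closed[of h] M.add.pair_sum_closed[of "legs h" \<beta>] by auto

lemma lin_sw:
  assumes "lin g" "\<And>x y. x \<in> carrier H \<Longrightarrow> y \<in> carrier H \<Longrightarrow> \<beta> x y \<in> carrier H"
  shows "g (sw \<beta> h) = sw (\<lambda>x y. g (\<beta> x y)) h"
  unfolding sw_def using legs_closed[of h] assms lin_closed[OF assms(1)]
  by (intro M.add.pair_sum_hom[OF comm_group_H]) (auto simp: hom_def lin_add)

lemma sw_add:
  assumes "\<And>x y. x \<in> carrier H \<Longrightarrow> y \<in> carrier H \<Longrightarrow> \<beta> x y \<in> carrier H"
    and "\<And>x y. x \<in> carrier H \<Longrightarrow> y \<in> carrier H \<Longrightarrow> \<gamma> x y \<in> carrier H"
  shows "sw (\<lambda>x y. \<beta> x y \<oplus>\<^bsub>H\<^esub> \<gamma> x y) h = sw \<beta> h \<oplus>\<^bsub>H\<^esub> sw \<gamma> h"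
  unfolding sw_def using legs_closed[of h] M.add.pair_sum_mult[of "legs h" \<beta> \<gamma>] assms
  by (auto simp: subset_iff)

lemma sw_zero [simp]: "sw (\<lambda>x y. \<zero>\<^bsub>H\<^esub>) h = \<zero>\<^bsub>H\<^esub>"
proof -
  have "pair_sum (add_monoid H) (\<lambda>x y. \<zero>\<^bsub>H\<^esub>) xs = \<zero>\<^bsub>H\<^esub>" for xs :: "('h \<times> 'h) list"
    by (induction xs) auto
  then show ?thesis by (simp add: sw_def)
qed

lemma sw_arg_add:
  assumes "bilin \<beta>" "x \<in> carrier H" "y \<in> carrier H"
  shows "sw \<beta> (x \<oplus>\<^bsub>H\<^esub> y) = sw \<beta> x \<oplus>\<^bsub>H\<^esub> sw \<beta> y"
proof -
  have "\<Delta> (x \<oplus>\<^bsub>H\<^esub> y) = \<Delta> x \<otimes>\<^bsub>HH.T\<^esub> \<Delta> y"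
    using comult_linear assms by (auto simp: module_hom_def)
  then show ?thesis
    using HH.tensor_lift_hom[OF comm_group_H bilin_balanced[OF assms(1)]] assms
    by (simp add: hom_def flip: sw_tensor_lift)
qed

lemma sw_arg_smult:
  assumes "bilin \<beta>" "c \<in> carrier K" "x \<in> carrier H"
  shows "sw \<beta> (c \<odot>\<^bsub>H\<^esub> x) = c \<odot>\<^bsub>H\<^esub> sw \<beta> x"
proof -
  have "\<Delta> (c \<odot>\<^bsub>H\<^esub> x) = c \<odot>\<^bsub>tensor K H H\<^esub> \<Delta> x"
    using comult_linear assms by (auto simp: module_hom_def)
  moreover have "tensor_lift (add_monoid H) \<beta> (c \<odot>\<^bsub>tensor K H H\<^esub> \<Delta> x) =
      c \<odot>\<^bsub>H\<^esub> tensor_lift (add_monoid H) \<beta> (\<Delta> x)"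
    using assms
    by (intro HH.tensor_lift_smult[OF module_axioms bilin_balanced]) (auto simp: lin_smult[OF bilinD2])
  ultimately show ?thesis using assms by (simp flip: sw_tensor_lift)
qed

lemma sw_swap:
  assumes "\<And>x y u v. x \<in> carrier H \<Longrightarrow> y \<in> carrier H \<Longrightarrow> u \<in> carrier H \<Longrightarrow> v \<in> carrier H \<Longrightarrow>
    F x y u v \<in> carrier H"
  shows "sw (\<lambda>x y. sw (\<lambda>u v. F x y u v) k) h = sw (\<lambda>u v. sw (\<lambda>x y. F x y u v) h) k"
proof -
  have "pair_sum (add_monoid H) (\<lambda>x y. sw (\<lambda>u v. F x y u v) k) xs =
      sw (\<lambda>u v. pair_sum (add_monoid H) (\<lambda>x y. F x y u v) xs) k"
    if "set xs \<subseteq> carrier H \<times> carrier H" for xs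
    using that
  proof (induction xs)
    case (Cons p xs)
    obtain x y where p: "p = (x, y)" by (cases p)
    have "pair_sum (add_monoid H) (\<lambda>x y. F x y u v) xs \<in> carrier H"
      if "u \<in> carrier H" "v \<in> carrier H" for u v
      using Cons.prems assms that by (intro M.add.pair_sum_closed) auto
    with Cons p show ?case by (simp add: sw_add assms)
  qed simp
  then show ?thesis using legs_closed[of h] by (simp add: sw_def[of _ h])
qed

text \<open>Coassociativity is an equation in \<open>H \<otimes> (H \<otimes> H)\<close>. A
  trilinear \<open>F\<close> induces a homomorphism from there to \<open>H\<close>, and applying it
  to both sides gives the two iterated sums.\<close>

lemma sw_assoc:
  assumes h: "h \<in> carrier H"
    and 1: "\<And>v y. v \<in> carrier H \<Longrightarrow> y \<in> carrier H \<Longrightarrow> lin (\<lambda>u. F u v y)"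
    and 2: "\<And>u y. u \<in> carrier H \<Longrightarrow> y \<in> carrier H \<Longrightarrow> lin (\<lambda>v. F u v y)"
    and 3: "\<And>u v. u \<in> carrier H \<Longrightarrow> v \<in> carrier H \<Longrightarrow> lin (\<lambda>y. F u v y)"
  shows "sw (\<lambda>x y. sw (\<lambda>u v. F u v y) x) h = sw (\<lambda>u w. sw (\<lambda>v y. F u v y) w) h"
proof -
  let ?G = "add_monoid (tensor K H (tensor K H H))"
  have xs: "set (legs h) \<subseteq> carrier H \<times> carrier H" "\<Delta> h = pair_sum HH.T HH.pt (legs h)"
    using legs[OF h] by auto
  have id: "(\<lambda>x. x) \<in> module_hom K H H" by (auto simp: module_hom_def)
  have pt_HT: "HT.pt (u \<oplus>\<^bsub>H\<^esub> u') t = HT.pt u t \<otimes>\<^bsub>HT.T\<^esub> HT.pt u' t"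
    if "u \<in> carrier H" "u' \<in> carrier H" "t \<in> carrier HH.T" for u u' t
    using HT.balanced_pt that by (simp add: balanced_def)
  have pt_HT': "HT.pt u (t \<otimes>\<^bsub>HH.T\<^esub> t') = HT.pt u t \<otimes>\<^bsub>HT.T\<^esub> HT.pt u t'"
    if "u \<in> carrier H" "t \<in> carrier HH.T" "t' \<in> carrier HH.T" for u t t'
    using HT.balanced_pt that by (simp add: balanced_def)
  have pt_HT_smult: "HT.pt (c \<odot>\<^bsub>H\<^esub> u) (HH.pt v w) = HT.pt u (HH.pt (c \<odot>\<^bsub>H\<^esub> v) w)"
    if "c \<in> carrier K" "u \<in> carrier H" "v \<in> carrier H" "w \<in> carrier H" for c u v w
    using HT.balanced_pt that HH.smult_tensor_pair_sum[of c "[(v, w)]"] by (simp add: balanced_def)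
  have pt_HH: "HH.pt (u \<oplus>\<^bsub>H\<^esub> u') t = HH.pt u t \<otimes>\<^bsub>HH.T\<^esub> HH.pt u' t"
    "HH.pt t (u \<oplus>\<^bsub>H\<^esub> u') = HH.pt t u \<otimes>\<^bsub>HH.T\<^esub> HH.pt t u'"
    if "u \<in> carrier H" "u' \<in> carrier H" "t \<in> carrier H" for u u' t
    using HH.balanced_pt that by (simp_all add: balanced_def)
  have pt_HH_smult: "HH.pt u (c \<odot>\<^bsub>H\<^esub> v) = HH.pt (c \<odot>\<^bsub>H\<^esub> u) v"
    if "c \<in> carrier K" "u \<in> carrier H" "v \<in> carrier H" for c u v
    using HH.balanced_pt that by (simp add: balanced_def)
  note pts = pt_HT pt_HT' pt_HT_smult pt_HH pt_HH_smult
  have bal: "balanced K H H ?G (\<lambda>u v. HT.pt u (HH.pt v w))" if "w \<in> carrier H" for w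
    by (rule balancedI) (use that in \<open>simp_all add: pts\<close>)
  \<comment> \<open>\<open>tensor_assoc\<close> is itself a lift of lifts: its outer lift can be
    evaluated on a list only once the inner one is known to be balanced.\<close>
  have bal': "balanced K (tensor K H H) H ?G (\<lambda>t w. tensor_lift ?G (\<lambda>u v. HT.pt u (HH.pt v w)) t)"
    by (rule HH.tensor_lift_balanced[OF HT.comm_group_tensor module_axioms bal])
      (simp_all add: pts)
  have "tensor_map K (tensor K H H) H \<Delta> (\<lambda>x. x) (\<Delta> h) =
      pair_sum TH.T (\<lambda>x y. TH.pt (\<Delta> x) y) (legs h)"
    by (subst xs(2)) (rule HH.tensor_map_pair_sum[OF TH.two_modules_axioms comult_linear id xs(1)])
  also have "\<dots> = pair_sum TH.T TH.pt (map (\<lambda>(x, y). (\<Delta> x, y)) (legs h))"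
    by (rule pair_sum_map[symmetric])
  finally have "tensor_assoc K H H H (tensor_map K (tensor K H H) H \<Delta> (\<lambda>x. x) (\<Delta> h)) =
    pair_sum ?G (\<lambda>t w. tensor_lift ?G (\<lambda>u v. HT.pt u (HH.pt v w)) t) (map (\<lambda>(x, y). (\<Delta> x, y)) (legs h))"
    unfolding tensor_assoc_def using xs(1)
    by (simp only:) (intro TH.tensor_lift_pair_sum[OF HT.comm_group_tensor bal'], auto)
  also have "\<dots> = pair_sum ?G (\<lambda>x y. tensor_lift ?G (\<lambda>u v. HT.pt u (HH.pt v y)) (\<Delta> x)) (legs h)"
    by (rule pair_sum_map)
  also have "\<dots> = pair_sum ?G (\<lambda>x y. pair_sum ?G (\<lambda>u v. HT.pt u (HH.pt v y)) (legs x)) (legs h)"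
  proof (rule pair_sum_cong)
    fix x y assume "(x, y) \<in> set (legs h)"
    then have "x \<in> carrier H" "y \<in> carrier H" using xs(1) by auto
    then show "tensor_lift ?G (\<lambda>u v. HT.pt u (HH.pt v y)) (\<Delta> x) =
        pair_sum ?G (\<lambda>u v. HT.pt u (HH.pt v y)) (legs x)"
      using legs[of x] HH.tensor_lift_pair_sum[OF HT.comm_group_tensor bal[of y], of "legs x"]
      by (simp only:)
  qed
  finally have L: "tensor_map K H (tensor K H H) (\<lambda>x. x) \<Delta> (\<Delta> h) =
      pair_sum ?G (\<lambda>x y. pair_sum ?G (\<lambda>u v. HT.pt u (HH.pt v y)) (legs x)) (legs h)"
    using coassoc[OF h] by simp
  have R: "tensor_map K H (tensor K H H) (\<lambda>x. x) \<Delta> (\<Delta> h) =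
      pair_sum HT.T HT.pt (map (\<lambda>(x, y). (x, \<Delta> y)) (legs h))"
    unfolding pair_sum_map
    by (subst xs(2)) (rule HH.tensor_map_pair_sum[OF HT.two_modules_axioms id comult_linear xs(1)])
  have balF: "balanced K H H (add_monoid H) (F u)" if "u \<in> carrier H" for u
    using 2 3 that by (intro bilin_balanced bilinI) auto
  let ?\<Phi> = "tensor_lift (add_monoid H) (\<lambda>u t. tensor_lift (add_monoid H) (F u) t)"
  have balF': "balanced K H (tensor K H H) (add_monoid H) (\<lambda>u t. tensor_lift (add_monoid H) (F u) t)"
    by (rule HH.tensor_lift_balanced[OF comm_group_H module_axioms balF])
      (simp_all add: lin_add[OF 1] lin_smult[OF 1] lin_smult[OF 2])
  have \<Phi>_pt: "?\<Phi> (HT.pt u (HH.pt v y)) = F u v y" if "u \<in> carrier H" "v \<in> carrier H" "y \<in> carrier H" for u v y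
    using that HT.tensor_lift_pt[OF comm_group_H balF'] HH.tensor_lift_pt[OF comm_group_H balF] by simp
  have \<Phi>: "?\<Phi> \<in> hom ?G (add_monoid H)"
    using HT.tensor_lift_hom[OF comm_group_H balF'] by (simp add: hom_def)
  have pc: "pair_sum ?G (\<lambda>u v. HT.pt u (HH.pt v y)) (legs x) \<in> carrier ?G" if "y \<in> carrier H" for x y
    using legs_closed[of x] that
    by (intro comm_group.pair_sum_closed[OF HT.comm_group_tensor]) auto
  have "?\<Phi> (tensor_map K H (tensor K H H) (\<lambda>x. x) \<Delta> (\<Delta> h)) =
      pair_sum (add_monoid H) (\<lambda>x y. ?\<Phi> (pair_sum ?G (\<lambda>u v. HT.pt u (HH.pt v y)) (legs x))) (legs h)"
    unfolding L using xs(1) pc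
    by (intro comm_group.pair_sum_hom[OF HT.comm_group_tensor comm_group_H \<Phi>]) auto
  also have "\<dots> = pair_sum (add_monoid H) (\<lambda>x y. sw (\<lambda>u v. F u v y) x) (legs h)"
  proof (rule pair_sum_cong)
    fix x y assume "(x, y) \<in> set (legs h)"
    then have y: "y \<in> carrier H" using xs(1) by auto
    have "?\<Phi> (pair_sum ?G (\<lambda>u v. HT.pt u (HH.pt v y)) (legs x)) =
        pair_sum (add_monoid H) (\<lambda>u v. ?\<Phi> (HT.pt u (HH.pt v y))) (legs x)"
      using legs_closed[of x] y
      by (intro comm_group.pair_sum_hom[OF HT.comm_group_tensor comm_group_H \<Phi>]) auto
    also have "\<dots> = sw (\<lambda>u v. F u v y) x"
      unfolding sw_def using legs_closed[of x] y by (intro pair_sum_cong \<Phi>_pt) auto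
    finally show "?\<Phi> (pair_sum ?G (\<lambda>u v. HT.pt u (HH.pt v y)) (legs x)) = sw (\<lambda>u v. F u v y) x" .
  qed
  finally have "sw (\<lambda>x y. sw (\<lambda>u v. F u v y) x) h = ?\<Phi> (tensor_map K H (tensor K H H) (\<lambda>x. x) \<Delta> (\<Delta> h))"
    by (simp add: sw_def[of _ h])
  also have "\<dots> = pair_sum (add_monoid H) (\<lambda>u t. tensor_lift (add_monoid H) (F u) t) (map (\<lambda>(x, y). (x, \<Delta> y)) (legs h))"
    unfolding R using xs(1) by (intro HT.tensor_lift_pair_sum[OF comm_group_H balF']) auto
  also have "\<dots> = pair_sum (add_monoid H) (\<lambda>u w. tensor_lift (add_monoid H) (F u) (\<Delta> w)) (legs h)"
    by (rule pair_sum_map)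
  also have "\<dots> = pair_sum (add_monoid H) (\<lambda>u w. sw (F u) w) (legs h)"
    using xs(1) 2 3 by (intro pair_sum_cong sw_tensor_lift) (auto intro!: bilinI)
  finally show ?thesis by (simp add: sw_def[of _ h])
qed

section \<open>Linearity of Sweedler expressions, and the counit and antipode identities\<close>

lemma lin_id: "lin (\<lambda>x. x)"
  by (rule linI) auto

lemma lin_mult_l: "a \<in> carrier H \<Longrightarrow> lin f \<Longrightarrow> lin (\<lambda>x. a \<otimes>\<^bsub>H\<^esub> f x)"
  by (rule linI) (auto simp: lin_closed lin_add lin_smult H.r_distr smult_mult_right)

lemma lin_mult_r: "a \<in> carrier H \<Longrightarrow> lin f \<Longrightarrow> lin (\<lambda>x. f x \<otimes>\<^bsub>H\<^esub> a)"
  by (rule linI) (auto simp: lin_closed lin_add lin_smult H.l_distr smult_mult_left)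

lemma lin_smult_fun: "c \<in> carrier K \<Longrightarrow> lin f \<Longrightarrow> lin (\<lambda>x. c \<odot>\<^bsub>H\<^esub> f x)"
  by (rule linI) (auto simp: lin_closed lin_add lin_smult smult_r_distr smult_assoc_simp R.m_comm)

lemma lin_add_fun: "lin f \<Longrightarrow> lin g \<Longrightarrow> lin (\<lambda>x. f x \<oplus>\<^bsub>H\<^esub> g x)"
  by (rule linI) (auto simp: lin_closed lin_add lin_smult smult_r_distr M.add.m_ac)

lemma lin_comp: "lin g \<Longrightarrow> lin f \<Longrightarrow> lin (\<lambda>x. g (f x))"
  by (rule linI) (auto simp: lin_closed lin_add lin_smult)

lemma lin_fnl: "fnl g \<Longrightarrow> lin f \<Longrightarrow> v \<in> carrier H \<Longrightarrow> lin (\<lambda>x. g (f x) \<odot>\<^bsub>H\<^esub> v)"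
  by (rule linI) (auto simp: lin_closed lin_add lin_smult fnl_closed fnl_add fnl_smult
      smult_l_distr smult_assoc1)

lemma fnl_lin: "fnl g \<Longrightarrow> lin f \<Longrightarrow> fnl (\<lambda>x. g (f x))"
  by (rule fnlI) (auto simp: lin_closed lin_add lin_smult fnl_closed fnl_add fnl_smult)

lemma lin_finsum_fun:
  assumes "\<And>b. b \<in> B \<Longrightarrow> lin (F b)"
  shows "lin (\<lambda>x. \<Oplus>\<^bsub>H\<^esub>b\<in>B. F b x)"
proof (rule linI)
  fix x y assume xy: "x \<in> carrier H" "y \<in> carrier H"
  have "(\<Oplus>\<^bsub>H\<^esub>b\<in>B. F b (x \<oplus>\<^bsub>H\<^esub> y)) = (\<Oplus>\<^bsub>H\<^esub>b\<in>B. F b x \<oplus>\<^bsub>H\<^esub> F b y)"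
    using xy assms by (intro M.finsum_cong') (auto simp: lin_add lin_closed)
  also have "\<dots> = (\<Oplus>\<^bsub>H\<^esub>b\<in>B. F b x) \<oplus>\<^bsub>H\<^esub> (\<Oplus>\<^bsub>H\<^esub>b\<in>B. F b y)"
    using xy assms by (intro M.finsum_addf) (auto simp: lin_closed)
  finally show "(\<Oplus>\<^bsub>H\<^esub>b\<in>B. F b (x \<oplus>\<^bsub>H\<^esub> y)) = \<dots>" .
next
  fix c x assume xy: "c \<in> carrier K" "x \<in> carrier H"
  have "(\<Oplus>\<^bsub>H\<^esub>b\<in>B. F b (c \<odot>\<^bsub>H\<^esub> x)) = (\<Oplus>\<^bsub>H\<^esub>b\<in>B. c \<odot>\<^bsub>H\<^esub> F b x)"
    using xy assms by (intro M.finsum_cong') (auto simp: lin_smult lin_closed)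
  also have "\<dots> = c \<odot>\<^bsub>H\<^esub> (\<Oplus>\<^bsub>H\<^esub>b\<in>B. F b x)"
    using xy assms by (intro finsum_smult[symmetric]) (auto simp: lin_closed)
  finally show "(\<Oplus>\<^bsub>H\<^esub>b\<in>B. F b (c \<odot>\<^bsub>H\<^esub> x)) = \<dots>" .
qed (use assms in \<open>auto intro!: M.finsum_closed simp: lin_closed\<close>)

lemma lin_sw_fun:
  assumes "\<And>x y. x \<in> carrier H \<Longrightarrow> y \<in> carrier H \<Longrightarrow> lin (\<lambda>z. \<beta> z x y)"
  shows "lin (\<lambda>z. sw (\<beta> z) h)"
proof (rule linI)
  fix x y assume xy: "x \<in> carrier H" "y \<in> carrier H"
  have "sw (\<beta> (x \<oplus>\<^bsub>H\<^esub> y)) h = sw (\<lambda>u v. \<beta> x u v \<oplus>\<^bsub>H\<^esub> \<beta> y u v) h"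
    using xy by (simp add: lin_add[OF assms])
  then show "sw (\<beta> (x \<oplus>\<^bsub>H\<^esub> y)) h = sw (\<beta> x) h \<oplus>\<^bsub>H\<^esub> sw (\<beta> y) h"
    using xy by (simp add: sw_add lin_closed[OF assms])
next
  fix c x assume xy: "c \<in> carrier K" "x \<in> carrier H"
  have "sw (\<beta> (c \<odot>\<^bsub>H\<^esub> x)) h = sw (\<lambda>u v. c \<odot>\<^bsub>H\<^esub> \<beta> x u v) h"
    using xy by (simp add: lin_smult[OF assms])
  then show "sw (\<beta> (c \<odot>\<^bsub>H\<^esub> x)) h = c \<odot>\<^bsub>H\<^esub> sw (\<beta> x) h"
    using xy lin_sw[OF lin_smult_fun[OF _ lin_id], of c "\<beta> x" h] by (simp add: lin_closed[OF assms])
qed (use lin_closed[OF assms] in simp)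

lemma lin_sw_arg: "bilin \<beta> \<Longrightarrow> lin g \<Longrightarrow> lin (\<lambda>z. sw \<beta> (g z))"
  by (rule linI) (auto simp: lin_closed lin_add lin_smult sw_arg_add sw_arg_smult bilin_closed)

lemma lin_antipode: "lin f \<Longrightarrow> lin (\<lambda>x. S (f x))"
  by (rule lin_comp) (use antipode_linear in \<open>auto simp: lin_def module_hom_def\<close>)

lemma fnl_counit: "fnl \<epsilon>"
  using counit_ring_hom counit_smult by (intro fnlI) (auto simp: ring_hom_def)

lemmas lin_counit = lin_fnl[OF fnl_counit]

text \<open>Applied backwards: linearity of a Sweedler term in one variable is reduced to the
  operations occurring in it. Further functionals are covered by adding instances of
  \<open>lin_fnl\<close> locally.\<close>

lemmas lins = lin_id lin_mult_l lin_mult_r lin_smult_fun lin_add_fun lin_sw_fun lin_sw_arg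
  lin_antipode lin_counit bilinI lin_finsum_fun

lemma antipode_closed [simp]: "x \<in> carrier H \<Longrightarrow> S x \<in> carrier H"
  using lin_closed[OF lin_antipode[OF lin_id]] .

lemma counit_closed [simp]: "x \<in> carrier H \<Longrightarrow> \<epsilon> x \<in> carrier K"
  using fnl_closed[OF fnl_counit] .

lemma counit_mult [simp]: "x \<in> carrier H \<Longrightarrow> y \<in> carrier H \<Longrightarrow> \<epsilon> (x \<otimes>\<^bsub>H\<^esub> y) = \<epsilon> x \<otimes>\<^bsub>K\<^esub> \<epsilon> y"
  using counit_ring_hom by (auto simp: ring_hom_def)

lemma counit_one [simp]: "\<epsilon> \<one>\<^bsub>H\<^esub> = \<one>\<^bsub>K\<^esub>"
  using counit_ring_hom by (auto simp: ring_hom_def)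

lemma sw_counit_l:
  assumes "lin f" "h \<in> carrier H"
  shows "sw (\<lambda>x y. \<epsilon> x \<odot>\<^bsub>H\<^esub> f y) h = f h"
proof -
  have "sw (\<lambda>x y. \<epsilon> x \<odot>\<^bsub>H\<^esub> y) h = h"
    using counit_left[OF assms(2)] assms(2) by (subst (asm) sw_tensor_lift) (simp_all add: lins)
  moreover have "f (sw (\<lambda>x y. \<epsilon> x \<odot>\<^bsub>H\<^esub> y) h) = sw (\<lambda>x y. \<epsilon> x \<odot>\<^bsub>H\<^esub> f y) h"
    using assms by (subst lin_sw) (simp_all add: lin_smult)
  ultimately show ?thesis by simp
qed

lemma sw_counit_r:
  assumes "lin f" "h \<in> carrier H"
  shows "sw (\<lambda>x y. \<epsilon> y \<odot>\<^bsub>H\<^esub> f x) h = f h"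
proof -
  have "sw (\<lambda>x y. \<epsilon> y \<odot>\<^bsub>H\<^esub> x) h = h"
    using counit_right[OF assms(2)] assms(2) by (subst (asm) sw_tensor_lift) (simp_all add: lins)
  moreover have "f (sw (\<lambda>x y. \<epsilon> y \<odot>\<^bsub>H\<^esub> x) h) = sw (\<lambda>x y. \<epsilon> y \<odot>\<^bsub>H\<^esub> f x) h"
    using assms by (subst lin_sw) (simp_all add: lin_smult)
  ultimately show ?thesis by simp
qed

lemma sw_antipode_l:
  assumes "lin f" "h \<in> carrier H"
  shows "sw (\<lambda>x y. f (S x \<otimes>\<^bsub>H\<^esub> y)) h = \<epsilon> h \<odot>\<^bsub>H\<^esub> f \<one>\<^bsub>H\<^esub>"
proof -
  have "sw (\<lambda>x y. S x \<otimes>\<^bsub>H\<^esub> y) h = \<epsilon> h \<odot>\<^bsub>H\<^esub> \<one>\<^bsub>H\<^esub>"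
    using antipode_left[OF assms(2)] assms(2) by (subst (asm) sw_tensor_lift) (simp_all add: lins)
  moreover have "f (sw (\<lambda>x y. S x \<otimes>\<^bsub>H\<^esub> y) h) = sw (\<lambda>x y. f (S x \<otimes>\<^bsub>H\<^esub> y)) h"
    using assms by (subst lin_sw) simp_all
  ultimately show ?thesis using assms by (simp add: lin_smult)
qed

lemma sw_antipode_r:
  assumes "lin f" "h \<in> carrier H"
  shows "sw (\<lambda>x y. f (x \<otimes>\<^bsub>H\<^esub> S y)) h = \<epsilon> h \<odot>\<^bsub>H\<^esub> f \<one>\<^bsub>H\<^esub>"
proof -
  have "sw (\<lambda>x y. x \<otimes>\<^bsub>H\<^esub> S y) h = \<epsilon> h \<odot>\<^bsub>H\<^esub> \<one>\<^bsub>H\<^esub>"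
    using antipode_right[OF assms(2)] assms(2) by (subst (asm) sw_tensor_lift) (simp_all add: lins)
  moreover have "f (sw (\<lambda>x y. x \<otimes>\<^bsub>H\<^esub> S y) h) = sw (\<lambda>x y. f (x \<otimes>\<^bsub>H\<^esub> S y)) h"
    using assms by (subst lin_sw) simp_all
  ultimately show ?thesis using assms by (simp add: lin_smult)
qed

section \<open>Multiplicativity of the comultiplication\<close>

lemma HH_pt_add:
  "u \<in> carrier H \<Longrightarrow> u' \<in> carrier H \<Longrightarrow> t \<in> carrier H \<Longrightarrow> HH.pt (u \<oplus>\<^bsub>H\<^esub> u') t = HH.pt u t \<otimes>\<^bsub>HH.T\<^esub> HH.pt u' t"
  "u \<in> carrier H \<Longrightarrow> u' \<in> carrier H \<Longrightarrow> t \<in> carrier H \<Longrightarrow> HH.pt t (u \<oplus>\<^bsub>H\<^esub> u') = HH.pt t u \<otimes>\<^bsub>HH.T\<^esub> HH.pt t u'"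
  "c \<in> carrier K \<Longrightarrow> u \<in> carrier H \<Longrightarrow> t \<in> carrier H \<Longrightarrow> HH.pt u (c \<odot>\<^bsub>H\<^esub> t) = HH.pt (c \<odot>\<^bsub>H\<^esub> u) t"
  using HH.balanced_pt by (simp_all add: balanced_def)

text \<open>The presentations of the two factors are arbitrary, so that those inside Hopf
  subalgebras can be inserted later. Multiplication of tensors is a double lift, and each lift is
  evaluated on its own list.\<close>

lemma comult_mult:
  assumes x: "x \<in> carrier H" and y: "y \<in> carrier H"
    and xs: "set xs \<subseteq> carrier H \<times> carrier H" "\<Delta> x = pair_sum HH.T HH.pt xs"
    and ys: "set ys \<subseteq> carrier H \<times> carrier H" "\<Delta> y = pair_sum HH.T HH.pt ys"
  shows "\<Delta> (x \<otimes>\<^bsub>H\<^esub> y) = pair_sum HH.T (\<lambda>a b. pair_sum HH.T (\<lambda>c d. HH.pt (a \<otimes>\<^bsub>H\<^esub> c) (b \<otimes>\<^bsub>H\<^esub> d)) ys) xs"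
proof -
  let ?g = "\<lambda>a b. pair_sum HH.T (\<lambda>c d. HH.pt (a \<otimes>\<^bsub>H\<^esub> c) (b \<otimes>\<^bsub>H\<^esub> d)) ys"
  let ?g' = "\<lambda>a b. tensor_lift HH.T (\<lambda>c d. HH.pt (a \<otimes>\<^bsub>H\<^esub> c) (b \<otimes>\<^bsub>H\<^esub> d)) (\<Delta> y)"
  have ysD: "a \<in> carrier H \<and> b \<in> carrier H" if "(a, b) \<in> set ys" for a b using that ys(1) by auto
  have bal: "balanced K H H HH.T (\<lambda>c d. HH.pt (a \<otimes>\<^bsub>H\<^esub> c) (b \<otimes>\<^bsub>H\<^esub> d))"
    if "a \<in> carrier H" "b \<in> carrier H" for a b
    by (rule balancedI) (use that in \<open>simp_all add: HH_pt_add H.r_distr smult_mult_right\<close>)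
  have g': "?g' a b = ?g a b" if "a \<in> carrier H" "b \<in> carrier H" for a b
    using HH.tensor_lift_pair_sum[OF HH.T.comm_group_axioms bal[OF that] ys(1)] ys(2) by simp
  have "balanced K H H HH.T ?g'"
  proof (rule balancedI, goal_cases)
    case (1 v w)
    then show ?case by (simp add: g') (auto intro!: HH.T.pair_sum_closed dest: ysD)
  next
    case (2 v v' w)
    then show ?case
      by (simp add: g', subst HH.T.pair_sum_mult[symmetric])
        (auto intro!: pair_sum_cong dest!: ysD simp: H.l_distr HH_pt_add(1))
  next
    case (3 v w w')
    then show ?case
      by (simp add: g', subst HH.T.pair_sum_mult[symmetric])
        (auto intro!: pair_sum_cong dest!: ysD simp: H.l_distr HH_pt_add(2))
  next
    case (4 c v w)
    then show ?case
      by (simp add: g') (auto intro!: pair_sum_cong dest!: ysD simp: HH_pt_add(3) smult_mult_left)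
  qed
  from HH.tensor_lift_pair_sum[OF HH.T.comm_group_axioms this xs(1)]
  have "tensor_lift HH.T ?g' (\<Delta> x) = pair_sum HH.T ?g' xs" using xs(2) by simp
  also have "\<dots> = pair_sum HH.T ?g xs"
    using xs(1) by (intro pair_sum_cong g') auto
  finally show ?thesis
    using comult_ring_hom x y by (simp add: ring_hom_def tensor_def)
qed

lemma sw_mult:
  assumes \<beta>: "bilin \<beta>" and x: "x \<in> carrier H" and y: "y \<in> carrier H"
  shows "sw \<beta> (x \<otimes>\<^bsub>H\<^esub> y) = sw (\<lambda>a b. sw (\<lambda>c d. \<beta> (a \<otimes>\<^bsub>H\<^esub> c) (b \<otimes>\<^bsub>H\<^esub> d)) y) x"
proof -
  let ?L = "tensor_lift (add_monoid H) \<beta>"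
  note hom = HH.tensor_lift_hom[OF comm_group_H bilin_balanced[OF \<beta>]]
  have closed: "pair_sum HH.T (\<lambda>c d. HH.pt (a \<otimes>\<^bsub>H\<^esub> c) (b \<otimes>\<^bsub>H\<^esub> d)) (legs y) \<in> carrier HH.T"
    if "(a, b) \<in> set (legs x)" for a b
    using legs_mem[OF that] by (intro HH.T.pair_sum_closed) (auto dest: legs_mem)
  have "sw \<beta> (x \<otimes>\<^bsub>H\<^esub> y) = ?L (\<Delta> (x \<otimes>\<^bsub>H\<^esub> y))"
    using assms by (simp add: sw_tensor_lift)
  also have "\<dots> = pair_sum (add_monoid H) (\<lambda>a b. ?L (pair_sum HH.T (\<lambda>c d. HH.pt (a \<otimes>\<^bsub>H\<^esub> c) (b \<otimes>\<^bsub>H\<^esub> d)) (legs y))) (legs x)"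
    unfolding comult_mult[OF x y legs_closed conjunct2[OF legs[OF x]] legs_closed conjunct2[OF legs[OF y]]] using closed by (intro HH.T.pair_sum_hom[OF comm_group_H hom]) auto
  also have "\<dots> = pair_sum (add_monoid H) (\<lambda>a b. sw (\<lambda>c d. \<beta> (a \<otimes>\<^bsub>H\<^esub> c) (b \<otimes>\<^bsub>H\<^esub> d)) y) (legs x)"
  proof (rule pair_sum_cong)
    fix a b assume "(a, b) \<in> set (legs x)"
    then have ab: "a \<in> carrier H" "b \<in> carrier H" using legs_closed[of x] by auto
    have "?L (pair_sum HH.T (\<lambda>c d. HH.pt (a \<otimes>\<^bsub>H\<^esub> c) (b \<otimes>\<^bsub>H\<^esub> d)) (legs y)) =
        pair_sum (add_monoid H) (\<lambda>c d. ?L (HH.pt (a \<otimes>\<^bsub>H\<^esub> c) (b \<otimes>\<^bsub>H\<^esub> d))) (legs y)"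
      using ab legs_closed[of y] by (intro HH.T.pair_sum_hom[OF comm_group_H hom]) auto
    also have "\<dots> = sw (\<lambda>c d. \<beta> (a \<otimes>\<^bsub>H\<^esub> c) (b \<otimes>\<^bsub>H\<^esub> d)) y"
      unfolding sw_def using ab legs_closed[of y]
      by (intro pair_sum_cong HH.tensor_lift_pt[OF comm_group_H bilin_balanced[OF \<beta>]]) auto
    finally show "?L (pair_sum HH.T (\<lambda>c d. HH.pt (a \<otimes>\<^bsub>H\<^esub> c) (b \<otimes>\<^bsub>H\<^esub> d)) (legs y)) = \<dots>" .
  qed
  finally show ?thesis by (simp add: sw_def[of _ x])
qed

lemma sw_one:
  assumes "bilin \<beta>"
  shows "sw \<beta> \<one>\<^bsub>H\<^esub> = \<beta> \<one>\<^bsub>H\<^esub> \<one>\<^bsub>H\<^esub>"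
proof -
  have "\<Delta> \<one>\<^bsub>H\<^esub> = HH.pt \<one>\<^bsub>H\<^esub> \<one>\<^bsub>H\<^esub>"
    using comult_ring_hom by (simp add: ring_hom_def tensor_def)
  then show ?thesis
    using assms sw_list[of "\<one>\<^bsub>H\<^esub>" \<beta> "[(\<one>\<^bsub>H\<^esub>, \<one>\<^bsub>H\<^esub>)]"] by (simp add: bilin_closed)
qed

lemma sw_pull:
  assumes "\<And>x y. x \<in> carrier H \<Longrightarrow> y \<in> carrier H \<Longrightarrow> \<beta> x y \<in> carrier H"
  shows "a \<in> carrier H \<Longrightarrow> a \<otimes>\<^bsub>H\<^esub> sw \<beta> h = sw (\<lambda>x y. a \<otimes>\<^bsub>H\<^esub> \<beta> x y) h"
    and "a \<in> carrier H \<Longrightarrow> sw \<beta> h \<otimes>\<^bsub>H\<^esub> a = sw (\<lambda>x y. \<beta> x y \<otimes>\<^bsub>H\<^esub> a) h"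
    and "c \<in> carrier K \<Longrightarrow> c \<odot>\<^bsub>H\<^esub> sw \<beta> h = sw (\<lambda>x y. c \<odot>\<^bsub>H\<^esub> \<beta> x y) h"
  using lin_sw[OF lin_mult_l[OF _ lin_id], of a \<beta> h] lin_sw[OF lin_mult_r[OF _ lin_id], of a \<beta> h]
    lin_sw[OF lin_smult_fun[OF _ lin_id], of c \<beta> h] assms by auto

lemma sw_finsum:
  assumes "finite B" "\<And>b x y. b \<in> B \<Longrightarrow> x \<in> carrier H \<Longrightarrow> y \<in> carrier H \<Longrightarrow> F b x y \<in> carrier H"
  shows "sw (\<lambda>x y. \<Oplus>\<^bsub>H\<^esub>b\<in>B. F b x y) h = (\<Oplus>\<^bsub>H\<^esub>b\<in>B. sw (F b) h)"
  using assms
proof (induction B)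
  case (insert b B)
  have "(\<Oplus>\<^bsub>H\<^esub>b\<in>insert b B. F b x y) = F b x y \<oplus>\<^bsub>H\<^esub> (\<Oplus>\<^bsub>H\<^esub>b\<in>B. F b x y)"
    if "x \<in> carrier H" "y \<in> carrier H" for x y
    using insert that by (intro M.finsum_insert) auto
  moreover have "(\<Oplus>\<^bsub>H\<^esub>b\<in>insert b B. sw (F b) h) = sw (F b) h \<oplus>\<^bsub>H\<^esub> (\<Oplus>\<^bsub>H\<^esub>b\<in>B. sw (F b) h)"
    using insert by (intro M.finsum_insert) auto
  moreover have "(\<Oplus>\<^bsub>H\<^esub>b\<in>B. F b x y) \<in> carrier H" if "x \<in> carrier H" "y \<in> carrier H" for x y
    using insert that by (intro M.finsum_closed) auto
  ultimately show ?case using insert by (simp add: sw_add)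
qed simp

text \<open>The counit recovers a scalar from its multiple of the unit, so scalar identities can be
  proved as \<open>H\<close>-valued Sweedler identities.\<close>

lemma smult_one_inject:
  assumes "a \<in> carrier K" "b \<in> carrier K" "a \<odot>\<^bsub>H\<^esub> \<one>\<^bsub>H\<^esub> = b \<odot>\<^bsub>H\<^esub> \<one>\<^bsub>H\<^esub>"
  shows "a = b"
proof -
  have "a \<otimes>\<^bsub>K\<^esub> \<epsilon> \<one>\<^bsub>H\<^esub> = b \<otimes>\<^bsub>K\<^esub> \<epsilon> \<one>\<^bsub>H\<^esub>"
    using assms(3) counit_smult[OF assms(1) H.one_closed] counit_smult[OF assms(2) H.one_closed] by simp
  then show ?thesis using assms by simp
qed

section \<open>The antipode as an anti-homomorphism of algebras and coalgebras\<close>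

lemma sw_antipode_l3:
  assumes "bilin G" "h \<in> carrier H"
  shows "sw (\<lambda>x w. sw (\<lambda>u v. G (S x \<otimes>\<^bsub>H\<^esub> u) v) w) h = G \<one>\<^bsub>H\<^esub> h"
proof -
  note l = bilinD1[OF assms(1)] and r = bilinD2[OF assms(1)]
  \<comment> \<open>Coassociativity brings the antipode and its neighbouring leg under one inner
    sum, where they collapse to a counit; the counit then absorbs a leg.\<close>
  have "sw (\<lambda>x w. sw (\<lambda>u v. G (S x \<otimes>\<^bsub>H\<^esub> u) v) w) h = sw (\<lambda>x v. sw (\<lambda>x u. G (S x \<otimes>\<^bsub>H\<^esub> u) v) x) h"
    using assms by (subst sw_assoc) (simp_all add: lins l lin_comp[OF r])
  also have "\<dots> = sw (\<lambda>x v. \<epsilon> x \<odot>\<^bsub>H\<^esub> G \<one>\<^bsub>H\<^esub> v) h"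
    by (simp add: sw_antipode_l[OF r])
  also have "\<dots> = G \<one>\<^bsub>H\<^esub> h" using assms by (simp add: sw_counit_l l)
  finally show ?thesis .
qed

lemma sw_antipode_r3:
  assumes "bilin G" "h \<in> carrier H"
  shows "sw (\<lambda>x w. sw (\<lambda>u v. G (x \<otimes>\<^bsub>H\<^esub> S u) v) w) h = G \<one>\<^bsub>H\<^esub> h"
proof -
  note l = bilinD1[OF assms(1)] and r = bilinD2[OF assms(1)]
  have "sw (\<lambda>x w. sw (\<lambda>u v. G (x \<otimes>\<^bsub>H\<^esub> S u) v) w) h = sw (\<lambda>x v. sw (\<lambda>x u. G (x \<otimes>\<^bsub>H\<^esub> S u) v) x) h"
    using assms by (subst sw_assoc) (simp_all add: lins l lin_comp[OF r])
  also have "\<dots> = sw (\<lambda>x v. \<epsilon> x \<odot>\<^bsub>H\<^esub> G \<one>\<^bsub>H\<^esub> v) h"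
    by (simp add: sw_antipode_r[OF r])
  also have "\<dots> = G \<one>\<^bsub>H\<^esub> h" using assms by (simp add: sw_counit_l l)
  finally show ?thesis .
qed

text \<open>Here the antipode and its partner already share the inner sum, so the identity collapses
  without rebracketing.\<close>

lemma sw_antipode_l3':
  assumes "bilin G" "h \<in> carrier H"
  shows "sw (\<lambda>x w. sw (\<lambda>u v. G x (S u \<otimes>\<^bsub>H\<^esub> v)) w) h = G h \<one>\<^bsub>H\<^esub>"
  using assms by (simp add: sw_antipode_l[OF bilinD1[OF assms(1)]] sw_counit_r bilinD2)

lemma antipode_one [simp]: "S \<one>\<^bsub>H\<^esub> = \<one>\<^bsub>H\<^esub>"
  using sw_antipode_l[OF lin_id H.one_closed] by (subst (asm) sw_one) (simp_all add: lins)

text \<open>The multiplicative counit is applied to \<open>S h1 h2\<close>; multiples of the unit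
  keep the sum \<open>H\<close>-valued.\<close>

lemma counit_antipode [simp]:
  assumes h: "h \<in> carrier H"
  shows "\<epsilon> (S h) = \<epsilon> h"
proof -
  have "\<epsilon> (S h) \<odot>\<^bsub>H\<^esub> \<one>\<^bsub>H\<^esub> = sw (\<lambda>x y. \<epsilon> y \<odot>\<^bsub>H\<^esub> (\<epsilon> (S x) \<odot>\<^bsub>H\<^esub> \<one>\<^bsub>H\<^esub>)) h"
    using h by (subst sw_counit_r) (simp_all add: lins)
  also have "\<dots> = sw (\<lambda>x y. \<epsilon> (S x \<otimes>\<^bsub>H\<^esub> y) \<odot>\<^bsub>H\<^esub> \<one>\<^bsub>H\<^esub>) h"
    by (simp add: R.m_comm smult_assoc1[symmetric])
  also have "\<dots> = \<epsilon> h \<odot>\<^bsub>H\<^esub> (\<epsilon> \<one>\<^bsub>H\<^esub> \<odot>\<^bsub>H\<^esub> \<one>\<^bsub>H\<^esub>)"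
    by (rule sw_antipode_l[of "\<lambda>z. \<epsilon> z \<odot>\<^bsub>H\<^esub> \<one>\<^bsub>H\<^esub>"]) (simp_all add: lins h)
  finally show ?thesis using h by (intro smult_one_inject) auto
qed

text \<open>Both sides are convolution inverses of the multiplication. The uniqueness argument is
  unwound: a counit is inserted as \<open>x2 y2 S (x3 y3)\<close>, after which
  \<open>S x1 x2\<close> and then \<open>S y1 y2\<close> collapse.\<close>

lemma antipode_mult:
  assumes x: "x \<in> carrier H" and y: "y \<in> carrier H"
  shows "S (x \<otimes>\<^bsub>H\<^esub> y) = S y \<otimes>\<^bsub>H\<^esub> S x"
proof -
  have "S y \<otimes>\<^bsub>H\<^esub> S x = sw (\<lambda>x1 x'. sw (\<lambda>y1 y'. \<epsilon> (x' \<otimes>\<^bsub>H\<^esub> y') \<odot>\<^bsub>H\<^esub> (S y1 \<otimes>\<^bsub>H\<^esub> S x1)) y) x"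
    using x y by (simp add: smult_assoc1 sw_pull(3)[symmetric] sw_counit_r lins)
  also have "\<dots> = sw (\<lambda>x1 x'. sw (\<lambda>y1 y'. sw (\<lambda>u v. S y1 \<otimes>\<^bsub>H\<^esub> S x1 \<otimes>\<^bsub>H\<^esub> (u \<otimes>\<^bsub>H\<^esub> S v)) (x' \<otimes>\<^bsub>H\<^esub> y')) y) x"
    by (simp only: sw_antipode_r[OF lin_mult_l[OF _ lin_id]] H.m_closed antipode_closed H.r_one cong: sw_cong)
  also have "\<dots> = sw (\<lambda>x1 x'. sw (\<lambda>y1 y'. sw (\<lambda>x2 x3. sw (\<lambda>y2 y3.
      S y1 \<otimes>\<^bsub>H\<^esub> S x1 \<otimes>\<^bsub>H\<^esub> (x2 \<otimes>\<^bsub>H\<^esub> y2 \<otimes>\<^bsub>H\<^esub> S (x3 \<otimes>\<^bsub>H\<^esub> y3))) y') x') y) x"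
    by (simp add: sw_mult lins)
  \<comment> \<open>The sums over the legs of \<open>x\<close> move outside, so that
    \<open>S x1\<close> and \<open>x2\<close> become neighbours in the nesting as well as in the
    product.\<close>
  also have "\<dots> = sw (\<lambda>x1 x'. sw (\<lambda>x2 x3. sw (\<lambda>y1 y'. sw (\<lambda>y2 y3.
      S y1 \<otimes>\<^bsub>H\<^esub> S x1 \<otimes>\<^bsub>H\<^esub> (x2 \<otimes>\<^bsub>H\<^esub> y2 \<otimes>\<^bsub>H\<^esub> S (x3 \<otimes>\<^bsub>H\<^esub> y3))) y') y) x') x"
    by (intro sw_cong refl sw_swap) simp
  also have "\<dots> = sw (\<lambda>x1 x'. sw (\<lambda>x2 x3. sw (\<lambda>y1 y'. sw (\<lambda>y2 y3.
      S y1 \<otimes>\<^bsub>H\<^esub> (S x1 \<otimes>\<^bsub>H\<^esub> x2) \<otimes>\<^bsub>H\<^esub> y2 \<otimes>\<^bsub>H\<^esub> S (x3 \<otimes>\<^bsub>H\<^esub> y3)) y') y) x') x"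
    by (simp add: H.m_assoc)
  also have "\<dots> = sw (\<lambda>y1 y'. sw (\<lambda>y2 y3.
      S y1 \<otimes>\<^bsub>H\<^esub> \<one>\<^bsub>H\<^esub> \<otimes>\<^bsub>H\<^esub> y2 \<otimes>\<^bsub>H\<^esub> S (x \<otimes>\<^bsub>H\<^esub> y3)) y') y"
    using x y by (intro sw_antipode_l3[of "\<lambda>z x3. sw (\<lambda>y1 y'. sw (\<lambda>y2 y3.
      S y1 \<otimes>\<^bsub>H\<^esub> z \<otimes>\<^bsub>H\<^esub> y2 \<otimes>\<^bsub>H\<^esub> S (x3 \<otimes>\<^bsub>H\<^esub> y3)) y') y"]) (simp_all add: lins)
  also have "\<dots> = sw (\<lambda>y1 y'. sw (\<lambda>y2 y3. (S y1 \<otimes>\<^bsub>H\<^esub> y2) \<otimes>\<^bsub>H\<^esub> S (x \<otimes>\<^bsub>H\<^esub> y3)) y') y"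
    by simp
  also have "\<dots> = \<one>\<^bsub>H\<^esub> \<otimes>\<^bsub>H\<^esub> S (x \<otimes>\<^bsub>H\<^esub> y)"
    using x y by (intro sw_antipode_l3[of "\<lambda>z y3. z \<otimes>\<^bsub>H\<^esub> S (x \<otimes>\<^bsub>H\<^esub> y3)"]) (simp_all add: lins)
  finally show ?thesis using x y by simp
qed

text \<open>Again uniqueness of convolution inverses, now for the comultiplication: a counit is
  written as \<open>\<Delta> (h3 S h4)\<close>, and the antipodes \<open>S h2\<close> and
  \<open>S h1\<close> cancel against the left and then the right leg of
  \<open>\<Delta> h3\<close>.\<close>

lemma sw_antipode:
  assumes \<beta>: "bilin \<beta>" and h: "h \<in> carrier H"
  shows "sw \<beta> (S h) = sw (\<lambda>x y. \<beta> (S y) (S x)) h"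
proof -
  note [simp] = bilin_closed[OF \<beta>]
  note \<beta>l = lin_comp[OF bilinD1[OF \<beta>]] lin_comp[OF bilinD2[OF \<beta>]]
  have ant: "sw (\<lambda>x y. sw (\<lambda>u v. \<beta> (S h2 \<otimes>\<^bsub>H\<^esub> u) (S h1 \<otimes>\<^bsub>H\<^esub> v)) (x \<otimes>\<^bsub>H\<^esub> S y)) r = \<epsilon> r \<odot>\<^bsub>H\<^esub> \<beta> (S h2) (S h1)"
    if "h1 \<in> carrier H" "h2 \<in> carrier H" "r \<in> carrier H" for h1 h2 r
    using that by (subst sw_antipode_r[of "\<lambda>z. sw (\<lambda>u v. \<beta> (S h2 \<otimes>\<^bsub>H\<^esub> u) (S h1 \<otimes>\<^bsub>H\<^esub> v)) z"])
      (simp_all add: lins \<beta>l sw_one)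
  have "sw (\<lambda>x y. \<beta> (S y) (S x)) h = sw (\<lambda>h1 r. sw (\<lambda>h2 h3. \<epsilon> h3 \<odot>\<^bsub>H\<^esub> \<beta> (S h2) (S h1)) r) h"
    by (simp add: sw_counit_r lins \<beta>l)
  also have "\<dots> = sw (\<lambda>h1 r. sw (\<lambda>h2 r. sw (\<lambda>x y. sw (\<lambda>u v. \<beta> (S h2 \<otimes>\<^bsub>H\<^esub> u) (S h1 \<otimes>\<^bsub>H\<^esub> v)) (x \<otimes>\<^bsub>H\<^esub> S y)) r) r) h"
    by (simp add: ant)
  also have "\<dots> = sw (\<lambda>h1 r. sw (\<lambda>h2 r. sw (\<lambda>x y. sw (\<lambda>a b. sw (\<lambda>p q.
      \<beta> (S h2 \<otimes>\<^bsub>H\<^esub> (a \<otimes>\<^bsub>H\<^esub> p)) (S h1 \<otimes>\<^bsub>H\<^esub> (b \<otimes>\<^bsub>H\<^esub> q))) (S y)) x) r) r) h"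
    by (simp add: sw_mult lins \<beta>l)
  also have "\<dots> = sw (\<lambda>h1 r. sw (\<lambda>h2 r. sw (\<lambda>a r. sw (\<lambda>b y. sw (\<lambda>p q.
      \<beta> ((S h2 \<otimes>\<^bsub>H\<^esub> a) \<otimes>\<^bsub>H\<^esub> p) (S h1 \<otimes>\<^bsub>H\<^esub> b \<otimes>\<^bsub>H\<^esub> q)) (S y)) r) r) r) h"
    by (simp add: sw_assoc lins \<beta>l H.m_assoc)
  also have "\<dots> = sw (\<lambda>h1 r. sw (\<lambda>b y. sw (\<lambda>p q.
      \<beta> (\<one>\<^bsub>H\<^esub> \<otimes>\<^bsub>H\<^esub> p) (S h1 \<otimes>\<^bsub>H\<^esub> b \<otimes>\<^bsub>H\<^esub> q)) (S y)) r) h"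
    by (rule sw_cong[OF refl], rule sw_antipode_l3[of "\<lambda>z w. sw (\<lambda>b y. sw (\<lambda>p q.
      \<beta> (z \<otimes>\<^bsub>H\<^esub> p) (S _ \<otimes>\<^bsub>H\<^esub> b \<otimes>\<^bsub>H\<^esub> q)) (S y)) w"]) (simp_all add: lins \<beta>l)
  also have "\<dots> = sw (\<lambda>p q. \<beta> (\<one>\<^bsub>H\<^esub> \<otimes>\<^bsub>H\<^esub> p) (\<one>\<^bsub>H\<^esub> \<otimes>\<^bsub>H\<^esub> q)) (S h)"
    by (rule sw_antipode_l3[of "\<lambda>z y. sw (\<lambda>p q. \<beta> (\<one>\<^bsub>H\<^esub> \<otimes>\<^bsub>H\<^esub> p) (z \<otimes>\<^bsub>H\<^esub> q)) (S y)"])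
      (simp_all add: lins \<beta>l h)
  finally show ?thesis by simp
qed

subsection \<open>Hopf subalgebras\<close>

abbreviation "hs A \<equiv> hopf_subalgebra K A H"

abbreviation "smod A \<equiv> LinearCombinations.submodule K A H"

lemma smodD:
  assumes "smod A"
  shows "A \<subseteq> carrier H" "\<zero>\<^bsub>H\<^esub> \<in> A" "x \<in> A \<Longrightarrow> y \<in> A \<Longrightarrow> x \<oplus>\<^bsub>H\<^esub> y \<in> A"
    "c \<in> carrier K \<Longrightarrow> x \<in> A \<Longrightarrow> c \<odot>\<^bsub>H\<^esub> x \<in> A"
  using assms by (auto simp: LinearCombinations.submodule_def)

lemma smodI:
  assumes "A \<subseteq> carrier H" "\<zero>\<^bsub>H\<^esub> \<in> A" "\<And>x y. x \<in> A \<Longrightarrow> y \<in> A \<Longrightarrow> x \<oplus>\<^bsub>H\<^esub> y \<in> A"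
    "\<And>c x. c \<in> carrier K \<Longrightarrow> x \<in> A \<Longrightarrow> c \<odot>\<^bsub>H\<^esub> x \<in> A"
  shows "smod A"
  using assms by (auto simp: LinearCombinations.submodule_def module_axioms)

lemma smod_minus: "smod A \<Longrightarrow> x \<in> A \<Longrightarrow> \<ominus>\<^bsub>H\<^esub> x \<in> A"
  using smodD(4)[of A "\<ominus>\<^bsub>K\<^esub> \<one>\<^bsub>K\<^esub>" x] smodD(1)[of A] by (auto simp: smult_minus_1 subset_iff)

lemma smod_diff: "smod A \<Longrightarrow> x \<in> A \<Longrightarrow> y \<in> A \<Longrightarrow> x \<ominus>\<^bsub>H\<^esub> y \<in> A"
  by (simp add: a_minus_def smodD smod_minus)

lemma smod_finsum:
  assumes "smod A" "\<And>b. b \<in> B \<Longrightarrow> F b \<in> A"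
  shows "(\<Oplus>\<^bsub>H\<^esub>b\<in>B. F b) \<in> A"
proof (cases "finite B")
  case True
  then show ?thesis
    using assms(2)
  proof (induction B)
    case (insert b B)
    have "F \<in> B \<rightarrow> carrier H" "F b \<in> carrier H" using insert.prems smodD(1)[OF assms(1)] by auto
    moreover have "F b \<in> A" "(\<Oplus>\<^bsub>H\<^esub>b\<in>B. F b) \<in> A" using insert by auto
    ultimately show ?case using insert.hyps smodD(3)[OF assms(1)] by simp
  qed (simp add: smodD(2)[OF assms(1)])
qed (simp add: M.add.finprod_infinite smodD(2)[OF assms(1)])

lemma smod_carrier: "smod (carrier H)"
  by (rule smodI) auto

lemma hsD:
  assumes "hs A"
  shows "smod A" "\<one>\<^bsub>H\<^esub> \<in> A" "x \<in> A \<Longrightarrow> y \<in> A \<Longrightarrow> x \<otimes>\<^bsub>H\<^esub> y \<in> A" "x \<in> A \<Longrightarrow> S x \<in> A"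
    "x \<in> A \<Longrightarrow> x \<in> carrier H"
  using assms smodD(1)[of A] by (auto simp: hopf_subalgebra_def submonoid_def)

lemma two_modules_sub: "smod A \<Longrightarrow> two_modules K (H\<lparr>carrier := A\<rparr>) (H\<lparr>carrier := A\<rparr>)"
  using submodule_is_module[of A] by (simp add: two_modules_def)

lemma sub_tensor_incl_pair_sum:
  assumes A: "smod A" and xs: "set xs \<subseteq> A \<times> A"
  shows "sub_tensor_incl K H (pair_sum (tensor_group K (H\<lparr>carrier := A\<rparr>) (H\<lparr>carrier := A\<rparr>))
      (pure_tensor K (H\<lparr>carrier := A\<rparr>) (H\<lparr>carrier := A\<rparr>)) xs) = pair_sum HH.T HH.pt xs"
proof -
  interpret A: two_modules K "H\<lparr>carrier := A\<rparr>" "H\<lparr>carrier := A\<rparr>" by (rule two_modules_sub[OF A])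
  have "(\<lambda>x. x) \<in> module_hom K (H\<lparr>carrier := A\<rparr>) H"
    using smodD(1)[OF A] by (auto simp: module_hom_def)
  then show ?thesis
    unfolding sub_tensor_incl_def
    using A.tensor_map_pair_sum[OF HH.two_modules_axioms, of "\<lambda>x. x" "\<lambda>x. x" xs] xs by simp
qed

text \<open>The map \<open>sub_tensor_incl\<close> sends the tensor presented by a list of pairs
  from \<open>A\<close> to the one presented by the same list in \<open>H\<close>; the condition on
  the comultiplication thus becomes the existence of such a list.\<close>

lemma hopf_subalgebra_iff:
  "hs A \<longleftrightarrow> smod A \<and> \<one>\<^bsub>H\<^esub> \<in> A \<and> (\<forall>x\<in>A. \<forall>y\<in>A. x \<otimes>\<^bsub>H\<^esub> y \<in> A) \<and> (\<forall>x\<in>A. S x \<in> A) \<and>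
     (\<forall>a\<in>A. \<exists>xs. set xs \<subseteq> A \<times> A \<and> \<Delta> a = pair_sum HH.T HH.pt xs)"
proof (cases "smod A")
  case True
  interpret A: two_modules K "H\<lparr>carrier := A\<rparr>" "H\<lparr>carrier := A\<rparr>" by (rule two_modules_sub[OF True])
  have "(t \<in> sub_tensor_incl K H ` carrier (tensor K (H\<lparr>carrier := A\<rparr>) (H\<lparr>carrier := A\<rparr>))) \<longleftrightarrow>
      (\<exists>xs. set xs \<subseteq> A \<times> A \<and> t = pair_sum HH.T HH.pt xs)" for t
  proof
    assume "t \<in> sub_tensor_incl K H ` carrier (tensor K (H\<lparr>carrier := A\<rparr>) (H\<lparr>carrier := A\<rparr>))"
    then obtain u where u: "u \<in> carrier A.T" "t = sub_tensor_incl K H u" by auto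
    obtain xs where "set xs \<subseteq> A \<times> A" "u = pair_sum A.T A.pt xs"
      using A.tensor_as_pair_sum[OF u(1)] by auto
    then show "\<exists>xs. set xs \<subseteq> A \<times> A \<and> t = pair_sum HH.T HH.pt xs"
      using u(2) sub_tensor_incl_pair_sum[OF True] by auto
  next
    assume "\<exists>xs. set xs \<subseteq> A \<times> A \<and> t = pair_sum HH.T HH.pt xs"
    then obtain xs where xs: "set xs \<subseteq> A \<times> A" "t = pair_sum HH.T HH.pt xs" by auto
    have "pair_sum A.T A.pt xs \<in> carrier A.T"
      using xs(1) by (intro A.T.pair_sum_closed A.pt_closed) auto
    then show "t \<in> sub_tensor_incl K H ` carrier (tensor K (H\<lparr>carrier := A\<rparr>) (H\<lparr>carrier := A\<rparr>))"
      using xs sub_tensor_incl_pair_sum[OF True xs(1)] by (auto intro!: image_eqI)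
  qed
  then show ?thesis
    using True smodD(1)[OF True] by (auto simp: hopf_subalgebra_def submonoid_def)
qed (simp add: hopf_subalgebra_def)

lemma hs_legs:
  assumes "hs A" "a \<in> A"
  obtains xs where "set xs \<subseteq> A \<times> A" "\<Delta> a = pair_sum HH.T HH.pt xs"
proof -
  have "\<exists>xs. set xs \<subseteq> A \<times> A \<and> \<Delta> a = pair_sum HH.T HH.pt xs"
    using assms(1)[unfolded hopf_subalgebra_iff] assms(2) by simp
  then show thesis using that by auto
qed

text \<open>The list \<open>legs a\<close> is chosen in \<open>H\<close> and may leave
  \<open>A\<close>. Bilinearity on all of \<open>H\<close> allows passing to a presentation inside
  \<open>A\<close>, where the two integrands agree.\<close>

lemma sw_sub:
  assumes A: "hs A" "a \<in> A" and "bilin \<beta>" "bilin \<gamma>"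
    and "\<And>x y. x \<in> A \<Longrightarrow> y \<in> A \<Longrightarrow> \<beta> x y = \<gamma> x y"
  shows "sw \<beta> a = sw \<gamma> a"
proof -
  obtain xs where xs: "set xs \<subseteq> A \<times> A" "\<Delta> a = pair_sum HH.T HH.pt xs" using hs_legs[OF A] .
  moreover have "a \<in> carrier H" "set xs \<subseteq> carrier H \<times> carrier H" using hsD(5)[OF A(1)] A(2) xs(1) by auto
  ultimately have "sw \<beta> a = pair_sum (add_monoid H) \<beta> xs" "sw \<gamma> a = pair_sum (add_monoid H) \<gamma> xs"
    using sw_list[of a _ xs] assms by auto
  then show ?thesis using xs(1) assms(5) by (auto intro: pair_sum_cong)
qed

lemma sw_sub_zero:
  assumes "hs A" "a \<in> A" "bilin \<beta>"
    and "\<And>x y. x \<in> A \<Longrightarrow> y \<in> A \<Longrightarrow> \<beta> x y = \<zero>\<^bsub>H\<^esub>"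
  shows "sw \<beta> a = \<zero>\<^bsub>H\<^esub>"
proof -
  have "bilin (\<lambda>x y. \<zero>\<^bsub>H\<^esub>)" by (intro bilinI linI) auto
  then show ?thesis using sw_sub[OF assms(1-3), of "\<lambda>x y. \<zero>\<^bsub>H\<^esub>"] assms(4) by simp
qed

lemma sw_sub_in:
  assumes A: "hs A" "a \<in> A" and "bilin \<beta>" and W: "smod W"
    and "\<And>x y. x \<in> A \<Longrightarrow> y \<in> A \<Longrightarrow> \<beta> x y \<in> W"
  shows "sw \<beta> a \<in> W"
proof -
  obtain xs where xs: "set xs \<subseteq> A \<times> A" "\<Delta> a = pair_sum HH.T HH.pt xs" using hs_legs[OF A] .
  moreover have "a \<in> carrier H" "set xs \<subseteq> carrier H \<times> carrier H" using hsD(5)[OF A(1)] A(2) xs(1) by auto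
  ultimately have "sw \<beta> a = pair_sum (add_monoid H) \<beta> xs"
    using sw_list[of a _ xs] assms by auto
  moreover have "pair_sum (add_monoid H) \<beta> xs \<in> W" using xs(1)
    by (induction xs) (auto simp: smodD[OF W] assms(5))
  ultimately show ?thesis by simp
qed

lemma finsum_swap:
  assumes "finite B" "finite C" "\<And>b c. b \<in> B \<Longrightarrow> c \<in> C \<Longrightarrow> F b c \<in> carrier H"
  shows "(\<Oplus>\<^bsub>H\<^esub>b\<in>B. \<Oplus>\<^bsub>H\<^esub>c\<in>C. F b c) = (\<Oplus>\<^bsub>H\<^esub>c\<in>C. \<Oplus>\<^bsub>H\<^esub>b\<in>B. F b c)"
  using assms(1,3)
proof (induction B)
  case (insert b B)
  have "(\<Oplus>\<^bsub>H\<^esub>c\<in>C. \<Oplus>\<^bsub>H\<^esub>b\<in>insert b B. F b c) = (\<Oplus>\<^bsub>H\<^esub>c\<in>C. F b c \<oplus>\<^bsub>H\<^esub> (\<Oplus>\<^bsub>H\<^esub>b\<in>B. F b c))"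
    using insert by (intro M.finsum_cong' M.finsum_insert) auto
  also have "\<dots> = (\<Oplus>\<^bsub>H\<^esub>c\<in>C. F b c) \<oplus>\<^bsub>H\<^esub> (\<Oplus>\<^bsub>H\<^esub>c\<in>C. \<Oplus>\<^bsub>H\<^esub>b\<in>B. F b c)"
    using insert by (intro M.finsum_addf) auto
  finally show ?case using insert by (subst M.finsum_insert) auto
qed simp

lemma fnl_finsum_smult:
  assumes "finite B" "\<And>b. b \<in> B \<Longrightarrow> f b \<in> carrier K" "v \<in> carrier H"
  shows "(\<Oplus>\<^bsub>K\<^esub>b\<in>B. f b) \<odot>\<^bsub>H\<^esub> v = (\<Oplus>\<^bsub>H\<^esub>b\<in>B. f b \<odot>\<^bsub>H\<^esub> v)"
  using assms by (intro finsum_smult_r) auto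

lemma fnl_finsum_fun:
  assumes "finite B" "\<And>b. b \<in> B \<Longrightarrow> fnl (F b)"
  shows "fnl (\<lambda>x. \<Oplus>\<^bsub>K\<^esub>b\<in>B. F b x)"
  using assms
proof (induction B)
  case empty
  show ?case by (rule fnlI) auto
next
  case (insert b B)
  then have IH: "fnl (\<lambda>x. \<Oplus>\<^bsub>K\<^esub>b\<in>B. F b x)" and b: "fnl (F b)" by auto
  have *: "(\<Oplus>\<^bsub>K\<^esub>b\<in>insert b B. F b x) = F b x \<oplus>\<^bsub>K\<^esub> (\<Oplus>\<^bsub>K\<^esub>b\<in>B. F b x)" if "x \<in> carrier H" for x
    using insert that by (intro R.finsum_insert) (auto intro: fnl_closed)
  show ?case
    by (rule fnlI) (auto simp: * fnl_closed[OF b] fnl_closed[OF IH] fnl_add[OF b] fnl_add[OF IH]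
        fnl_smult[OF b] fnl_smult[OF IH] R.r_distr R.add.m_ac)
qed

subsection \<open>Integrals of finite-dimensional Hopf algebras\<close>

text \<open>A left integral in the dual algebra of \<open>A\<close>. The functional is defined on
  all of \<open>H\<close> while the condition concerns \<open>A\<close> only, so that integrals of
  different subalgebras can be combined without restricting maps.\<close>

definition left_integral_on :: "'h set \<Rightarrow> ('h \<Rightarrow> 'k) \<Rightarrow> bool" where
  "left_integral_on A f \<longleftrightarrow> fnl f \<and> (\<forall>a\<in>A. sw (\<lambda>x y. f y \<odot>\<^bsub>H\<^esub> x) a = f a \<odot>\<^bsub>H\<^esub> \<one>\<^bsub>H\<^esub>)"

text \<open>Only the one vector \<open>q\<close> has to be expanded by \<open>B\<close>. With
  \<open>q\<close> a leg inside the subalgebra spanned by \<open>B\<close>, this contracts a basis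
  sum against its coordinates.\<close>

lemma coord_collapse:
  assumes "lin G" "finite B" "B \<subseteq> carrier H" "\<And>b. b \<in> B \<Longrightarrow> fnl (c b)" "q \<in> carrier H"
    and "(\<Oplus>\<^bsub>H\<^esub>b\<in>B. c b q \<odot>\<^bsub>H\<^esub> b) = q"
  shows "(\<Oplus>\<^bsub>H\<^esub>b\<in>B. c b q \<odot>\<^bsub>H\<^esub> G b) = G q"
proof -
  have "G (\<Oplus>\<^bsub>H\<^esub>b\<in>B. c b q \<odot>\<^bsub>H\<^esub> b) = (\<Oplus>\<^bsub>H\<^esub>b\<in>B. G (c b q \<odot>\<^bsub>H\<^esub> b))"
    using assms fnl_closed by (intro lin_finsum) auto
  also have "\<dots> = (\<Oplus>\<^bsub>H\<^esub>b\<in>B. c b q \<odot>\<^bsub>H\<^esub> G b)"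
    using assms fnl_closed lin_closed[OF assms(1)]
    by (intro M.finsum_cong') (auto simp: lin_smult[OF assms(1)] subset_iff)
  finally show ?thesis using assms(6) by simp
qed

text \<open>The left leg of \<open>\<Delta> (x S (S u2))\<close> is \<open>x1\<close> times a double
  antipode; multiplied by \<open>S u1\<close> it becomes \<open>x1 S (u1 S u2)\<close> and
  collapses. The square of the antipode in the trace formula is there for this cancellation.\<close>

lemma sw_twist:
  assumes g: "fnl g" and x: "x \<in> carrier H" and u: "u \<in> carrier H"
  shows "sw (\<lambda>u1 u2. sw (\<lambda>p q. g q \<odot>\<^bsub>H\<^esub> (p \<otimes>\<^bsub>H\<^esub> S u1)) (x \<otimes>\<^bsub>H\<^esub> S (S u2))) u =
    sw (\<lambda>x1 x2. g (x2 \<otimes>\<^bsub>H\<^esub> S (S u)) \<odot>\<^bsub>H\<^esub> x1) x"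
proof -
  note [simp] = fnl_closed[OF g] and gl = lin_fnl[OF g]
  have "sw (\<lambda>u1 r. sw (\<lambda>p q. g q \<odot>\<^bsub>H\<^esub> (p \<otimes>\<^bsub>H\<^esub> S u1)) (x \<otimes>\<^bsub>H\<^esub> S (S r))) u =
    sw (\<lambda>u1 r. sw (\<lambda>x1 x2. sw (\<lambda>u2 u3. g (x2 \<otimes>\<^bsub>H\<^esub> S (S u3)) \<odot>\<^bsub>H\<^esub> (x1 \<otimes>\<^bsub>H\<^esub> S (S u2) \<otimes>\<^bsub>H\<^esub> S u1)) r) x) u"
    using x by (simp add: sw_mult sw_antipode lins gl)
  also have "\<dots> = sw (\<lambda>u1 r. sw (\<lambda>u2 u3. sw (\<lambda>x1 x2. g (x2 \<otimes>\<^bsub>H\<^esub> S (S u3)) \<odot>\<^bsub>H\<^esub> (x1 \<otimes>\<^bsub>H\<^esub> S (u1 \<otimes>\<^bsub>H\<^esub> S u2))) x) r) u"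
    by (rule sw_cong[OF refl], subst sw_swap) (simp_all add: antipode_mult H.m_assoc)
  also have "\<dots> = sw (\<lambda>x1 x2. g (x2 \<otimes>\<^bsub>H\<^esub> S (S u)) \<odot>\<^bsub>H\<^esub> (x1 \<otimes>\<^bsub>H\<^esub> S \<one>\<^bsub>H\<^esub>)) x"
    using x u by (intro sw_antipode_r3[of "\<lambda>z u3. sw (\<lambda>x1 x2. g (x2 \<otimes>\<^bsub>H\<^esub> S (S u3)) \<odot>\<^bsub>H\<^esub> (x1 \<otimes>\<^bsub>H\<^esub> S z)) x"])
      (simp_all add: lins gl)
  finally show ?thesis by simp
qed

text \<open>The functional is the trace \<open>x \<mapsto> tr(a \<mapsto> f(a\<^sub>2) x S\<^sup>2(a\<^sub>1))\<close> on \<open>A\<close>, written in a basis.\<close>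

lemma trace_integral:
  assumes A: "hs A" and B: "finite B" "B \<subseteq> A" "\<And>b. b \<in> B \<Longrightarrow> fnl (c b)"
    and repr: "\<And>x. x \<in> A \<Longrightarrow> (\<Oplus>\<^bsub>H\<^esub>b\<in>B. c b x \<odot>\<^bsub>H\<^esub> b) = x" and f: "fnl f"
  shows "left_integral_on A (\<lambda>x. \<Oplus>\<^bsub>K\<^esub>b\<in>B. c b (sw (\<lambda>u v. f v \<odot>\<^bsub>H\<^esub> (x \<otimes>\<^bsub>H\<^esub> S (S u))) b))"
    (is "left_integral_on A ?L")
proof -
  note Ac = hsD(5)[OF A]
  have Bc: "B \<subseteq> carrier H" by (rule subsetI, rule Ac, rule subsetD[OF B(2)])
  note [simp] = fnl_closed[OF f] fnl_closed[OF B(3)] and fl = lin_fnl[OF f] and cl = lin_fnl[OF B(3)]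
  note ls = lins fl cl
  have bc: "b \<in> B \<Longrightarrow> b \<in> carrier H" for b using Bc by auto
  have bA: "b \<in> B \<Longrightarrow> b \<in> A" for b using B(2) by auto
  note [simp] = bc
  have cc: "fnl (\<lambda>x. c b (sw (\<lambda>u v. f v \<odot>\<^bsub>H\<^esub> (x \<otimes>\<^bsub>H\<^esub> S (S u))) b))" if "b \<in> B" for b
    using that by (intro fnl_lin[OF B(3)]) (simp_all add: ls)
  have Lf: "fnl ?L" by (rule fnl_finsum_fun[OF B(1) cc])
  have L: "?L x \<odot>\<^bsub>H\<^esub> v = (\<Oplus>\<^bsub>H\<^esub>b\<in>B. c b (sw (\<lambda>u v. f v \<odot>\<^bsub>H\<^esub> (x \<otimes>\<^bsub>H\<^esub> S (S u))) b) \<odot>\<^bsub>H\<^esub> v)"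
    if "x \<in> carrier H" "v \<in> carrier H" for x v
    using that by (intro fnl_finsum_smult[OF B(1)]) auto
  have "sw (\<lambda>x y. ?L y \<odot>\<^bsub>H\<^esub> x) x = ?L x \<odot>\<^bsub>H\<^esub> \<one>\<^bsub>H\<^esub>" if xA: "x \<in> A" for x
  proof -
    have x: "x \<in> carrier H" using xA Ac by auto
    \<comment> \<open>The operator whose trace is the value at \<open>x\<close>. It maps
      \<open>A\<close> to itself, so it has a matrix in the basis \<open>B\<close>.\<close>
    define T where "T w = sw (\<lambda>u v. f v \<odot>\<^bsub>H\<^esub> (x \<otimes>\<^bsub>H\<^esub> S (S u))) w" for w
    have T: "lin T" unfolding T_def using x by (simp add: ls)
    have Tc [simp]: "T w \<in> carrier H" if "w \<in> carrier H" for w using lin_closed[OF T that] .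
    have TA: "T w \<in> A" if "w \<in> A" for w
      unfolding T_def using that xA x
      by (intro sw_sub_in[OF A]) (simp_all add: ls hsD[OF A] smodD[OF hsD(1)[OF A]])
    note ls' = ls lin_comp[OF T] lin_fnl[OF B(3)]
    \<comment> \<open>\<open>sw_twist\<close> moves the splitting from \<open>x\<close> to the
      operator applied to \<open>b\<close>, so that only \<open>T\<close> remains; expanding
      \<open>T w\<close> in \<open>B\<close> then separates the two basis indices.\<close>
    have inner: "sw (\<lambda>x1 x2. c b (sw (\<lambda>u v. f v \<odot>\<^bsub>H\<^esub> (x2 \<otimes>\<^bsub>H\<^esub> S (S u))) b) \<odot>\<^bsub>H\<^esub> x1) x =
        (\<Oplus>\<^bsub>H\<^esub>b'\<in>B. sw (\<lambda>p q. c b q \<odot>\<^bsub>H\<^esub> sw (\<lambda>u1 w. c b' (T w) \<odot>\<^bsub>H\<^esub> (p \<otimes>\<^bsub>H\<^esub> S u1)) b) b')"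
      if b: "b \<in> B" for b
    proof -
      have "sw (\<lambda>x1 x2. c b (sw (\<lambda>u v. f v \<odot>\<^bsub>H\<^esub> (x2 \<otimes>\<^bsub>H\<^esub> S (S u))) b) \<odot>\<^bsub>H\<^esub> x1) x =
          sw (\<lambda>x1 x2. sw (\<lambda>u v. f v \<odot>\<^bsub>H\<^esub> (c b (x2 \<otimes>\<^bsub>H\<^esub> S (S u)) \<odot>\<^bsub>H\<^esub> x1)) b) x"
      proof (rule sw_cong[OF refl])
        fix x1 x2 assume "x1 \<in> carrier H" "x2 \<in> carrier H"
        then show "c b (sw (\<lambda>u v. f v \<odot>\<^bsub>H\<^esub> (x2 \<otimes>\<^bsub>H\<^esub> S (S u))) b) \<odot>\<^bsub>H\<^esub> x1 =
            sw (\<lambda>u v. f v \<odot>\<^bsub>H\<^esub> (c b (x2 \<otimes>\<^bsub>H\<^esub> S (S u)) \<odot>\<^bsub>H\<^esub> x1)) b"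
          using b lin_sw[OF lin_fnl[OF B(3)[OF b] lin_id], of x1 "\<lambda>u v. f v \<odot>\<^bsub>H\<^esub> (x2 \<otimes>\<^bsub>H\<^esub> S (S u))" b]
          by (simp add: fnl_smult[OF B(3)[OF b]] smult_assoc1)
      qed
      also have "\<dots> = sw (\<lambda>u v. f v \<odot>\<^bsub>H\<^esub> sw (\<lambda>x1 x2. c b (x2 \<otimes>\<^bsub>H\<^esub> S (S u)) \<odot>\<^bsub>H\<^esub> x1) x) b"
        using b by (subst sw_swap) (simp_all add: sw_pull)
      also have "\<dots> = sw (\<lambda>u v. sw (\<lambda>u1 u2. f v \<odot>\<^bsub>H\<^esub> sw (\<lambda>p q. c b q \<odot>\<^bsub>H\<^esub> (p \<otimes>\<^bsub>H\<^esub> S u1)) (x \<otimes>\<^bsub>H\<^esub> S (S u2))) u) b"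
        using b x by (simp add: sw_twist[OF B(3), symmetric] sw_pull(3))
      also have "\<dots> = sw (\<lambda>u1 w. sw (\<lambda>u2 v. f v \<odot>\<^bsub>H\<^esub> sw (\<lambda>p q. c b q \<odot>\<^bsub>H\<^esub> (p \<otimes>\<^bsub>H\<^esub> S u1)) (x \<otimes>\<^bsub>H\<^esub> S (S u2))) w) b"
        using b x by (intro sw_assoc) (simp_all add: ls)
      also have "\<dots> = sw (\<lambda>u1 w. sw (\<lambda>p q. c b q \<odot>\<^bsub>H\<^esub> (p \<otimes>\<^bsub>H\<^esub> S u1)) (T w)) b"
      proof (rule sw_cong[OF refl])
        fix u1 w assume "u1 \<in> carrier H" "w \<in> carrier H"
        then show "sw (\<lambda>u2 v. f v \<odot>\<^bsub>H\<^esub> sw (\<lambda>p q. c b q \<odot>\<^bsub>H\<^esub> (p \<otimes>\<^bsub>H\<^esub> S u1)) (x \<otimes>\<^bsub>H\<^esub> S (S u2))) w =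
            sw (\<lambda>p q. c b q \<odot>\<^bsub>H\<^esub> (p \<otimes>\<^bsub>H\<^esub> S u1)) (T w)"
          unfolding T_def using b x
          by (subst lin_sw[where g = "\<lambda>z. sw (\<lambda>p q. c b q \<odot>\<^bsub>H\<^esub> (p \<otimes>\<^bsub>H\<^esub> S u1)) z"])
            (simp_all add: ls sw_arg_smult)
      qed
      also have "\<dots> = sw (\<lambda>u1 w. \<Oplus>\<^bsub>H\<^esub>b'\<in>B. c b' (T w) \<odot>\<^bsub>H\<^esub> sw (\<lambda>p q. c b q \<odot>\<^bsub>H\<^esub> (p \<otimes>\<^bsub>H\<^esub> S u1)) b') b"
      proof (rule sw_sub[OF A])
        fix u1 w assume "u1 \<in> A" "w \<in> A"
        then have "u1 \<in> carrier H" "w \<in> carrier H" "T w \<in> A" using Ac TA by auto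
        then show "sw (\<lambda>p q. c b q \<odot>\<^bsub>H\<^esub> (p \<otimes>\<^bsub>H\<^esub> S u1)) (T w) =
            (\<Oplus>\<^bsub>H\<^esub>b'\<in>B. c b' (T w) \<odot>\<^bsub>H\<^esub> sw (\<lambda>p q. c b q \<odot>\<^bsub>H\<^esub> (p \<otimes>\<^bsub>H\<^esub> S u1)) b')"
          using b by - (rule coord_collapse[symmetric, OF _ B(1) Bc B(3)], simp_all add: ls repr)
      qed (use b x bA in \<open>simp_all add: ls' T\<close>)
      also have "\<dots> = (\<Oplus>\<^bsub>H\<^esub>b'\<in>B. sw (\<lambda>u1 w. c b' (T w) \<odot>\<^bsub>H\<^esub> sw (\<lambda>p q. c b q \<odot>\<^bsub>H\<^esub> (p \<otimes>\<^bsub>H\<^esub> S u1)) b') b)"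
        using b by (intro sw_finsum[OF B(1)]) simp
      also have "\<dots> = (\<Oplus>\<^bsub>H\<^esub>b'\<in>B. sw (\<lambda>p q. c b q \<odot>\<^bsub>H\<^esub> sw (\<lambda>u1 w. c b' (T w) \<odot>\<^bsub>H\<^esub> (p \<otimes>\<^bsub>H\<^esub> S u1)) b) b')"
      proof (rule M.finsum_cong'[OF refl])
        fix b' assume b': "b' \<in> B"
        have "sw (\<lambda>u1 w. c b' (T w) \<odot>\<^bsub>H\<^esub> sw (\<lambda>p q. c b q \<odot>\<^bsub>H\<^esub> (p \<otimes>\<^bsub>H\<^esub> S u1)) b') b =
            sw (\<lambda>u1 w. sw (\<lambda>p q. c b q \<odot>\<^bsub>H\<^esub> (c b' (T w) \<odot>\<^bsub>H\<^esub> (p \<otimes>\<^bsub>H\<^esub> S u1))) b') b"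
          using b b' by (simp add: sw_pull(3) smult_assoc1[symmetric] R.m_comm)
        then show "sw (\<lambda>u1 w. c b' (T w) \<odot>\<^bsub>H\<^esub> sw (\<lambda>p q. c b q \<odot>\<^bsub>H\<^esub> (p \<otimes>\<^bsub>H\<^esub> S u1)) b') b =
            sw (\<lambda>p q. c b q \<odot>\<^bsub>H\<^esub> sw (\<lambda>u1 w. c b' (T w) \<odot>\<^bsub>H\<^esub> (p \<otimes>\<^bsub>H\<^esub> S u1)) b) b'"
          using b b' by (subst (asm) sw_swap) (simp_all add: sw_pull(3))
      qed (use b in auto)
      finally show ?thesis .
    qed
    have "sw (\<lambda>x y. ?L y \<odot>\<^bsub>H\<^esub> x) x =
        (\<Oplus>\<^bsub>H\<^esub>b\<in>B. sw (\<lambda>x1 x2. c b (sw (\<lambda>u v. f v \<odot>\<^bsub>H\<^esub> (x2 \<otimes>\<^bsub>H\<^esub> S (S u))) b) \<odot>\<^bsub>H\<^esub> x1) x)"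
      by (simp add: L) (rule sw_finsum[OF B(1)], simp)
    also have "\<dots> = (\<Oplus>\<^bsub>H\<^esub>b\<in>B. \<Oplus>\<^bsub>H\<^esub>b'\<in>B. sw (\<lambda>p q. c b q \<odot>\<^bsub>H\<^esub> sw (\<lambda>u1 w. c b' (T w) \<odot>\<^bsub>H\<^esub> (p \<otimes>\<^bsub>H\<^esub> S u1)) b) b')"
      by (intro M.finsum_cong'[OF refl] inner) (auto intro!: M.finsum_closed)
    \<comment> \<open>Cyclicity of the trace, as an exchange of the two basis sums: the sum over
      \<open>b\<close> now contracts and leaves three consecutive legs of \<open>b'\<close>, the
      first two of which cancel by the antipode.\<close>
    also have "\<dots> = (\<Oplus>\<^bsub>H\<^esub>b'\<in>B. \<Oplus>\<^bsub>H\<^esub>b\<in>B. sw (\<lambda>p q. c b q \<odot>\<^bsub>H\<^esub> sw (\<lambda>u1 w. c b' (T w) \<odot>\<^bsub>H\<^esub> (p \<otimes>\<^bsub>H\<^esub> S u1)) b) b')"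
      by (intro finsum_swap B(1)) simp
    also have "\<dots> = (\<Oplus>\<^bsub>H\<^esub>b'\<in>B. c b' (T b') \<odot>\<^bsub>H\<^esub> \<one>\<^bsub>H\<^esub>)"
    proof (rule M.finsum_cong'[OF refl])
      fix b' assume b': "b' \<in> B"
      have "(\<Oplus>\<^bsub>H\<^esub>b\<in>B. sw (\<lambda>p q. c b q \<odot>\<^bsub>H\<^esub> sw (\<lambda>u1 w. c b' (T w) \<odot>\<^bsub>H\<^esub> (p \<otimes>\<^bsub>H\<^esub> S u1)) b) b') =
          sw (\<lambda>p q. \<Oplus>\<^bsub>H\<^esub>b\<in>B. c b q \<odot>\<^bsub>H\<^esub> sw (\<lambda>u1 w. c b' (T w) \<odot>\<^bsub>H\<^esub> (p \<otimes>\<^bsub>H\<^esub> S u1)) b) b'"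
        using b' by (intro sw_finsum[symmetric] B(1)) simp
      also have "\<dots> = sw (\<lambda>p q. sw (\<lambda>u1 w. c b' (T w) \<odot>\<^bsub>H\<^esub> (p \<otimes>\<^bsub>H\<^esub> S u1)) q) b'"
      proof (rule sw_sub[OF A])
        fix p q assume "p \<in> A" "q \<in> A"
        then have "p \<in> carrier H" "q \<in> carrier H" "q \<in> A" using Ac by auto
        then show "(\<Oplus>\<^bsub>H\<^esub>b\<in>B. c b q \<odot>\<^bsub>H\<^esub> sw (\<lambda>u1 w. c b' (T w) \<odot>\<^bsub>H\<^esub> (p \<otimes>\<^bsub>H\<^esub> S u1)) b) =
            sw (\<lambda>u1 w. c b' (T w) \<odot>\<^bsub>H\<^esub> (p \<otimes>\<^bsub>H\<^esub> S u1)) q"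
          using b' by - (rule coord_collapse[OF _ B(1) Bc B(3)], simp_all add: ls' T repr)
      qed (use b' bA in \<open>simp_all add: ls' T\<close>)
      also have "\<dots> = c b' (T b') \<odot>\<^bsub>H\<^esub> \<one>\<^bsub>H\<^esub>"
        using b' by (intro sw_antipode_r3[of "\<lambda>z w. c b' (T w) \<odot>\<^bsub>H\<^esub> z"]) (simp_all add: ls' T)
      finally show "(\<Oplus>\<^bsub>H\<^esub>b\<in>B. sw (\<lambda>p q. c b q \<odot>\<^bsub>H\<^esub> sw (\<lambda>u1 w. c b' (T w) \<odot>\<^bsub>H\<^esub> (p \<otimes>\<^bsub>H\<^esub> S u1)) b) b') =
        c b' (T b') \<odot>\<^bsub>H\<^esub> \<one>\<^bsub>H\<^esub>" .
    qed simp
    also have "\<dots> = ?L x \<odot>\<^bsub>H\<^esub> \<one>\<^bsub>H\<^esub>" using x by (simp add: L T_def)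
    finally show ?thesis .
  qed
  with Lf show ?thesis by (simp add: left_integral_on_def)
qed

lemma fnl_lin1: "fnl f \<Longrightarrow> lin (\<lambda>x. f x \<odot>\<^bsub>H\<^esub> \<one>\<^bsub>H\<^esub>)"
  using lin_fnl[OF _ lin_id] by simp

text \<open>The trace integrals built from the coordinate functionals cannot all vanish on
  \<open>A\<close>: their values \<open>L b (S b)\<close> add up to 1 over the basis.\<close>

lemma nonzero_left_integral:
  assumes fd: fin_dim and A: "hs A"
  obtains f where "left_integral_on A f" "\<exists>a\<in>A. f a \<noteq> \<zero>\<^bsub>K\<^esub>"
proof -
  note Ac = hsD(5)[OF A]
  obtain B c where B: "finite B" "B \<subseteq> A" "\<And>b. b \<in> B \<Longrightarrow> fnl (c b)"
    and repr: "\<And>x. x \<in> A \<Longrightarrow> (\<Oplus>\<^bsub>H\<^esub>b\<in>B. c b x \<odot>\<^bsub>H\<^esub> b) = x"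
    using coefficient_functionals[OF fd hsD(1)[OF A]] by metis
  have bA: "b \<in> B \<Longrightarrow> b \<in> A" for b using B(2) by auto
  have bc [simp]: "b \<in> B \<Longrightarrow> b \<in> carrier H" for b using bA Ac by auto
  have Bc: "B \<subseteq> carrier H" using bc by auto
  note [simp] = fnl_closed[OF B(3)] and cl = lin_fnl[OF B(3)]
  define L where "L b x = (\<Oplus>\<^bsub>K\<^esub>b'\<in>B. c b' (sw (\<lambda>u v. c b v \<odot>\<^bsub>H\<^esub> (x \<otimes>\<^bsub>H\<^esub> S (S u))) b'))" for b x
  have Lint: "left_integral_on A (L b)" if "b \<in> B" for b
    unfolding L_def by (rule trace_integral[OF A B repr B(3)[OF that]]) auto
  have Lfnl: "fnl (L b)" if "b \<in> B" for b using Lint[OF that] by (simp add: left_integral_on_def)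
  note [simp] = fnl_closed[OF Lfnl] and Ll = lin_fnl[OF Lfnl]
  have Lv: "L b x \<odot>\<^bsub>H\<^esub> v = (\<Oplus>\<^bsub>H\<^esub>b'\<in>B. c b' (sw (\<lambda>u v. c b v \<odot>\<^bsub>H\<^esub> (x \<otimes>\<^bsub>H\<^esub> S (S u))) b') \<odot>\<^bsub>H\<^esub> v)"
    if "b \<in> B" "x \<in> carrier H" "v \<in> carrier H" for b x v
    unfolding L_def using that by (intro fnl_finsum_smult[OF B(1)]) auto
  note ls = lins cl
  \<comment> \<open>The leg closed off by the counit makes the summand equal to
    \<open>L b (S b)\<close>. Contracting over \<open>b\<close> turns the argument of
    \<open>c b'\<close> into \<open>S u S (S p) = S (S p u)\<close> with \<open>p\<close>,
    \<open>u\<close> consecutive legs of \<open>b'\<close>, and this collapses to the unit.\<close>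
  have key: "(\<Oplus>\<^bsub>H\<^esub>b\<in>B. sw (\<lambda>u v. L b (S u) \<odot>\<^bsub>H\<^esub> (\<epsilon> v \<odot>\<^bsub>H\<^esub> \<one>\<^bsub>H\<^esub>)) b) = \<one>\<^bsub>H\<^esub>"
  proof -
    have "(\<Oplus>\<^bsub>H\<^esub>b\<in>B. sw (\<lambda>u v. L b (S u) \<odot>\<^bsub>H\<^esub> (\<epsilon> v \<odot>\<^bsub>H\<^esub> \<one>\<^bsub>H\<^esub>)) b) =
        (\<Oplus>\<^bsub>H\<^esub>b\<in>B. \<Oplus>\<^bsub>H\<^esub>b'\<in>B. sw (\<lambda>p q. c b q \<odot>\<^bsub>H\<^esub>
          sw (\<lambda>u v. c b' (S u \<otimes>\<^bsub>H\<^esub> S (S p)) \<odot>\<^bsub>H\<^esub> (\<epsilon> v \<odot>\<^bsub>H\<^esub> \<one>\<^bsub>H\<^esub>)) b) b')"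
    proof (rule M.finsum_cong'[OF refl])
      fix b assume b: "b \<in> B"
      have "sw (\<lambda>u v. L b (S u) \<odot>\<^bsub>H\<^esub> (\<epsilon> v \<odot>\<^bsub>H\<^esub> \<one>\<^bsub>H\<^esub>)) b = sw (\<lambda>u v. \<Oplus>\<^bsub>H\<^esub>b'\<in>B.
          c b' (sw (\<lambda>p q. c b q \<odot>\<^bsub>H\<^esub> (S u \<otimes>\<^bsub>H\<^esub> S (S p))) b') \<odot>\<^bsub>H\<^esub> (\<epsilon> v \<odot>\<^bsub>H\<^esub> \<one>\<^bsub>H\<^esub>)) b"
        using b by (simp add: Lv)
      also have "\<dots> = (\<Oplus>\<^bsub>H\<^esub>b'\<in>B. sw (\<lambda>u v.
          c b' (sw (\<lambda>p q. c b q \<odot>\<^bsub>H\<^esub> (S u \<otimes>\<^bsub>H\<^esub> S (S p))) b') \<odot>\<^bsub>H\<^esub> (\<epsilon> v \<odot>\<^bsub>H\<^esub> \<one>\<^bsub>H\<^esub>)) b)"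
        using b by (intro sw_finsum[OF B(1)]) simp
      also have "\<dots> = (\<Oplus>\<^bsub>H\<^esub>b'\<in>B. sw (\<lambda>p q. c b q \<odot>\<^bsub>H\<^esub>
          sw (\<lambda>u v. c b' (S u \<otimes>\<^bsub>H\<^esub> S (S p)) \<odot>\<^bsub>H\<^esub> (\<epsilon> v \<odot>\<^bsub>H\<^esub> \<one>\<^bsub>H\<^esub>)) b) b')"
      proof (rule M.finsum_cong'[OF refl])
        fix b' assume b': "b' \<in> B"
        have "c b' (sw (\<lambda>p q. c b q \<odot>\<^bsub>H\<^esub> (S u \<otimes>\<^bsub>H\<^esub> S (S p))) b') \<odot>\<^bsub>H\<^esub> (\<epsilon> v \<odot>\<^bsub>H\<^esub> \<one>\<^bsub>H\<^esub>) =
            sw (\<lambda>p q. c b q \<odot>\<^bsub>H\<^esub> (c b' (S u \<otimes>\<^bsub>H\<^esub> S (S p)) \<odot>\<^bsub>H\<^esub> (\<epsilon> v \<odot>\<^bsub>H\<^esub> \<one>\<^bsub>H\<^esub>))) b'"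
          if "u \<in> carrier H" "v \<in> carrier H" for u v
          using b b' that lin_sw[OF lin_fnl[OF B(3)[OF b'] lin_id], of "\<epsilon> v \<odot>\<^bsub>H\<^esub> \<one>\<^bsub>H\<^esub>" "\<lambda>p q. c b q \<odot>\<^bsub>H\<^esub> (S u \<otimes>\<^bsub>H\<^esub> S (S p))" b']
          by (simp add: fnl_smult[OF B(3)[OF b']] smult_assoc1)
        then have "sw (\<lambda>u v. c b' (sw (\<lambda>p q. c b q \<odot>\<^bsub>H\<^esub> (S u \<otimes>\<^bsub>H\<^esub> S (S p))) b') \<odot>\<^bsub>H\<^esub> (\<epsilon> v \<odot>\<^bsub>H\<^esub> \<one>\<^bsub>H\<^esub>)) b =
            sw (\<lambda>u v. sw (\<lambda>p q. c b q \<odot>\<^bsub>H\<^esub> (c b' (S u \<otimes>\<^bsub>H\<^esub> S (S p)) \<odot>\<^bsub>H\<^esub> (\<epsilon> v \<odot>\<^bsub>H\<^esub> \<one>\<^bsub>H\<^esub>))) b') b"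
          by (intro sw_cong refl)
        then show "sw (\<lambda>u v. c b' (sw (\<lambda>p q. c b q \<odot>\<^bsub>H\<^esub> (S u \<otimes>\<^bsub>H\<^esub> S (S p))) b') \<odot>\<^bsub>H\<^esub> (\<epsilon> v \<odot>\<^bsub>H\<^esub> \<one>\<^bsub>H\<^esub>)) b =
          sw (\<lambda>p q. c b q \<odot>\<^bsub>H\<^esub> sw (\<lambda>u v. c b' (S u \<otimes>\<^bsub>H\<^esub> S (S p)) \<odot>\<^bsub>H\<^esub> (\<epsilon> v \<odot>\<^bsub>H\<^esub> \<one>\<^bsub>H\<^esub>)) b) b'"
          using b b' by (subst (asm) sw_swap) (simp_all add: sw_pull(3))
      qed (use b in simp)
      finally show "sw (\<lambda>u v. L b (S u) \<odot>\<^bsub>H\<^esub> (\<epsilon> v \<odot>\<^bsub>H\<^esub> \<one>\<^bsub>H\<^esub>)) b = \<dots>" .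
    qed (auto intro!: M.finsum_closed)
    also have "\<dots> = (\<Oplus>\<^bsub>H\<^esub>b'\<in>B. \<Oplus>\<^bsub>H\<^esub>b\<in>B. sw (\<lambda>p q. c b q \<odot>\<^bsub>H\<^esub>
          sw (\<lambda>u v. c b' (S u \<otimes>\<^bsub>H\<^esub> S (S p)) \<odot>\<^bsub>H\<^esub> (\<epsilon> v \<odot>\<^bsub>H\<^esub> \<one>\<^bsub>H\<^esub>)) b) b')"
      by (intro finsum_swap B(1)) simp
    also have "\<dots> = (\<Oplus>\<^bsub>H\<^esub>b'\<in>B. c b' \<one>\<^bsub>H\<^esub> \<odot>\<^bsub>H\<^esub> (\<epsilon> b' \<odot>\<^bsub>H\<^esub> \<one>\<^bsub>H\<^esub>))"
    proof (rule M.finsum_cong'[OF refl])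
      fix b' assume b': "b' \<in> B"
      have "(\<Oplus>\<^bsub>H\<^esub>b\<in>B. sw (\<lambda>p q. c b q \<odot>\<^bsub>H\<^esub>
          sw (\<lambda>u v. c b' (S u \<otimes>\<^bsub>H\<^esub> S (S p)) \<odot>\<^bsub>H\<^esub> (\<epsilon> v \<odot>\<^bsub>H\<^esub> \<one>\<^bsub>H\<^esub>)) b) b') =
        sw (\<lambda>p q. \<Oplus>\<^bsub>H\<^esub>b\<in>B. c b q \<odot>\<^bsub>H\<^esub>
          sw (\<lambda>u v. c b' (S u \<otimes>\<^bsub>H\<^esub> S (S p)) \<odot>\<^bsub>H\<^esub> (\<epsilon> v \<odot>\<^bsub>H\<^esub> \<one>\<^bsub>H\<^esub>)) b) b'"
        using b' by (intro sw_finsum[symmetric] B(1)) simp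
      also have "\<dots> = sw (\<lambda>p q. sw (\<lambda>u v. c b' (S u \<otimes>\<^bsub>H\<^esub> S (S p)) \<odot>\<^bsub>H\<^esub> (\<epsilon> v \<odot>\<^bsub>H\<^esub> \<one>\<^bsub>H\<^esub>)) q) b'"
      proof (rule sw_sub[OF A])
        fix p q assume "p \<in> A" "q \<in> A"
        then have "p \<in> carrier H" "q \<in> carrier H" "q \<in> A" using Ac by auto
        then show "(\<Oplus>\<^bsub>H\<^esub>b\<in>B. c b q \<odot>\<^bsub>H\<^esub> sw (\<lambda>u v. c b' (S u \<otimes>\<^bsub>H\<^esub> S (S p)) \<odot>\<^bsub>H\<^esub> (\<epsilon> v \<odot>\<^bsub>H\<^esub> \<one>\<^bsub>H\<^esub>)) b) =
            sw (\<lambda>u v. c b' (S u \<otimes>\<^bsub>H\<^esub> S (S p)) \<odot>\<^bsub>H\<^esub> (\<epsilon> v \<odot>\<^bsub>H\<^esub> \<one>\<^bsub>H\<^esub>)) q"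
          using b' by - (rule coord_collapse[OF _ B(1) Bc B(3)], simp_all add: ls repr)
      qed (use b' bA in \<open>simp_all add: ls\<close>)
      also have "\<dots> = sw (\<lambda>p q. sw (\<lambda>u v. c b' (S (S p \<otimes>\<^bsub>H\<^esub> u)) \<odot>\<^bsub>H\<^esub> (\<epsilon> v \<odot>\<^bsub>H\<^esub> \<one>\<^bsub>H\<^esub>)) q) b'"
        by (simp add: antipode_mult)
      also have "\<dots> = c b' (S \<one>\<^bsub>H\<^esub>) \<odot>\<^bsub>H\<^esub> (\<epsilon> b' \<odot>\<^bsub>H\<^esub> \<one>\<^bsub>H\<^esub>)"
        using b' by (intro sw_antipode_l3[of "\<lambda>z v. c b' (S z) \<odot>\<^bsub>H\<^esub> (\<epsilon> v \<odot>\<^bsub>H\<^esub> \<one>\<^bsub>H\<^esub>)"]) (simp_all add: ls)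
      finally show "(\<Oplus>\<^bsub>H\<^esub>b\<in>B. sw (\<lambda>p q. c b q \<odot>\<^bsub>H\<^esub>
          sw (\<lambda>u v. c b' (S u \<otimes>\<^bsub>H\<^esub> S (S p)) \<odot>\<^bsub>H\<^esub> (\<epsilon> v \<odot>\<^bsub>H\<^esub> \<one>\<^bsub>H\<^esub>)) b) b') = c b' \<one>\<^bsub>H\<^esub> \<odot>\<^bsub>H\<^esub> (\<epsilon> b' \<odot>\<^bsub>H\<^esub> \<one>\<^bsub>H\<^esub>)"
        by simp
    qed simp
    also have "\<dots> = \<epsilon> \<one>\<^bsub>H\<^esub> \<odot>\<^bsub>H\<^esub> \<one>\<^bsub>H\<^esub>"
      by (rule coord_collapse[of "\<lambda>b. \<epsilon> b \<odot>\<^bsub>H\<^esub> \<one>\<^bsub>H\<^esub>", OF _ B(1) Bc B(3)])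
        (simp_all add: ls repr hsD(2)[OF A])
    finally show ?thesis by simp
  qed
  have "\<exists>b\<in>B. \<exists>a\<in>A. L b a \<noteq> \<zero>\<^bsub>K\<^esub>"
  proof (rule ccontr)
    assume "\<not> ?thesis"
    then have Z: "L b a = \<zero>\<^bsub>K\<^esub>" if "b \<in> B" "a \<in> A" for a b using that by auto
    have "sw (\<lambda>u v. L b (S u) \<odot>\<^bsub>H\<^esub> (\<epsilon> v \<odot>\<^bsub>H\<^esub> \<one>\<^bsub>H\<^esub>)) b = \<zero>\<^bsub>H\<^esub>" if "b \<in> B" for b
    proof (rule sw_sub_zero[OF A bA[OF that]])
      fix x y assume "x \<in> A" "y \<in> A"
      then show "L b (S x) \<odot>\<^bsub>H\<^esub> (\<epsilon> y \<odot>\<^bsub>H\<^esub> \<one>\<^bsub>H\<^esub>) = \<zero>\<^bsub>H\<^esub>"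
        using Z[OF that] hsD(4)[OF A] Ac by simp
    qed (use that in \<open>simp_all add: lins Ll\<close>)
    then have "\<one>\<^bsub>H\<^esub> = \<zero>\<^bsub>H\<^esub>" using key by simp
    then have "\<one>\<^bsub>K\<^esub> = \<zero>\<^bsub>K\<^esub>" using counit_one fnl_zero[OF fnl_counit] by simp
    then show False by simp
  qed
  then show thesis using that Lint by blast
qed

section \<open>Nondegeneracy of integrals and bijectivity of the antipode\<close>

lemma sw_left_integral:
  assumes "left_integral_on A f" "a \<in> A" "a \<in> carrier H" "lin g"
  shows "sw (\<lambda>x y. f y \<odot>\<^bsub>H\<^esub> g x) a = f a \<odot>\<^bsub>H\<^esub> g \<one>\<^bsub>H\<^esub>"
proof -
  have f: "fnl f" and e: "sw (\<lambda>x y. f y \<odot>\<^bsub>H\<^esub> x) a = f a \<odot>\<^bsub>H\<^esub> \<one>\<^bsub>H\<^esub>"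
    using assms by (auto simp: left_integral_on_def)
  have "g (sw (\<lambda>x y. f y \<odot>\<^bsub>H\<^esub> x) a) = sw (\<lambda>x y. f y \<odot>\<^bsub>H\<^esub> g x) a"
    using assms(4) by (subst lin_sw) (simp_all add: fnl_closed[OF f] lin_smult)
  then show ?thesis using assms e by (simp add: lin_smult fnl_closed[OF f])
qed

text \<open>The integral property is used at \<open>x S h1\<close> and multiplied by
  \<open>h2\<close> on the right. Expanding \<open>\<Delta> (x S h1)\<close> places an antipode
  directly before \<open>h2\<close>, where the two cancel.\<close>

lemma left_integral_shift:
  assumes A: "hs A" and f: "left_integral_on A f" and x: "x \<in> A" and h: "h \<in> A"
  shows "sw (\<lambda>x1 x2. f (x2 \<otimes>\<^bsub>H\<^esub> S h) \<odot>\<^bsub>H\<^esub> x1) x = sw (\<lambda>h1 h2. f (x \<otimes>\<^bsub>H\<^esub> S h1) \<odot>\<^bsub>H\<^esub> h2) h"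
proof -
  have ff: "fnl f" using f by (simp add: left_integral_on_def)
  note Ac = hsD(5)[OF A] and [simp] = fnl_closed[OF ff] and ls = lins lin_fnl[OF ff]
  have xc [simp]: "x \<in> carrier H" and hc [simp]: "h \<in> carrier H" using Ac x h by auto
  have "sw (\<lambda>h1 h2. f (x \<otimes>\<^bsub>H\<^esub> S h1) \<odot>\<^bsub>H\<^esub> h2) h =
      sw (\<lambda>h1 h2. sw (\<lambda>p q. f q \<odot>\<^bsub>H\<^esub> (p \<otimes>\<^bsub>H\<^esub> h2)) (x \<otimes>\<^bsub>H\<^esub> S h1)) h"
  proof (rule sw_sub[OF A h])
    fix h1 h2 assume "h1 \<in> A" "h2 \<in> A"
    moreover from this have "h1 \<in> carrier H" "h2 \<in> carrier H" using Ac by auto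
    ultimately show "f (x \<otimes>\<^bsub>H\<^esub> S h1) \<odot>\<^bsub>H\<^esub> h2 = sw (\<lambda>p q. f q \<odot>\<^bsub>H\<^esub> (p \<otimes>\<^bsub>H\<^esub> h2)) (x \<otimes>\<^bsub>H\<^esub> S h1)"
      using x by (subst sw_left_integral[OF f, of _ "\<lambda>p. p \<otimes>\<^bsub>H\<^esub> h2"]) (simp_all add: ls hsD(3,4)[OF A])
  qed (simp_all add: ls)
  also have "\<dots> = sw (\<lambda>r h2. sw (\<lambda>x1 x2. sw (\<lambda>a b. f (x2 \<otimes>\<^bsub>H\<^esub> S a) \<odot>\<^bsub>H\<^esub> (x1 \<otimes>\<^bsub>H\<^esub> S b \<otimes>\<^bsub>H\<^esub> h2)) r) x) h"
    by (simp add: sw_mult sw_antipode ls)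
  also have "\<dots> = sw (\<lambda>r h2. sw (\<lambda>a b. sw (\<lambda>x1 x2. f (x2 \<otimes>\<^bsub>H\<^esub> S a) \<odot>\<^bsub>H\<^esub> (x1 \<otimes>\<^bsub>H\<^esub> S b \<otimes>\<^bsub>H\<^esub> h2)) x) r) h"
    by (rule sw_cong[OF refl], subst sw_swap) simp_all
  also have "\<dots> = sw (\<lambda>a w. sw (\<lambda>b h2. sw (\<lambda>x1 x2. f (x2 \<otimes>\<^bsub>H\<^esub> S a) \<odot>\<^bsub>H\<^esub> (x1 \<otimes>\<^bsub>H\<^esub> (S b \<otimes>\<^bsub>H\<^esub> h2))) x) w) h"
    by (subst sw_assoc) (simp_all add: ls H.m_assoc)
  also have "\<dots> = sw (\<lambda>x1 x2. f (x2 \<otimes>\<^bsub>H\<^esub> S h) \<odot>\<^bsub>H\<^esub> (x1 \<otimes>\<^bsub>H\<^esub> \<one>\<^bsub>H\<^esub>)) x"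
    by (rule sw_antipode_l3'[of "\<lambda>a z. sw (\<lambda>x1 x2. f (x2 \<otimes>\<^bsub>H\<^esub> S a) \<odot>\<^bsub>H\<^esub> (x1 \<otimes>\<^bsub>H\<^esub> z)) x"])
      (simp_all add: ls)
  finally show ?thesis by simp
qed

lemma smult_eq_zero:
  assumes "c \<in> carrier K" "v \<in> carrier H" "c \<odot>\<^bsub>H\<^esub> v = \<zero>\<^bsub>H\<^esub>" "c \<noteq> \<zero>\<^bsub>K\<^esub>"
  shows "v = \<zero>\<^bsub>H\<^esub>"
  using mult_inverse[OF assms(1,2) assms(3) assms(4)] assms inverse_exists[of c] by simp

text \<open>Stated for \<open>S h\<close> because the antipode is not yet known to be onto. The
  vector \<open>f x h\<close> is recovered from the legs of \<open>h\<close> as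
  \<open>f (x S (h1 S h2)) h3\<close>, and the hypothesis kills every term of this sum.\<close>

lemma left_integral_nondegenerate_antipode:
  assumes fd: fin_dim and A: "hs A" and f: "left_integral_on A f" "\<exists>a\<in>A. f a \<noteq> \<zero>\<^bsub>K\<^esub>"
    and h: "h \<in> A" and z: "\<And>x. x \<in> A \<Longrightarrow> f (x \<otimes>\<^bsub>H\<^esub> S h) = \<zero>\<^bsub>K\<^esub>"
  shows "h = \<zero>\<^bsub>H\<^esub>"
proof -
  have ff: "fnl f" using f by (simp add: left_integral_on_def)
  obtain B c where B: "finite B" "B \<subseteq> A" "\<And>b. b \<in> B \<Longrightarrow> fnl (c b)"
    and repr: "\<And>x. x \<in> A \<Longrightarrow> (\<Oplus>\<^bsub>H\<^esub>b\<in>B. c b x \<odot>\<^bsub>H\<^esub> b) = x"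
    by (rule coefficient_functionals[OF fd hsD(1)[OF A]]) blast
  note Ac = hsD(5)[OF A]
  have bA: "b \<in> B \<Longrightarrow> b \<in> A" for b using B(2) by auto
  have bc [simp]: "b \<in> B \<Longrightarrow> b \<in> carrier H" for b using bA Ac by auto
  have Bc: "B \<subseteq> carrier H" using bc by auto
  note [simp] = fnl_closed[OF ff] fnl_closed[OF B(3)] and ls = lins lin_fnl[OF ff] lin_fnl[OF B(3)]
  have hc [simp]: "h \<in> carrier H" using h Ac by auto
  \<comment> \<open>The hypothesis mentions \<open>h\<close> as a whole; the shift identity
    transports it to the legs of \<open>h\<close>, since the second leg of \<open>u\<close> lies in
    \<open>A\<close>.\<close>
  have F: "sw (\<lambda>h1 h2. f (u \<otimes>\<^bsub>H\<^esub> S h1) \<odot>\<^bsub>H\<^esub> h2) h = \<zero>\<^bsub>H\<^esub>" if u: "u \<in> A" for u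
    unfolding left_integral_shift[OF A f(1) u h, symmetric]
    by (rule sw_sub_zero[OF A u]) (simp_all add: ls z Ac)
  obtain x where x: "x \<in> A" "f x \<noteq> \<zero>\<^bsub>K\<^esub>" using f(2) by auto
  have xc [simp]: "x \<in> carrier H" using x Ac by auto
  have "f (x \<otimes>\<^bsub>H\<^esub> S \<one>\<^bsub>H\<^esub>) \<odot>\<^bsub>H\<^esub> h =
      sw (\<lambda>h1 r. sw (\<lambda>h2 h3. f (x \<otimes>\<^bsub>H\<^esub> S (h1 \<otimes>\<^bsub>H\<^esub> S h2)) \<odot>\<^bsub>H\<^esub> h3) r) h"
    by (rule sw_antipode_r3[of "\<lambda>z h3. f (x \<otimes>\<^bsub>H\<^esub> S z) \<odot>\<^bsub>H\<^esub> h3", symmetric]) (simp_all add: ls)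
  also have "\<dots> = sw (\<lambda>h1 r. sw (\<lambda>h2 h3. f (x \<otimes>\<^bsub>H\<^esub> (S (S h2) \<otimes>\<^bsub>H\<^esub> S h1)) \<odot>\<^bsub>H\<^esub> h3) r) h"
    by (simp add: antipode_mult)
  \<comment> \<open>Expanding \<open>S (S h2)\<close> in the basis replaces the middle factor by a
    constant \<open>b\<close>, so that \<open>x b\<close> can take the place of \<open>u\<close> in
    \<open>F\<close> while the other legs are gathered in a linear map.\<close>
  also have "\<dots> = sw (\<lambda>h1 r. \<Oplus>\<^bsub>H\<^esub>b\<in>B. sw (\<lambda>h2 h3. c b (S (S h2)) \<odot>\<^bsub>H\<^esub> (f (x \<otimes>\<^bsub>H\<^esub> (b \<otimes>\<^bsub>H\<^esub> S h1)) \<odot>\<^bsub>H\<^esub> h3)) r) h"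
  proof (rule sw_sub[OF A h])
    fix h1 r assume h1: "h1 \<in> A" and r: "r \<in> A"
    then have [simp]: "h1 \<in> carrier H" "r \<in> carrier H" using Ac by auto
    have "sw (\<lambda>h2 h3. f (x \<otimes>\<^bsub>H\<^esub> (S (S h2) \<otimes>\<^bsub>H\<^esub> S h1)) \<odot>\<^bsub>H\<^esub> h3) r =
        sw (\<lambda>h2 h3. \<Oplus>\<^bsub>H\<^esub>b\<in>B. c b (S (S h2)) \<odot>\<^bsub>H\<^esub> (f (x \<otimes>\<^bsub>H\<^esub> (b \<otimes>\<^bsub>H\<^esub> S h1)) \<odot>\<^bsub>H\<^esub> h3)) r"
    proof (rule sw_sub[OF A r])
      fix h2 h3 assume "h2 \<in> A" "h3 \<in> A"
      moreover from this have "h2 \<in> carrier H" "h3 \<in> carrier H" using Ac by auto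
      ultimately show "f (x \<otimes>\<^bsub>H\<^esub> (S (S h2) \<otimes>\<^bsub>H\<^esub> S h1)) \<odot>\<^bsub>H\<^esub> h3 =
          (\<Oplus>\<^bsub>H\<^esub>b\<in>B. c b (S (S h2)) \<odot>\<^bsub>H\<^esub> (f (x \<otimes>\<^bsub>H\<^esub> (b \<otimes>\<^bsub>H\<^esub> S h1)) \<odot>\<^bsub>H\<^esub> h3))"
        by - (rule coord_collapse[symmetric, OF _ B(1) Bc B(3)], simp_all add: ls repr hsD(4)[OF A])
    qed (simp_all add: ls)
    also have "\<dots> = (\<Oplus>\<^bsub>H\<^esub>b\<in>B. sw (\<lambda>h2 h3. c b (S (S h2)) \<odot>\<^bsub>H\<^esub> (f (x \<otimes>\<^bsub>H\<^esub> (b \<otimes>\<^bsub>H\<^esub> S h1)) \<odot>\<^bsub>H\<^esub> h3)) r)"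
      by (rule sw_finsum[OF B(1)]) simp
    finally show "sw (\<lambda>h2 h3. f (x \<otimes>\<^bsub>H\<^esub> (S (S h2) \<otimes>\<^bsub>H\<^esub> S h1)) \<odot>\<^bsub>H\<^esub> h3) r = \<dots>" .
  qed (simp_all add: ls)
  also have "\<dots> = (\<Oplus>\<^bsub>H\<^esub>b\<in>B. sw (\<lambda>h1 r. sw (\<lambda>h2 h3. c b (S (S h2)) \<odot>\<^bsub>H\<^esub> (f (x \<otimes>\<^bsub>H\<^esub> (b \<otimes>\<^bsub>H\<^esub> S h1)) \<odot>\<^bsub>H\<^esub> h3)) r) h)"
    by (rule sw_finsum[OF B(1)]) simp
  also have "\<dots> = (\<Oplus>\<^bsub>H\<^esub>b\<in>B. \<zero>\<^bsub>H\<^esub>)"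
  proof (rule M.finsum_cong'[OF refl])
    fix b assume b: "b \<in> B"
    let ?\<phi> = "\<lambda>r. sw (\<lambda>h2 h3. c b (S (S h2)) \<odot>\<^bsub>H\<^esub> h3) r"
    have \<phi>: "lin ?\<phi>" using b by (simp add: ls)
    have "sw (\<lambda>h1 r. sw (\<lambda>h2 h3. c b (S (S h2)) \<odot>\<^bsub>H\<^esub> (f (x \<otimes>\<^bsub>H\<^esub> (b \<otimes>\<^bsub>H\<^esub> S h1)) \<odot>\<^bsub>H\<^esub> h3)) r) h =
        sw (\<lambda>h1 r. ?\<phi> (f (x \<otimes>\<^bsub>H\<^esub> b \<otimes>\<^bsub>H\<^esub> S h1) \<odot>\<^bsub>H\<^esub> r)) h"
    proof (rule sw_cong[OF refl])
      fix h1 r assume [simp]: "h1 \<in> carrier H" "r \<in> carrier H"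
      have "?\<phi> (f (x \<otimes>\<^bsub>H\<^esub> b \<otimes>\<^bsub>H\<^esub> S h1) \<odot>\<^bsub>H\<^esub> r) = f (x \<otimes>\<^bsub>H\<^esub> b \<otimes>\<^bsub>H\<^esub> S h1) \<odot>\<^bsub>H\<^esub> ?\<phi> r"
        using b by (intro lin_smult[OF \<phi>]) simp_all
      then show "sw (\<lambda>h2 h3. c b (S (S h2)) \<odot>\<^bsub>H\<^esub> (f (x \<otimes>\<^bsub>H\<^esub> (b \<otimes>\<^bsub>H\<^esub> S h1)) \<odot>\<^bsub>H\<^esub> h3)) r =
          ?\<phi> (f (x \<otimes>\<^bsub>H\<^esub> b \<otimes>\<^bsub>H\<^esub> S h1) \<odot>\<^bsub>H\<^esub> r)"
        using b by (simp add: sw_pull(3) H.m_assoc smult_assoc1[symmetric] R.m_comm)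
    qed
    also have "\<dots> = ?\<phi> (sw (\<lambda>h1 r. f (x \<otimes>\<^bsub>H\<^esub> b \<otimes>\<^bsub>H\<^esub> S h1) \<odot>\<^bsub>H\<^esub> r) h)"
      using b by (intro lin_sw[OF \<phi>, symmetric]) simp
    also have "\<dots> = \<zero>\<^bsub>H\<^esub>"
      using F[of "x \<otimes>\<^bsub>H\<^esub> b"] x bA[OF b] hsD(3)[OF A] lin_zero[OF \<phi>] by simp
    finally show "sw (\<lambda>h1 r. sw (\<lambda>h2 h3. c b (S (S h2)) \<odot>\<^bsub>H\<^esub> (f (x \<otimes>\<^bsub>H\<^esub> (b \<otimes>\<^bsub>H\<^esub> S h1)) \<odot>\<^bsub>H\<^esub> h3)) r) h = \<zero>\<^bsub>H\<^esub>" .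
  qed simp
  finally have "f x \<odot>\<^bsub>H\<^esub> h = \<zero>\<^bsub>H\<^esub>" by simp
  then show ?thesis using x(2) smult_eq_zero[of "f x" h] by simp
qed

text \<open>If \<open>S x = 0\<close>, the nondegeneracy just proved applies to \<open>x\<close> at
  once. Finite dimension turns injectivity into surjectivity, and on each Hopf subalgebra
  separately, so preimages stay inside it.\<close>

lemma antipode_bij:
  assumes fd: fin_dim and A: "hs A"
  shows "x \<in> A \<Longrightarrow> S x = \<zero>\<^bsub>H\<^esub> \<Longrightarrow> x = \<zero>\<^bsub>H\<^esub>" and "S ` A = A"
proof -
  obtain f where f: "left_integral_on A f" "\<exists>a\<in>A. f a \<noteq> \<zero>\<^bsub>K\<^esub>"
    using nonzero_left_integral[OF fd A] .
  have ff: "fnl f" using f by (simp add: left_integral_on_def)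
  show inj: "x = \<zero>\<^bsub>H\<^esub>" if "x \<in> A" "S x = \<zero>\<^bsub>H\<^esub>" for x
    using that hsD(5)[OF A]
    by (intro left_integral_nondegenerate_antipode[OF fd A f]) (simp_all add: fnl_zero[OF ff])
  show "S ` A = A"
    using inj_endo_surj[OF fd hsD(1)[OF A] lin_antipode[OF lin_id] hsD(4)[OF A] inj] .
qed

text \<open>Injectivity of the map from \<open>A\<close> to its dual suffices by dimension. Reading
  values on a basis as coordinates makes it an endomorphism \<open>P\<close> of \<open>A\<close>, to
  which \<open>inj_endo_surj\<close> applies directly.\<close>

lemma representing_vector:
  assumes fd: fin_dim and A: "smod A" and \<phi>: "\<And>x. x \<in> carrier H \<Longrightarrow> fnl (\<phi> x)"
    "\<And>y. y \<in> carrier H \<Longrightarrow> fnl (\<lambda>x. \<phi> x y)"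
    and inj: "\<And>x. x \<in> A \<Longrightarrow> (\<And>y. y \<in> A \<Longrightarrow> \<phi> x y = \<zero>\<^bsub>K\<^esub>) \<Longrightarrow> x = \<zero>\<^bsub>H\<^esub>"
    and g: "fnl g"
  shows "\<exists>x\<in>A. \<forall>y\<in>A. \<phi> x y = g y"
proof -
  obtain B c where B: "finite B" "B \<subseteq> A" "\<And>b. b \<in> B \<Longrightarrow> fnl (c b)"
    and repr: "\<And>x. x \<in> A \<Longrightarrow> (\<Oplus>\<^bsub>H\<^esub>b\<in>B. c b x \<odot>\<^bsub>H\<^esub> b) = x"
    and dual: "\<And>b b'. b \<in> B \<Longrightarrow> b' \<in> B \<Longrightarrow> c b b' = (if b = b' then \<one>\<^bsub>K\<^esub> else \<zero>\<^bsub>K\<^esub>)"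
    by (rule coefficient_functionals[OF fd A]) blast
  have Ac: "A \<subseteq> carrier H" using smodD(1)[OF A] .
  have bA: "b \<in> B \<Longrightarrow> b \<in> A" for b using B(2) by auto
  have bc [simp]: "b \<in> B \<Longrightarrow> b \<in> carrier H" for b using bA Ac by auto
  have Bc: "B \<subseteq> carrier H" using bc by auto
  have Axc: "x \<in> carrier H" if "x \<in> A" for x using that Ac by auto
  have eq_on: "p y = q y" if "fnl p" "fnl q" "\<And>b. b \<in> B \<Longrightarrow> p b = q b" "y \<in> A" for p q y
  proof -
    have "p y \<odot>\<^bsub>H\<^esub> \<one>\<^bsub>H\<^esub> = (\<Oplus>\<^bsub>H\<^esub>b\<in>B. c b y \<odot>\<^bsub>H\<^esub> (p b \<odot>\<^bsub>H\<^esub> \<one>\<^bsub>H\<^esub>))"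
      using that(1) by (rule coord_collapse[symmetric, OF fnl_lin1 B(1) Bc B(3) Axc[OF that(4)] repr[OF that(4)]])
    also have "\<dots> = (\<Oplus>\<^bsub>H\<^esub>b\<in>B. c b y \<odot>\<^bsub>H\<^esub> (q b \<odot>\<^bsub>H\<^esub> \<one>\<^bsub>H\<^esub>))"
      using that Axc by (intro M.finsum_cong') (auto intro!: smult_closed fnl_closed B(3))
    also have "\<dots> = q y \<odot>\<^bsub>H\<^esub> \<one>\<^bsub>H\<^esub>"
      using that(2) by (rule coord_collapse[OF fnl_lin1 B(1) Bc B(3) Axc[OF that(4)] repr[OF that(4)]])
    finally show ?thesis using that Axc fnl_closed by (intro smult_one_inject) auto
  qed
  define P where "P x = (\<Oplus>\<^bsub>H\<^esub>b\<in>B. \<phi> x b \<odot>\<^bsub>H\<^esub> b)" for x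
  have P: "lin P" unfolding P_def
    using lin_fnl[OF \<phi>(2) lin_id] by (intro lin_finsum_fun) simp
  have coeff: "c b (\<Oplus>\<^bsub>H\<^esub>b'\<in>B. t b' \<odot>\<^bsub>H\<^esub> b') = t b" if b: "b \<in> B" and t: "\<And>b. b \<in> B \<Longrightarrow> t b \<in> carrier K" for b t
  proof -
    have "c b (\<Oplus>\<^bsub>H\<^esub>b'\<in>B. t b' \<odot>\<^bsub>H\<^esub> b') \<odot>\<^bsub>H\<^esub> \<one>\<^bsub>H\<^esub> = (\<Oplus>\<^bsub>H\<^esub>b'\<in>B. c b (t b' \<odot>\<^bsub>H\<^esub> b') \<odot>\<^bsub>H\<^esub> \<one>\<^bsub>H\<^esub>)"
      using b t by (intro lin_finsum[OF fnl_lin1[OF B(3)]]) auto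
    also have "\<dots> = (\<Oplus>\<^bsub>H\<^esub>b'\<in>B. if b = b' then t b \<odot>\<^bsub>H\<^esub> \<one>\<^bsub>H\<^esub> else \<zero>\<^bsub>H\<^esub>)"
      using b t by (intro M.finsum_cong') (auto simp: fnl_smult[OF B(3)] dual)
    also have "\<dots> = t b \<odot>\<^bsub>H\<^esub> \<one>\<^bsub>H\<^esub>"
      using b t B(1) M.finsum_singleton[of b B "\<lambda>_. t b \<odot>\<^bsub>H\<^esub> \<one>\<^bsub>H\<^esub>"] by auto
    finally show ?thesis
      using b t fnl_closed[OF B(3)[OF b]] by (intro smult_one_inject) (auto intro!: M.finsum_closed)
  qed
  have PA: "P x \<in> A" if "x \<in> A" for x
    unfolding P_def using that Axc bA fnl_closed[OF \<phi>(1)] by (intro smod_finsum[OF A] smodD(4)[OF A]) auto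
  have "P ` A = A"
  proof (rule inj_endo_surj[OF fd A P PA])
    fix x assume x: "x \<in> A" "P x = \<zero>\<^bsub>H\<^esub>"
    have "\<phi> x b = \<zero>\<^bsub>K\<^esub>" if b: "b \<in> B" for b
      using coeff[OF b, of "\<phi> x"] x Axc fnl_closed[OF \<phi>(1)] fnl_zero[OF B(3)[OF b]] by (simp add: P_def)
    moreover have "fnl (\<lambda>y. \<zero>\<^bsub>K\<^esub>)" by (rule fnlI) auto
    ultimately show "x = \<zero>\<^bsub>H\<^esub>"
      using x eq_on[OF \<phi>(1), of x "\<lambda>y. \<zero>\<^bsub>K\<^esub>"] Axc by (intro inj) auto
  qed
  moreover have "(\<Oplus>\<^bsub>H\<^esub>b\<in>B. g b \<odot>\<^bsub>H\<^esub> b) \<in> A"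
    using bA fnl_closed[OF g] by (intro smod_finsum[OF A] smodD(4)[OF A]) auto
  ultimately obtain x where x: "x \<in> A" "P x = (\<Oplus>\<^bsub>H\<^esub>b\<in>B. g b \<odot>\<^bsub>H\<^esub> b)"
    by (metis imageE)
  have eqB: "\<phi> x b = g b" if b: "b \<in> B" for b
    using coeff[OF b, of "\<phi> x"] coeff[OF b, of g] x Axc fnl_closed[OF \<phi>(1)] fnl_closed[OF g]
    by (simp add: P_def)
  show ?thesis
    using x(1) eq_on[OF \<phi>(1)[OF Axc[OF x(1)]] g eqB] by blast
qed

lemma separating_functional:
  assumes fd: fin_dim and v: "v \<in> carrier H" "\<And>g. fnl g \<Longrightarrow> g v = \<zero>\<^bsub>K\<^esub>"
  shows "v = \<zero>\<^bsub>H\<^esub>"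
proof -
  obtain B c where B: "finite B" "B \<subseteq> carrier H" "\<And>b. b \<in> B \<Longrightarrow> fnl (c b)"
    and repr: "\<And>x. x \<in> carrier H \<Longrightarrow> (\<Oplus>\<^bsub>H\<^esub>b\<in>B. c b x \<odot>\<^bsub>H\<^esub> b) = x"
    by (rule coefficient_functionals[OF fd smod_carrier]) blast
  have "c b v \<odot>\<^bsub>H\<^esub> b = \<zero>\<^bsub>H\<^esub>" if "b \<in> B" for b
    using v(2)[OF B(3)[OF that]] B(2) that by (simp add: subset_iff)
  then have "(\<Oplus>\<^bsub>H\<^esub>b\<in>B. c b v \<odot>\<^bsub>H\<^esub> b) = (\<Oplus>\<^bsub>H\<^esub>b\<in>B. \<zero>\<^bsub>H\<^esub>)"
    by (intro M.finsum_cong') auto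
  then show ?thesis using repr[OF v(1)] by simp
qed

section \<open>Nondegeneracy in both arguments and integral elements\<close>

lemma fnl_mult_l: "fnl f \<Longrightarrow> a \<in> carrier H \<Longrightarrow> fnl (\<lambda>x. f (a \<otimes>\<^bsub>H\<^esub> x))"
  and fnl_mult_r: "fnl f \<Longrightarrow> a \<in> carrier H \<Longrightarrow> fnl (\<lambda>x. f (x \<otimes>\<^bsub>H\<^esub> a))"
  by (rule fnl_lin, simp, simp add: lins)+

lemma left_integral_nondegenerate_l:
  assumes fd: fin_dim and A: "hs A" and f: "left_integral_on A f" "\<exists>a\<in>A. f a \<noteq> \<zero>\<^bsub>K\<^esub>"
    and a: "a \<in> A" and z: "\<And>x. x \<in> A \<Longrightarrow> f (x \<otimes>\<^bsub>H\<^esub> a) = \<zero>\<^bsub>K\<^esub>"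
  shows "a = \<zero>\<^bsub>H\<^esub>"
proof -
  obtain h where h: "h \<in> A" "a = S h" using antipode_bij(2)[OF fd A] a by auto
  then have "h = \<zero>\<^bsub>H\<^esub>" using z by (intro left_integral_nondegenerate_antipode[OF fd A f]) auto
  then show ?thesis using h lin_zero[OF lin_antipode[OF lin_id]] by simp
qed

text \<open>By nondegeneracy in the other argument every functional agrees on \<open>A\<close> with
  \<open>y \<mapsto> f (y b)\<close> for some \<open>b\<close>; an element annihilated by all of
  these is zero.\<close>

lemma left_integral_nondegenerate_r:
  assumes fd: fin_dim and A: "hs A" and f: "left_integral_on A f" "\<exists>a\<in>A. f a \<noteq> \<zero>\<^bsub>K\<^esub>"
    and a: "a \<in> A" and z: "\<And>x. x \<in> A \<Longrightarrow> f (a \<otimes>\<^bsub>H\<^esub> x) = \<zero>\<^bsub>K\<^esub>"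
  shows "a = \<zero>\<^bsub>H\<^esub>"
proof (rule separating_functional[OF fd])
  show "a \<in> carrier H" using a hsD(5)[OF A] by auto
  have ff: "fnl f" using f by (simp add: left_integral_on_def)
  fix g assume g: "fnl g"
  have "\<exists>b\<in>A. \<forall>y\<in>A. f (y \<otimes>\<^bsub>H\<^esub> b) = g y"
    by (rule representing_vector[OF fd hsD(1)[OF A] _ _ _ g], erule fnl_mult_r[OF ff],
      erule fnl_mult_l[OF ff], rule left_integral_nondegenerate_l[OF fd A f], assumption, simp)
  then obtain b where b: "b \<in> A" "f (a \<otimes>\<^bsub>H\<^esub> b) = g a" using a by auto
  then show "g a = \<zero>\<^bsub>K\<^esub>" using z[OF b(1)] by simp
qed

text \<open>The normalisation \<open>f \<Gamma> = 1\<close> turns the left integral property of \<open>f\<close> at \<open>\<Gamma>\<close> into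
  \<open>\<Gamma>\<^sub>1 f(\<Gamma>\<^sub>2) = 1\<close>.\<close>

lemma right_integral_element:
  assumes fd: fin_dim and A: "hs A" and f: "left_integral_on A f" "\<exists>a\<in>A. f a \<noteq> \<zero>\<^bsub>K\<^esub>"
  obtains \<Gamma> where "\<Gamma> \<in> A" "\<And>a. a \<in> A \<Longrightarrow> \<Gamma> \<otimes>\<^bsub>H\<^esub> a = \<epsilon> a \<odot>\<^bsub>H\<^esub> \<Gamma>" "f \<Gamma> = \<one>\<^bsub>K\<^esub>"
proof -
  have ff: "fnl f" using f by (simp add: left_integral_on_def)
  note Ac = hsD(5)[OF A]
  \<comment> \<open>\<Gamma> is the vector representing the counit through \<open>f\<close>;
    evaluation at the unit gives the normalisation.\<close>
  have "\<exists>\<Gamma>\<in>A. \<forall>y\<in>A. f (\<Gamma> \<otimes>\<^bsub>H\<^esub> y) = \<epsilon> y"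
    by (rule representing_vector[OF fd hsD(1)[OF A] _ _ _ fnl_counit], erule fnl_mult_l[OF ff],
      erule fnl_mult_r[OF ff], rule left_integral_nondegenerate_r[OF fd A f], assumption, simp)
  then obtain \<Gamma> where \<Gamma>: "\<Gamma> \<in> A" "\<And>y. y \<in> A \<Longrightarrow> f (\<Gamma> \<otimes>\<^bsub>H\<^esub> y) = \<epsilon> y"
    by auto
  have \<Gamma>c: "\<Gamma> \<in> carrier H" using \<Gamma>(1) Ac by auto
  show thesis
  proof (rule that[OF \<Gamma>(1)])
    show "f \<Gamma> = \<one>\<^bsub>K\<^esub>" using \<Gamma>(2)[of "\<one>\<^bsub>H\<^esub>"] hsD(2)[OF A] \<Gamma>c by simp
    fix a assume a: "a \<in> A"
    then have ac: "a \<in> carrier H" using Ac by auto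
    \<comment> \<open>The difference lies in the radical of \<open>f\<close>: multiplied by
      \<open>x\<close>, both terms take the value \<open>\<epsilon> a \<epsilon> x\<close> under
      \<open>f\<close>.\<close>
    have "\<Gamma> \<otimes>\<^bsub>H\<^esub> a \<ominus>\<^bsub>H\<^esub> \<epsilon> a \<odot>\<^bsub>H\<^esub> \<Gamma> = \<zero>\<^bsub>H\<^esub>"
    proof (rule left_integral_nondegenerate_r[OF fd A f])
      show "\<Gamma> \<otimes>\<^bsub>H\<^esub> a \<ominus>\<^bsub>H\<^esub> \<epsilon> a \<odot>\<^bsub>H\<^esub> \<Gamma> \<in> A"
        using a ac \<Gamma>(1) by (intro smod_diff[OF hsD(1)[OF A]] smodD(4)[OF hsD(1)[OF A]] hsD(3)[OF A]) auto
      fix x assume x: "x \<in> A"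
      then have xc: "x \<in> carrier H" using Ac by auto
      have l: "lin (\<lambda>z. f (z \<otimes>\<^bsub>H\<^esub> x) \<odot>\<^bsub>H\<^esub> \<one>\<^bsub>H\<^esub>)" using xc by (intro lin_fnl[OF ff]) (simp_all add: lins)
      have 1: "f (\<Gamma> \<otimes>\<^bsub>H\<^esub> a \<otimes>\<^bsub>H\<^esub> x) = \<epsilon> a \<otimes>\<^bsub>K\<^esub> \<epsilon> x"
        using \<Gamma>(2)[of "a \<otimes>\<^bsub>H\<^esub> x"] hsD(3)[OF A a x] a x ac xc \<Gamma>c by (simp add: H.m_assoc)
      have 2: "f ((\<epsilon> a \<odot>\<^bsub>H\<^esub> \<Gamma>) \<otimes>\<^bsub>H\<^esub> x) = \<epsilon> a \<otimes>\<^bsub>K\<^esub> \<epsilon> x"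
        unfolding smult_mult_left[OF counit_closed[OF ac] \<Gamma>c xc]
          fnl_smult[OF ff counit_closed[OF ac] H.m_closed[OF \<Gamma>c xc]] \<Gamma>(2)[OF x] ..
      show "f ((\<Gamma> \<otimes>\<^bsub>H\<^esub> a \<ominus>\<^bsub>H\<^esub> \<epsilon> a \<odot>\<^bsub>H\<^esub> \<Gamma>) \<otimes>\<^bsub>H\<^esub> x) = \<zero>\<^bsub>K\<^esub>"
        using lin_diff[OF l, of "\<Gamma> \<otimes>\<^bsub>H\<^esub> a" "\<epsilon> a \<odot>\<^bsub>H\<^esub> \<Gamma>"] 1 2 ac xc \<Gamma>c fnl_closed[OF ff]
        by (intro smult_one_inject) auto
    qed
    then show "\<Gamma> \<otimes>\<^bsub>H\<^esub> a = \<epsilon> a \<odot>\<^bsub>H\<^esub> \<Gamma>" using ac \<Gamma>c by simp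
  qed
qed

text \<open>A right integral is pulled back along the antipode,
  \<open>\<Gamma> = S \<Lambda>\<close>, with \<open>g\<close> the composite of \<open>f\<close> and
  \<open>S\<close>. Both identities are checked after applying \<open>S\<close>, which is injective
  on \<open>A\<close>; the slice identity then is the integral property of \<open>f\<close> at
  \<Gamma>.\<close>

lemma left_integral_element:
  assumes fd: fin_dim and A: "hs A"
  obtains \<Lambda> g where "\<Lambda> \<in> A" "\<And>a. a \<in> A \<Longrightarrow> a \<otimes>\<^bsub>H\<^esub> \<Lambda> = \<epsilon> a \<odot>\<^bsub>H\<^esub> \<Lambda>" "fnl g"
    "sw (\<lambda>x y. g x \<odot>\<^bsub>H\<^esub> y) \<Lambda> = \<one>\<^bsub>H\<^esub>"
proof -
  obtain f where f: "left_integral_on A f" "\<exists>a\<in>A. f a \<noteq> \<zero>\<^bsub>K\<^esub>"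
    using nonzero_left_integral[OF fd A] .
  have ff: "fnl f" using f by (simp add: left_integral_on_def)
  note Ac = hsD(5)[OF A]
  obtain \<Gamma> where \<Gamma>: "\<Gamma> \<in> A" "\<And>a. a \<in> A \<Longrightarrow> \<Gamma> \<otimes>\<^bsub>H\<^esub> a = \<epsilon> a \<odot>\<^bsub>H\<^esub> \<Gamma>" "f \<Gamma> = \<one>\<^bsub>K\<^esub>"
    by (rule right_integral_element[OF fd A f]) blast
  obtain \<Lambda> where \<Lambda>: "\<Lambda> \<in> A" "\<Gamma> = S \<Lambda>" using antipode_bij(2)[OF fd A] \<Gamma>(1) by auto
  have c [simp]: "\<Gamma> \<in> carrier H" "\<Lambda> \<in> carrier H" using \<Gamma>(1) \<Lambda>(1) Ac by auto
  note [simp] = fnl_closed[OF ff] and ls = lins lin_fnl[OF ff]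
  have inj: "x = y" if "x \<in> A" "y \<in> A" "S x = S y" for x y
  proof -
    have xy: "x \<in> carrier H" "y \<in> carrier H" using that Ac by auto
    have "S (x \<ominus>\<^bsub>H\<^esub> y) = \<zero>\<^bsub>H\<^esub>" using that xy by (subst lin_diff[OF lin_antipode[OF lin_id]]) auto
    then have "x \<ominus>\<^bsub>H\<^esub> y = \<zero>\<^bsub>H\<^esub>"
      by (rule antipode_bij(1)[OF fd A smod_diff[OF hsD(1)[OF A] that(1,2)]])
    then show ?thesis using xy by simp
  qed
  show thesis
  proof (rule that[OF \<Lambda>(1)])
    fix a assume a: "a \<in> A"
    then have ac [simp]: "a \<in> carrier H" using Ac by auto
    have "S (a \<otimes>\<^bsub>H\<^esub> \<Lambda>) = S (\<epsilon> a \<odot>\<^bsub>H\<^esub> \<Lambda>)"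
      using \<Gamma>(2)[OF hsD(4)[OF A a]] by (simp add: antipode_mult lin_smult[OF lin_antipode[OF lin_id]] \<Lambda>(2)[symmetric])
    then show "a \<otimes>\<^bsub>H\<^esub> \<Lambda> = \<epsilon> a \<odot>\<^bsub>H\<^esub> \<Lambda>"
      using a \<Lambda>(1) by - (rule inj, auto intro: hsD(3)[OF A] smodD(4)[OF hsD(1)[OF A]])
  next
    show "fnl (\<lambda>x. f (S x))" by (rule fnl_lin[OF ff]) (simp add: lins)
    have "S (sw (\<lambda>x y. f (S x) \<odot>\<^bsub>H\<^esub> y) \<Lambda>) = sw (\<lambda>x y. f (S x) \<odot>\<^bsub>H\<^esub> S y) \<Lambda>"
      by (subst lin_sw[OF lin_antipode[OF lin_id]]) (simp_all add: lin_smult[OF lin_antipode[OF lin_id]])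
    also have "\<dots> = sw (\<lambda>x y. f y \<odot>\<^bsub>H\<^esub> x) (S \<Lambda>)"
      by (subst sw_antipode) (simp_all add: ls)
    also have "\<dots> = S \<one>\<^bsub>H\<^esub>"
      using f(1) \<Gamma> \<Lambda> by (simp add: left_integral_on_def)
    finally have e: "S (sw (\<lambda>x y. f (S x) \<odot>\<^bsub>H\<^esub> y) \<Lambda>) = S \<one>\<^bsub>H\<^esub>" .
    have "sw (\<lambda>x y. f (S x) \<odot>\<^bsub>H\<^esub> y) \<Lambda> \<in> A"
      by (rule sw_sub_in[OF A \<Lambda>(1) _ hsD(1)[OF A]])
        (simp_all add: ls smodD(4)[OF hsD(1)[OF A]] Ac)
    then show "sw (\<lambda>x y. f (S x) \<odot>\<^bsub>H\<^esub> y) \<Lambda> = \<one>\<^bsub>H\<^esub>"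
      using e by (rule inj[OF _ hsD(2)[OF A]])
  qed
qed

subsection \<open>Intersections of Hopf subalgebras\<close>

lemma projection_onto:
  assumes fd: fin_dim and W: "smod W"
  obtains pr where "lin pr" "\<And>x. x \<in> carrier H \<Longrightarrow> pr x \<in> W" "\<And>x. x \<in> W \<Longrightarrow> pr x = x"
proof -
  obtain B c where B: "finite B" "B \<subseteq> W" "\<And>b. b \<in> B \<Longrightarrow> fnl (c b)"
    and repr: "\<And>x. x \<in> W \<Longrightarrow> (\<Oplus>\<^bsub>H\<^esub>b\<in>B. c b x \<odot>\<^bsub>H\<^esub> b) = x"
    by (rule coefficient_functionals[OF fd W]) blast
  have bW: "b \<in> B \<Longrightarrow> b \<in> W" for b using B(2) by auto
  have bc: "b \<in> B \<Longrightarrow> b \<in> carrier H" for b using bW smodD(1)[OF W] by auto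
  show thesis
  proof (rule that[of "\<lambda>x. \<Oplus>\<^bsub>H\<^esub>b\<in>B. c b x \<odot>\<^bsub>H\<^esub> b"])
    show "lin (\<lambda>x. \<Oplus>\<^bsub>H\<^esub>b\<in>B. c b x \<odot>\<^bsub>H\<^esub> b)"
      using lin_fnl[OF B(3) lin_id] bc by (intro lin_finsum_fun) simp
    show "(\<Oplus>\<^bsub>H\<^esub>b\<in>B. c b x \<odot>\<^bsub>H\<^esub> b) \<in> W" if "x \<in> carrier H" for x
      using that bW fnl_closed[OF B(3)] by (intro smod_finsum[OF W] smodD(4)[OF W]) auto
  qed (rule repr)
qed

lemma balanced_zero:
  assumes G: "comm_group G" and \<beta>: "balanced K H H G \<beta>" and x: "x \<in> carrier H"
  shows "\<beta> x \<zero>\<^bsub>H\<^esub> = \<one>\<^bsub>G\<^esub>" and "\<beta> \<zero>\<^bsub>H\<^esub> x = \<one>\<^bsub>G\<^esub>"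
proof -
  interpret G: comm_group G by fact
  have "\<beta> x \<zero>\<^bsub>H\<^esub> \<in> carrier G" "\<beta> x \<zero>\<^bsub>H\<^esub> \<otimes>\<^bsub>G\<^esub> \<beta> x \<zero>\<^bsub>H\<^esub> = \<beta> x (\<zero>\<^bsub>H\<^esub> \<oplus>\<^bsub>H\<^esub> \<zero>\<^bsub>H\<^esub>)"
    using \<beta> x by (auto simp: balanced_def simp del: M.add.l_one M.add.r_one M.l_zero M.r_zero)
  then show "\<beta> x \<zero>\<^bsub>H\<^esub> = \<one>\<^bsub>G\<^esub>" using G.l_cancel_one by simp
  have "\<beta> \<zero>\<^bsub>H\<^esub> x \<in> carrier G" "\<beta> \<zero>\<^bsub>H\<^esub> x \<otimes>\<^bsub>G\<^esub> \<beta> \<zero>\<^bsub>H\<^esub> x = \<beta> (\<zero>\<^bsub>H\<^esub> \<oplus>\<^bsub>H\<^esub> \<zero>\<^bsub>H\<^esub>) x"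
    using \<beta> x by (auto simp: balanced_def simp del: M.add.l_one M.add.r_one M.l_zero M.r_zero)
  then show "\<beta> \<zero>\<^bsub>H\<^esub> x = \<one>\<^bsub>G\<^esub>" using G.l_cancel_one by simp
qed

lemma balanced_finsum_r:
  assumes \<beta>: "balanced K H H HH.T \<beta>" and x: "x \<in> carrier H" and B: "finite B" "\<And>b. b \<in> B \<Longrightarrow> g b \<in> carrier H"
  shows "\<beta> x (\<Oplus>\<^bsub>H\<^esub>b\<in>B. g b) = finprod HH.T (\<lambda>b. \<beta> x (g b)) B"
  using B
proof (induction B)
  case empty
  show ?case by (simp add: balanced_zero(1)[OF HH.T.comm_group_axioms \<beta> x])
next
  case (insert b B)
  have c: "\<beta> x (g b') \<in> carrier HH.T" if "b' \<in> insert b B" for b'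
    using \<beta> x insert.prems[OF that] by (simp add: balanced_def)
  have "(\<Oplus>\<^bsub>H\<^esub>b\<in>insert b B. g b) = g b \<oplus>\<^bsub>H\<^esub> (\<Oplus>\<^bsub>H\<^esub>b\<in>B. g b)"
    using insert by (intro M.finsum_insert) auto
  moreover have "\<beta> x (g b \<oplus>\<^bsub>H\<^esub> (\<Oplus>\<^bsub>H\<^esub>b\<in>B. g b)) = \<beta> x (g b) \<otimes>\<^bsub>HH.T\<^esub> \<beta> x (\<Oplus>\<^bsub>H\<^esub>b\<in>B. g b)"
  proof -
    have "g b \<in> carrier H" "(\<Oplus>\<^bsub>H\<^esub>b\<in>B. g b) \<in> carrier H"
      using insert by (auto intro!: M.finsum_closed)
    then show ?thesis using \<beta> x by (simp add: balanced_def)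
  qed
  moreover have "finprod HH.T (\<lambda>b. \<beta> x (g b)) (insert b B) =
      \<beta> x (g b) \<otimes>\<^bsub>HH.T\<^esub> finprod HH.T (\<lambda>b. \<beta> x (g b)) B"
    using insert c by (intro HH.T.finprod_insert) auto
  ultimately show ?case using insert by simp
qed

text \<open>Expanding the second entries in a basis of \<open>H\<close> rewrites the tensor as a sum
  of terms whose first leg is the slice by \<open>c b\<close> and whose second leg is
  \<open>b\<close>; over a field the slices determine the tensor.\<close>

lemma balanced_zero_slices:
  assumes fd: fin_dim and \<beta>: "balanced K H H HH.T \<beta>" and zs: "set zs \<subseteq> carrier H \<times> carrier H"
    and slice: "\<And>f. fnl f \<Longrightarrow> pair_sum (add_monoid H) (\<lambda>x y. f y \<odot>\<^bsub>H\<^esub> x) zs = \<zero>\<^bsub>H\<^esub>"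
  shows "pair_sum HH.T \<beta> zs = \<one>\<^bsub>HH.T\<^esub>"
proof -
  obtain B c where B: "finite B" "B \<subseteq> carrier H" "\<And>b. b \<in> B \<Longrightarrow> fnl (c b)"
    and repr: "\<And>x. x \<in> carrier H \<Longrightarrow> (\<Oplus>\<^bsub>H\<^esub>b\<in>B. c b x \<odot>\<^bsub>H\<^esub> b) = x"
    by (rule coefficient_functionals[OF fd smod_carrier]) blast
  have bc [simp]: "b \<in> B \<Longrightarrow> b \<in> carrier H" for b using B(2) by auto
  note [simp] = fnl_closed[OF B(3)]
  have \<beta>_closed [simp]: "\<beta> x y \<in> carrier HH.T" if "x \<in> carrier H" "y \<in> carrier H" for x y
    using \<beta> that by (auto simp: balanced_def)
  have hom: "(\<lambda>x. \<beta> x y) \<in> hom (add_monoid H) HH.T" if "y \<in> carrier H" for y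
    using \<beta> that by (auto simp: hom_def balanced_def)
  have zsD: "x \<in> carrier H \<and> y \<in> carrier H" if "(x, y) \<in> set zs" for x y using that zs by auto
  have "pair_sum HH.T \<beta> zs = pair_sum HH.T (\<lambda>x y. finprod HH.T (\<lambda>b. \<beta> (c b y \<odot>\<^bsub>H\<^esub> x) b) B) zs"
  proof (rule pair_sum_cong)
    fix x y assume "(x, y) \<in> set zs"
    then have xy: "x \<in> carrier H" "y \<in> carrier H" using zsD by auto
    have "\<beta> x y = \<beta> x (\<Oplus>\<^bsub>H\<^esub>b\<in>B. c b y \<odot>\<^bsub>H\<^esub> b)" using repr[OF xy(2)] by simp
    also have "\<dots> = finprod HH.T (\<lambda>b. \<beta> x (c b y \<odot>\<^bsub>H\<^esub> b)) B"
      using xy by (intro balanced_finsum_r[OF \<beta> xy(1) B(1)]) simp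
    also have "\<dots> = finprod HH.T (\<lambda>b. \<beta> (c b y \<odot>\<^bsub>H\<^esub> x) b) B"
      using xy \<beta> by (intro HH.T.finprod_cong') (auto simp: balanced_def)
    finally show "\<beta> x y = finprod HH.T (\<lambda>b. \<beta> (c b y \<odot>\<^bsub>H\<^esub> x) b) B" .
  qed
  also have "\<dots> = finprod HH.T (\<lambda>b. pair_sum HH.T (\<lambda>x y. \<beta> (c b y \<odot>\<^bsub>H\<^esub> x) b) zs) B"
    using zsD
  proof (induction zs)
    case (Cons p zs)
    obtain x y where p: "p = (x, y)" by (cases p)
    have xy: "x \<in> carrier H" "y \<in> carrier H" using Cons.prems p by auto
    have zs: "v \<in> carrier H \<and> w \<in> carrier H" if "(v, w) \<in> set zs" for v w
      using Cons.prems[of v w] that by simp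
    have "(\<lambda>b. pair_sum HH.T (\<lambda>x y. \<beta> (c b y \<odot>\<^bsub>H\<^esub> x) b) zs) \<in> B \<rightarrow> carrier HH.T"
      by (auto intro!: HH.T.pair_sum_closed dest!: zs)
    then have "finprod HH.T (\<lambda>b. \<beta> (c b y \<odot>\<^bsub>H\<^esub> x) b \<otimes>\<^bsub>HH.T\<^esub> pair_sum HH.T (\<lambda>x y. \<beta> (c b y \<odot>\<^bsub>H\<^esub> x) b) zs) B =
      finprod HH.T (\<lambda>b. \<beta> (c b y \<odot>\<^bsub>H\<^esub> x) b) B \<otimes>\<^bsub>HH.T\<^esub>
      finprod HH.T (\<lambda>b. pair_sum HH.T (\<lambda>x y. \<beta> (c b y \<odot>\<^bsub>H\<^esub> x) b) zs) B"
      using xy by (intro HH.T.finprod_multf) auto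
    then show ?case using Cons.IH[OF zs] p by simp
  qed simp
  also have "\<dots> = finprod HH.T (\<lambda>b. \<one>\<^bsub>HH.T\<^esub>) B"
  proof (rule HH.T.finprod_cong'[OF refl])
    fix b assume b: "b \<in> B"
    have "pair_sum HH.T (\<lambda>x y. \<beta> (c b y \<odot>\<^bsub>H\<^esub> x) b) zs =
        \<beta> (pair_sum (add_monoid H) (\<lambda>x y. c b y \<odot>\<^bsub>H\<^esub> x) zs) b"
      using b zsD by (intro M.add.pair_sum_hom[symmetric, OF HH.T.comm_group_axioms hom]) auto
    also have "\<dots> = \<beta> \<zero>\<^bsub>H\<^esub> b" using slice[OF B(3)[OF b]] by simp
    also have "\<dots> = \<one>\<^bsub>HH.T\<^esub>"
      using group_hom.hom_one[of "add_monoid H" HH.T "\<lambda>x. \<beta> x b"] hom[OF bc[OF b]]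
      by (simp add: group_hom_def group_hom_axioms_def M.add.is_group)
    finally show "pair_sum HH.T (\<lambda>x y. \<beta> (c b y \<odot>\<^bsub>H\<^esub> x) b) zs = \<one>\<^bsub>HH.T\<^esub>" .
  qed simp
  finally show ?thesis by simp
qed

text \<open>The complementary map, \<open>x\<close> minus \<open>pr x\<close>, kills every slice
  that \<open>pr\<close> fixes, so the part of the tensor outside the projection has zero
  slices.\<close>

lemma balanced_project:
  assumes fd: fin_dim and \<beta>: "balanced K H H HH.T \<beta>" and zs: "set zs \<subseteq> carrier H \<times> carrier H"
    and pr: "lin pr"
    and slice: "\<And>f. fnl f \<Longrightarrow> pr (pair_sum (add_monoid H) (\<lambda>x y. f y \<odot>\<^bsub>H\<^esub> x) zs) =
      pair_sum (add_monoid H) (\<lambda>x y. f y \<odot>\<^bsub>H\<^esub> x) zs"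
  shows "pair_sum HH.T \<beta> zs = pair_sum HH.T (\<lambda>x y. \<beta> (pr x) y) zs"
proof -
  note prc [simp] = lin_closed[OF pr]
  have \<beta>_closed [simp]: "\<beta> x y \<in> carrier HH.T" if "x \<in> carrier H" "y \<in> carrier H" for x y
    using \<beta> that by (auto simp: balanced_def)
  have zsD: "x \<in> carrier H \<and> y \<in> carrier H" if "(x, y) \<in> set zs" for x y using that zs by auto
  let ?q = "\<lambda>x. x \<oplus>\<^bsub>H\<^esub> \<ominus>\<^bsub>H\<^esub> pr x"
  have q: "lin ?q"
    by (rule linI) (simp_all add: lin_add[OF pr] lin_smult[OF pr] M.minus_add M.add.m_ac smult_r_distr smult_r_minus)
  let ?zs = "map (\<lambda>(x, y). (?q x, y)) zs"
  have "pair_sum HH.T \<beta> ?zs = \<one>\<^bsub>HH.T\<^esub>"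
  proof (rule balanced_zero_slices[OF fd \<beta>])
    fix f assume f: "fnl f"
    have cl: "pair_sum (add_monoid H) (\<lambda>x y. f y \<odot>\<^bsub>H\<^esub> x) zs \<in> carrier H"
      using zsD fnl_closed[OF f] M.add.pair_sum_closed[of zs "\<lambda>x y. f y \<odot>\<^bsub>H\<^esub> x"] by auto
    have "pair_sum (add_monoid H) (\<lambda>x y. f y \<odot>\<^bsub>H\<^esub> x) ?zs = pair_sum (add_monoid H) (\<lambda>x y. f y \<odot>\<^bsub>H\<^esub> ?q x) zs"
      by (rule pair_sum_map[of "add_monoid H" "\<lambda>x y. f y \<odot>\<^bsub>H\<^esub> x" ?q "\<lambda>y. y"])
    also have "\<dots> = pair_sum (add_monoid H) (\<lambda>x y. ?q (f y \<odot>\<^bsub>H\<^esub> x)) zs"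
      using zsD fnl_closed[OF f] by (intro pair_sum_cong) (auto simp only: lin_smult[OF q])
    also have "\<dots> = ?q (pair_sum (add_monoid H) (\<lambda>x y. f y \<odot>\<^bsub>H\<^esub> x) zs)"
      using zsD fnl_closed[OF f]
      by (intro M.add.pair_sum_hom[symmetric, OF comm_group_H]) (auto simp: hom_def lin_add[OF q])
    also have "\<dots> = \<zero>\<^bsub>H\<^esub>" using slice[OF f] cl by (simp add: M.r_neg)
    finally show "pair_sum (add_monoid H) (\<lambda>x y. f y \<odot>\<^bsub>H\<^esub> x) ?zs = \<zero>\<^bsub>H\<^esub>" .
  qed (use zsD in auto)
  then have "pair_sum HH.T (\<lambda>x y. \<beta> (?q x) y) zs = \<one>\<^bsub>HH.T\<^esub>"
    using pair_sum_map[of HH.T \<beta> ?q "\<lambda>y. y" zs] by simp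
  then have "pair_sum HH.T (\<lambda>x y. \<beta> (pr x) y) zs =
      pair_sum HH.T (\<lambda>x y. \<beta> (?q x) y) zs \<otimes>\<^bsub>HH.T\<^esub> pair_sum HH.T (\<lambda>x y. \<beta> (pr x) y) zs"
    using zsD by (simp add: HH.T.pair_sum_closed)
  also have "\<dots> = pair_sum HH.T (\<lambda>x y. \<beta> (?q x) y \<otimes>\<^bsub>HH.T\<^esub> \<beta> (pr x) y) zs"
    using zsD by (intro HH.T.pair_sum_mult[symmetric]) auto
  also have "\<dots> = pair_sum HH.T \<beta> zs"
  proof (rule pair_sum_cong)
    fix x y assume "(x, y) \<in> set zs"
    then have xy: "x \<in> carrier H" "y \<in> carrier H" using zsD by auto
    have "\<beta> (?q x \<oplus>\<^bsub>H\<^esub> pr x) y = \<beta> (?q x) y \<otimes>\<^bsub>HH.T\<^esub> \<beta> (pr x) y"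
      using \<beta> xy lin_closed[OF q] by (simp add: balanced_def)
    moreover have "?q x \<oplus>\<^bsub>H\<^esub> pr x = x" using xy by (simp add: M.a_assoc M.l_neg)
    ultimately show "\<beta> (?q x) y \<otimes>\<^bsub>HH.T\<^esub> \<beta> (pr x) y = \<beta> x y" by simp
  qed
  finally show ?thesis ..
qed

text \<open>The projection onto \<open>W\<close> may be applied to one leg at a time without
  changing the tensor. The gain is that slices are elements of \<open>H\<close>, hence easy to
  locate in intersections and products, unlike presentations by pairs.\<close>

lemma legs_in_subspace:
  assumes fd: fin_dim and W: "smod W" and h: "h \<in> carrier H"
    and left: "\<And>f. fnl f \<Longrightarrow> sw (\<lambda>x y. f x \<odot>\<^bsub>H\<^esub> y) h \<in> W"
    and right: "\<And>f. fnl f \<Longrightarrow> sw (\<lambda>x y. f y \<odot>\<^bsub>H\<^esub> x) h \<in> W"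
  shows "\<exists>xs. set xs \<subseteq> W \<times> W \<and> \<Delta> h = pair_sum HH.T HH.pt xs"
proof -
  obtain pr where pr: "lin pr" "\<And>x. x \<in> carrier H \<Longrightarrow> pr x \<in> W" "\<And>x. x \<in> W \<Longrightarrow> pr x = x"
    using projection_onto[OF fd W] by blast
  note [simp] = lin_closed[OF pr(1)]
  have bal: "balanced K H H HH.T (\<lambda>y x. HH.pt (pr x) y)"
    by (rule balancedI) (simp_all add: HH_pt_add lin_add[OF pr(1)] lin_smult[OF pr(1)])
  have "\<Delta> h = pair_sum HH.T HH.pt (legs h)" using legs[OF h] by simp
  also have "\<dots> = pair_sum HH.T (\<lambda>x y. HH.pt (pr x) y) (legs h)"
    using right by (intro balanced_project[OF fd HH.balanced_pt legs_closed pr(1)]) (simp add: pr(3) flip: sw_def)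
  also have "\<dots> = pair_sum HH.T (\<lambda>y x. HH.pt (pr x) y) (map (\<lambda>(x, y). (y, x)) (legs h))"
    by (simp add: pair_sum_def foldr_map split_def comp_def)
  \<comment> \<open>After the interchange of legs the functional tests the other leg. The balanced
    map already projects what is now its second argument, so that both legs end up in
    \<open>W\<close>.\<close>
  also have "\<dots> = pair_sum HH.T (\<lambda>y x. HH.pt (pr x) (pr y)) (map (\<lambda>(x, y). (y, x)) (legs h))"
  proof (rule balanced_project[OF fd bal _ pr(1)])
    fix f assume f: "fnl f"
    have "pair_sum (add_monoid H) (\<lambda>x y. f y \<odot>\<^bsub>H\<^esub> x) (map (\<lambda>(x, y). (y, x)) (legs h)) =
        sw (\<lambda>x y. f x \<odot>\<^bsub>H\<^esub> y) h"
      by (simp add: pair_sum_def sw_def foldr_map split_def comp_def)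
    then show "pr (pair_sum (add_monoid H) (\<lambda>x y. f y \<odot>\<^bsub>H\<^esub> x) (map (\<lambda>(x, y). (y, x)) (legs h))) =
        pair_sum (add_monoid H) (\<lambda>x y. f y \<odot>\<^bsub>H\<^esub> x) (map (\<lambda>(x, y). (y, x)) (legs h))"
      using left[OF f] pr(3) by simp
  qed (use legs_closed[of h] in auto)
  also have "\<dots> = pair_sum HH.T HH.pt (map (\<lambda>(x, y). (pr x, pr y)) (legs h))"
    by (simp add: pair_sum_def foldr_map split_def comp_def)
  finally have "\<Delta> h = \<dots>" .
  moreover have "set (map (\<lambda>(x, y). (pr x, pr y)) (legs h)) \<subseteq> W \<times> W"
    using legs_closed[of h] pr(2) by auto
  ultimately show ?thesis by blast
qed

lemma smod_Int: "smod A \<Longrightarrow> smod B \<Longrightarrow> smod (A \<inter> B)"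
  by (auto simp: LinearCombinations.submodule_def)

text \<open>Presentations of \<open>\<Delta> a\<close> by pairs from \<open>A\<close> and by pairs
  from \<open>B\<close> are unrelated, but its slices lie in both subalgebras.\<close>

lemma hs_Int:
  assumes fd: fin_dim and A: "hs A" and B: "hs B"
  shows "hs (A \<inter> B)"
  unfolding hopf_subalgebra_iff
proof (intro conjI ballI)
  have W: "smod (A \<inter> B)" by (rule smod_Int[OF hsD(1)[OF A] hsD(1)[OF B]])
  show "smod (A \<inter> B)" by fact
  fix a assume a: "a \<in> A \<inter> B"
  then have aA: "a \<in> A" and aB: "a \<in> B" and ac: "a \<in> carrier H" using hsD(5)[OF A] by auto
  note sl = smodD(4)[OF hsD(1)]
  show "\<exists>xs. set xs \<subseteq> (A \<inter> B) \<times> (A \<inter> B) \<and> \<Delta> a = pair_sum HH.T HH.pt xs"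
  proof (rule legs_in_subspace[OF fd W ac])
    fix f assume f: "fnl f"
    note ls = lins lin_fnl[OF f] lin_smult_fun[OF fnl_closed[OF f] lin_id]
    have in_sub: "sw (\<lambda>x y. f x \<odot>\<^bsub>H\<^esub> y) a \<in> C" "sw (\<lambda>x y. f y \<odot>\<^bsub>H\<^esub> x) a \<in> C" if C: "hs C" "a \<in> C" for C
      by (rule sw_sub_in[OF C _ hsD(1)[OF C(1)]],
          simp_all add: ls fnl_closed[OF f] hsD(5)[OF C(1)] smodD(4)[OF hsD(1)[OF C(1)]])+
    show "sw (\<lambda>x y. f x \<odot>\<^bsub>H\<^esub> y) a \<in> A \<inter> B" "sw (\<lambda>x y. f y \<odot>\<^bsub>H\<^esub> x) a \<in> A \<inter> B"
      using in_sub[OF A aA] in_sub[OF B aB] by auto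
  qed
qed (use hsD[OF A] hsD[OF B] in auto)

subsection \<open>Adjoint actions and products of subspaces\<close>

definition adl :: "'h \<Rightarrow> 'h \<Rightarrow> 'h" where
  "adl h a = sw (\<lambda>x y. x \<otimes>\<^bsub>H\<^esub> a \<otimes>\<^bsub>H\<^esub> S y) h"

definition adr :: "'h \<Rightarrow> 'h \<Rightarrow> 'h" where
  "adr h a = sw (\<lambda>x y. S x \<otimes>\<^bsub>H\<^esub> a \<otimes>\<^bsub>H\<^esub> y) h"

text \<open>Stated inside \<open>H\<close> and without \<open>N \<subseteq> L\<close>, since in the
  Zassenhaus lemma an intersection acts on a normal subalgebra that it need not contain. For Hopf
  subalgebras with \<open>N \<subseteq> L\<close> it is normality in \<open>sub_hopf\<close>, see
  \<open>normal_sub_hopf_iff\<close>.\<close>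

definition normalizes :: "'h set \<Rightarrow> 'h set \<Rightarrow> bool" where
  "normalizes L N \<longleftrightarrow> (\<forall>h\<in>L. \<forall>a\<in>N. adl h a \<in> N \<and> adr h a \<in> N)"

abbreviation "aug A \<equiv> augmentation K H A"

lemma adl_closed [simp]: "h \<in> carrier H \<Longrightarrow> a \<in> carrier H \<Longrightarrow> adl h a \<in> carrier H"
  and adr_closed [simp]: "h \<in> carrier H \<Longrightarrow> a \<in> carrier H \<Longrightarrow> adr h a \<in> carrier H"
  by (simp_all add: adl_def adr_def)

lemma lin_adl: "a \<in> carrier H \<Longrightarrow> lin g \<Longrightarrow> lin (\<lambda>h. adl (g h) a)"
  and lin_adl': "h \<in> carrier H \<Longrightarrow> lin g \<Longrightarrow> lin (\<lambda>a. adl h (g a))"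
  and lin_adr: "a \<in> carrier H \<Longrightarrow> lin g \<Longrightarrow> lin (\<lambda>h. adr (g h) a)"
  and lin_adr': "h \<in> carrier H \<Longrightarrow> lin g \<Longrightarrow> lin (\<lambda>a. adr h (g a))"
  unfolding adl_def adr_def by (simp_all add: lins)

lemmas lin_ad = lin_adl lin_adl' lin_adr lin_adr'

lemma counit_sw:
  assumes "bilin \<beta>"
  shows "\<epsilon> (sw \<beta> h) \<odot>\<^bsub>H\<^esub> \<one>\<^bsub>H\<^esub> = sw (\<lambda>x y. \<epsilon> (\<beta> x y) \<odot>\<^bsub>H\<^esub> \<one>\<^bsub>H\<^esub>) h"
  using lin_sw[OF fnl_lin1[OF fnl_counit], of \<beta> h] bilin_closed[OF assms] by simp

lemma counit_adl: "h \<in> carrier H \<Longrightarrow> a \<in> carrier H \<Longrightarrow> \<epsilon> (adl h a) = \<epsilon> h \<otimes>\<^bsub>K\<^esub> \<epsilon> a"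
proof (rule smult_one_inject)
  assume h: "h \<in> carrier H" and a: "a \<in> carrier H"
  have "\<epsilon> (adl h a) \<odot>\<^bsub>H\<^esub> \<one>\<^bsub>H\<^esub> = sw (\<lambda>x y. \<epsilon> (x \<otimes>\<^bsub>H\<^esub> a \<otimes>\<^bsub>H\<^esub> S y) \<odot>\<^bsub>H\<^esub> \<one>\<^bsub>H\<^esub>) h"
    unfolding adl_def using a by (intro counit_sw) (simp add: lins)
  also have "\<dots> = sw (\<lambda>x y. \<epsilon> y \<odot>\<^bsub>H\<^esub> (\<epsilon> x \<odot>\<^bsub>H\<^esub> (\<epsilon> a \<odot>\<^bsub>H\<^esub> \<one>\<^bsub>H\<^esub>))) h"
    using a by (simp add: smult_assoc1[symmetric] R.m_ac)
  also have "\<dots> = (\<epsilon> h \<otimes>\<^bsub>K\<^esub> \<epsilon> a) \<odot>\<^bsub>H\<^esub> \<one>\<^bsub>H\<^esub>"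
    using h a by (subst sw_counit_r) (simp_all add: lins smult_assoc1)
  finally show "\<epsilon> (adl h a) \<odot>\<^bsub>H\<^esub> \<one>\<^bsub>H\<^esub> = (\<epsilon> h \<otimes>\<^bsub>K\<^esub> \<epsilon> a) \<odot>\<^bsub>H\<^esub> \<one>\<^bsub>H\<^esub>" .
qed auto

lemma counit_adr: "h \<in> carrier H \<Longrightarrow> a \<in> carrier H \<Longrightarrow> \<epsilon> (adr h a) = \<epsilon> h \<otimes>\<^bsub>K\<^esub> \<epsilon> a"
proof (rule smult_one_inject)
  assume h: "h \<in> carrier H" and a: "a \<in> carrier H"
  have "\<epsilon> (adr h a) \<odot>\<^bsub>H\<^esub> \<one>\<^bsub>H\<^esub> = sw (\<lambda>x y. \<epsilon> (S x \<otimes>\<^bsub>H\<^esub> a \<otimes>\<^bsub>H\<^esub> y) \<odot>\<^bsub>H\<^esub> \<one>\<^bsub>H\<^esub>) h"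
    unfolding adr_def using a by (intro counit_sw) (simp add: lins)
  also have "\<dots> = sw (\<lambda>x y. \<epsilon> y \<odot>\<^bsub>H\<^esub> (\<epsilon> x \<odot>\<^bsub>H\<^esub> (\<epsilon> a \<odot>\<^bsub>H\<^esub> \<one>\<^bsub>H\<^esub>))) h"
    using a by (simp add: smult_assoc1[symmetric] R.m_ac)
  also have "\<dots> = (\<epsilon> h \<otimes>\<^bsub>K\<^esub> \<epsilon> a) \<odot>\<^bsub>H\<^esub> \<one>\<^bsub>H\<^esub>"
    using h a by (subst sw_counit_r) (simp_all add: lins smult_assoc1)
  finally show "\<epsilon> (adr h a) \<odot>\<^bsub>H\<^esub> \<one>\<^bsub>H\<^esub> = (\<epsilon> h \<otimes>\<^bsub>K\<^esub> \<epsilon> a) \<odot>\<^bsub>H\<^esub> \<one>\<^bsub>H\<^esub>" .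
qed auto

text \<open>In \<open>h1 a S h2 h3\<close> the antipode cancels, so \<open>a\<close> can be moved
  across \<open>h\<close> at the cost of acting on it.\<close>

lemma mult_eq_sw_adl:
  assumes h: "h \<in> carrier H" and a: "a \<in> carrier H"
  shows "h \<otimes>\<^bsub>H\<^esub> a = sw (\<lambda>x y. adl x a \<otimes>\<^bsub>H\<^esub> y) h"
proof -
  have "sw (\<lambda>x y. adl x a \<otimes>\<^bsub>H\<^esub> y) h = sw (\<lambda>r y. sw (\<lambda>x z. x \<otimes>\<^bsub>H\<^esub> a \<otimes>\<^bsub>H\<^esub> (S z \<otimes>\<^bsub>H\<^esub> y)) r) h"
    using a by (simp add: adl_def sw_pull H.m_assoc)
  also have "\<dots> = sw (\<lambda>x r. sw (\<lambda>z y. x \<otimes>\<^bsub>H\<^esub> a \<otimes>\<^bsub>H\<^esub> (S z \<otimes>\<^bsub>H\<^esub> y)) r) h"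
    using h a by (intro sw_assoc) (simp_all add: lins)
  also have "\<dots> = h \<otimes>\<^bsub>H\<^esub> a \<otimes>\<^bsub>H\<^esub> \<one>\<^bsub>H\<^esub>"
    using h a by (intro sw_antipode_l3'[of "\<lambda>x z. x \<otimes>\<^bsub>H\<^esub> a \<otimes>\<^bsub>H\<^esub> z"]) (simp_all add: lins)
  finally show ?thesis using h a by simp
qed

lemma mult_eq_sw_adr:
  assumes h: "h \<in> carrier H" and a: "a \<in> carrier H"
  shows "a \<otimes>\<^bsub>H\<^esub> h = sw (\<lambda>x y. x \<otimes>\<^bsub>H\<^esub> adr y a) h"
proof -
  have "sw (\<lambda>x y. x \<otimes>\<^bsub>H\<^esub> adr y a) h = sw (\<lambda>x r. sw (\<lambda>z y. (x \<otimes>\<^bsub>H\<^esub> S z) \<otimes>\<^bsub>H\<^esub> (a \<otimes>\<^bsub>H\<^esub> y)) r) h"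
    using a by (simp add: adr_def sw_pull H.m_assoc)
  also have "\<dots> = \<one>\<^bsub>H\<^esub> \<otimes>\<^bsub>H\<^esub> (a \<otimes>\<^bsub>H\<^esub> h)"
    using h a by (intro sw_antipode_r3[of "\<lambda>z y. z \<otimes>\<^bsub>H\<^esub> (a \<otimes>\<^bsub>H\<^esub> y)"]) (simp_all add: lins)
  finally show ?thesis using h a by simp
qed

lemma adl_mult:
  assumes "h \<in> carrier H" "k \<in> carrier H" "a \<in> carrier H"
  shows "adl (h \<otimes>\<^bsub>H\<^esub> k) a = adl h (adl k a)"
  using assms by (simp add: adl_def sw_mult lins sw_pull antipode_mult H.m_assoc)

lemma adr_mult:
  assumes "h \<in> carrier H" "k \<in> carrier H" "a \<in> carrier H"
  shows "adr (h \<otimes>\<^bsub>H\<^esub> k) a = adr k (adr h a)"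
proof -
  have "adr (h \<otimes>\<^bsub>H\<^esub> k) a = sw (\<lambda>x y. sw (\<lambda>u v. S u \<otimes>\<^bsub>H\<^esub> (S x \<otimes>\<^bsub>H\<^esub> a \<otimes>\<^bsub>H\<^esub> y) \<otimes>\<^bsub>H\<^esub> v) k) h"
    using assms by (simp add: adr_def sw_mult lins antipode_mult H.m_assoc)
  also have "\<dots> = adr k (adr h a)"
    using assms by (subst sw_swap) (simp_all add: adr_def sw_pull)
  finally show ?thesis .
qed

text \<open>The adjoint action makes \<open>H\<close> a module algebra: between \<open>a\<close> and
  \<open>b\<close> the factors \<open>S h2 h3\<close> cancel.\<close>

lemma adl_prod:
  assumes h: "h \<in> carrier H" and a: "a \<in> carrier H" and b: "b \<in> carrier H"
  shows "adl h (a \<otimes>\<^bsub>H\<^esub> b) = sw (\<lambda>x y. adl x a \<otimes>\<^bsub>H\<^esub> adl y b) h"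
proof -
  have "sw (\<lambda>x y. adl x a \<otimes>\<^bsub>H\<^esub> adl y b) h =
      sw (\<lambda>r s. sw (\<lambda>x z. x \<otimes>\<^bsub>H\<^esub> a \<otimes>\<^bsub>H\<^esub> (S z \<otimes>\<^bsub>H\<^esub> adl s b)) r) h"
    using a b by (simp add: adl_def[of _ a] sw_pull H.m_assoc)
  also have "\<dots> = sw (\<lambda>x r. sw (\<lambda>z s. x \<otimes>\<^bsub>H\<^esub> a \<otimes>\<^bsub>H\<^esub> (S z \<otimes>\<^bsub>H\<^esub> adl s b)) r) h"
    using h a b by (intro sw_assoc) (simp_all add: lins lin_ad)
  also have "\<dots> = sw (\<lambda>x r. sw (\<lambda>z s. sw (\<lambda>u v. x \<otimes>\<^bsub>H\<^esub> a \<otimes>\<^bsub>H\<^esub> ((S z \<otimes>\<^bsub>H\<^esub> u) \<otimes>\<^bsub>H\<^esub> (b \<otimes>\<^bsub>H\<^esub> S v))) s) r) h"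
    using a b by (simp add: adl_def sw_pull H.m_assoc)
  also have "\<dots> = sw (\<lambda>x r. x \<otimes>\<^bsub>H\<^esub> a \<otimes>\<^bsub>H\<^esub> (\<one>\<^bsub>H\<^esub> \<otimes>\<^bsub>H\<^esub> (b \<otimes>\<^bsub>H\<^esub> S r))) h"
    using a b
    by (intro sw_cong refl sw_antipode_l3[of "\<lambda>w v. _ \<otimes>\<^bsub>H\<^esub> a \<otimes>\<^bsub>H\<^esub> (w \<otimes>\<^bsub>H\<^esub> (b \<otimes>\<^bsub>H\<^esub> S v))"]) (simp_all add: lins)
  also have "\<dots> = adl h (a \<otimes>\<^bsub>H\<^esub> b)"
    using a b by (simp add: adl_def H.m_assoc)
  finally show ?thesis ..
qed

lemma adr_prod:
  assumes h: "h \<in> carrier H" and a: "a \<in> carrier H" and b: "b \<in> carrier H"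
  shows "adr h (a \<otimes>\<^bsub>H\<^esub> b) = sw (\<lambda>x y. adr x a \<otimes>\<^bsub>H\<^esub> adr y b) h"
proof -
  have "sw (\<lambda>x y. adr x a \<otimes>\<^bsub>H\<^esub> adr y b) h =
      sw (\<lambda>r s. sw (\<lambda>x z. S x \<otimes>\<^bsub>H\<^esub> a \<otimes>\<^bsub>H\<^esub> (z \<otimes>\<^bsub>H\<^esub> adr s b)) r) h"
    using a b by (simp add: adr_def[of _ a] sw_pull H.m_assoc)
  also have "\<dots> = sw (\<lambda>x r. sw (\<lambda>z s. S x \<otimes>\<^bsub>H\<^esub> a \<otimes>\<^bsub>H\<^esub> (z \<otimes>\<^bsub>H\<^esub> adr s b)) r) h"
    using h a b by (intro sw_assoc) (simp_all add: lins lin_ad)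
  also have "\<dots> = sw (\<lambda>x r. sw (\<lambda>z s. sw (\<lambda>u v. S x \<otimes>\<^bsub>H\<^esub> a \<otimes>\<^bsub>H\<^esub> ((z \<otimes>\<^bsub>H\<^esub> S u) \<otimes>\<^bsub>H\<^esub> (b \<otimes>\<^bsub>H\<^esub> v))) s) r) h"
    using a b by (simp add: adr_def sw_pull H.m_assoc)
  also have "\<dots> = sw (\<lambda>x r. S x \<otimes>\<^bsub>H\<^esub> a \<otimes>\<^bsub>H\<^esub> (\<one>\<^bsub>H\<^esub> \<otimes>\<^bsub>H\<^esub> (b \<otimes>\<^bsub>H\<^esub> r))) h"
    using a b
    by (intro sw_cong refl sw_antipode_r3[of "\<lambda>w v. _ \<otimes>\<^bsub>H\<^esub> a \<otimes>\<^bsub>H\<^esub> (w \<otimes>\<^bsub>H\<^esub> (b \<otimes>\<^bsub>H\<^esub> v))"]) (simp_all add: lins)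
  also have "\<dots> = adr h (a \<otimes>\<^bsub>H\<^esub> b)"
    using a b by (simp add: adr_def H.m_assoc)
  finally show ?thesis ..
qed

lemma smod_aug: "smod N \<Longrightarrow> smod (aug N)"
  by (rule smodI) (auto simp: augmentation_def smodD fnl_zero[OF fnl_counit] fnl_add[OF fnl_counit]
      fnl_smult[OF fnl_counit] subset_iff dest: smodD(1))


section \<open>Products of subspaces and commutation with a normalized subspace\<close>

abbreviation "ip \<equiv> ideal_prod H"

lemma ip_smod:
  assumes X: "smod X" and Y: "smod Y"
  shows "smod (ip X Y)"
proof (rule smodI)
  have XY: "x \<in> carrier H" "y \<in> carrier H" if "x \<in> X" "y \<in> Y" for x y
    using that smodD(1)[OF X] smodD(1)[OF Y] by auto
  have c: "z \<in> carrier H" if "z \<in> ip X Y" for z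
    using that by induction (auto simp: XY)
  then show "ip X Y \<subseteq> carrier H" by auto
  show "\<zero>\<^bsub>H\<^esub> \<in> ip X Y"
    using ideal_prod.prod[OF smodD(2)[OF X] smodD(2)[OF Y], of H] by simp
  show "c \<odot>\<^bsub>H\<^esub> z \<in> ip X Y" if "c \<in> carrier K" "z \<in> ip X Y" for c z
    using that(2)
  proof induction
    case (prod i j)
    then have "(c \<odot>\<^bsub>H\<^esub> i) \<otimes>\<^bsub>H\<^esub> j \<in> ip X Y" using that(1) smodD(4)[OF X] by (intro ideal_prod.prod)
    then show ?case using prod XY that(1) by (simp add: smult_mult_left)
  next
    case (sum s t)
    then show ?case using c that(1) by (simp add: smult_r_distr ideal_prod.sum)
  qed
qed (rule ideal_prod.sum)

lemma ip_least:
  assumes W: "smod W" and "\<And>x y. x \<in> X \<Longrightarrow> y \<in> Y \<Longrightarrow> x \<otimes>\<^bsub>H\<^esub> y \<in> W"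
  shows "ip X Y \<subseteq> W"
proof
  fix z assume "z \<in> ip X Y"
  then show "z \<in> W" by induction (auto simp: assms(2) smodD(3)[OF W])
qed

lemma lin_ip_zero:
  assumes "lin f" "X \<subseteq> carrier H" "Y \<subseteq> carrier H" "z \<in> ip X Y"
    and "\<And>x y. x \<in> X \<Longrightarrow> y \<in> Y \<Longrightarrow> f (x \<otimes>\<^bsub>H\<^esub> y) = \<zero>\<^bsub>H\<^esub>"
  shows "f z = \<zero>\<^bsub>H\<^esub>"
proof -
  have "z \<in> carrier H \<and> f z = \<zero>\<^bsub>H\<^esub>" using assms(4)
    by induction (use assms in \<open>auto simp: lin_add subset_iff\<close>)
  then show ?thesis by simp
qed

lemma smod_preimage: "lin f \<Longrightarrow> smod W \<Longrightarrow> smod {x \<in> carrier H. f x \<in> W}"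
  by (rule smodI) (auto simp: lin_zero lin_add lin_smult smodD)

text \<open>Each inclusion uses one of the two adjoint actions, which is why stability under both is
  asked for.\<close>

lemma ip_commute:
  assumes L: "hs L" and X: "smod X" and norm: "normalizes L X"
  shows "ip L X = ip X L"
proof
  note Lc = hsD(5)[OF L]
  have Xc: "a \<in> carrier H" if "a \<in> X" for a using that smodD(1)[OF X] by auto
  show "ip L X \<subseteq> ip X L"
  proof (rule ip_least[OF ip_smod[OF X hsD(1)[OF L]]])
    fix h a assume h: "h \<in> L" and a: "a \<in> X"
    show "h \<otimes>\<^bsub>H\<^esub> a \<in> ip X L"
      unfolding mult_eq_sw_adl[OF Lc[OF h] Xc[OF a]]
    proof (rule sw_sub_in[OF L h _ ip_smod[OF X hsD(1)[OF L]]])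
      show "adl x a \<otimes>\<^bsub>H\<^esub> y \<in> ip X L" if "x \<in> L" "y \<in> L" for x y
        using that a norm by (intro ideal_prod.prod) (auto simp: normalizes_def)
    qed (use Xc[OF a] in \<open>simp add: lins lin_ad\<close>)
  qed
  show "ip X L \<subseteq> ip L X"
  proof (rule ip_least[OF ip_smod[OF hsD(1)[OF L] X]])
    fix h a assume h: "h \<in> L" and a: "a \<in> X"
    show "a \<otimes>\<^bsub>H\<^esub> h \<in> ip L X"
      unfolding mult_eq_sw_adr[OF Lc[OF h] Xc[OF a]]
    proof (rule sw_sub_in[OF L h _ ip_smod[OF hsD(1)[OF L] X]])
      show "x \<otimes>\<^bsub>H\<^esub> adr y a \<in> ip L X" if "x \<in> L" "y \<in> L" for x y
        using that a norm by (intro ideal_prod.prod) (auto simp: normalizes_def)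
    qed (use Xc[OF a] in \<open>simp add: lins lin_ad\<close>)
  qed
qed

lemma normalizes_aug:
  assumes L: "hs L" and N: "hs N" and "normalizes L N"
  shows "normalizes L (aug N)"
  using assms(3) hsD(5)[OF L] hsD(5)[OF N]
  by (auto simp: normalizes_def augmentation_def counit_adl counit_adr)

lemma normalizes_mono: "normalizes L N \<Longrightarrow> D \<subseteq> L \<Longrightarrow> normalizes D N"
  by (auto simp: normalizes_def)

lemma normalizes_self:
  assumes D: "hs D"
  shows "normalizes D D"
  unfolding normalizes_def
proof (intro ballI conjI)
  fix h a assume h: "h \<in> D" and a: "a \<in> D"
  then have ac: "a \<in> carrier H" using hsD(5)[OF D] by auto
  show "adl h a \<in> D" unfolding adl_def
    by (rule sw_sub_in[OF D h _ hsD(1)[OF D]]) (use ac a in \<open>simp_all add: lins hsD(3,4)[OF D]\<close>)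
  show "adr h a \<in> D" unfolding adr_def
    by (rule sw_sub_in[OF D h _ hsD(1)[OF D]]) (use ac a in \<open>simp_all add: lins hsD(3,4)[OF D]\<close>)
qed

lemma normalizes_Int: "normalizes L M \<Longrightarrow> normalizes L N \<Longrightarrow> normalizes L (M \<inter> N)"
  by (auto simp: normalizes_def)

lemma aug_subset: "aug N \<subseteq> N"
  by (auto simp: augmentation_def)

lemma augI: "smod N \<Longrightarrow> \<one>\<^bsub>H\<^esub> \<in> N \<Longrightarrow> a \<in> N \<Longrightarrow> a \<ominus>\<^bsub>H\<^esub> \<epsilon> a \<odot>\<^bsub>H\<^esub> \<one>\<^bsub>H\<^esub> \<in> aug N"
proof -
  assume N: "smod N" "\<one>\<^bsub>H\<^esub> \<in> N" "a \<in> N"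
  then have a: "a \<in> carrier H" using smodD(1) by auto
  have "(\<epsilon> (a \<ominus>\<^bsub>H\<^esub> \<epsilon> a \<odot>\<^bsub>H\<^esub> \<one>\<^bsub>H\<^esub>)) \<odot>\<^bsub>H\<^esub> \<one>\<^bsub>H\<^esub> = \<zero>\<^bsub>K\<^esub> \<odot>\<^bsub>H\<^esub> \<one>\<^bsub>H\<^esub>"
    using a lin_diff[OF fnl_lin1[OF fnl_counit], of a "\<epsilon> a \<odot>\<^bsub>H\<^esub> \<one>\<^bsub>H\<^esub>"]
    by (simp add: fnl_smult[OF fnl_counit])
  then have "\<epsilon> (a \<ominus>\<^bsub>H\<^esub> \<epsilon> a \<odot>\<^bsub>H\<^esub> \<one>\<^bsub>H\<^esub>) = \<zero>\<^bsub>K\<^esub>"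
    using a by - (rule smult_one_inject, auto)
  then show ?thesis using N a by (auto simp: augmentation_def intro!: smod_diff smodD(4))
qed

subsection \<open>Intersection with a normal ideal\<close>

lemma smult_eq_zero_iff:
  assumes "c \<in> carrier K" "c \<odot>\<^bsub>H\<^esub> \<one>\<^bsub>H\<^esub> = \<zero>\<^bsub>H\<^esub>"
  shows "c = \<zero>\<^bsub>K\<^esub>"
proof -
  have "c \<odot>\<^bsub>H\<^esub> \<one>\<^bsub>H\<^esub> = \<zero>\<^bsub>K\<^esub> \<odot>\<^bsub>H\<^esub> \<one>\<^bsub>H\<^esub>" using assms by simp
  then show ?thesis using assms(1) by - (rule smult_one_inject, auto)
qed

text \<open>For a left integral \<open>\<Lambda>\<close> of \<open>N\<close>, the condition \<open>c\<^sub>1 \<otimes> c\<^sub>2\<Lambda> = c \<otimes> \<Lambda>\<close> gives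
  \<open>\<Lambda>\<^sub>1 \<otimes> c\<Lambda>\<^sub>2 = S(c)\<Lambda>\<^sub>1 \<otimes> \<Lambda>\<^sub>2\<close>, and slicing with a functional \<open>g\<close> such that
  \<open>g(\<Lambda>\<^sub>1)\<Lambda>\<^sub>2 = 1\<close> exhibits \<open>c\<close> as an element of \<open>N\<close>.\<close>

lemma coinvariant_in_subalgebra:
  assumes N: "hs N" and \<Lambda>: "\<Lambda> \<in> N" and g: "fnl g" "sw (\<lambda>x y. g x \<odot>\<^bsub>H\<^esub> y) \<Lambda> = \<one>\<^bsub>H\<^esub>"
    and c: "c \<in> carrier H"
    and coinv: "\<And>\<beta>. bilin \<beta> \<Longrightarrow> sw (\<lambda>x y. \<beta> x (y \<otimes>\<^bsub>H\<^esub> \<Lambda>)) c = \<beta> c \<Lambda>"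
  shows "c \<in> N"
proof -
  have \<Lambda>c [simp]: "\<Lambda> \<in> carrier H" using hsD(5)[OF N \<Lambda>] .
  note [simp] = c fnl_closed[OF g(1)] and ls = lins lin_fnl[OF g(1)]
  have "sw (\<lambda>s t. g (S c \<otimes>\<^bsub>H\<^esub> s) \<odot>\<^bsub>H\<^esub> t) \<Lambda> =
      sw (\<lambda>x y. sw (\<lambda>s t. g (S x \<otimes>\<^bsub>H\<^esub> s) \<odot>\<^bsub>H\<^esub> t) (y \<otimes>\<^bsub>H\<^esub> \<Lambda>)) c"
    by (rule coinv[symmetric]) (simp add: ls)
  also have "\<dots> = sw (\<lambda>x r. sw (\<lambda>y1 y2. sw (\<lambda>s t. g (S x \<otimes>\<^bsub>H\<^esub> y1 \<otimes>\<^bsub>H\<^esub> s) \<odot>\<^bsub>H\<^esub> (y2 \<otimes>\<^bsub>H\<^esub> t)) \<Lambda>) r) c"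
    by (simp add: sw_mult ls H.m_assoc)
  also have "\<dots> = sw (\<lambda>s t. g (\<one>\<^bsub>H\<^esub> \<otimes>\<^bsub>H\<^esub> s) \<odot>\<^bsub>H\<^esub> (c \<otimes>\<^bsub>H\<^esub> t)) \<Lambda>"
    by (rule sw_antipode_l3[of "\<lambda>z y2. sw (\<lambda>s t. g (z \<otimes>\<^bsub>H\<^esub> s) \<odot>\<^bsub>H\<^esub> (y2 \<otimes>\<^bsub>H\<^esub> t)) \<Lambda>"]) (simp_all add: ls)
  also have "\<dots> = c \<otimes>\<^bsub>H\<^esub> sw (\<lambda>s t. g s \<odot>\<^bsub>H\<^esub> t) \<Lambda>"
    by (simp add: sw_pull smult_mult_right)
  also have "\<dots> = c" using g(2) by simp
  finally have e: "sw (\<lambda>s t. g (S c \<otimes>\<^bsub>H\<^esub> s) \<odot>\<^bsub>H\<^esub> t) \<Lambda> = c" .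
  have "sw (\<lambda>s t. g (S c \<otimes>\<^bsub>H\<^esub> s) \<odot>\<^bsub>H\<^esub> t) \<Lambda> \<in> N"
    by (rule sw_sub_in[OF N \<Lambda> _ hsD(1)[OF N]])
      (simp_all add: ls smodD(4)[OF hsD(1)[OF N]] hsD(5)[OF N])
  then show ?thesis unfolding e .
qed

text \<open>A right integral \<open>\<Gamma>\<close> of a normal Hopf subalgebra \<open>E\<close> of \<open>D\<close> detects \<open>D E\<^sup>+\<close>: from
  \<open>\<Gamma>d = 0\<close> one gets \<open>\<Gamma>d\<^sub>1 \<otimes> q(d\<^sub>2) = 0\<close>, where \<open>q\<close> is a linear projection with kernel
  \<open>D E\<^sup>+\<close> on \<open>D\<close>, and acting on the first factor by the antipode of the second one turns this into
  \<open>\<Gamma> \<otimes> q(d) = 0\<close>.\<close>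

lemma annihilator_right_integral:
  assumes fd: fin_dim and D: "hs D" and E: "hs E" and ED: "E \<subseteq> D" and norm: "normalizes D E"
    and \<Gamma>: "\<Gamma> \<in> E" "\<And>a. a \<in> E \<Longrightarrow> \<Gamma> \<otimes>\<^bsub>H\<^esub> a = \<epsilon> a \<odot>\<^bsub>H\<^esub> \<Gamma>"
    and \<gamma>: "fnl \<gamma>" "\<gamma> \<Gamma> = \<one>\<^bsub>K\<^esub>"
    and d: "d \<in> D" "\<Gamma> \<otimes>\<^bsub>H\<^esub> d = \<zero>\<^bsub>H\<^esub>"
  shows "d \<in> ip D (aug E)"
proof -
  note Dc = hsD(5)[OF D] and Ec = hsD(5)[OF E]
  let ?W = "ip D (aug E)"
  have augE: "smod (aug E)" by (rule smod_aug[OF hsD(1)[OF E]])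
  have augD: "a \<in> aug E \<Longrightarrow> a \<in> D \<and> a \<in> E \<and> a \<in> carrier H \<and> \<epsilon> a = \<zero>\<^bsub>K\<^esub>" for a
    using ED Ec by (auto simp: augmentation_def)
  have W: "smod ?W" by (rule ip_smod[OF hsD(1)[OF D] augE])
  have comm: "?W = ip (aug E) D" by (rule ip_commute[OF D augE normalizes_aug[OF D E norm]])
  have WD: "?W \<subseteq> D" using augD by (intro ip_least[OF hsD(1)[OF D]] hsD(3)[OF D]) auto
  obtain pr where pr: "lin pr" "\<And>x. x \<in> carrier H \<Longrightarrow> pr x \<in> ?W" "\<And>x. x \<in> ?W \<Longrightarrow> pr x = x"
    using projection_onto[OF fd W] by blast
  \<comment> \<open>A model of the quotient map modulo \<open>D E\<^sup>+\<close> with values in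
    \<open>H\<close>, so that it can occur inside Sweedler sums.\<close>
  define q where "q x = x \<oplus>\<^bsub>H\<^esub> \<ominus>\<^bsub>H\<^esub> pr x" for x
  have q: "lin q"
    unfolding q_def using lin_closed[OF pr(1)]
    by (intro linI) (simp_all add: lin_add[OF pr(1)] lin_smult[OF pr(1)] M.minus_add M.add.m_ac smult_r_distr smult_r_minus)
  have qc [simp]: "q x \<in> carrier H" if "x \<in> carrier H" for x using lin_closed[OF q that] .
  have q0: "q x = \<zero>\<^bsub>H\<^esub>" if "x \<in> ?W" for x
    using that pr(3) smodD(1)[OF W] by (auto simp: q_def M.r_neg subset_iff)
  have qdiff: "x \<ominus>\<^bsub>H\<^esub> q x \<in> ?W" if "x \<in> carrier H" for x
  proof -
    have "x \<ominus>\<^bsub>H\<^esub> q x = pr x"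
      using that lin_closed[OF pr(1) that] by (simp add: q_def a_minus_def M.minus_add M.r_neg2)
    then show ?thesis using pr(2)[OF that] by simp
  qed
  have \<Gamma>c [simp]: "\<Gamma> \<in> carrier H" using Ec \<Gamma>(1) by auto
  have dc [simp]: "d \<in> carrier H" using Dc d(1) by auto
  note [simp] = fnl_closed[OF \<gamma>(1)] and ls = lins lin_fnl[OF \<gamma>(1)] lin_comp[OF q]
  \<comment> \<open>Since \<open>D E\<^sup>+ = E\<^sup>+ D\<close>, left multiplication by an
    element of \<open>E\<close> acts on the quotient through its counit.\<close>
  have q_mult: "q (t \<otimes>\<^bsub>H\<^esub> y) = \<epsilon> t \<odot>\<^bsub>H\<^esub> q y" if t: "t \<in> E" and y: "y \<in> D" for t y
  proof -
    have c: "t \<in> carrier H" "y \<in> carrier H" using t y Dc Ec by auto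
    have "(t \<ominus>\<^bsub>H\<^esub> \<epsilon> t \<odot>\<^bsub>H\<^esub> \<one>\<^bsub>H\<^esub>) \<otimes>\<^bsub>H\<^esub> y \<in> ip (aug E) D"
      by (rule ideal_prod.prod[OF augI[OF hsD(1)[OF E] hsD(2)[OF E] t] y])
    then have "q ((t \<ominus>\<^bsub>H\<^esub> \<epsilon> t \<odot>\<^bsub>H\<^esub> \<one>\<^bsub>H\<^esub>) \<otimes>\<^bsub>H\<^esub> y) = \<zero>\<^bsub>H\<^esub>"
      by (intro q0) (simp add: comm)
    moreover have "q ((t \<ominus>\<^bsub>H\<^esub> \<epsilon> t \<odot>\<^bsub>H\<^esub> \<one>\<^bsub>H\<^esub>) \<otimes>\<^bsub>H\<^esub> y) = q (t \<otimes>\<^bsub>H\<^esub> y) \<ominus>\<^bsub>H\<^esub> \<epsilon> t \<odot>\<^bsub>H\<^esub> q y"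
      using c lin_diff[of "\<lambda>z. q (z \<otimes>\<^bsub>H\<^esub> y)" t "\<epsilon> t \<odot>\<^bsub>H\<^esub> \<one>\<^bsub>H\<^esub>"]
      by (simp add: ls smult_mult_left lin_smult[OF q])
    ultimately show ?thesis using c by simp
  qed
  \<comment> \<open>The device that undoes the comultiplication: fed with \<open>\<Gamma> d1\<close>
    and \<open>d2\<close> it gives \<open>\<gamma> (\<Gamma> d1 S d2) q d3\<close>, which is
    \<open>q d\<close>.\<close>
  define b where "b u y = sw (\<lambda>y1 y2. \<gamma> (u \<otimes>\<^bsub>H\<^esub> S y1) \<odot>\<^bsub>H\<^esub> q y2) y" for u y
  have b: "bilin b" unfolding b_def using q by (simp add: ls)
  note [simp] = bilin_closed[OF b]
  note bl = lin_comp[OF bilinD1[OF b]] lin_comp[OF bilinD2[OF b]]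
  have \<Gamma>W: "\<Gamma> \<otimes>\<^bsub>H\<^esub> w = \<zero>\<^bsub>H\<^esub>" if "w \<in> ?W" for w
  proof (rule lin_ip_zero[of "\<lambda>w. \<Gamma> \<otimes>\<^bsub>H\<^esub> w" "aug E" D])
    fix x y assume "x \<in> aug E" "y \<in> D"
    then show "\<Gamma> \<otimes>\<^bsub>H\<^esub> (x \<otimes>\<^bsub>H\<^esub> y) = \<zero>\<^bsub>H\<^esub>"
      using augD[of x] Dc[of y] \<Gamma>(2)[of x] by (simp flip: H.m_assoc)
  qed (use that comm augD Dc in \<open>auto simp: lins\<close>)
  \<comment> \<open>Hence \<open>b (\<Gamma> x)\<close> factors through \<open>q\<close> on
    \<open>D\<close>. For a product \<open>a z\<close> with \<open>a\<close> in
    \<open>E\<^sup>+\<close>, the leg of \<open>a\<close> inside \<open>q\<close> becomes a counit,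
    and then \<open>a\<close> meets \<Gamma> in \<open>x S z1 S a\<close>, an element of
    \<open>D E\<^sup>+\<close>, which \<Gamma> annihilates.\<close>
  have b0: "b (\<Gamma> \<otimes>\<^bsub>H\<^esub> x) w = \<zero>\<^bsub>H\<^esub>" if x: "x \<in> D" and w: "w \<in> ?W" for x w
  proof (rule lin_ip_zero[of "b (\<Gamma> \<otimes>\<^bsub>H\<^esub> x)" "aug E" D])
    have xc [simp]: "x \<in> carrier H" using x Dc by auto
    show "lin (b (\<Gamma> \<otimes>\<^bsub>H\<^esub> x))" by (intro bilinD1[OF b]) simp
    show "w \<in> ip (aug E) D" using w comm by simp
    show "aug E \<subseteq> carrier H" "D \<subseteq> carrier H" using augD Dc by auto
    fix a z assume a: "a \<in> aug E" and z: "z \<in> D"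
    have ac [simp]: "a \<in> carrier H" and zc [simp]: "z \<in> carrier H" using augD[OF a] Dc z by auto
    have "b (\<Gamma> \<otimes>\<^bsub>H\<^esub> x) (a \<otimes>\<^bsub>H\<^esub> z) =
        sw (\<lambda>a1 a2. sw (\<lambda>z1 z2. \<gamma> (\<Gamma> \<otimes>\<^bsub>H\<^esub> x \<otimes>\<^bsub>H\<^esub> S (a1 \<otimes>\<^bsub>H\<^esub> z1)) \<odot>\<^bsub>H\<^esub> q (a2 \<otimes>\<^bsub>H\<^esub> z2)) z) a"
      unfolding b_def using q by (subst sw_mult) (simp_all add: ls)
    also have "\<dots> = sw (\<lambda>a1 a2. sw (\<lambda>z1 z2. \<epsilon> a2 \<odot>\<^bsub>H\<^esub> (\<gamma> (\<Gamma> \<otimes>\<^bsub>H\<^esub> x \<otimes>\<^bsub>H\<^esub> S (a1 \<otimes>\<^bsub>H\<^esub> z1)) \<odot>\<^bsub>H\<^esub> q z2)) z) a"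
    proof (rule sw_sub[OF E])
      fix a1 a2 assume a12: "a1 \<in> E" "a2 \<in> E"
      then have [simp]: "a1 \<in> carrier H" "a2 \<in> carrier H" using Ec by auto
      show "sw (\<lambda>z1 z2. \<gamma> (\<Gamma> \<otimes>\<^bsub>H\<^esub> x \<otimes>\<^bsub>H\<^esub> S (a1 \<otimes>\<^bsub>H\<^esub> z1)) \<odot>\<^bsub>H\<^esub> q (a2 \<otimes>\<^bsub>H\<^esub> z2)) z =
          sw (\<lambda>z1 z2. \<epsilon> a2 \<odot>\<^bsub>H\<^esub> (\<gamma> (\<Gamma> \<otimes>\<^bsub>H\<^esub> x \<otimes>\<^bsub>H\<^esub> S (a1 \<otimes>\<^bsub>H\<^esub> z1)) \<odot>\<^bsub>H\<^esub> q z2)) z"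
      proof (rule sw_sub[OF D z])
        fix z1 z2 assume "z1 \<in> D" "z2 \<in> D"
        then show "\<gamma> (\<Gamma> \<otimes>\<^bsub>H\<^esub> x \<otimes>\<^bsub>H\<^esub> S (a1 \<otimes>\<^bsub>H\<^esub> z1)) \<odot>\<^bsub>H\<^esub> q (a2 \<otimes>\<^bsub>H\<^esub> z2) =
          \<epsilon> a2 \<odot>\<^bsub>H\<^esub> (\<gamma> (\<Gamma> \<otimes>\<^bsub>H\<^esub> x \<otimes>\<^bsub>H\<^esub> S (a1 \<otimes>\<^bsub>H\<^esub> z1)) \<odot>\<^bsub>H\<^esub> q z2)"
          using a12 Dc[of z1] Dc[of z2] by (simp add: q_mult smult_assoc1[symmetric] R.m_comm)
      qed (use q in \<open>simp_all add: ls\<close>)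
    qed (use augD[OF a] q in \<open>simp_all add: ls\<close>)
    also have "\<dots> = sw (\<lambda>a1 a2. \<epsilon> a2 \<odot>\<^bsub>H\<^esub> sw (\<lambda>z1 z2. \<gamma> (\<Gamma> \<otimes>\<^bsub>H\<^esub> x \<otimes>\<^bsub>H\<^esub> S (a1 \<otimes>\<^bsub>H\<^esub> z1)) \<odot>\<^bsub>H\<^esub> q z2) z) a"
      by (simp add: sw_pull(3))
    also have "\<dots> = sw (\<lambda>z1 z2. \<gamma> (\<Gamma> \<otimes>\<^bsub>H\<^esub> x \<otimes>\<^bsub>H\<^esub> S (a \<otimes>\<^bsub>H\<^esub> z1)) \<odot>\<^bsub>H\<^esub> q z2) z"
      using q by (subst sw_counit_r) (simp_all add: ls)
    also have "\<dots> = \<zero>\<^bsub>H\<^esub>"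
    proof (rule sw_sub_zero[OF D z])
      fix z1 z2 assume z12: "z1 \<in> D" "z2 \<in> D"
      then have [simp]: "z1 \<in> carrier H" "z2 \<in> carrier H" using Dc by auto
      have "S a \<in> aug E" using augD[OF a] hsD(4)[OF E] by (simp add: augmentation_def)
      then have "(x \<otimes>\<^bsub>H\<^esub> S z1) \<otimes>\<^bsub>H\<^esub> S a \<in> ?W"
        using x z12 hsD(3,4)[OF D] by (intro ideal_prod.prod) auto
      then have "\<Gamma> \<otimes>\<^bsub>H\<^esub> x \<otimes>\<^bsub>H\<^esub> S (a \<otimes>\<^bsub>H\<^esub> z1) = \<zero>\<^bsub>H\<^esub>"
        using \<Gamma>W by (simp add: antipode_mult H.m_assoc)
      then show "\<gamma> (\<Gamma> \<otimes>\<^bsub>H\<^esub> x \<otimes>\<^bsub>H\<^esub> S (a \<otimes>\<^bsub>H\<^esub> z1)) \<odot>\<^bsub>H\<^esub> q z2 = \<zero>\<^bsub>H\<^esub>"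
        by (simp add: fnl_zero[OF \<gamma>(1)])
    qed (use q in \<open>simp add: ls\<close>)
    finally show "b (\<Gamma> \<otimes>\<^bsub>H\<^esub> x) (a \<otimes>\<^bsub>H\<^esub> z) = \<zero>\<^bsub>H\<^esub>" .
  qed
  have bq: "b (\<Gamma> \<otimes>\<^bsub>H\<^esub> x) (q y) = b (\<Gamma> \<otimes>\<^bsub>H\<^esub> x) y" if x: "x \<in> D" and y: "y \<in> D" for x y
  proof -
    have c: "x \<in> carrier H" "y \<in> carrier H" using x y Dc by auto
    have "b (\<Gamma> \<otimes>\<^bsub>H\<^esub> x) y \<ominus>\<^bsub>H\<^esub> b (\<Gamma> \<otimes>\<^bsub>H\<^esub> x) (q y) = b (\<Gamma> \<otimes>\<^bsub>H\<^esub> x) (y \<ominus>\<^bsub>H\<^esub> q y)"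
      using c by (intro lin_diff[symmetric] bilinD1[OF b]) auto
    also have "\<dots> = \<zero>\<^bsub>H\<^esub>" using c by (intro b0[OF x] qdiff)
    finally show ?thesis using c by simp
  qed
  \<comment> \<open>The vanishing of \<open>\<Gamma> d\<close> is exploited: the legs of \<Gamma>
    are reunited by \<open>q_mult\<close> and the counit, \<open>q\<close> is dropped by
    \<open>bq\<close>, and the antipode hidden in \<open>b\<close> collapses.\<close>
  have "\<zero>\<^bsub>H\<^esub> = sw (\<lambda>x y. b x (q y)) (\<Gamma> \<otimes>\<^bsub>H\<^esub> d)"
    using d(2) lin_zero[OF lin_sw_arg[of "\<lambda>x y. b x (q y)" "\<lambda>x. x"]] q by (simp add: ls bl)
  also have "\<dots> = sw (\<lambda>s t. sw (\<lambda>x y. b (s \<otimes>\<^bsub>H\<^esub> x) (q (t \<otimes>\<^bsub>H\<^esub> y))) d) \<Gamma>"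
    using q by (subst sw_mult) (simp_all add: ls bl)
  also have "\<dots> = sw (\<lambda>s t. sw (\<lambda>x y. \<epsilon> t \<odot>\<^bsub>H\<^esub> b (s \<otimes>\<^bsub>H\<^esub> x) (q y)) d) \<Gamma>"
  proof (rule sw_sub[OF E \<Gamma>(1)])
    fix s t assume st: "s \<in> E" "t \<in> E"
    then have [simp]: "s \<in> carrier H" "t \<in> carrier H" using Ec by auto
    show "sw (\<lambda>x y. b (s \<otimes>\<^bsub>H\<^esub> x) (q (t \<otimes>\<^bsub>H\<^esub> y))) d = sw (\<lambda>x y. \<epsilon> t \<odot>\<^bsub>H\<^esub> b (s \<otimes>\<^bsub>H\<^esub> x) (q y)) d"
    proof (rule sw_sub[OF D d(1)])
      fix x y assume "x \<in> D" "y \<in> D"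
      then show "b (s \<otimes>\<^bsub>H\<^esub> x) (q (t \<otimes>\<^bsub>H\<^esub> y)) = \<epsilon> t \<odot>\<^bsub>H\<^esub> b (s \<otimes>\<^bsub>H\<^esub> x) (q y)"
        using st Dc[of x] Dc[of y] by (simp add: q_mult lin_smult[OF bilinD1[OF b]])
    qed (use q in \<open>simp_all add: ls bl\<close>)
  qed (use q in \<open>simp_all add: ls bl\<close>)
  also have "\<dots> = sw (\<lambda>s t. \<epsilon> t \<odot>\<^bsub>H\<^esub> sw (\<lambda>x y. b (s \<otimes>\<^bsub>H\<^esub> x) (q y)) d) \<Gamma>"
    by (simp add: sw_pull(3))
  also have "\<dots> = sw (\<lambda>x y. b (\<Gamma> \<otimes>\<^bsub>H\<^esub> x) (q y)) d"
    using q by (subst sw_counit_r) (simp_all add: ls bl)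
  also have "\<dots> = sw (\<lambda>x y. b (\<Gamma> \<otimes>\<^bsub>H\<^esub> x) y) d"
    using q by (intro sw_sub[OF D d(1)] bq) (simp_all add: ls bl bilinD1[OF b])
  also have "\<dots> = sw (\<lambda>x r. sw (\<lambda>y1 y2. \<gamma> (\<Gamma> \<otimes>\<^bsub>H\<^esub> (x \<otimes>\<^bsub>H\<^esub> S y1)) \<odot>\<^bsub>H\<^esub> q y2) r) d"
    by (simp add: b_def H.m_assoc)
  also have "\<dots> = \<gamma> (\<Gamma> \<otimes>\<^bsub>H\<^esub> \<one>\<^bsub>H\<^esub>) \<odot>\<^bsub>H\<^esub> q d"
    using q by (intro sw_antipode_r3[of "\<lambda>z y2. \<gamma> (\<Gamma> \<otimes>\<^bsub>H\<^esub> z) \<odot>\<^bsub>H\<^esub> q y2"]) (simp_all add: ls)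
  finally have "q d = \<zero>\<^bsub>H\<^esub>" using \<gamma>(2) by simp
  then show ?thesis using qdiff[OF dc] by (simp add: a_minus_def)
qed

lemma smult_counit_eq: "x \<in> carrier H \<Longrightarrow> c \<in> carrier K \<Longrightarrow> \<epsilon> (c \<odot>\<^bsub>H\<^esub> x) = c \<otimes>\<^bsub>K\<^esub> \<epsilon> x"
  by (rule fnl_smult[OF fnl_counit])

text \<open>The functional \<open>x \<mapsto> f(x\<Lambda>)\<close>, with \<open>f\<close> an integral on \<open>P\<close> and \<open>\<Lambda>\<close> a left integral of \<open>N\<close>,
  plays the role of an integral on the quotient \<open>P / P N\<^sup>+\<close>.  Composing its slice map \<open>D \<rightarrow> E\<close> with an
  integral on \<open>E\<close> yields an integral on \<open>D\<close>, whose nondegeneracy forces \<open>\<Gamma>\<close> to annihilate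
  \<open>D \<inter> P N\<^sup>+\<close>.\<close>

theorem subalgebra_Int_normal_ideal:
  assumes fd: fin_dim and D: "hs D" and N: "hs N" and P: "hs P" and DP: "D \<subseteq> P" and NP: "N \<subseteq> P"
    and norm: "normalizes P N" and gen: "P \<subseteq> ip D N"
    and d: "d \<in> D" "d \<in> ip P (aug N)"
  shows "d \<in> ip D (aug (D \<inter> N))"
proof -
  let ?E = "D \<inter> N"
  have E: "hs ?E" by (rule hs_Int[OF fd D N])
  note Dc = hsD(5)[OF D] and Nc = hsD(5)[OF N] and Pc = hsD(5)[OF P] and Ec = hsD(5)[OF E]
  obtain f where f: "left_integral_on P f" "\<exists>a\<in>P. f a \<noteq> \<zero>\<^bsub>K\<^esub>"
    using nonzero_left_integral[OF fd P] .
  have ff: "fnl f" using f by (simp add: left_integral_on_def)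
  obtain \<Lambda> g where \<Lambda>: "\<Lambda> \<in> N" "\<And>a. a \<in> N \<Longrightarrow> a \<otimes>\<^bsub>H\<^esub> \<Lambda> = \<epsilon> a \<odot>\<^bsub>H\<^esub> \<Lambda>"
    and g: "fnl g" "sw (\<lambda>x y. g x \<odot>\<^bsub>H\<^esub> y) \<Lambda> = \<one>\<^bsub>H\<^esub>"
    by (rule left_integral_element[OF fd N]) blast
  have \<Lambda>c [simp]: "\<Lambda> \<in> carrier H" using \<Lambda>(1) Nc by auto
  define l where "l x = f (x \<otimes>\<^bsub>H\<^esub> \<Lambda>)" for x
  have l: "fnl l" unfolding l_def by (rule fnl_mult_r[OF ff]) simp
  note [simp] = fnl_closed[OF l] fnl_closed[OF ff]
  note ls = lins lin_fnl[OF l] lin_fnl[OF ff]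
  \<comment> \<open>Moved across \<open>h\<close> by the right adjoint action, \<open>n\<close>
    stays in \<open>N\<close>, meets \<Lambda> and becomes a scalar. Together with
    \<open>l_mult'\<close> this makes \<open>l\<close> see \<open>N\<close> only through the counit,
    from either side.\<close>
  have l_mult: "l (n \<otimes>\<^bsub>H\<^esub> h) = \<epsilon> n \<otimes>\<^bsub>K\<^esub> l h" if n: "n \<in> N" and h: "h \<in> P" for n h
  proof -
    have [simp]: "n \<in> carrier H" "h \<in> carrier H" using n h Nc Pc by auto
    have "n \<otimes>\<^bsub>H\<^esub> h \<otimes>\<^bsub>H\<^esub> \<Lambda> = sw (\<lambda>x y. x \<otimes>\<^bsub>H\<^esub> (adr y n \<otimes>\<^bsub>H\<^esub> \<Lambda>)) h"
      using mult_eq_sw_adr[of h n] by (simp add: sw_pull H.m_assoc)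
    also have "\<dots> = sw (\<lambda>x y. \<epsilon> y \<odot>\<^bsub>H\<^esub> (\<epsilon> n \<odot>\<^bsub>H\<^esub> (x \<otimes>\<^bsub>H\<^esub> \<Lambda>))) h"
    proof (rule sw_sub[OF P h])
      fix x y assume xy: "x \<in> P" "y \<in> P"
      then have [simp]: "x \<in> carrier H" "y \<in> carrier H" using Pc by auto
      have "adr y n \<in> N" using norm xy n by (simp add: normalizes_def)
      then show "x \<otimes>\<^bsub>H\<^esub> (adr y n \<otimes>\<^bsub>H\<^esub> \<Lambda>) = \<epsilon> y \<odot>\<^bsub>H\<^esub> (\<epsilon> n \<odot>\<^bsub>H\<^esub> (x \<otimes>\<^bsub>H\<^esub> \<Lambda>))"
        by (simp add: \<Lambda>(2) counit_adr smult_mult_right smult_assoc1)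
    qed (simp_all add: ls lin_ad)
    also have "\<dots> = \<epsilon> n \<odot>\<^bsub>H\<^esub> (h \<otimes>\<^bsub>H\<^esub> \<Lambda>)"
      by (subst sw_counit_r) (simp_all add: ls)
    finally show ?thesis by (simp add: l_def fnl_smult[OF ff])
  qed
  have l_mult': "l (h \<otimes>\<^bsub>H\<^esub> n) = \<epsilon> n \<otimes>\<^bsub>K\<^esub> l h" if n: "n \<in> N" and h: "h \<in> carrier H" for n h
    using Nc[OF n] h \<Lambda>(2)[OF n] by (simp add: l_def H.m_assoc smult_mult_right fnl_smult[OF ff])
  have l_ideal: "l z = \<zero>\<^bsub>K\<^esub>" if "z \<in> ip P (aug N)" for z
  proof (rule smult_eq_zero_iff)
    have z: "z \<in> carrier H"
      using that ip_smod[OF hsD(1)[OF P] smod_aug[OF hsD(1)[OF N]]] smodD(1) by blast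
    then show "l z \<in> carrier K" by simp
    show "l z \<odot>\<^bsub>H\<^esub> \<one>\<^bsub>H\<^esub> = \<zero>\<^bsub>H\<^esub>"
    proof (rule lin_ip_zero[OF fnl_lin1[OF l] _ _ that])
      fix x y assume "x \<in> P" "y \<in> aug N"
      then show "l (x \<otimes>\<^bsub>H\<^esub> y) \<odot>\<^bsub>H\<^esub> \<one>\<^bsub>H\<^esub> = \<zero>\<^bsub>H\<^esub>"
        using l_mult'[of y x] Pc[of x] by (simp add: augmentation_def)
    qed (use Pc Nc aug_subset in auto)
  qed
  define p where "p x = sw (\<lambda>u v. l v \<odot>\<^bsub>H\<^esub> u) x" for x
  have p: "lin p" unfolding p_def by (simp add: ls)
  have pc [simp]: "p x \<in> carrier H" if "x \<in> carrier H" for x using lin_closed[OF p that] .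
  have pD: "p x \<in> D" if "x \<in> D" for x
    unfolding p_def
    by (rule sw_sub_in[OF D that _ hsD(1)[OF D]]) (simp_all add: ls smodD(4)[OF hsD(1)[OF D]] Dc)
  \<comment> \<open>The integral property of \<open>l\<close>, up to a right factor \<Lambda>. A
    counit inserted on the first leg of \<Lambda> is exchanged for multiplication by that leg,
    because \<Lambda> is a left integral; this assembles \<open>\<Delta> (w \<Lambda>)\<close>, on
    which \<open>f\<close> acts as an integral.\<close>
  have int\<Lambda>: "sw (\<lambda>v y. l y \<odot>\<^bsub>H\<^esub> \<beta> (v \<otimes>\<^bsub>H\<^esub> \<Lambda>)) w = l w \<odot>\<^bsub>H\<^esub> \<beta> \<Lambda>"
    if w: "w \<in> P" and \<beta>: "lin \<beta>" for w \<beta>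
  proof -
    have wc [simp]: "w \<in> carrier H" using w Pc by auto
    note [simp] = lin_closed[OF \<beta>]
    have "sw (\<lambda>v y. l y \<odot>\<^bsub>H\<^esub> \<beta> (v \<otimes>\<^bsub>H\<^esub> \<Lambda>)) w =
        sw (\<lambda>v y. sw (\<lambda>s t. \<epsilon> s \<odot>\<^bsub>H\<^esub> (f (y \<otimes>\<^bsub>H\<^esub> t) \<odot>\<^bsub>H\<^esub> \<beta> (v \<otimes>\<^bsub>H\<^esub> \<Lambda>))) \<Lambda>) w"
      by (simp add: sw_counit_l ls l_def)
    also have "\<dots> = sw (\<lambda>v y. sw (\<lambda>s t. f (y \<otimes>\<^bsub>H\<^esub> t) \<odot>\<^bsub>H\<^esub> \<beta> (v \<otimes>\<^bsub>H\<^esub> s \<otimes>\<^bsub>H\<^esub> \<Lambda>)) \<Lambda>) w"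
    proof (rule sw_cong[OF refl], rule sw_sub[OF N \<Lambda>(1)])
      fix v y s t assume [simp]: "v \<in> carrier H" "y \<in> carrier H" and st: "s \<in> N" "t \<in> N"
      have [simp]: "s \<in> carrier H" "t \<in> carrier H" using st Nc by auto
      have "\<beta> (v \<otimes>\<^bsub>H\<^esub> s \<otimes>\<^bsub>H\<^esub> \<Lambda>) = \<epsilon> s \<odot>\<^bsub>H\<^esub> \<beta> (v \<otimes>\<^bsub>H\<^esub> \<Lambda>)"
        using \<Lambda>(2)[OF st(1)] by (simp add: H.m_assoc smult_mult_right lin_smult[OF \<beta>])
      then show "\<epsilon> s \<odot>\<^bsub>H\<^esub> (f (y \<otimes>\<^bsub>H\<^esub> t) \<odot>\<^bsub>H\<^esub> \<beta> (v \<otimes>\<^bsub>H\<^esub> \<Lambda>)) = f (y \<otimes>\<^bsub>H\<^esub> t) \<odot>\<^bsub>H\<^esub> \<beta> (v \<otimes>\<^bsub>H\<^esub> s \<otimes>\<^bsub>H\<^esub> \<Lambda>)"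
        by (simp add: smult_assoc1[symmetric] R.m_comm)
    qed (simp_all add: ls lin_comp[OF \<beta>])
    also have "\<dots> = sw (\<lambda>v y. f y \<odot>\<^bsub>H\<^esub> \<beta> (v \<otimes>\<^bsub>H\<^esub> \<Lambda>)) (w \<otimes>\<^bsub>H\<^esub> \<Lambda>)"
      by (simp add: sw_mult ls lin_comp[OF \<beta>])
    also have "\<dots> = f (w \<otimes>\<^bsub>H\<^esub> \<Lambda>) \<odot>\<^bsub>H\<^esub> \<beta> (\<one>\<^bsub>H\<^esub> \<otimes>\<^bsub>H\<^esub> \<Lambda>)"
      using hsD(3)[OF P w, of \<Lambda>] NP \<Lambda>(1)
      by (intro sw_left_integral[OF f(1)]) (auto simp: ls lin_comp[OF \<beta>])
    finally show ?thesis by (simp add: l_def)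
  qed
  \<comment> \<open>Coassociativity moves \<open>l\<close> to the third leg, and
    \<open>int\<Lambda>\<close> then delivers the coinvariance that places \<open>p x\<close> in
    \<open>N\<close>.\<close>
  have pN: "p x \<in> N" if x: "x \<in> D" for x
  proof (rule coinvariant_in_subalgebra[OF N \<Lambda>(1) g])
    have xc [simp]: "x \<in> carrier H" using x Dc by auto
    show "p x \<in> carrier H" by simp
    fix \<beta> assume \<beta>: "bilin \<beta>"
    note [simp] = bilin_closed[OF \<beta>] and \<beta>l = lin_comp[OF bilinD1[OF \<beta>]] lin_comp[OF bilinD2[OF \<beta>]]
      bilinD1[OF \<beta>] bilinD2[OF \<beta>]
    let ?B = "\<lambda>z. sw (\<lambda>u v. \<beta> u (v \<otimes>\<^bsub>H\<^esub> \<Lambda>)) z"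
    have B: "lin ?B" by (simp add: ls \<beta>l)
    have "?B (p x) = sw (\<lambda>z y. ?B (l y \<odot>\<^bsub>H\<^esub> z)) x"
      unfolding p_def by (rule lin_sw[OF B]) simp
    also have "\<dots> = sw (\<lambda>z y. sw (\<lambda>u v. l y \<odot>\<^bsub>H\<^esub> \<beta> u (v \<otimes>\<^bsub>H\<^esub> \<Lambda>)) z) x"
      by (rule sw_cong[OF refl]) (simp add: lin_smult[OF B] sw_pull(3))
    also have "\<dots> = sw (\<lambda>u w. sw (\<lambda>v y. l y \<odot>\<^bsub>H\<^esub> \<beta> u (v \<otimes>\<^bsub>H\<^esub> \<Lambda>)) w) x"
      by (intro sw_assoc) (simp_all add: ls \<beta>l)
    also have "\<dots> = sw (\<lambda>u w. l w \<odot>\<^bsub>H\<^esub> \<beta> u \<Lambda>) x"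
    proof (rule sw_sub[OF D x])
      fix u w assume "u \<in> D" "w \<in> D"
      then show "sw (\<lambda>v y. l y \<odot>\<^bsub>H\<^esub> \<beta> u (v \<otimes>\<^bsub>H\<^esub> \<Lambda>)) w = l w \<odot>\<^bsub>H\<^esub> \<beta> u \<Lambda>"
        using DP Dc[of u] by (intro int\<Lambda> bilinD1[OF \<beta>]) auto
    qed (simp_all add: ls \<beta>l)
    also have "\<dots> = \<beta> (p x) \<Lambda>"
      unfolding p_def by (subst lin_sw[OF bilinD2[OF \<beta> \<Lambda>c]]) (simp_all add: lin_smult[OF bilinD2[OF \<beta> \<Lambda>c]])
    finally show "?B (p x) = \<beta> (p x) \<Lambda>" .
  qed
  have pE: "p x \<in> ?E" if "x \<in> D" for x using pD pN that by auto
  \<comment> \<open>Linearity over \<open>E\<close>: the leg of \<open>e\<close> that falls under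
    \<open>l\<close> turns into a counit by \<open>l_mult\<close>.\<close>
  have p_mult: "p (e \<otimes>\<^bsub>H\<^esub> x) = e \<otimes>\<^bsub>H\<^esub> p x" if e: "e \<in> ?E" and x: "x \<in> D" for e x
  proof -
    have [simp]: "e \<in> carrier H" "x \<in> carrier H" using e x Ec Dc by auto
    have "p (e \<otimes>\<^bsub>H\<^esub> x) = sw (\<lambda>e1 e2. sw (\<lambda>x1 x2. l (e2 \<otimes>\<^bsub>H\<^esub> x2) \<odot>\<^bsub>H\<^esub> (e1 \<otimes>\<^bsub>H\<^esub> x1)) x) e"
      unfolding p_def by (simp add: sw_mult ls)
    also have "\<dots> = sw (\<lambda>e1 e2. sw (\<lambda>x1 x2. \<epsilon> e2 \<odot>\<^bsub>H\<^esub> (l x2 \<odot>\<^bsub>H\<^esub> (e1 \<otimes>\<^bsub>H\<^esub> x1))) x) e"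
    proof (rule sw_sub[OF E e])
      fix e1 e2 assume e12: "e1 \<in> ?E" "e2 \<in> ?E"
      then have [simp]: "e1 \<in> carrier H" "e2 \<in> carrier H" using Ec by auto
      show "sw (\<lambda>x1 x2. l (e2 \<otimes>\<^bsub>H\<^esub> x2) \<odot>\<^bsub>H\<^esub> (e1 \<otimes>\<^bsub>H\<^esub> x1)) x =
          sw (\<lambda>x1 x2. \<epsilon> e2 \<odot>\<^bsub>H\<^esub> (l x2 \<odot>\<^bsub>H\<^esub> (e1 \<otimes>\<^bsub>H\<^esub> x1))) x"
      proof (rule sw_sub[OF D x])
        fix x1 x2 assume "x1 \<in> D" "x2 \<in> D"
        then show "l (e2 \<otimes>\<^bsub>H\<^esub> x2) \<odot>\<^bsub>H\<^esub> (e1 \<otimes>\<^bsub>H\<^esub> x1) = \<epsilon> e2 \<odot>\<^bsub>H\<^esub> (l x2 \<odot>\<^bsub>H\<^esub> (e1 \<otimes>\<^bsub>H\<^esub> x1))"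
          using e12 l_mult[of e2 x2] DP Dc[of x1] Dc[of x2] by (simp add: smult_assoc1 subset_iff)
      qed (simp_all add: ls)
    qed (simp_all add: ls)
    also have "\<dots> = sw (\<lambda>e1 e2. \<epsilon> e2 \<odot>\<^bsub>H\<^esub> (e1 \<otimes>\<^bsub>H\<^esub> p x)) e"
      by (simp add: sw_pull p_def smult_mult_right)
    also have "\<dots> = e \<otimes>\<^bsub>H\<^esub> p x" by (subst sw_counit_r) (simp_all add: ls)
    finally show ?thesis .
  qed
  have counit_p: "\<epsilon> (p x) = l x" if x: "x \<in> carrier H" for x
  proof (rule smult_one_inject)
    have "\<epsilon> (p x) \<odot>\<^bsub>H\<^esub> \<one>\<^bsub>H\<^esub> = sw (\<lambda>u v. \<epsilon> (l v \<odot>\<^bsub>H\<^esub> u) \<odot>\<^bsub>H\<^esub> \<one>\<^bsub>H\<^esub>) x"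
      unfolding p_def by (rule counit_sw) (simp add: ls)
    also have "\<dots> = sw (\<lambda>u v. \<epsilon> u \<odot>\<^bsub>H\<^esub> (l v \<odot>\<^bsub>H\<^esub> \<one>\<^bsub>H\<^esub>)) x"
      by (rule sw_cong[OF refl]) (simp add: smult_counit_eq smult_assoc1[symmetric] R.m_comm)
    also have "\<dots> = l x \<odot>\<^bsub>H\<^esub> \<one>\<^bsub>H\<^esub>"
      using x by (subst sw_counit_l) (simp_all add: ls)
    finally show "\<epsilon> (p x) \<odot>\<^bsub>H\<^esub> \<one>\<^bsub>H\<^esub> = l x \<odot>\<^bsub>H\<^esub> \<one>\<^bsub>H\<^esub>" .
  qed (use x in auto)
  \<comment> \<open>Here \<open>P \<subseteq> ip D N\<close> enters: vanishing on \<open>D\<close>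
    would spread to \<open>P\<close> by \<open>l_mult'\<close>, and nondegeneracy of
    \<open>f\<close> would give \<open>\<Lambda> = 0\<close>, although \<Lambda> has the unit as a
    slice.\<close>
  have "\<exists>x\<in>D. l x \<noteq> \<zero>\<^bsub>K\<^esub>"
  proof (rule ccontr)
    assume "\<not> ?thesis"
    then have l0: "l x = \<zero>\<^bsub>K\<^esub>" if "x \<in> D" for x using that by auto
    have "\<Lambda> = \<zero>\<^bsub>H\<^esub>"
    proof (rule left_integral_nondegenerate_l[OF fd P f])
      show "\<Lambda> \<in> P" using \<Lambda>(1) NP by auto
      fix x assume "x \<in> P"
      then have x: "x \<in> ip D N" "x \<in> carrier H" using gen Pc by auto
      have "l x \<odot>\<^bsub>H\<^esub> \<one>\<^bsub>H\<^esub> = \<zero>\<^bsub>H\<^esub>"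
      proof (rule lin_ip_zero[OF fnl_lin1[OF l] _ _ x(1)])
        fix u v assume "u \<in> D" "v \<in> N"
        then show "l (u \<otimes>\<^bsub>H\<^esub> v) \<odot>\<^bsub>H\<^esub> \<one>\<^bsub>H\<^esub> = \<zero>\<^bsub>H\<^esub>"
          using l_mult'[of v u] Dc[of u] Nc[of v] l0[of u] by simp
      qed (use Dc Nc in auto)
      then show "f (x \<otimes>\<^bsub>H\<^esub> \<Lambda>) = \<zero>\<^bsub>K\<^esub>"
        using x(2) smult_eq_zero_iff[of "l x"] by (simp add: l_def)
    qed
    then have "\<one>\<^bsub>H\<^esub> = \<zero>\<^bsub>H\<^esub>"
      using g(2) lin_zero[OF lin_sw_arg[OF _ lin_id], of "\<lambda>x y. g x \<odot>\<^bsub>H\<^esub> y"]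
      by (simp add: lins lin_fnl[OF g(1)] fnl_closed[OF g(1)])
    then have "\<one>\<^bsub>K\<^esub> = \<zero>\<^bsub>K\<^esub>" using counit_one fnl_zero[OF fnl_counit] by simp
    then show False by simp
  qed
  then obtain x0 where x0: "x0 \<in> D" "l x0 \<noteq> \<zero>\<^bsub>K\<^esub>" by auto
  have x0c [simp]: "x0 \<in> carrier H" using x0 Dc by auto
  obtain k where k: "left_integral_on ?E k" "\<exists>a\<in>?E. k a \<noteq> \<zero>\<^bsub>K\<^esub>"
    using nonzero_left_integral[OF fd E] .
  have kf: "fnl k" using k by (simp add: left_integral_on_def)
  note [simp] = fnl_closed[OF kf] and kl = lin_fnl[OF kf]
  let ?\<psi> = "\<lambda>x. k (p x)"
  have \<psi>f: "fnl ?\<psi>" by (rule fnl_lin[OF kf p])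
  have \<psi>: "left_integral_on D ?\<psi>"
    unfolding left_integral_on_def
  proof (intro conjI ballI \<psi>f)
    fix x assume x: "x \<in> D"
    have xc [simp]: "x \<in> carrier H" using x Dc by auto
    let ?\<Theta> = "\<lambda>z. sw (\<lambda>x a. k a \<odot>\<^bsub>H\<^esub> x) z"
    have \<Theta>: "lin ?\<Theta>" by (simp add: ls kl)
    have "sw (\<lambda>x y. k (p y) \<odot>\<^bsub>H\<^esub> x) x = sw (\<lambda>x y. sw (\<lambda>a b. l b \<odot>\<^bsub>H\<^esub> (k a \<odot>\<^bsub>H\<^esub> x)) y) x"
    proof (rule sw_cong[OF refl])
      fix x y assume [simp]: "x \<in> carrier H" "y \<in> carrier H"
      have "k (p y) \<odot>\<^bsub>H\<^esub> x = sw (\<lambda>a b. k (l b \<odot>\<^bsub>H\<^esub> a) \<odot>\<^bsub>H\<^esub> x) y"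
        unfolding p_def by (rule lin_sw[OF lin_fnl[OF kf lin_id]]) simp_all
      then show "k (p y) \<odot>\<^bsub>H\<^esub> x = sw (\<lambda>a b. l b \<odot>\<^bsub>H\<^esub> (k a \<odot>\<^bsub>H\<^esub> x)) y"
        by (simp add: fnl_smult[OF kf] smult_assoc1)
    qed
    also have "\<dots> = sw (\<lambda>d b. sw (\<lambda>x a. l b \<odot>\<^bsub>H\<^esub> (k a \<odot>\<^bsub>H\<^esub> x)) d) x"
      by (intro sw_assoc[symmetric]) (simp_all add: ls kl)
    also have "\<dots> = sw (\<lambda>d b. ?\<Theta> (l b \<odot>\<^bsub>H\<^esub> d)) x"
      by (rule sw_cong[OF refl]) (simp add: lin_smult[OF \<Theta>] sw_pull(3))
    also have "\<dots> = ?\<Theta> (p x)"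
      unfolding p_def by (rule lin_sw[OF \<Theta>, symmetric]) simp
    also have "\<dots> = k (p x) \<odot>\<^bsub>H\<^esub> \<one>\<^bsub>H\<^esub>"
      using k(1) pE[OF x] by (simp add: left_integral_on_def)
    finally show "sw (\<lambda>x y. k (p y) \<odot>\<^bsub>H\<^esub> x) x = k (p x) \<odot>\<^bsub>H\<^esub> \<one>\<^bsub>H\<^esub>" .
  qed
  \<comment> \<open>A nonzero vector of \<open>E\<close> is detected by \<open>k\<close> after
    multiplication by some \<open>e\<close>; linearity over \<open>E\<close> moves \<open>e\<close>
    inside \<open>p\<close>, so the composite functional is nonzero on \<open>D\<close>.\<close>
  have "p x0 \<noteq> \<zero>\<^bsub>H\<^esub>" using x0 counit_p[OF x0c] fnl_zero[OF fnl_counit] by auto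
  then obtain e where e: "e \<in> ?E" "k (e \<otimes>\<^bsub>H\<^esub> p x0) \<noteq> \<zero>\<^bsub>K\<^esub>"
    using left_integral_nondegenerate_l[OF fd E k pE[OF x0(1)]] by blast
  have \<psi>0: "\<exists>a\<in>D. ?\<psi> a \<noteq> \<zero>\<^bsub>K\<^esub>"
    using e p_mult[OF e(1) x0(1)] hsD(3)[OF D, of e x0] x0(1) by (intro bexI[of _ "e \<otimes>\<^bsub>H\<^esub> x0"]) auto
  obtain \<Gamma> where \<Gamma>: "\<Gamma> \<in> ?E" "\<And>a. a \<in> ?E \<Longrightarrow> \<Gamma> \<otimes>\<^bsub>H\<^esub> a = \<epsilon> a \<odot>\<^bsub>H\<^esub> \<Gamma>" "k \<Gamma> = \<one>\<^bsub>K\<^esub>"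
    by (rule right_integral_element[OF fd E k]) blast
  have \<Gamma>c [simp]: "\<Gamma> \<in> carrier H" using \<Gamma>(1) Ec by auto
  have dc [simp]: "d \<in> carrier H" using d(1) Dc by auto
  \<comment> \<open>The ideal \<open>P N\<^sup>+\<close> equals \<open>N\<^sup>+ P\<close> and is
    therefore stable under right multiplication, as the nondegeneracy test below requires.\<close>
  have idl: "d \<otimes>\<^bsub>H\<^esub> x \<in> ip P (aug N)" if x: "x \<in> D" for x
  proof -
    have xc [simp]: "x \<in> carrier H" and xP: "x \<in> P" using x Dc DP by auto
    have aug: "smod (aug N)" by (rule smod_aug[OF hsD(1)[OF N]])
    have comm: "ip P (aug N) = ip (aug N) P" by (rule ip_commute[OF P aug normalizes_aug[OF P N norm]])
    have J: "smod (ip P (aug N))" by (rule ip_smod[OF hsD(1)[OF P] aug])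
    have "ip (aug N) P \<subseteq> {z \<in> carrier H. z \<otimes>\<^bsub>H\<^esub> x \<in> ip P (aug N)}"
    proof (rule ip_least[OF smod_preimage[OF _ J]])
      show "lin (\<lambda>z. z \<otimes>\<^bsub>H\<^esub> x)" by (simp add: lins)
      fix a y assume ay: "a \<in> aug N" "y \<in> P"
      then have [simp]: "a \<in> carrier H" "y \<in> carrier H" using Pc Nc aug_subset by auto
      have "a \<otimes>\<^bsub>H\<^esub> (y \<otimes>\<^bsub>H\<^esub> x) \<in> ip (aug N) P" using ay xP by (intro ideal_prod.prod hsD(3)[OF P])
      then show "a \<otimes>\<^bsub>H\<^esub> y \<in> {z \<in> carrier H. z \<otimes>\<^bsub>H\<^esub> x \<in> ip P (aug N)}"
        using comm by (simp add: H.m_assoc)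
    qed
    then show ?thesis using d(2) comm by auto
  qed
  have "\<Gamma> \<otimes>\<^bsub>H\<^esub> d = \<zero>\<^bsub>H\<^esub>"
  proof (rule left_integral_nondegenerate_r[OF fd D \<psi> \<psi>0])
    show "\<Gamma> \<otimes>\<^bsub>H\<^esub> d \<in> D" using \<Gamma>(1) d(1) hsD(3)[OF D] by auto
    fix x assume x: "x \<in> D"
    then have xc [simp]: "x \<in> carrier H" using Dc by auto
    have dx: "d \<otimes>\<^bsub>H\<^esub> x \<in> D" using d(1) x hsD(3)[OF D] by auto
    \<comment> \<open>\<Gamma> absorbs \<open>p (d x)\<close>, an element of \<open>E\<close>, and
      leaves its counit, which is \<open>l (d x)\<close> and vanishes on the ideal.\<close>
    have "k (p (\<Gamma> \<otimes>\<^bsub>H\<^esub> (d \<otimes>\<^bsub>H\<^esub> x))) = k (\<epsilon> (p (d \<otimes>\<^bsub>H\<^esub> x)) \<odot>\<^bsub>H\<^esub> \<Gamma>)"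
      using p_mult[OF \<Gamma>(1) dx] \<Gamma>(2)[OF pE[OF dx]] by simp
    also have "\<dots> = \<zero>\<^bsub>K\<^esub>"
      using counit_p[of "d \<otimes>\<^bsub>H\<^esub> x"] l_ideal[OF idl[OF x]] by (simp add: fnl_zero[OF kf])
    finally show "k (p (\<Gamma> \<otimes>\<^bsub>H\<^esub> d \<otimes>\<^bsub>H\<^esub> x)) = \<zero>\<^bsub>K\<^esub>" by (simp add: H.m_assoc)
  qed
  moreover have "normalizes D ?E"
    using normalizes_Int[OF normalizes_self[OF D] normalizes_mono[OF norm DP]] .
  ultimately show ?thesis
    by (intro annihilator_right_integral[OF fd D E _ _ \<Gamma>(1,2) kf \<Gamma>(3) d(1)]) auto
qed

subsection \<open>Products of Hopf subalgebras\<close>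

lemma ip_mono: "X \<subseteq> X' \<Longrightarrow> Y \<subseteq> Y' \<Longrightarrow> ip X Y \<subseteq> ip X' Y'"
proof
  fix z assume s: "X \<subseteq> X'" "Y \<subseteq> Y'" and "z \<in> ip X Y"
  from this(3) show "z \<in> ip X' Y'" using s by induction (auto intro: ideal_prod.intros)
qed

lemma ip_left:
  assumes "X \<subseteq> carrier H" "\<one>\<^bsub>H\<^esub> \<in> Y"
  shows "X \<subseteq> ip X Y"
proof
  fix x assume x: "x \<in> X"
  then have "x \<in> carrier H" using assms(1) by auto
  then show "x \<in> ip X Y" using ideal_prod.prod[OF x assms(2), of H] by simp
qed

lemma ip_right:
  assumes "Y \<subseteq> carrier H" "\<one>\<^bsub>H\<^esub> \<in> X"
  shows "Y \<subseteq> ip X Y"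
proof
  fix y assume y: "y \<in> Y"
  then have "y \<in> carrier H" using assms(1) by auto
  then show "y \<in> ip X Y" using ideal_prod.prod[OF assms(2) y, of H] by simp
qed

lemma lin_ip_in:
  assumes "lin f" "smod W" "X \<subseteq> carrier H" "Y \<subseteq> carrier H" "z \<in> ip X Y"
    and "\<And>x y. x \<in> X \<Longrightarrow> y \<in> Y \<Longrightarrow> f (x \<otimes>\<^bsub>H\<^esub> y) \<in> W"
  shows "f z \<in> W"
proof -
  have "ip X Y \<subseteq> {x \<in> carrier H. f x \<in> W}"
    using assms by (intro ip_least smod_preimage) auto
  then show ?thesis using assms(5) by auto
qed

text \<open>The relation \<open>C N = N C\<close> lets factors be reordered, which gives closure
  under products and, as \<open>S\<close> reverses factors, under the antipode. The comultiplication
  is found through the slices of \<open>\<Delta> (n c)\<close>.\<close>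

lemma hs_ip:
  assumes fd: fin_dim and N: "hs N" and C: "hs C" and norm: "normalizes C N"
  shows "hs (ip N C)"
  unfolding hopf_subalgebra_iff
proof (intro conjI ballI)
  note Nc = hsD(5)[OF N] and Cc = hsD(5)[OF C]
  have sub: "N \<subseteq> carrier H" "C \<subseteq> carrier H" using Nc Cc by auto
  show W: "smod (ip N C)" by (rule ip_smod[OF hsD(1)[OF N] hsD(1)[OF C]])
  note Wc = smodD(1)[OF W, THEN subsetD]
  have comm: "ip C N = ip N C" by (rule ip_commute[OF C hsD(1)[OF N] norm])
  show "\<one>\<^bsub>H\<^esub> \<in> ip N C" using ip_left[OF sub(1) hsD(2)[OF C]] hsD(2)[OF N] by auto
  have Wr: "z \<otimes>\<^bsub>H\<^esub> c \<in> ip N C" if z: "z \<in> ip N C" and c: "c \<in> C" for z c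
  proof (rule lin_ip_in[of "\<lambda>z. z \<otimes>\<^bsub>H\<^esub> c", OF _ W sub z])
    show "lin (\<lambda>z. z \<otimes>\<^bsub>H\<^esub> c)" using Cc[OF c] by (simp add: lins)
    show "x \<otimes>\<^bsub>H\<^esub> y \<otimes>\<^bsub>H\<^esub> c \<in> ip N C" if "x \<in> N" "y \<in> C" for x y
      using that c Nc Cc ideal_prod.prod[OF that(1) hsD(3)[OF C that(2) c], of H] by (simp add: H.m_assoc)
  qed
  have Wl: "n \<otimes>\<^bsub>H\<^esub> z \<in> ip N C" if z: "z \<in> ip N C" and n: "n \<in> N" for z n
  proof (rule lin_ip_in[of "\<lambda>z. n \<otimes>\<^bsub>H\<^esub> z", OF _ W sub z])
    show "lin (\<lambda>z. n \<otimes>\<^bsub>H\<^esub> z)" using Nc[OF n] by (simp add: lins)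
    show "n \<otimes>\<^bsub>H\<^esub> (x \<otimes>\<^bsub>H\<^esub> y) \<in> ip N C" if "x \<in> N" "y \<in> C" for x y
      using that n Nc Cc ideal_prod.prod[OF hsD(3)[OF N n that(1)] that(2), of H] by (simp flip: H.m_assoc)
  qed
  show "z \<otimes>\<^bsub>H\<^esub> w \<in> ip N C" if z: "z \<in> ip N C" and w: "w \<in> ip N C" for z w
  proof (rule lin_ip_in[of "\<lambda>z. z \<otimes>\<^bsub>H\<^esub> w", OF _ W sub z])
    show "lin (\<lambda>z. z \<otimes>\<^bsub>H\<^esub> w)" using Wc[OF w] by (simp add: lins)
    fix n c assume n: "n \<in> N" and c: "c \<in> C"
    have cw: "c \<otimes>\<^bsub>H\<^esub> w \<in> ip N C"
    proof (rule lin_ip_in[of "\<lambda>w. c \<otimes>\<^bsub>H\<^esub> w", OF _ W sub w])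
      show "lin (\<lambda>w. c \<otimes>\<^bsub>H\<^esub> w)" using Cc[OF c] by (simp add: lins)
      fix n' c' assume n': "n' \<in> N" and c': "c' \<in> C"
      have "c \<otimes>\<^bsub>H\<^esub> n' \<in> ip N C" using ideal_prod.prod[OF c n', of H] comm by simp
      then have "c \<otimes>\<^bsub>H\<^esub> n' \<otimes>\<^bsub>H\<^esub> c' \<in> ip N C" by (rule Wr[OF _ c'])
      then show "c \<otimes>\<^bsub>H\<^esub> (n' \<otimes>\<^bsub>H\<^esub> c') \<in> ip N C"
        using Nc[OF n'] Cc[OF c] Cc[OF c'] by (simp add: H.m_assoc)
    qed
    then show "n \<otimes>\<^bsub>H\<^esub> c \<otimes>\<^bsub>H\<^esub> w \<in> ip N C"
      using Wl[OF cw n] Nc[OF n] Cc[OF c] Wc[OF w] by (simp add: H.m_assoc)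
  qed
  show "S z \<in> ip N C" if z: "z \<in> ip N C" for z
  proof (rule lin_ip_in[of S, OF _ W sub z])
    show "lin S" using lin_antipode[OF lin_id] by simp
    show "S (x \<otimes>\<^bsub>H\<^esub> y) \<in> ip N C" if "x \<in> N" "y \<in> C" for x y
      using that Nc Cc ideal_prod.prod[OF hsD(4)[OF C that(2)] hsD(4)[OF N that(1)], of H] comm
      by (simp add: antipode_mult)
  qed
  fix z assume z: "z \<in> ip N C"
  show "\<exists>xs. set xs \<subseteq> ip N C \<times> ip N C \<and> \<Delta> z = pair_sum HH.T HH.pt xs"
  proof (rule legs_in_subspace[OF fd W Wc[OF z]])
    fix f assume f: "fnl f"
    note [simp] = fnl_closed[OF f] and ls = lins lin_fnl[OF f] lin_smult_fun[OF fnl_closed[OF f] lin_id]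
    have el: "c \<odot>\<^bsub>H\<^esub> (x \<otimes>\<^bsub>H\<^esub> y) \<in> ip N C" if "x \<in> N" "y \<in> C" "c \<in> carrier K" for c x y
      using that by (intro smodD(4)[OF W] ideal_prod.prod)
    show "sw (\<lambda>x y. f x \<odot>\<^bsub>H\<^esub> y) z \<in> ip N C"
    proof (rule lin_ip_in[OF _ W sub z])
      show "lin (\<lambda>z. sw (\<lambda>x y. f x \<odot>\<^bsub>H\<^esub> y) z)" by (simp add: ls)
      fix n c assume n: "n \<in> N" and c: "c \<in> C"
      have [simp]: "n \<in> carrier H" "c \<in> carrier H" using n c Nc Cc by auto
      have "sw (\<lambda>x y. f x \<odot>\<^bsub>H\<^esub> y) (n \<otimes>\<^bsub>H\<^esub> c) =
          sw (\<lambda>n1 n2. sw (\<lambda>c1 c2. f (n1 \<otimes>\<^bsub>H\<^esub> c1) \<odot>\<^bsub>H\<^esub> (n2 \<otimes>\<^bsub>H\<^esub> c2)) c) n"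
        by (simp add: sw_mult ls)
      also have "\<dots> \<in> ip N C"
      proof (rule sw_sub_in[OF N n _ W])
        fix n1 n2 assume n12: "n1 \<in> N" "n2 \<in> N"
        then have [simp]: "n1 \<in> carrier H" "n2 \<in> carrier H" using Nc by auto
        show "sw (\<lambda>c1 c2. f (n1 \<otimes>\<^bsub>H\<^esub> c1) \<odot>\<^bsub>H\<^esub> (n2 \<otimes>\<^bsub>H\<^esub> c2)) c \<in> ip N C"
          by (rule sw_sub_in[OF C c _ W]) (use n12 in \<open>simp_all add: ls el Cc\<close>)
      qed (simp add: ls)
      finally show "sw (\<lambda>x y. f x \<odot>\<^bsub>H\<^esub> y) (n \<otimes>\<^bsub>H\<^esub> c) \<in> ip N C" .
    qed
    show "sw (\<lambda>x y. f y \<odot>\<^bsub>H\<^esub> x) z \<in> ip N C"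
    proof (rule lin_ip_in[OF _ W sub z])
      show "lin (\<lambda>z. sw (\<lambda>x y. f y \<odot>\<^bsub>H\<^esub> x) z)" by (simp add: ls)
      fix n c assume n: "n \<in> N" and c: "c \<in> C"
      have [simp]: "n \<in> carrier H" "c \<in> carrier H" using n c Nc Cc by auto
      have "sw (\<lambda>x y. f y \<odot>\<^bsub>H\<^esub> x) (n \<otimes>\<^bsub>H\<^esub> c) =
          sw (\<lambda>n1 n2. sw (\<lambda>c1 c2. f (n2 \<otimes>\<^bsub>H\<^esub> c2) \<odot>\<^bsub>H\<^esub> (n1 \<otimes>\<^bsub>H\<^esub> c1)) c) n"
        by (simp add: sw_mult ls)
      also have "\<dots> \<in> ip N C"
      proof (rule sw_sub_in[OF N n _ W])
        fix n1 n2 assume n12: "n1 \<in> N" "n2 \<in> N"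
        then have [simp]: "n1 \<in> carrier H" "n2 \<in> carrier H" using Nc by auto
        show "sw (\<lambda>c1 c2. f (n2 \<otimes>\<^bsub>H\<^esub> c2) \<odot>\<^bsub>H\<^esub> (n1 \<otimes>\<^bsub>H\<^esub> c1)) c \<in> ip N C"
          by (rule sw_sub_in[OF C c _ W]) (use n12 in \<open>simp_all add: ls el Cc\<close>)
      qed (simp add: ls)
      finally show "sw (\<lambda>x y. f y \<odot>\<^bsub>H\<^esub> x) (n \<otimes>\<^bsub>H\<^esub> c) \<in> ip N C" .
    qed
  qed
qed

text \<open>The action of a product is a composite, so the acting element may be taken in
  \<open>N\<close> or in \<open>D\<close>. The former lies in \<open>N C\<close>, which normalizes
  itself; the latter acts on \<open>n c\<close> through its two legs and preserves both
  factors.\<close>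

lemma normalizes_ip:
  assumes fd: fin_dim and N: "hs N" and C: "hs C" and D: "hs D" and CD: "C \<subseteq> D"
    and norm: "normalizes D N" "normalizes D C"
  shows "normalizes (ip N D) (ip N C)"
proof -
  note Nc = hsD(5)[OF N] and Cc = hsD(5)[OF C] and Dc = hsD(5)[OF D]
  have sub: "N \<subseteq> carrier H" "C \<subseteq> carrier H" "D \<subseteq> carrier H" using Nc Cc Dc by auto
  let ?Q = "ip N C"
  have Q: "hs ?Q" by (rule hs_ip[OF fd N C normalizes_mono[OF norm(1) CD]])
  note Qc = hsD(5)[OF Q] and W = hsD(1)[OF Q]
  have NQ: "N \<subseteq> ?Q" by (rule ip_left[OF sub(1) hsD(2)[OF C]])
  have nQ: "adl n a \<in> ?Q \<and> adr n a \<in> ?Q" if "n \<in> N" "a \<in> ?Q" for n a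
    using normalizes_self[OF Q] NQ that by (auto simp: normalizes_def)
  have dQ: "adl d a \<in> ?Q \<and> adr d a \<in> ?Q" if d: "d \<in> D" and a: "a \<in> ?Q" for d a
  proof
    have [simp]: "d \<in> carrier H" using Dc d by auto
    have el: "adl x n \<otimes>\<^bsub>H\<^esub> adl y c \<in> ?Q" "adr x n \<otimes>\<^bsub>H\<^esub> adr y c \<in> ?Q"
      if "n \<in> N" "c \<in> C" "x \<in> D" "y \<in> D" for n c x y
      using norm that by (auto simp: normalizes_def intro!: ideal_prod.prod)
    show "adl d a \<in> ?Q"
    proof (rule lin_ip_in[OF _ W sub(1,2) a])
      show "lin (\<lambda>a. adl d a)" by (simp add: lin_ad lins)
      fix n c assume n: "n \<in> N" and c: "c \<in> C"
      have [simp]: "n \<in> carrier H" "c \<in> carrier H" using n c Nc Cc by auto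
      show "adl d (n \<otimes>\<^bsub>H\<^esub> c) \<in> ?Q"
        by (subst adl_prod, simp_all, rule sw_sub_in[OF D d _ W])
          (use n c in \<open>simp_all add: el lins lin_ad\<close>)
    qed
    show "adr d a \<in> ?Q"
    proof (rule lin_ip_in[OF _ W sub(1,2) a])
      show "lin (\<lambda>a. adr d a)" by (simp add: lin_ad lins)
      fix n c assume n: "n \<in> N" and c: "c \<in> C"
      have [simp]: "n \<in> carrier H" "c \<in> carrier H" using n c Nc Cc by auto
      show "adr d (n \<otimes>\<^bsub>H\<^esub> c) \<in> ?Q"
        by (subst adr_prod, simp_all, rule sw_sub_in[OF D d _ W])
          (use n c in \<open>simp_all add: el lins lin_ad\<close>)
    qed
  qed
  show ?thesis
    unfolding normalizes_def
  proof (intro ballI conjI)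
    fix h a assume h: "h \<in> ip N D" and a: "a \<in> ?Q"
    have [simp]: "a \<in> carrier H" using Qc[OF a] .
    show "adl h a \<in> ?Q"
    proof (rule lin_ip_in[OF _ W sub(1,3) h])
      show "lin (\<lambda>h. adl h a)" by (simp add: lin_ad lins)
      show "adl (n \<otimes>\<^bsub>H\<^esub> d) a \<in> ?Q" if "n \<in> N" "d \<in> D" for n d
        using that nQ dQ a Nc Dc by (simp add: adl_mult)
    qed
    show "adr h a \<in> ?Q"
    proof (rule lin_ip_in[OF _ W sub(1,3) h])
      show "lin (\<lambda>h. adr h a)" by (simp add: lin_ad lins)
      show "adr (n \<otimes>\<^bsub>H\<^esub> d) a \<in> ?Q" if "n \<in> N" "d \<in> D" for n d
        using that nQ dQ a Nc Dc by (simp add: adr_mult)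
    qed
  qed
qed

section \<open>Splittings modulo augmentation ideals, Hopf ideals and the kernel on the
  intersection\<close>

lemma smod_sum:
  assumes "smod X" "smod Y"
  shows "smod {x \<oplus>\<^bsub>H\<^esub> y | x y. x \<in> X \<and> y \<in> Y}" (is "smod ?Z")
proof (rule smodI)
  have c: "x \<in> X \<Longrightarrow> x \<in> carrier H" "y \<in> Y \<Longrightarrow> y \<in> carrier H" for x y
    using smodD(1)[OF assms(1)] smodD(1)[OF assms(2)] by auto
  show "?Z \<subseteq> carrier H" using c by auto
  show "\<zero>\<^bsub>H\<^esub> \<in> ?Z" using smodD(2)[OF assms(1)] smodD(2)[OF assms(2)] M.r_zero[OF M.zero_closed] by force
  show "z \<oplus>\<^bsub>H\<^esub> w \<in> ?Z" if zw: "z \<in> ?Z" "w \<in> ?Z" for z w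
  proof -
    obtain x y x' y' where e: "z = x \<oplus>\<^bsub>H\<^esub> y" "w = x' \<oplus>\<^bsub>H\<^esub> y'" "x \<in> X" "y \<in> Y" "x' \<in> X" "y' \<in> Y"
      using zw by blast
    then have "z \<oplus>\<^bsub>H\<^esub> w = (x \<oplus>\<^bsub>H\<^esub> x') \<oplus>\<^bsub>H\<^esub> (y \<oplus>\<^bsub>H\<^esub> y')"
      using c by (simp add: M.add.m_ac)
    then show ?thesis using smodD(3)[OF assms(1) e(3,5)] smodD(3)[OF assms(2) e(4,6)] by blast
  qed
  show "k \<odot>\<^bsub>H\<^esub> z \<in> ?Z" if k: "k \<in> carrier K" and z: "z \<in> ?Z" for k z
  proof -
    obtain x y where e: "z = x \<oplus>\<^bsub>H\<^esub> y" "x \<in> X" "y \<in> Y" using z by blast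
    then have "k \<odot>\<^bsub>H\<^esub> z = (k \<odot>\<^bsub>H\<^esub> x) \<oplus>\<^bsub>H\<^esub> (k \<odot>\<^bsub>H\<^esub> y)"
      using c k by (simp add: smult_r_distr)
    then show ?thesis using smodD(4)[OF assms(1) k e(2)] smodD(4)[OF assms(2) k e(3)] by blast
  qed
qed

text \<open>The reason is \<open>N = k \<oplus> N\<^sup>+\<close>.\<close>

lemma ip_split_aug:
  assumes X: "smod X" and N: "hs N" and z: "z \<in> ip X N"
  obtains x j where "x \<in> X" "j \<in> ip X (aug N)" "z = x \<oplus>\<^bsub>H\<^esub> j"
proof -
  have c: "x \<in> X \<Longrightarrow> x \<in> carrier H" "y \<in> N \<Longrightarrow> y \<in> carrier H" for x y
    using smodD(1)[OF X] hsD(5)[OF N] by auto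
  have "ip X N \<subseteq> {x \<oplus>\<^bsub>H\<^esub> j | x j. x \<in> X \<and> j \<in> ip X (aug N)}"
  proof (rule ip_least[OF smod_sum[OF X ip_smod[OF X smod_aug[OF hsD(1)[OF N]]]]])
    fix x n assume x: "x \<in> X" and n: "n \<in> N"
    have "x \<otimes>\<^bsub>H\<^esub> n = (\<epsilon> n \<odot>\<^bsub>H\<^esub> x) \<oplus>\<^bsub>H\<^esub> x \<otimes>\<^bsub>H\<^esub> (n \<ominus>\<^bsub>H\<^esub> \<epsilon> n \<odot>\<^bsub>H\<^esub> \<one>\<^bsub>H\<^esub>)"
      using c(1)[OF x] c(2)[OF n]
      by (simp add: a_minus_def H.r_distr H.r_minus smult_mult_right M.add.m_lcomm M.r_neg)
    then show "x \<otimes>\<^bsub>H\<^esub> n \<in> {x \<oplus>\<^bsub>H\<^esub> j | x j. x \<in> X \<and> j \<in> ip X (aug N)}"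
      using smodD(4)[OF X _ x, of "\<epsilon> n"] c(2)[OF n]
        ideal_prod.prod[OF x augI[OF hsD(1)[OF N] hsD(2)[OF N] n], of H] by auto
  qed
  then show thesis using z that by blast
qed

text \<open>Normality makes the left ideal \<open>A Q\<^sup>+\<close> equal to
  \<open>Q\<^sup>+ A\<close>, hence two-sided; stability under the antipode uses this too, because
  \<open>S\<close> exchanges the two descriptions. Compatibility with the comultiplication is
  treated separately, through maps out of the tensor product.\<close>

lemma normal_ideal:
  assumes A: "hs A" and Q: "hs Q" and QA: "Q \<subseteq> A" and norm: "normalizes A Q"
  defines "I \<equiv> ip A (aug Q)"
  shows "smod I" "I \<subseteq> A" "I = ip (aug Q) A" "x \<in> A \<Longrightarrow> i \<in> I \<Longrightarrow> x \<otimes>\<^bsub>H\<^esub> i \<in> I" "x \<in> A \<Longrightarrow> i \<in> I \<Longrightarrow> i \<otimes>\<^bsub>H\<^esub> x \<in> I"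
    "i \<in> I \<Longrightarrow> \<epsilon> i = \<zero>\<^bsub>K\<^esub>" "i \<in> I \<Longrightarrow> S i \<in> I"
proof -
  note Ac = hsD(5)[OF A] and Qc = hsD(5)[OF Q]
  have aug: "smod (aug Q)" by (rule smod_aug[OF hsD(1)[OF Q]])
  have augc: "aug Q \<subseteq> carrier H" "A \<subseteq> carrier H" using aug_subset Qc Ac by auto
  show I: "smod I" unfolding I_def by (rule ip_smod[OF hsD(1)[OF A] aug])
  show "I \<subseteq> A"
    unfolding I_def using QA aug_subset[of Q] by (intro ip_least[OF hsD(1)[OF A]] hsD(3)[OF A]) auto
  show comm: "I = ip (aug Q) A"
    unfolding I_def by (rule ip_commute[OF A aug normalizes_aug[OF A Q norm]])
  show "x \<otimes>\<^bsub>H\<^esub> i \<in> I" if x: "x \<in> A" and i: "i \<in> I" for x i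
  proof (rule lin_ip_in[OF _ I augc(2,1) i[unfolded I_def]])
    show "lin (\<lambda>i. x \<otimes>\<^bsub>H\<^esub> i)" using Ac[OF x] by (simp add: lins)
    show "x \<otimes>\<^bsub>H\<^esub> (y \<otimes>\<^bsub>H\<^esub> q) \<in> I" if "y \<in> A" "q \<in> aug Q" for y q
      using ideal_prod.prod[OF hsD(3)[OF A x that(1)] that(2), of H] Ac[OF x] Ac[OF that(1)] augc(1) that(2)
      by (simp add: I_def H.m_assoc subset_iff)
  qed
  show "i \<otimes>\<^bsub>H\<^esub> x \<in> I" if x: "x \<in> A" and i: "i \<in> I" for x i
  proof (rule lin_ip_in[OF _ I augc i[unfolded comm]])
    show "lin (\<lambda>i. i \<otimes>\<^bsub>H\<^esub> x)" using Ac[OF x] by (simp add: lins)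
    show "q \<otimes>\<^bsub>H\<^esub> y \<otimes>\<^bsub>H\<^esub> x \<in> I" if "q \<in> aug Q" "y \<in> A" for y q
      using ideal_prod.prod[OF that(1) hsD(3)[OF A that(2) x], of H] Ac[OF x] Ac[OF that(2)] augc(1) that(1)
      by (simp add: comm H.m_assoc subset_iff)
  qed
  show "\<epsilon> i = \<zero>\<^bsub>K\<^esub>" if i: "i \<in> I"
  proof (rule smult_eq_zero_iff)
    show "\<epsilon> i \<in> carrier K" using smodD(1)[OF I] i by auto
    show "\<epsilon> i \<odot>\<^bsub>H\<^esub> \<one>\<^bsub>H\<^esub> = \<zero>\<^bsub>H\<^esub>"
    proof (rule lin_ip_zero[OF fnl_lin1[OF fnl_counit] augc(2,1) i[unfolded I_def]])
      show "\<epsilon> (x \<otimes>\<^bsub>H\<^esub> y) \<odot>\<^bsub>H\<^esub> \<one>\<^bsub>H\<^esub> = \<zero>\<^bsub>H\<^esub>" if "x \<in> A" "y \<in> aug Q" for x y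
        using Ac[OF that(1)] Qc[of y] that(2) by (simp add: augmentation_def)
    qed
  qed
  show "S i \<in> I" if i: "i \<in> I"
  proof (rule lin_ip_in[of S, OF _ I augc(2,1) i[unfolded I_def]])
    show "lin S" using lin_antipode[OF lin_id] by simp
    show "S (x \<otimes>\<^bsub>H\<^esub> q) \<in> I" if x: "x \<in> A" and q: "q \<in> aug Q" for x q
    proof -
      have qQ: "q \<in> Q" "\<epsilon> q = \<zero>\<^bsub>K\<^esub>" using q by (auto simp: augmentation_def)
      have "S q \<in> aug Q" using qQ Qc hsD(4)[OF Q] by (simp add: augmentation_def)
      then show ?thesis
        using ideal_prod.prod[OF _ hsD(4)[OF A x], of "S q" "aug Q" H] Ac[OF x] Qc[OF qQ(1)]
        by (simp add: comm antipode_mult)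
    qed
  qed
qed

lemma smod_add_cancel: "smod W \<Longrightarrow> x \<in> carrier H \<Longrightarrow> w \<in> W \<Longrightarrow> x \<oplus>\<^bsub>H\<^esub> w \<in> W \<longleftrightarrow> x \<in> W"
proof
  assume W: "smod W" and x: "x \<in> carrier H" and w: "w \<in> W" and "x \<oplus>\<^bsub>H\<^esub> w \<in> W"
  then have "(x \<oplus>\<^bsub>H\<^esub> w) \<ominus>\<^bsub>H\<^esub> w \<in> W" by (intro smod_diff)
  moreover have "w \<in> carrier H" using smodD(1)[OF W] w by auto
  ultimately show "x \<in> W" using x by (simp add: a_minus_def M.a_assoc M.r_neg)
qed (rule smodD(3))

lemma normalizes_ip_left:
  assumes N: "hs N" and D: "hs D" and norm: "normalizes D N"
  shows "normalizes (ip N D) N"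
  unfolding normalizes_def
proof (intro ballI conjI)
  note Nc = hsD(5)[OF N] and Dc = hsD(5)[OF D] and W = hsD(1)[OF N]
  have sub: "N \<subseteq> carrier H" "D \<subseteq> carrier H" using Nc Dc by auto
  have nN: "adl n a \<in> N \<and> adr n a \<in> N" if "n \<in> N" "a \<in> N" for n a
    using normalizes_self[OF N] that by (auto simp: normalizes_def)
  have dN: "adl d a \<in> N \<and> adr d a \<in> N" if "d \<in> D" "a \<in> N" for d a
    using norm that by (auto simp: normalizes_def)
  fix h a assume h: "h \<in> ip N D" and a: "a \<in> N"
  have [simp]: "a \<in> carrier H" using Nc[OF a] .
  show "adl h a \<in> N"
  proof (rule lin_ip_in[OF _ W sub h])
    show "lin (\<lambda>h. adl h a)" by (simp add: lin_ad lins)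
    show "adl (n \<otimes>\<^bsub>H\<^esub> d) a \<in> N" if "n \<in> N" "d \<in> D" for n d
      using that nN dN a Nc Dc by (simp add: adl_mult)
  qed
  show "adr h a \<in> N"
  proof (rule lin_ip_in[OF _ W sub h])
    show "lin (\<lambda>h. adr h a)" by (simp add: lin_ad lins)
    show "adr (n \<otimes>\<^bsub>H\<^esub> d) a \<in> N" if "n \<in> N" "d \<in> D" for n d
      using that nN dN a Nc Dc by (simp add: adr_mult)
  qed
qed

lemma aug_mono: "A \<subseteq> B \<Longrightarrow> aug A \<subseteq> aug B"
  by (auto simp: augmentation_def)

text \<open>The kernel of \<open>D \<rightarrow> N D / N D (N C)\<^sup>+\<close>.  Modulo \<open>D C\<^sup>+\<close>, which lies in \<open>D\<close>, the modular law of
  subspaces reduces it to \<open>D \<inter> N D N\<^sup>+\<close>.\<close>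

lemma kernel_to_factor:
  assumes fd: fin_dim and N: "hs N" and C: "hs C" and D: "hs D" and CD: "C \<subseteq> D"
    and norm: "normalizes D N" "normalizes D C" and d: "d \<in> D"
  shows "d \<in> ip (ip N D) (aug (ip N C)) \<longleftrightarrow>
    d \<in> {x \<oplus>\<^bsub>H\<^esub> y | x y. x \<in> ip D (aug (D \<inter> N)) \<and> y \<in> ip D (aug C)}"
proof
  note Nc = hsD(5)[OF N] and Cc = hsD(5)[OF C] and Dc = hsD(5)[OF D]
  have sub: "N \<subseteq> carrier H" "C \<subseteq> carrier H" "D \<subseteq> carrier H" using Nc Cc Dc by auto
  let ?P = "ip N D" and ?Q = "ip N C"
  have normC: "normalizes C N" by (rule normalizes_mono[OF norm(1) CD])
  have P: "hs ?P" by (rule hs_ip[OF fd N D norm(1)])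
  have Q: "hs ?Q" by (rule hs_ip[OF fd N C normC])
  have NP: "N \<subseteq> ?P" and NQ: "N \<subseteq> ?Q" and DP: "D \<subseteq> ?P" and CQ: "C \<subseteq> ?Q"
    using ip_left[OF sub(1) hsD(2)[OF D]] ip_left[OF sub(1) hsD(2)[OF C]]
      ip_right[OF sub(3) hsD(2)[OF N]] ip_right[OF sub(2) hsD(2)[OF N]] by auto
  have PDN: "?P = ip D N" by (rule ip_commute[OF D hsD(1)[OF N] norm(1), symmetric])
  have QCN: "?Q = ip C N" by (rule ip_commute[OF C hsD(1)[OF N] normC, symmetric])
  have normP: "normalizes ?P N" by (rule normalizes_ip_left[OF N D norm(1)])
  have DN: "hs (D \<inter> N)" by (rule hs_Int[OF fd D N])
  have augC: "smod (aug C)" by (rule smod_aug[OF hsD(1)[OF C]])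
  have V: "smod (ip D (aug C))" by (rule ip_smod[OF hsD(1)[OF D] augC])
  have VD: "ip D (aug C) \<subseteq> D"
    by (rule ip_least[OF hsD(1)[OF D]]) (use CD aug_subset[of C] hsD(3)[OF D] in auto)
  note J = normal_ideal[OF P N NP normP]
  let ?J = "ip ?P (aug N)" and ?V = "ip D (aug C)"
  show "d \<in> {x \<oplus>\<^bsub>H\<^esub> y | x y. x \<in> ip D (aug (D \<inter> N)) \<and> y \<in> ip D (aug C)}"
    if dI: "d \<in> ip ?P (aug ?Q)"
  proof -
    have Jc: "j \<in> carrier H" if "j \<in> ?J" for j using that smodD(1)[OF J(1)] by auto
    \<comment> \<open>Both factors of a generator are split modulo \<open>N\<^sup>+\<close>. In the
      product of \<open>d' + j'\<close> and \<open>c + j\<close> every term except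
      \<open>d' c\<close> lies in the two-sided ideal \<open>P N\<^sup>+\<close>.\<close>
    have "ip ?P (aug ?Q) \<subseteq> {x \<oplus>\<^bsub>H\<^esub> y | x y. x \<in> ?J \<and> y \<in> ?V}"
    proof (rule ip_least[OF smod_sum[OF J(1) V]])
      fix x q assume x: "x \<in> ?P" and q: "q \<in> aug ?Q"
      have "q \<in> ip C N" "\<epsilon> q = \<zero>\<^bsub>K\<^esub>" using q QCN by (auto simp: augmentation_def)
      then obtain c j where c: "c \<in> C" and j: "j \<in> ip C (aug N)" and qe: "q = c \<oplus>\<^bsub>H\<^esub> j"
        using ip_split_aug[OF hsD(1)[OF C] N] by blast
      have jJ: "j \<in> ?J" using j ip_mono[of C ?P "aug N" "aug N"] CD DP by auto
      have [simp]: "c \<in> carrier H" "j \<in> carrier H" "x \<in> carrier H" using Cc c Jc jJ hsD(5)[OF P x] by auto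
      \<comment> \<open>The counit vanishes on \<open>q\<close> and on the ideal, hence on
        \<open>c\<close>; without this \<open>d' c\<close> would only lie in
        \<open>D C\<close>.\<close>
      have cA: "c \<in> aug C"
        using \<open>\<epsilon> q = \<zero>\<^bsub>K\<^esub>\<close> J(6)[OF jJ] c by (simp add: qe augmentation_def fnl_add[OF fnl_counit])
      obtain d' j' where d': "d' \<in> D" and j': "j' \<in> ip D (aug N)" and xe: "x = d' \<oplus>\<^bsub>H\<^esub> j'"
        using ip_split_aug[OF hsD(1)[OF D] N] x PDN by blast
      have j'J: "j' \<in> ?J" using j' ip_mono[of D ?P "aug N" "aug N"] DP by auto
      have [simp]: "d' \<in> carrier H" "j' \<in> carrier H" using Dc d' Jc j'J by auto
      have "x \<otimes>\<^bsub>H\<^esub> q = (x \<otimes>\<^bsub>H\<^esub> j \<oplus>\<^bsub>H\<^esub> j' \<otimes>\<^bsub>H\<^esub> c) \<oplus>\<^bsub>H\<^esub> d' \<otimes>\<^bsub>H\<^esub> c"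
        by (simp add: qe H.r_distr) (simp add: xe H.l_distr M.add.m_ac)
      moreover have "x \<otimes>\<^bsub>H\<^esub> j \<oplus>\<^bsub>H\<^esub> j' \<otimes>\<^bsub>H\<^esub> c \<in> ?J"
        using J(4)[OF x jJ] J(5)[OF _ j'J, of c] c CD DP by (intro smodD(3)[OF J(1)]) auto
      moreover have "d' \<otimes>\<^bsub>H\<^esub> c \<in> ?V" using d' cA by (rule ideal_prod.prod)
      ultimately show "x \<otimes>\<^bsub>H\<^esub> q \<in> {x \<oplus>\<^bsub>H\<^esub> y | x y. x \<in> ?J \<and> y \<in> ?V}" by blast
    qed
    then obtain j v where j: "j \<in> ?J" and v: "v \<in> ?V" and de: "d = j \<oplus>\<^bsub>H\<^esub> v" using dI by blast
    \<comment> \<open>The modular law: \<open>d\<close> and \<open>v\<close> lie in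
      \<open>D\<close>, hence so does \<open>j\<close>, and the intersection theorem applies to
      it.\<close>
    have "j \<in> D" using smod_add_cancel[OF hsD(1)[OF D] Jc[OF j], of v] v VD d de by auto
    have "j \<in> ip D (aug (D \<inter> N))"
      by (rule subalgebra_Int_normal_ideal[OF fd D N P DP NP normP _ \<open>j \<in> D\<close> j]) (simp add: PDN)
    then show ?thesis using v de by blast
  qed
  show "d \<in> ip ?P (aug ?Q)" if "d \<in> {x \<oplus>\<^bsub>H\<^esub> y | x y. x \<in> ip D (aug (D \<inter> N)) \<and> y \<in> ip D (aug C)}"
  proof -
    have W: "smod (ip ?P (aug ?Q))" by (rule ip_smod[OF hsD(1)[OF P] smod_aug[OF hsD(1)[OF Q]]])
    have "ip D (aug (D \<inter> N)) \<subseteq> ip ?P (aug ?Q)" "ip D (aug C) \<subseteq> ip ?P (aug ?Q)"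
      using NQ CQ by (intro ip_mono[OF DP] aug_mono; blast)+
    then show ?thesis using that smodD(3)[OF W] by blast
  qed
qed

text \<open>Surjectivity of the map from \<open>D\<close> to the factor: with
  \<open>N D = D N\<close> and \<open>N\<close> split into scalars and \<open>N\<^sup>+\<close>, an
  element of the product is one of \<open>D\<close> up to an error in the ideal.\<close>

lemma ip_split_factor:
  assumes fd: fin_dim and N: "hs N" and C: "hs C" and D: "hs D" and CD: "C \<subseteq> D"
    and norm: "normalizes D N" and p: "p \<in> ip N D"
  obtains d j where "d \<in> D" "j \<in> ip (ip N D) (aug (ip N C))" "p = d \<oplus>\<^bsub>H\<^esub> j"
proof -
  note Nc = hsD(5)[OF N] and Cc = hsD(5)[OF C] and Dc = hsD(5)[OF D]
  have sub: "N \<subseteq> carrier H" "C \<subseteq> carrier H" "D \<subseteq> carrier H" using Nc Cc Dc by auto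
  have "p \<in> ip D N" using p ip_commute[OF D hsD(1)[OF N] norm] by simp
  then obtain d j where dj: "d \<in> D" "j \<in> ip D (aug N)" "p = d \<oplus>\<^bsub>H\<^esub> j"
    using ip_split_aug[OF hsD(1)[OF D] N] by blast
  have "ip D (aug N) \<subseteq> ip (ip N D) (aug (ip N C))"
    by (intro ip_mono aug_mono ip_left[OF sub(1) hsD(2)[OF C]] ip_right[OF sub(3) hsD(2)[OF N]])
  then show thesis using dj that by blast
qed

subsection \<open>Hopf subalgebras as Hopf algebras\<close>

lemma sub_hopf_simps [simp]:
  "carrier (sub_hopf K H A) = A" "add (sub_hopf K H A) = add H" "mult (sub_hopf K H A) = mult H"
  "zero (sub_hopf K H A) = zero H" "one (sub_hopf K H A) = one H" "smult (sub_hopf K H A) = smult H"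
  "counit (sub_hopf K H A) = \<epsilon>" "antipode (sub_hopf K H A) = S"
  by (simp_all add: sub_hopf_def)

lemma tensor_sub_hopf [simp]:
  "tensor_group K (sub_hopf K H A) (sub_hopf K H A) = tensor_group K (H\<lparr>carrier := A\<rparr>) (H\<lparr>carrier := A\<rparr>)"
  "pure_tensor K (sub_hopf K H A) (sub_hopf K H A) = pure_tensor K (H\<lparr>carrier := A\<rparr>) (H\<lparr>carrier := A\<rparr>)"
  "tensor K (sub_hopf K H A) (sub_hopf K H A) = tensor K (H\<lparr>carrier := A\<rparr>) (H\<lparr>carrier := A\<rparr>)"
  "tensor K ((sub_hopf K H A)\<lparr>carrier := B\<rparr>) ((sub_hopf K H A)\<lparr>carrier := B\<rparr>) = tensor K (H\<lparr>carrier := B\<rparr>) (H\<lparr>carrier := B\<rparr>)"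
proof -
  have *: "tensor_relators K (sub_hopf K H A) (sub_hopf K H A) = tensor_relators K (H\<lparr>carrier := A\<rparr>) (H\<lparr>carrier := A\<rparr>)"
    by (simp add: tensor_relators_def)
  have **: "tensor_relators K ((sub_hopf K H A)\<lparr>carrier := B\<rparr>) ((sub_hopf K H A)\<lparr>carrier := B\<rparr>) = tensor_relators K (H\<lparr>carrier := B\<rparr>) (H\<lparr>carrier := B\<rparr>)"
    by (simp add: tensor_relators_def)
  show g: "tensor_group K (sub_hopf K H A) (sub_hopf K H A) = tensor_group K (H\<lparr>carrier := A\<rparr>) (H\<lparr>carrier := A\<rparr>)"
    by (simp add: tensor_group_def tensor_relations_def *)
  show p: "pure_tensor K (sub_hopf K H A) (sub_hopf K H A) = pure_tensor K (H\<lparr>carrier := A\<rparr>) (H\<lparr>carrier := A\<rparr>)"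
    by (intro ext) (simp add: pure_tensor_def tensor_relations_def *)
  show "tensor K (sub_hopf K H A) (sub_hopf K H A) = tensor K (H\<lparr>carrier := A\<rparr>) (H\<lparr>carrier := A\<rparr>)"
    by (simp add: tensor_def g p)
  have "tensor_group K ((sub_hopf K H A)\<lparr>carrier := B\<rparr>) ((sub_hopf K H A)\<lparr>carrier := B\<rparr>) = tensor_group K (H\<lparr>carrier := B\<rparr>) (H\<lparr>carrier := B\<rparr>)"
    by (simp add: tensor_group_def tensor_relations_def **)
  moreover have "pure_tensor K ((sub_hopf K H A)\<lparr>carrier := B\<rparr>) ((sub_hopf K H A)\<lparr>carrier := B\<rparr>) = pure_tensor K (H\<lparr>carrier := B\<rparr>) (H\<lparr>carrier := B\<rparr>)"
    by (intro ext) (simp add: pure_tensor_def tensor_relations_def **)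
  ultimately show "tensor K ((sub_hopf K H A)\<lparr>carrier := B\<rparr>) ((sub_hopf K H A)\<lparr>carrier := B\<rparr>) = tensor K (H\<lparr>carrier := B\<rparr>) (H\<lparr>carrier := B\<rparr>)"
    by (simp add: tensor_def)
qed

text \<open>A linear projection onto \<open>A\<close> yields the left inverse
  \<open>pr \<otimes> pr\<close>. Injectivity is what makes \<open>inv_into\<close> in
  \<open>sub_hopf\<close> a genuine inverse.\<close>

lemma sub_tensor_incl_inj:
  assumes fd: fin_dim and A: "smod A"
  shows "inj_on (sub_tensor_incl K H) (carrier (tensor K (H\<lparr>carrier := A\<rparr>) (H\<lparr>carrier := A\<rparr>)))"
proof -
  interpret A: two_modules K "H\<lparr>carrier := A\<rparr>" "H\<lparr>carrier := A\<rparr>" by (rule two_modules_sub[OF A])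
  obtain pr where pr: "lin pr" "\<And>x. x \<in> carrier H \<Longrightarrow> pr x \<in> A" "\<And>x. x \<in> A \<Longrightarrow> pr x = x"
    using projection_onto[OF fd A] by blast
  have hom: "pr \<in> module_hom K H (H\<lparr>carrier := A\<rparr>)"
    using pr by (auto simp: module_hom_def lin_add lin_smult)
  have "tensor_map K (H\<lparr>carrier := A\<rparr>) (H\<lparr>carrier := A\<rparr>) pr pr (sub_tensor_incl K H t) = t"
    if t: "t \<in> carrier A.T" for t
  proof -
    obtain xs where xs: "set xs \<subseteq> A \<times> A" "t = pair_sum A.T A.pt xs"
      using A.tensor_as_pair_sum[OF t] by auto
    then have xs': "set xs \<subseteq> carrier H \<times> carrier H" using smodD(1)[OF A] by auto
    show ?thesis
      unfolding xs(2) sub_tensor_incl_pair_sum[OF A xs(1)]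
        HH.tensor_map_pair_sum[OF A.two_modules_axioms hom hom xs']
      using xs(1) pr(3) by (intro pair_sum_cong) auto
  qed
  then show ?thesis by (intro inj_on_inverseI) simp
qed

text \<open>Resolves the choice in \<open>sub_hopf\<close>: a presentation of
  \<open>\<Delta> x\<close> by pairs from \<open>A\<close> also presents the comultiplication of
  \<open>A\<close>, only read in the smaller tensor product.\<close>

lemma comult_sub_hopf:
  assumes fd: fin_dim and A: "smod A" and xs: "set xs \<subseteq> A \<times> A" "\<Delta> x = pair_sum HH.T HH.pt xs"
  shows "comult (sub_hopf K H A) x =
    pair_sum (tensor_group K (H\<lparr>carrier := A\<rparr>) (H\<lparr>carrier := A\<rparr>))
      (pure_tensor K (H\<lparr>carrier := A\<rparr>) (H\<lparr>carrier := A\<rparr>)) xs"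
proof -
  interpret A: two_modules K "H\<lparr>carrier := A\<rparr>" "H\<lparr>carrier := A\<rparr>" by (rule two_modules_sub[OF A])
  have "pair_sum A.T A.pt xs \<in> carrier (tensor K (H\<lparr>carrier := A\<rparr>) (H\<lparr>carrier := A\<rparr>))"
    using xs(1) by (auto intro!: A.T.pair_sum_closed)
  moreover have "comult (sub_hopf K H A) x = inv_into (carrier (tensor K (H\<lparr>carrier := A\<rparr>) (H\<lparr>carrier := A\<rparr>)))
      (sub_tensor_incl K H) (sub_tensor_incl K H (pair_sum A.T A.pt xs))"
    by (simp add: sub_hopf_def xs(2) sub_tensor_incl_pair_sum[OF A xs(1)])
  ultimately show ?thesis by (simp only: inv_into_f_f[OF sub_tensor_incl_inj[OF fd A]])
qed

lemma tensor_lift_sub_hopf: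
  assumes fd: fin_dim and A: "hs A" and \<beta>: "bilin \<beta>" "\<And>x y. x \<in> A \<Longrightarrow> y \<in> A \<Longrightarrow> \<beta> x y \<in> A" and h: "h \<in> A"
  shows "tensor_lift (add_monoid (sub_hopf K H A)) \<beta> (comult (sub_hopf K H A) h) = sw \<beta> h"
proof -
  interpret A: two_modules K "H\<lparr>carrier := A\<rparr>" "H\<lparr>carrier := A\<rparr>" by (rule two_modules_sub[OF hsD(1)[OF A]])
  obtain xs where xs: "set xs \<subseteq> A \<times> A" "\<Delta> h = pair_sum HH.T HH.pt xs" using hs_legs[OF A h] .
  have c: "A \<subseteq> carrier H" "h \<in> carrier H" using hsD(5)[OF A] h by auto
  then have xs': "set xs \<subseteq> carrier H \<times> carrier H" using xs(1) by auto
  have G: "comm_group (add_monoid (sub_hopf K H A))"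
    using A.V.a_comm_group by simp
  have bal: "balanced K (H\<lparr>carrier := A\<rparr>) (H\<lparr>carrier := A\<rparr>) (add_monoid (sub_hopf K H A)) \<beta>"
    using bilin_balanced[OF \<beta>(1)] \<beta>(2) c(1) unfolding balanced_def by (auto simp: subset_iff)
  have "tensor_lift (add_monoid (sub_hopf K H A)) \<beta> (comult (sub_hopf K H A) h) =
      pair_sum (add_monoid (sub_hopf K H A)) \<beta> xs"
    unfolding comult_sub_hopf[OF fd hsD(1)[OF A] xs]
    by (rule A.tensor_lift_pair_sum[OF G bal]) (use xs(1) in simp)
  also have "\<dots> = pair_sum (add_monoid H) \<beta> xs" by (simp add: pair_sum_def)
  also have "\<dots> = sw \<beta> h" by (rule sw_list[OF c(2) \<beta>(1) xs' xs(2), symmetric])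
  finally show ?thesis .
qed

lemma adjoint_sub_hopf:
  assumes fd: fin_dim and A: "hs A" and h: "h \<in> A" and a: "a \<in> A"
  shows "tensor_lift (add_monoid (sub_hopf K H A))
      (\<lambda>x y. x \<otimes>\<^bsub>H\<^esub> a \<otimes>\<^bsub>H\<^esub> S y) (comult (sub_hopf K H A) h) = adl h a"
    and "tensor_lift (add_monoid (sub_hopf K H A))
      (\<lambda>x y. S x \<otimes>\<^bsub>H\<^esub> a \<otimes>\<^bsub>H\<^esub> y) (comult (sub_hopf K H A) h) = adr h a"
  unfolding adl_def adr_def
  by (rule tensor_lift_sub_hopf[OF fd A _ _ h]; use a hsD(5)[OF A a] in \<open>simp add: lins hsD(3,4)[OF A]\<close>)+

lemma hopf_subalgebra_sub_hopf:
  assumes fd: fin_dim and P: "hs P" and Q: "hs Q" and QP: "Q \<subseteq> P"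
  shows "hopf_subalgebra K Q (sub_hopf K H P)"
  unfolding hopf_subalgebra_def
proof (intro conjI ballI)
  interpret P: two_modules K "H\<lparr>carrier := P\<rparr>" "H\<lparr>carrier := P\<rparr>" by (rule two_modules_sub[OF hsD(1)[OF P]])
  interpret Q: two_modules K "H\<lparr>carrier := Q\<rparr>" "H\<lparr>carrier := Q\<rparr>" by (rule two_modules_sub[OF hsD(1)[OF Q]])
  have "module K (sub_hopf K H P)"
    using P.V.module_axioms
    by (simp add: module_def module_axioms_def abelian_group_def abelian_monoid_def abelian_group_axioms_def)
  then show "LinearCombinations.submodule K Q (sub_hopf K H P)"
    using smodD[OF hsD(1)[OF Q]] QP by (auto simp: LinearCombinations.submodule_def)
  show "submonoid Q (sub_hopf K H P)"
    using hsD(2,3)[OF Q] QP by (auto simp: submonoid_def)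
  show "antipode (sub_hopf K H P) a \<in> Q" if "a \<in> Q" for a using hsD(4)[OF Q that] by simp
  fix a assume a: "a \<in> Q"
  obtain xs where xs: "set xs \<subseteq> Q \<times> Q" "\<Delta> a = pair_sum HH.T HH.pt xs" using hs_legs[OF Q a] .
  then have xsP: "set xs \<subseteq> P \<times> P" using QP by auto
  have id: "(\<lambda>x. x) \<in> module_hom K (H\<lparr>carrier := Q\<rparr>) (H\<lparr>carrier := P\<rparr>)"
    using QP by (auto simp: module_hom_def)
  have "pair_sum Q.T Q.pt xs \<in> carrier Q.T" using xs(1) by (auto intro!: Q.T.pair_sum_closed)
  moreover have "sub_tensor_incl K (sub_hopf K H P) (pair_sum Q.T Q.pt xs) = comult (sub_hopf K H P) a"
    unfolding comult_sub_hopf[OF fd hsD(1)[OF P] xsP xs(2)]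
    using Q.tensor_map_pair_sum[OF P.two_modules_axioms id id, of xs] xs(1)
    by (simp add: sub_tensor_incl_def tensor_map_def)
  ultimately show "comult (sub_hopf K H P) a \<in> sub_tensor_incl K (sub_hopf K H P) `
      carrier (tensor K ((sub_hopf K H P)\<lparr>carrier := Q\<rparr>) ((sub_hopf K H P)\<lparr>carrier := Q\<rparr>))"
    by (auto intro!: image_eqI[symmetric])
qed

text \<open>The adjoint actions formed with the comultiplication of \<open>P\<close> agree with
  those of \<open>H\<close>, so normality of every step of a series can be handled by
  \<open>normalizes\<close>.\<close>

lemma normal_sub_hopf_iff:
  assumes fd: fin_dim and P: "hs P" and Q: "hs Q" and QP: "Q \<subseteq> P"
  shows "normal_hopf_subalgebra K Q (sub_hopf K H P) \<longleftrightarrow> normalizes P Q"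
proof -
  have "a \<in> P" if "a \<in> Q" for a using that QP by auto
  then show ?thesis
    unfolding normal_hopf_subalgebra_def normalizes_def
    by (auto simp: hopf_subalgebra_sub_hopf[OF assms] adjoint_sub_hopf[OF fd P, simplified])
qed

text \<open>\<open>\<Delta> q - 1 \<otimes> q \<in> Q\<^sup>+ \<otimes> Q\<close> for \<open>q \<in> Q\<close>; hence \<open>P Q\<^sup>+\<close> is a coideal of \<open>P\<close>.\<close>

lemma balanced_vanishes_on_ideal:
  assumes P: "hs P" and Q: "hs Q" and QP: "Q \<subseteq> P"
    and G: "comm_group G" and \<beta>: "balanced K H H G \<beta>"
    and vanish: "\<And>i y. i \<in> ip P (aug Q) \<Longrightarrow> y \<in> P \<Longrightarrow> \<beta> i y = \<one>\<^bsub>G\<^esub>"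
      "\<And>x i. x \<in> P \<Longrightarrow> i \<in> ip P (aug Q) \<Longrightarrow> \<beta> x i = \<one>\<^bsub>G\<^esub>"
    and z: "z \<in> ip P (aug Q)"
  shows "tensor_lift G \<beta> (\<Delta> z) = \<one>\<^bsub>G\<^esub>"
proof -
  interpret G: comm_group G by fact
  note Pc = hsD(5)[OF P] and Qc = hsD(5)[OF Q]
  note hom = HH.tensor_lift_hom[OF G \<beta>]
  have \<beta>c [simp]: "\<beta> x y \<in> carrier G" if "x \<in> carrier H" "y \<in> carrier H" for x y
    using \<beta> that by (auto simp: balanced_def)
  have "z \<in> carrier H \<and> tensor_lift G \<beta> (\<Delta> z) = \<one>\<^bsub>G\<^esub>"
    using z
  proof induction
    case (prod p q)
    then have p: "p \<in> P" and q: "q \<in> Q" "\<epsilon> q = \<zero>\<^bsub>K\<^esub>" "q \<in> aug Q" by (auto simp: augmentation_def)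
    have [simp]: "p \<in> carrier H" "q \<in> carrier H" using p q Pc Qc by auto
    obtain ps where ps: "set ps \<subseteq> P \<times> P" "\<Delta> p = pair_sum HH.T HH.pt ps" using hs_legs[OF P p] .
    obtain qs where qs: "set qs \<subseteq> Q \<times> Q" "\<Delta> q = pair_sum HH.T HH.pt qs" using hs_legs[OF Q q(1)] .
    have psD: "a \<in> P \<and> b \<in> P \<and> a \<in> carrier H \<and> b \<in> carrier H" if "(a, b) \<in> set ps" for a b
      using that ps(1) Pc by auto
    have qsD: "a \<in> Q \<and> b \<in> Q \<and> a \<in> carrier H \<and> b \<in> carrier H" if "(a, b) \<in> set qs" for a b
      using that qs(1) Qc by auto
    have psc: "set ps \<subseteq> carrier H \<times> carrier H" and qsc: "set qs \<subseteq> carrier H \<times> carrier H"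
      using psD qsD by auto
    have "tensor_lift G \<beta> (\<Delta> (p \<otimes>\<^bsub>H\<^esub> q)) =
        pair_sum G (\<lambda>a b. tensor_lift G \<beta> (pair_sum HH.T (\<lambda>c d. HH.pt (a \<otimes>\<^bsub>H\<^esub> c) (b \<otimes>\<^bsub>H\<^esub> d)) qs)) ps"
      unfolding comult_mult[OF \<open>p \<in> carrier H\<close> \<open>q \<in> carrier H\<close> psc ps(2) qsc qs(2)]
      by (rule HH.T.pair_sum_hom[OF G hom]) (auto intro!: HH.T.pair_sum_closed dest!: psD qsD)
    also have "\<dots> = pair_sum G (\<lambda>a b. \<one>\<^bsub>G\<^esub>) ps"
    proof (rule pair_sum_cong)
      fix a b assume "(a, b) \<in> set ps"
      then have ab: "a \<in> P" "b \<in> P" and [simp]: "a \<in> carrier H" "b \<in> carrier H" using psD by auto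
      have "tensor_lift G \<beta> (pair_sum HH.T (\<lambda>c d. HH.pt (a \<otimes>\<^bsub>H\<^esub> c) (b \<otimes>\<^bsub>H\<^esub> d)) qs) =
          pair_sum G (\<lambda>c d. tensor_lift G \<beta> (HH.pt (a \<otimes>\<^bsub>H\<^esub> c) (b \<otimes>\<^bsub>H\<^esub> d))) qs"
        by (rule HH.T.pair_sum_hom[OF G hom]) (auto dest!: qsD)
      also have "\<dots> = pair_sum G (\<lambda>c d. \<beta> a (b \<otimes>\<^bsub>H\<^esub> (\<epsilon> c \<odot>\<^bsub>H\<^esub> d))) qs"
      proof (rule pair_sum_cong)
        fix c d assume "(c, d) \<in> set qs"
        then have cd: "c \<in> Q" "d \<in> Q" and [simp]: "c \<in> carrier H" "d \<in> carrier H" using qsD by auto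
        \<comment> \<open>Without its scalar part the leg lies in \<open>Q\<^sup>+\<close>, so its
          contribution is killed by \<open>vanish(1)\<close>. What remains carries a counit, and the
          sum over the legs of \<open>q\<close> collapses to \<open>q\<close>.\<close>
        let ?c = "c \<ominus>\<^bsub>H\<^esub> \<epsilon> c \<odot>\<^bsub>H\<^esub> \<one>\<^bsub>H\<^esub>"
        have c': "?c \<in> carrier H" by simp
        have "a \<otimes>\<^bsub>H\<^esub> c = a \<otimes>\<^bsub>H\<^esub> ?c \<oplus>\<^bsub>H\<^esub> \<epsilon> c \<odot>\<^bsub>H\<^esub> a"
          by (simp add: a_minus_def H.r_distr H.r_minus smult_mult_right M.a_assoc M.l_neg)
        then have "\<beta> (a \<otimes>\<^bsub>H\<^esub> c) (b \<otimes>\<^bsub>H\<^esub> d) =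
            \<beta> (a \<otimes>\<^bsub>H\<^esub> ?c) (b \<otimes>\<^bsub>H\<^esub> d) \<otimes>\<^bsub>G\<^esub> \<beta> (\<epsilon> c \<odot>\<^bsub>H\<^esub> a) (b \<otimes>\<^bsub>H\<^esub> d)"
          using \<beta> c' by (simp add: balanced_def)
        moreover have "\<beta> (a \<otimes>\<^bsub>H\<^esub> ?c) (b \<otimes>\<^bsub>H\<^esub> d) = \<one>\<^bsub>G\<^esub>"
          using cd ab QP augI[OF hsD(1,2)[OF Q] cd(1)] hsD(3)[OF P] by (intro vanish(1) ideal_prod.prod) auto
        moreover have "\<beta> (\<epsilon> c \<odot>\<^bsub>H\<^esub> a) (b \<otimes>\<^bsub>H\<^esub> d) = \<beta> a (b \<otimes>\<^bsub>H\<^esub> (\<epsilon> c \<odot>\<^bsub>H\<^esub> d))"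
          using \<beta> by (simp add: balanced_def smult_mult_right)
        ultimately show "tensor_lift G \<beta> (HH.pt (a \<otimes>\<^bsub>H\<^esub> c) (b \<otimes>\<^bsub>H\<^esub> d)) = \<beta> a (b \<otimes>\<^bsub>H\<^esub> (\<epsilon> c \<odot>\<^bsub>H\<^esub> d))"
          by (simp add: HH.tensor_lift_pt[OF G \<beta>])
      qed
      also have "\<dots> = \<beta> a (b \<otimes>\<^bsub>H\<^esub> pair_sum (add_monoid H) (\<lambda>c d. \<epsilon> c \<odot>\<^bsub>H\<^esub> d) qs)"
        by (rule M.add.pair_sum_hom[OF G, of "\<lambda>x. \<beta> a (b \<otimes>\<^bsub>H\<^esub> x)", symmetric])
          (use \<beta> in \<open>auto simp: hom_def balanced_def H.r_distr dest: qsD\<close>)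
      also have "pair_sum (add_monoid H) (\<lambda>c d. \<epsilon> c \<odot>\<^bsub>H\<^esub> d) qs = sw (\<lambda>c d. \<epsilon> c \<odot>\<^bsub>H\<^esub> d) q"
        by (rule sw_list[symmetric, OF _ _ qsc qs(2)]) (simp_all add: lins)
      also have "\<dots> = q" by (subst sw_counit_l) (simp_all add: lins)
      also have "\<beta> a (b \<otimes>\<^bsub>H\<^esub> q) = \<one>\<^bsub>G\<^esub>" using ab q(3) by (intro vanish(2) ideal_prod.prod)
      finally show "tensor_lift G \<beta> (pair_sum HH.T (\<lambda>c d. HH.pt (a \<otimes>\<^bsub>H\<^esub> c) (b \<otimes>\<^bsub>H\<^esub> d)) qs) = \<one>\<^bsub>G\<^esub>" .
    qed
    also have "\<dots> = \<one>\<^bsub>G\<^esub>" by (induction ps) auto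
    finally show ?case by simp
  next
    case (sum z w)
    then have zw: "z \<in> carrier H" "w \<in> carrier H" by auto
    then have "\<Delta> (z \<oplus>\<^bsub>H\<^esub> w) = \<Delta> z \<otimes>\<^bsub>HH.T\<^esub> \<Delta> w"
      using comult_linear by (auto simp: module_hom_def)
    then show ?case using sum zw hom by (auto simp: hom_def)
  qed
  then show ?thesis by simp
qed

text \<open>Well-definedness of the comultiplication on cosets: the two representatives differ by an
  element of the ideal, where the lift is trivial. Vanishing is asked against \<open>P\<close> only,
  since both presentations consist of pairs from \<open>P\<close>.\<close>

lemma balanced_descends:
  assumes P: "hs P" and Q: "hs Q" and QP: "Q \<subseteq> P"
    and G: "comm_group G" and \<beta>: "balanced K H H G \<beta>"
    and vanish: "\<And>i y. i \<in> ip P (aug Q) \<Longrightarrow> y \<in> P \<Longrightarrow> \<beta> i y = \<one>\<^bsub>G\<^esub>"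
      "\<And>x i. x \<in> P \<Longrightarrow> i \<in> ip P (aug Q) \<Longrightarrow> \<beta> x i = \<one>\<^bsub>G\<^esub>"
    and x: "x \<in> P" "set xs \<subseteq> P \<times> P" "\<Delta> x = pair_sum HH.T HH.pt xs"
    and y: "y \<in> P" "set ys \<subseteq> P \<times> P" "\<Delta> y = pair_sum HH.T HH.pt ys"
    and xy: "x \<ominus>\<^bsub>H\<^esub> y \<in> ip P (aug Q)"
  shows "pair_sum G \<beta> xs = pair_sum G \<beta> ys"
proof -
  interpret G: comm_group G by fact
  note Pc = hsD(5)[OF P] and hom = HH.tensor_lift_hom[OF G \<beta>]
  have [simp]: "x \<in> carrier H" "y \<in> carrier H" using x y Pc by auto
  have c: "set xs \<subseteq> carrier H \<times> carrier H" "set ys \<subseteq> carrier H \<times> carrier H" using x(2) y(2) Pc by auto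
  have e: "tensor_lift G \<beta> (\<Delta> x) = pair_sum G \<beta> xs" "tensor_lift G \<beta> (\<Delta> y) = pair_sum G \<beta> ys"
    using HH.tensor_lift_pair_sum[OF G \<beta> c(1)] HH.tensor_lift_pair_sum[OF G \<beta> c(2)] x(3) y(3) by auto
  have "(x \<ominus>\<^bsub>H\<^esub> y) \<oplus>\<^bsub>H\<^esub> y = x" by (simp add: a_minus_def M.a_assoc M.l_neg)
  moreover have "\<Delta> ((x \<ominus>\<^bsub>H\<^esub> y) \<oplus>\<^bsub>H\<^esub> y) = \<Delta> (x \<ominus>\<^bsub>H\<^esub> y) \<otimes>\<^bsub>HH.T\<^esub> \<Delta> y"
    using comult_linear by (auto simp: module_hom_def)
  ultimately have "tensor_lift G \<beta> (\<Delta> x) = tensor_lift G \<beta> (\<Delta> (x \<ominus>\<^bsub>H\<^esub> y)) \<otimes>\<^bsub>G\<^esub> tensor_lift G \<beta> (\<Delta> y)"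
    using hom by (simp add: hom_def)
  moreover have "tensor_lift G \<beta> (\<Delta> (x \<ominus>\<^bsub>H\<^esub> y)) = \<one>\<^bsub>G\<^esub>"
    by (rule balanced_vanishes_on_ideal[OF P Q QP G \<beta> vanish xy])
  moreover have "tensor_lift G \<beta> (\<Delta> y) \<in> carrier G"
    using hom by (auto simp: hom_def)
  ultimately show ?thesis using e by simp
qed

end

subsection \<open>Factors\<close>

text \<open>Both subalgebras are kept inside \<open>H\<close>, so cosets have representatives in
  \<open>H\<close> and the ideal is formed there; \<open>hopf_factor_eq\<close> identifies the
  result with the factor of \<open>sub_hopf\<close>.\<close>

locale hopf_quotient = hopf_algebra K H
  for K :: "('k, 'r) ring_scheme" and H :: "('k, 'h, 's) hopf_scheme" +
  fixes P Q :: "'h set"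
  assumes fd: fin_dim and P: "hs P" and Q: "hs Q" and QP: "Q \<subseteq> P" and norm: "normalizes P Q"
begin

abbreviation "I \<equiv> ip P (aug Q)"
abbreviation "\<pi> x \<equiv> I +>\<^bsub>H\<^esub> x"
abbreviation "U \<equiv> quotient_module (sub_hopf K H P) I"
abbreviation "E \<equiv> hopf_factor K (sub_hopf K H P) Q"

lemmas ideal = normal_ideal[OF P Q QP norm]
lemmas Pc = hsD(5)[OF P]

lemma Ic: "i \<in> I \<Longrightarrow> i \<in> carrier H"
  using smodD(1)[OF ideal(1)] by auto

lemma proj_iff: "y \<in> \<pi> x \<longleftrightarrow> (\<exists>i\<in>I. y = i \<oplus>\<^bsub>H\<^esub> x)"
  by (auto simp: a_r_coset_def')

lemma proj_mem_iff: "x \<in> carrier H \<Longrightarrow> y \<in> \<pi> x \<longleftrightarrow> y \<in> carrier H \<and> y \<ominus>\<^bsub>H\<^esub> x \<in> I"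
proof
  assume x: "x \<in> carrier H"
  assume "y \<in> \<pi> x"
  then obtain i where i: "i \<in> I" "y = i \<oplus>\<^bsub>H\<^esub> x" by (auto simp: proj_iff)
  then have "y \<ominus>\<^bsub>H\<^esub> x = i" using x Ic[OF i(1)] by (simp add: a_minus_def M.a_assoc M.r_neg)
  then show "y \<in> carrier H \<and> y \<ominus>\<^bsub>H\<^esub> x \<in> I" using i x Ic[OF i(1)] by simp
next
  assume x: "x \<in> carrier H"
  assume "y \<in> carrier H \<and> y \<ominus>\<^bsub>H\<^esub> x \<in> I"
  moreover from this have "y = (y \<ominus>\<^bsub>H\<^esub> x) \<oplus>\<^bsub>H\<^esub> x" using x by (simp add: a_minus_def M.a_assoc M.l_neg)
  ultimately show "y \<in> \<pi> x" by (auto simp: proj_iff)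
qed

lemma proj_self: "x \<in> carrier H \<Longrightarrow> x \<in> \<pi> x"
  using smodD(2)[OF ideal(1)] by (simp add: proj_mem_iff a_minus_def M.r_neg)

lemma proj_eq_iff:
  assumes x: "x \<in> carrier H" and y: "y \<in> carrier H"
  shows "\<pi> x = \<pi> y \<longleftrightarrow> x \<ominus>\<^bsub>H\<^esub> y \<in> I"
proof
  assume "\<pi> x = \<pi> y"
  then show "x \<ominus>\<^bsub>H\<^esub> y \<in> I" using proj_self[OF x] proj_mem_iff[OF y] by auto
next
  assume d: "x \<ominus>\<^bsub>H\<^esub> y \<in> I"
  have "z \<ominus>\<^bsub>H\<^esub> x \<in> I \<longleftrightarrow> z \<ominus>\<^bsub>H\<^esub> y \<in> I" if z: "z \<in> carrier H" for z
  proof -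
    have "z \<ominus>\<^bsub>H\<^esub> y = (z \<ominus>\<^bsub>H\<^esub> x) \<oplus>\<^bsub>H\<^esub> (x \<ominus>\<^bsub>H\<^esub> y)"
      using x y z by (simp add: a_minus_def M.a_assoc) (simp add: M.a_assoc[symmetric] M.l_neg)
    then show ?thesis using smod_add_cancel[OF ideal(1) _ d, of "z \<ominus>\<^bsub>H\<^esub> x"] x z by simp
  qed
  then show "\<pi> x = \<pi> y" using x y by (auto simp: proj_mem_iff)
qed

lemma hopf_factor_eq: "E = quotient_hopf K (sub_hopf K H P) I"
proof -
  have "z \<in> ideal_prod (sub_hopf K H P) P (aug Q)" if "z \<in> I" for z
    using that
  proof induction
    case (prod i j)
    then show ?case using ideal_prod.prod[of i P j "aug Q" "sub_hopf K H P"] by simp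
  next
    case (sum s t)
    then show ?case using ideal_prod.sum[of s "sub_hopf K H P" P "aug Q" t] by simp
  qed
  moreover have "z \<in> I" if "z \<in> ideal_prod (sub_hopf K H P) P (aug Q)" for z
    using that
  proof induction
    case (prod i j)
    then show ?case using ideal_prod.prod[of i P j "aug Q" H] by simp
  next
    case (sum s t)
    then show ?case using ideal_prod.sum[of s H P "aug Q" t] by simp
  qed
  ultimately have "ideal_prod (sub_hopf K H P) P (aug Q) = I" by blast
  then show ?thesis by (simp add: hopf_factor_def augmentation_def)
qed

lemma proj_sub: "I +>\<^bsub>sub_hopf K H P\<^esub> x = \<pi> x"
  by (simp add: a_r_coset_def')

lemma proj_sub_P: "x \<in> P \<Longrightarrow> y \<in> \<pi> x \<Longrightarrow> y \<in> P"
  using ideal(2) hsD(1)[OF P] by (auto simp: proj_iff smodD)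

text \<open>The structure maps of the quotient pick representatives by \<open>SOME\<close>; what
  matters of the choice is that it stays in \<open>P\<close> and differs from \<open>x\<close> by an
  element of the ideal.\<close>

lemma some_proj:
  assumes x: "x \<in> P"
  shows "(SOME y. y \<in> \<pi> x) \<in> P" "\<pi> (SOME y. y \<in> \<pi> x) = \<pi> x" "(SOME y. y \<in> \<pi> x) \<ominus>\<^bsub>H\<^esub> x \<in> I"
proof -
  have m: "(SOME y. y \<in> \<pi> x) \<in> \<pi> x" using proj_self[OF Pc[OF x]] by (rule someI)
  then show P: "(SOME y. y \<in> \<pi> x) \<in> P" using proj_sub_P[OF x] by simp
  show "(SOME y. y \<in> \<pi> x) \<ominus>\<^bsub>H\<^esub> x \<in> I" using m proj_mem_iff[OF Pc[OF x]] by simp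
  then show "\<pi> (SOME y. y \<in> \<pi> x) = \<pi> x" using proj_eq_iff[OF Pc[OF P] Pc[OF x]] by simp
qed

lemma carrier_U: "carrier U = {\<pi> x | x. x \<in> P}"
  by (auto simp: quotient_module_def ring.defs module.defs FactRing_def A_RCOSETS_def' proj_sub)

lemma proj_closed [simp]: "x \<in> P \<Longrightarrow> \<pi> x \<in> carrier U"
  by (auto simp: carrier_U)

lemma proj_add: "x \<in> P \<Longrightarrow> y \<in> P \<Longrightarrow> \<pi> x \<oplus>\<^bsub>U\<^esub> \<pi> y = \<pi> (x \<oplus>\<^bsub>H\<^esub> y)"
proof -
  assume x: "x \<in> P" and y: "y \<in> P"
  note [simp] = Pc[OF x] Pc[OF y]
  have "\<pi> x \<oplus>\<^bsub>U\<^esub> \<pi> y = (\<Union>u\<in>\<pi> x. \<Union>v\<in>\<pi> y. {u \<oplus>\<^bsub>H\<^esub> v})"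
    by (simp add: quotient_module_def ring.defs module.defs FactRing_def set_add_def')
  also have "\<dots> = \<pi> (x \<oplus>\<^bsub>H\<^esub> y)"
  proof
    show "(\<Union>u\<in>\<pi> x. \<Union>v\<in>\<pi> y. {u \<oplus>\<^bsub>H\<^esub> v}) \<subseteq> \<pi> (x \<oplus>\<^bsub>H\<^esub> y)"
    proof clarsimp
      fix u v assume "u \<in> \<pi> x" "v \<in> \<pi> y"
      then obtain i j where ij: "i \<in> I" "j \<in> I" "u = i \<oplus>\<^bsub>H\<^esub> x" "v = j \<oplus>\<^bsub>H\<^esub> y" by (auto simp: proj_iff)
      then have "u \<oplus>\<^bsub>H\<^esub> v = (i \<oplus>\<^bsub>H\<^esub> j) \<oplus>\<^bsub>H\<^esub> (x \<oplus>\<^bsub>H\<^esub> y)" using Ic by (simp add: M.add.m_ac)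
      then show "u \<oplus>\<^bsub>H\<^esub> v \<in> \<pi> (x \<oplus>\<^bsub>H\<^esub> y)" using ij smodD(3)[OF ideal(1)] by (auto simp: proj_iff)
    qed
    show "\<pi> (x \<oplus>\<^bsub>H\<^esub> y) \<subseteq> (\<Union>u\<in>\<pi> x. \<Union>v\<in>\<pi> y. {u \<oplus>\<^bsub>H\<^esub> v})"
    proof
      fix z assume "z \<in> \<pi> (x \<oplus>\<^bsub>H\<^esub> y)"
      then obtain i where i: "i \<in> I" "z = i \<oplus>\<^bsub>H\<^esub> (x \<oplus>\<^bsub>H\<^esub> y)" by (auto simp: proj_iff)
      then have "z = (i \<oplus>\<^bsub>H\<^esub> x) \<oplus>\<^bsub>H\<^esub> y" "i \<oplus>\<^bsub>H\<^esub> x \<in> \<pi> x" using Ic by (auto simp: M.a_assoc proj_iff)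
      then show "z \<in> (\<Union>u\<in>\<pi> x. \<Union>v\<in>\<pi> y. {u \<oplus>\<^bsub>H\<^esub> v})" using proj_self[of y] by auto
    qed
  qed
  finally show ?thesis .
qed

lemma proj_zero: "\<zero>\<^bsub>U\<^esub> = \<pi> \<zero>\<^bsub>H\<^esub>"
proof -
  have "\<pi> \<zero>\<^bsub>H\<^esub> = I" using Ic by (force simp: a_r_coset_def')
  then show ?thesis by (simp add: quotient_module_def ring.defs module.defs FactRing_def)
qed

lemma proj_smult: "c \<in> carrier K \<Longrightarrow> x \<in> P \<Longrightarrow> c \<odot>\<^bsub>U\<^esub> \<pi> x = \<pi> (c \<odot>\<^bsub>H\<^esub> x)"
proof -
  assume c: "c \<in> carrier K" and x: "x \<in> P"
  let ?y = "SOME y. y \<in> \<pi> x"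
  note y = some_proj[OF x]
  have [simp]: "?y \<in> carrier H" "x \<in> carrier H" using y x Pc by auto
  have "c \<odot>\<^bsub>H\<^esub> ?y \<ominus>\<^bsub>H\<^esub> c \<odot>\<^bsub>H\<^esub> x = c \<odot>\<^bsub>H\<^esub> (?y \<ominus>\<^bsub>H\<^esub> x)"
    using c by (simp add: a_minus_def smult_r_distr smult_r_minus)
  then have "\<pi> (c \<odot>\<^bsub>H\<^esub> ?y) = \<pi> (c \<odot>\<^bsub>H\<^esub> x)"
    using c y(3) smodD(4)[OF ideal(1) c] by (subst proj_eq_iff) simp_all
  then show ?thesis by (simp add: quotient_module_def ring.defs module.defs proj_sub)
qed

lemma carrier_UE: "X \<in> carrier U \<Longrightarrow> (\<And>x. x \<in> P \<Longrightarrow> X = \<pi> x \<Longrightarrow> thesis) \<Longrightarrow> thesis"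
  by (auto simp: carrier_U)

lemma module_U: "module K U"
proof -
  note W = hsD(1)[OF P]
  note simps = smodD(2-4)[OF W] Pc proj_add proj_smult proj_zero
  have "abelian_group U"
  proof (rule abelian_groupI)
    fix X assume "X \<in> carrier U"
    then show "\<exists>Y\<in>carrier U. Y \<oplus>\<^bsub>U\<^esub> X = \<zero>\<^bsub>U\<^esub>"
    proof (elim carrier_UE)
      fix x assume x: "x \<in> P" "X = \<pi> x"
      then have "\<pi> (\<ominus>\<^bsub>H\<^esub> x) \<oplus>\<^bsub>U\<^esub> X = \<zero>\<^bsub>U\<^esub>" using smod_minus[OF W] by (simp add: simps M.l_neg)
      then show ?thesis using proj_closed[OF smod_minus[OF W x(1)]] by blast
    qed
  qed ((elim carrier_UE)?, simp add: simps M.add.m_ac)+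
  then show ?thesis
    by (intro moduleI[OF R.cring_axioms]; (elim carrier_UE)?)
      (simp_all add: simps smult_l_distr smult_r_distr smult_assoc1)
qed

sublocale UU: two_modules K U U
  by (rule two_modules.intro[OF module_U module_U])

lemma E_simps [simp]:
  "carrier E = carrier U" "mult E = mult U" "one E = one U" "zero E = zero U" "add E = add U" "smult E = smult U"
  by (simp_all add: hopf_factor_eq quotient_hopf_def hopf.defs module.defs quotient_module_def ring.defs)

lemma tensor_E [simp]:
  "tensor_group K E E = UU.T" "pure_tensor K E E = UU.pt" "tensor K E E = tensor K U U"
proof -
  have *: "tensor_relators K E E = tensor_relators K U U" by (simp add: tensor_relators_def)
  show g: "tensor_group K E E = UU.T" by (simp add: tensor_group_def tensor_relations_def *)
  show p: "pure_tensor K E E = UU.pt" by (intro ext) (simp add: pure_tensor_def tensor_relations_def *)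
  show "tensor K E E = tensor K U U" by (simp add: tensor_def g p)
qed

lemma proj_one: "\<one>\<^bsub>U\<^esub> = \<pi> \<one>\<^bsub>H\<^esub>"
  by (simp add: quotient_module_def ring.defs module.defs FactRing_def proj_sub)

lemma proj_mult: "x \<in> P \<Longrightarrow> y \<in> P \<Longrightarrow> \<pi> x \<otimes>\<^bsub>U\<^esub> \<pi> y = \<pi> (x \<otimes>\<^bsub>H\<^esub> y)"
proof -
  assume x: "x \<in> P" and y: "y \<in> P"
  note [simp] = Pc[OF x] Pc[OF y]
  have "\<pi> (u \<otimes>\<^bsub>H\<^esub> v) = \<pi> (x \<otimes>\<^bsub>H\<^esub> y)" if u: "u \<in> \<pi> x" and v: "v \<in> \<pi> y" for u v
  proof -
    obtain i j where ij: "i \<in> I" "j \<in> I" "u = i \<oplus>\<^bsub>H\<^esub> x" "v = j \<oplus>\<^bsub>H\<^esub> y" using u v by (auto simp: proj_iff)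
    note [simp] = Ic[OF ij(1)] Ic[OF ij(2)]
    have vP: "v \<in> P" using proj_sub_P[OF y v] .
    have "u \<otimes>\<^bsub>H\<^esub> v = (i \<otimes>\<^bsub>H\<^esub> v \<oplus>\<^bsub>H\<^esub> x \<otimes>\<^bsub>H\<^esub> j) \<oplus>\<^bsub>H\<^esub> x \<otimes>\<^bsub>H\<^esub> y"
      by (simp add: ij(3,4) H.l_distr H.r_distr M.add.m_ac)
    then have "u \<otimes>\<^bsub>H\<^esub> v \<ominus>\<^bsub>H\<^esub> x \<otimes>\<^bsub>H\<^esub> y = i \<otimes>\<^bsub>H\<^esub> v \<oplus>\<^bsub>H\<^esub> x \<otimes>\<^bsub>H\<^esub> j"
      by (simp add: ij(4) a_minus_def M.a_assoc M.r_neg)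
    moreover have "i \<otimes>\<^bsub>H\<^esub> v \<oplus>\<^bsub>H\<^esub> x \<otimes>\<^bsub>H\<^esub> j \<in> I"
      using ideal(5)[OF vP ij(1)] ideal(4)[OF x ij(2)] by (rule smodD(3)[OF ideal(1)])
    ultimately show ?thesis by (subst proj_eq_iff) (simp_all add: ij(3,4))
  qed
  then have "(\<Union>u\<in>\<pi> x. \<Union>v\<in>\<pi> y. \<pi> (u \<otimes>\<^bsub>H\<^esub> v)) = (\<Union>u\<in>\<pi> x. \<Union>v\<in>\<pi> y. \<pi> (x \<otimes>\<^bsub>H\<^esub> y))"
    by (simp cong: SUP_cong)
  moreover have "\<pi> a \<noteq> {}" if "a \<in> P" for a
  proof
    assume "\<pi> a = {}"
    then show False using proj_self[OF Pc[OF that]] by simp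
  qed
  moreover have "\<pi> x \<otimes>\<^bsub>U\<^esub> \<pi> y = (\<Union>u\<in>\<pi> x. \<Union>v\<in>\<pi> y. \<pi> (u \<otimes>\<^bsub>H\<^esub> v))"
    by (simp add: quotient_module_def ring.defs module.defs FactRing_def rcoset_mult_def proj_sub)
  ultimately show ?thesis using x y by simp
qed

lemma counit_proj: "x \<in> P \<Longrightarrow> counit E (\<pi> x) = \<epsilon> x"
proof -
  assume x: "x \<in> P"
  let ?y = "SOME y. y \<in> \<pi> x"
  note y = some_proj[OF x]
  have [simp]: "?y \<in> carrier H" "x \<in> carrier H" using y x Pc by auto
  have "?y = (?y \<ominus>\<^bsub>H\<^esub> x) \<oplus>\<^bsub>H\<^esub> x" by (simp add: a_minus_def M.a_assoc M.l_neg)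
  then have "\<epsilon> ?y = \<epsilon> (?y \<ominus>\<^bsub>H\<^esub> x) \<oplus>\<^bsub>K\<^esub> \<epsilon> x"
    using fnl_add[OF fnl_counit, of "?y \<ominus>\<^bsub>H\<^esub> x" x] by simp
  then show ?thesis using ideal(6)[OF y(3)]
    by (simp add: hopf_factor_eq quotient_hopf_def hopf.defs module.defs)
qed

lemma antipode_proj: "x \<in> P \<Longrightarrow> antipode E (\<pi> x) = \<pi> (S x)"
proof -
  assume x: "x \<in> P"
  let ?y = "SOME y. y \<in> \<pi> x"
  note y = some_proj[OF x]
  have [simp]: "?y \<in> carrier H" "x \<in> carrier H" using y x Pc by auto
  have "S (?y \<ominus>\<^bsub>H\<^esub> x) = S ?y \<ominus>\<^bsub>H\<^esub> S x"
    using lin_diff[of S ?y x] lin_antipode[OF lin_id] by simp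
  then have "\<pi> (S ?y) = \<pi> (S x)" using ideal(7)[OF y(3)] by (subst proj_eq_iff) simp_all
  then show ?thesis by (simp add: hopf_factor_eq quotient_hopf_def hopf.defs module.defs proj_sub)
qed

text \<open>The chosen representative is exchanged for \<open>x\<close> by
  \<open>balanced_descends\<close>. That lemma concerns maps on all of \<open>H\<close>, while the
  coset of an element is in the factor only for elements of \<open>P\<close>; hence the coset map is
  first extended by a projection onto \<open>P\<close>.\<close>

lemma comult_proj:
  assumes x: "x \<in> P" and xs: "set xs \<subseteq> P \<times> P" "\<Delta> x = pair_sum HH.T HH.pt xs"
  shows "comult E (\<pi> x) = pair_sum UU.T (\<lambda>u v. UU.pt (\<pi> u) (\<pi> v)) xs"
proof -
  interpret A: two_modules K "H\<lparr>carrier := P\<rparr>" "H\<lparr>carrier := P\<rparr>" by (rule two_modules_sub[OF hsD(1)[OF P]])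
  let ?y = "SOME y. y \<in> \<pi> x"
  note y = some_proj[OF x]
  obtain ys where ys: "set ys \<subseteq> P \<times> P" "\<Delta> ?y = pair_sum HH.T HH.pt ys" using hs_legs[OF P y(1)] .
  obtain pr where pr: "lin pr" "\<And>x. x \<in> carrier H \<Longrightarrow> pr x \<in> P" "\<And>x. x \<in> P \<Longrightarrow> pr x = x"
    using projection_onto[OF fd hsD(1)[OF P]] by blast
  have hom: "\<pi> \<in> module_hom K (H\<lparr>carrier := P\<rparr>) U"
    by (auto simp: module_hom_def proj_add proj_smult)
  let ?\<gamma> = "\<lambda>u v. UU.pt (\<pi> (pr u)) (\<pi> (pr v))"
  have "(\<lambda>u. \<pi> (pr u)) \<in> module_hom K H U"
    using pr by (auto simp: module_hom_def lin_add lin_smult proj_add[symmetric] proj_smult[symmetric])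
  from HH.tensor_map_balanced[OF UU.two_modules_axioms this this, of "[]"]
  have \<gamma>: "balanced K H H UU.T ?\<gamma>" by (simp add: balanced_def)
  have zero: "\<pi> i = \<zero>\<^bsub>U\<^esub>" if "i \<in> I" for i
    using that Ic[OF that] by (simp add: proj_zero proj_eq_iff a_minus_def)
  have zeroP: "\<zero>\<^bsub>H\<^esub> \<in> P" by (rule smodD(2)[OF hsD(1)[OF P]])
  have z0: "\<pi> \<zero>\<^bsub>H\<^esub> = \<zero>\<^bsub>U\<^esub>" by (rule proj_zero[symmetric])
  have "comult E (\<pi> x) = tensor_map K U U \<pi> \<pi> (comult (sub_hopf K H P) ?y)"
    by (simp add: hopf_factor_eq quotient_hopf_def hopf.defs module.defs proj_sub)
  also have "\<dots> = pair_sum UU.T (\<lambda>u v. UU.pt (\<pi> u) (\<pi> v)) ys"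
    unfolding comult_sub_hopf[OF fd hsD(1)[OF P] ys]
    by (rule A.tensor_map_pair_sum[OF UU.two_modules_axioms hom hom]) (use ys(1) in simp)
  also have "\<dots> = pair_sum UU.T ?\<gamma> ys"
    using ys(1) pr(3) by (intro pair_sum_cong) auto
  also have "\<dots> = pair_sum UU.T ?\<gamma> xs"
  proof (rule balanced_descends[OF P Q QP UU.T.comm_group_axioms \<gamma> _ _ y(1) ys x xs y(3)])
    fix i u assume i: "i \<in> I" and u: "u \<in> P"
    have "pr i = i" "pr \<zero>\<^bsub>H\<^esub> = \<zero>\<^bsub>H\<^esub>" using pr(3) ideal(2) i zeroP by auto
    then have "?\<gamma> i u = ?\<gamma> \<zero>\<^bsub>H\<^esub> u" "?\<gamma> u i = ?\<gamma> u \<zero>\<^bsub>H\<^esub>" using zero[OF i] z0 by simp_all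
    then show "?\<gamma> i u = \<one>\<^bsub>UU.T\<^esub>" "?\<gamma> u i = \<one>\<^bsub>UU.T\<^esub>"
      using balanced_zero[OF UU.T.comm_group_axioms \<gamma> Pc[OF u]] by simp_all
  qed
  also have "\<dots> = pair_sum UU.T (\<lambda>u v. UU.pt (\<pi> u) (\<pi> v)) xs"
    using xs(1) pr(3) by (intro pair_sum_cong) auto
  finally show ?thesis .
qed

end

subsection \<open>The Zassenhaus isomorphism\<close>

context hopf_algebra
begin

text \<open>Both factors are images of \<open>D\<close> with the same kernel in \<open>D\<close>, so
  the coset of \<open>d\<close> can be sent to the coset of \<open>d\<close>. The comultiplications
  correspond because one presentation of \<open>\<Delta> d\<close> by pairs from \<open>D\<close>
  serves on both sides.\<close>

lemma hopf_isomorphic_factors: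
  assumes D: "hs D" and q1: "hopf_quotient K H P1 Q1" and q2: "hopf_quotient K H P2 Q2"
    and DP: "D \<subseteq> P1" "D \<subseteq> P2"
    and surj1: "\<And>p. p \<in> P1 \<Longrightarrow> \<exists>d\<in>D. \<exists>i\<in>ip P1 (aug Q1). p = d \<oplus>\<^bsub>H\<^esub> i"
    and surj2: "\<And>p. p \<in> P2 \<Longrightarrow> \<exists>d\<in>D. \<exists>i\<in>ip P2 (aug Q2). p = d \<oplus>\<^bsub>H\<^esub> i"
    and ker: "\<And>d. d \<in> D \<Longrightarrow> d \<in> ip P1 (aug Q1) \<longleftrightarrow> d \<in> ip P2 (aug Q2)"
  shows "hopf_isomorphic K (hopf_factor K (sub_hopf K H P1) Q1) (hopf_factor K (sub_hopf K H P2) Q2)"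
proof -
  interpret q1: hopf_quotient K H P1 Q1 by fact
  interpret q2: hopf_quotient K H P2 Q2 by fact
  note Dc = hsD(5)[OF D] and W = hsD(1)[OF D]
  have P12: "d \<in> P1" "d \<in> P2" if "d \<in> D" for d using that DP by auto
  have eq: "q1.\<pi> d = q1.\<pi> e \<longleftrightarrow> q2.\<pi> d = q2.\<pi> e" if "d \<in> D" "e \<in> D" for d e
    using that by (simp add: q1.proj_eq_iff q2.proj_eq_iff Dc ker smod_diff[OF W])
  have surj1': "\<exists>d\<in>D. X = q1.\<pi> d" if X: "X \<in> carrier q1.U" for X
  proof -
    obtain p where p: "p \<in> P1" "X = q1.\<pi> p" using X by (rule q1.carrier_UE)
    obtain d i where d: "d \<in> D" "i \<in> q1.I" "p = d \<oplus>\<^bsub>H\<^esub> i" using surj1[OF p(1)] by blast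
    then have "p \<ominus>\<^bsub>H\<^esub> d = i"
      using Dc q1.Ic M.a_comm[of d i] by (simp add: a_minus_def M.a_assoc M.r_neg)
    then show ?thesis using p d Dc q1.Pc by (intro bexI[of _ d]) (simp_all add: q1.proj_eq_iff)
  qed
  have surj2': "\<exists>d\<in>D. X = q2.\<pi> d" if X: "X \<in> carrier q2.U" for X
  proof -
    obtain p where p: "p \<in> P2" "X = q2.\<pi> p" using X by (rule q2.carrier_UE)
    obtain d i where d: "d \<in> D" "i \<in> q2.I" "p = d \<oplus>\<^bsub>H\<^esub> i" using surj2[OF p(1)] by blast
    then have "p \<ominus>\<^bsub>H\<^esub> d = i"
      using Dc q2.Ic M.a_comm[of d i] by (simp add: a_minus_def M.a_assoc M.r_neg)
    then show ?thesis using p d Dc q2.Pc by (intro bexI[of _ d]) (simp_all add: q2.proj_eq_iff)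
  qed
  \<comment> \<open>Any element of \<open>D\<close> in the coset will do: \<open>surj1'\<close>
    provides one, and \<open>eq\<close> makes the value independent of the choice.\<close>
  define f where "f X = q2.\<pi> (SOME d. d \<in> D \<and> q1.\<pi> d = X)" for X
  have f: "f (q1.\<pi> d) = q2.\<pi> d" if d: "d \<in> D" for d
  proof -
    have "(SOME e. e \<in> D \<and> q1.\<pi> e = q1.\<pi> d) \<in> D \<and> q1.\<pi> (SOME e. e \<in> D \<and> q1.\<pi> e = q1.\<pi> d) = q1.\<pi> d"
      by (rule someI[of _ d]) (simp add: d)
    then show ?thesis using eq d unfolding f_def by blast
  qed
  have E: "thesis" if "X \<in> carrier q1.U" "\<And>d. d \<in> D \<Longrightarrow> X = q1.\<pi> d \<Longrightarrow> thesis" for X thesis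
    using surj1' that by blast
  have mh: "f \<in> module_hom K q1.U q2.U"
  proof -
    have 1: "f X \<in> carrier q2.U" if "X \<in> carrier q1.U" for X
      using that by (rule E) (simp add: f P12)
    have 2: "f (X \<oplus>\<^bsub>q1.U\<^esub> Y) = f X \<oplus>\<^bsub>q2.U\<^esub> f Y" if X: "X \<in> carrier q1.U" and Y: "Y \<in> carrier q1.U" for X Y
      by (rule E[OF X], rule E[OF Y]) (simp add: q1.proj_add q2.proj_add f P12 smodD(3)[OF W])
    have 3: "f (c \<odot>\<^bsub>q1.U\<^esub> X) = c \<odot>\<^bsub>q2.U\<^esub> f X" if c: "c \<in> carrier K" and X: "X \<in> carrier q1.U" for c X
      by (rule E[OF X]) (simp add: q1.proj_smult q2.proj_smult f P12 c smodD(4)[OF W])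
    show ?thesis using 1 2 3 by (simp add: module_hom_def)
  qed
  have rh: "f \<in> ring_hom q1.E q2.E"
  proof (rule ring_hom_memI)
    show "f X \<in> carrier q2.E" if "X \<in> carrier q1.E" for X
      using that mh by (auto simp: module_hom_def)
    show "f (X \<oplus>\<^bsub>q1.E\<^esub> Y) = f X \<oplus>\<^bsub>q2.E\<^esub> f Y" if "X \<in> carrier q1.E" "Y \<in> carrier q1.E" for X Y
      using that mh by (simp add: module_hom_def)
    show "f (X \<otimes>\<^bsub>q1.E\<^esub> Y) = f X \<otimes>\<^bsub>q2.E\<^esub> f Y" if "X \<in> carrier q1.E" "Y \<in> carrier q1.E" for X Y
    proof -
      have X: "X \<in> carrier q1.U" and Y: "Y \<in> carrier q1.U" using that by simp_all
      show ?thesis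
        by (rule E[OF X], rule E[OF Y]) (simp add: q1.proj_mult q2.proj_mult f P12 hsD(3)[OF D])
    qed
    show "f \<one>\<^bsub>q1.E\<^esub> = \<one>\<^bsub>q2.E\<^esub>" by (simp add: q1.proj_one q2.proj_one f hsD(2)[OF D])
  qed
  have co: "comult q2.E (f X) = tensor_map K q2.E q2.E f f (comult q1.E X) \<and>
      counit q2.E (f X) = counit q1.E X \<and> antipode q2.E (f X) = f (antipode q1.E X)"
    if X: "X \<in> carrier q1.U" for X
  proof (rule E[OF X], intro conjI)
    fix d assume d: "d \<in> D" and Xd: "X = q1.\<pi> d"
    show "counit q2.E (f X) = counit q1.E X"
      using d by (simp add: Xd f q1.counit_proj q2.counit_proj P12)
    show "antipode q2.E (f X) = f (antipode q1.E X)"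
      using d by (simp add: Xd f q1.antipode_proj q2.antipode_proj P12 hsD(4)[OF D])
    obtain ds where ds: "set ds \<subseteq> D \<times> D" "\<Delta> d = pair_sum HH.T HH.pt ds" using hs_legs[OF D d] .
    then have ds1: "set ds \<subseteq> P1 \<times> P1" and ds2: "set ds \<subseteq> P2 \<times> P2" using P12 by auto
    let ?ds = "map (\<lambda>(u, v). (q1.\<pi> u, q1.\<pi> v)) ds"
    have m: "set ?ds \<subseteq> carrier q1.U \<times> carrier q1.U" using ds1 by auto
    have "comult q1.E X = pair_sum q1.UU.T (\<lambda>u v. q1.UU.pt (q1.\<pi> u) (q1.\<pi> v)) ds"
      unfolding Xd by (rule q1.comult_proj[OF P12(1)[OF d] ds1 ds(2)])
    also have "\<dots> = pair_sum q1.UU.T q1.UU.pt ?ds" by (rule pair_sum_map[symmetric])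
    finally have "tensor_map K q2.E q2.E f f (comult q1.E X) =
        tensor_map K q2.U q2.U f f (pair_sum q1.UU.T q1.UU.pt ?ds)"
      by (simp only: tensor_map_def q2.tensor_E)
    also have "\<dots> = pair_sum q2.UU.T (\<lambda>X Y. q2.UU.pt (f X) (f Y)) ?ds"
      by (rule q1.UU.tensor_map_pair_sum[OF q2.UU.two_modules_axioms mh mh m])
    also have "\<dots> = pair_sum q2.UU.T (\<lambda>u v. q2.UU.pt (f (q1.\<pi> u)) (f (q1.\<pi> v))) ds"
      by (rule pair_sum_map[of _ "\<lambda>X Y. q2.UU.pt (f X) (f Y)"])
    also have "\<dots> = pair_sum q2.UU.T (\<lambda>u v. q2.UU.pt (q2.\<pi> u) (q2.\<pi> v)) ds"
      using ds(1) f by (intro pair_sum_cong) auto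
    also have "\<dots> = comult q2.E (f X)"
      unfolding Xd f[OF d] by (rule q2.comult_proj[OF P12(2)[OF d] ds2 ds(2), symmetric])
    finally show "comult q2.E (f X) = tensor_map K q2.E q2.E f f (comult q1.E X)" by (rule sym)
  qed
  have bij: "bij_betw f (carrier q1.U) (carrier q2.U)"
    unfolding bij_betw_def
  proof
    show "inj_on f (carrier q1.U)"
    proof (rule inj_onI)
      fix X Y assume X: "X \<in> carrier q1.U" and Y: "Y \<in> carrier q1.U" and e: "f X = f Y"
      show "X = Y"
        by (rule E[OF X], rule E[OF Y]) (use e eq in \<open>simp add: f\<close>)
    qed
    show "f ` carrier q1.U = carrier q2.U"
    proof
      show "f ` carrier q1.U \<subseteq> carrier q2.U" using mh by (auto simp: module_hom_def)
      show "carrier q2.U \<subseteq> f ` carrier q1.U"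
      proof
        fix X assume "X \<in> carrier q2.U"
        then obtain d where "d \<in> D" "X = q2.\<pi> d" using surj2' by blast
        then show "X \<in> f ` carrier q1.U"
          using f P12(1) by (intro image_eqI[of _ _ "q1.\<pi> d"]) simp_all
      qed
    qed
  qed
  have "f \<in> module_hom K q1.E q2.E" using mh by (simp add: module_hom_def)
  then have "f \<in> hopf_hom K q1.E q2.E"
    using rh co by (simp add: hopf_hom_def)
  then show ?thesis unfolding hopf_isomorphic_def using bij by (intro bexI[of _ f]) simp_all
qed

lemma hopf_isomorphic_factor_refl:
  assumes "hopf_quotient K H P Q"
  shows "hopf_isomorphic K (hopf_factor K (sub_hopf K H P) Q) (hopf_factor K (sub_hopf K H P) Q)"
proof -
  interpret q: hopf_quotient K H P Q by fact
  have "\<exists>d\<in>P. \<exists>i\<in>q.I. p = d \<oplus>\<^bsub>H\<^esub> i" if "p \<in> P" for p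
    using that smodD(2)[OF q.ideal(1)] q.Pc[OF that] by (intro bexI[of _ p] bexI[of _ "\<zero>\<^bsub>H\<^esub>"]) auto
  then show ?thesis by (intro hopf_isomorphic_factors[OF q.P assms assms]) auto
qed

text \<open>One side of the comparison, used twice with the indices exchanged. The identity
  \<open>D \<inter> N1 = L2 \<inter> N1\<close> brings the kernel into a form in which the two sides
  play the same part.\<close>

lemma zassenhaus_factor:
  assumes fd: fin_dim and N1: "hs N1" "normalizes L1 N1" "N1 \<subseteq> L1" and L1: "hs L1"
    and N2: "hs N2" "normalizes L2 N2" "N2 \<subseteq> L2" and L2: "hs L2"
  defines "D \<equiv> L1 \<inter> L2" and "P \<equiv> ip N1 (L1 \<inter> L2)" and "Q \<equiv> ip N1 (L1 \<inter> N2)"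
  shows "hopf_quotient K H P Q" "hs D" "D \<subseteq> P"
    "p \<in> P \<Longrightarrow> \<exists>d\<in>D. \<exists>i\<in>ip P (aug Q). p = d \<oplus>\<^bsub>H\<^esub> i"
    "d \<in> D \<Longrightarrow> d \<in> ip P (aug Q) \<longleftrightarrow>
      (\<exists>x\<in>ip D (aug (L2 \<inter> N1)). \<exists>y\<in>ip D (aug (L1 \<inter> N2)). d = x \<oplus>\<^bsub>H\<^esub> y)"
proof -
  let ?C = "L1 \<inter> N2"
  have C: "hs ?C" by (rule hs_Int[OF fd L1 N2(1)])
  show D: "hs D" unfolding D_def by (rule hs_Int[OF fd L1 L2])
  have CD: "?C \<subseteq> D" using N2(3) by (auto simp: D_def)
  have nN: "normalizes D N1" by (rule normalizes_mono[OF N1(2)]) (auto simp: D_def)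
  have nC: "normalizes D ?C"
    by (rule normalizes_Int[OF normalizes_mono[OF normalizes_self[OF L1]] normalizes_mono[OF N2(2)]])
      (auto simp: D_def)
  have P: "P = ip N1 D" by (simp add: P_def D_def)
  show "hopf_quotient K H P Q"
    unfolding P Q_def
  proof (intro hopf_quotient.intro hopf_quotient_axioms.intro hopf_algebra_axioms fd)
    show "hs (ip N1 D)" by (rule hs_ip[OF fd N1(1) D nN])
    show "hs (ip N1 ?C)" by (rule hs_ip[OF fd N1(1) C normalizes_mono[OF nN CD]])
    show "ip N1 ?C \<subseteq> ip N1 D" by (rule ip_mono[OF subset_refl CD])
    show "normalizes (ip N1 D) (ip N1 ?C)" by (rule normalizes_ip[OF fd N1(1) C D CD nN nC])
  qed
  show "D \<subseteq> P" unfolding P using ip_right[of D N1] hsD(5)[OF D] hsD(2)[OF N1(1)] by auto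
  show "\<exists>d\<in>D. \<exists>i\<in>ip P (aug Q). p = d \<oplus>\<^bsub>H\<^esub> i" if p: "p \<in> P"
    using ip_split_factor[OF fd N1(1) C D CD nN p[unfolded P]] unfolding P Q_def by blast
  have "D \<inter> N1 = L2 \<inter> N1" using N1(3) by (auto simp: D_def)
  then show "d \<in> ip P (aug Q) \<longleftrightarrow>
      (\<exists>x\<in>ip D (aug (L2 \<inter> N1)). \<exists>y\<in>ip D (aug (L1 \<inter> N2)). d = x \<oplus>\<^bsub>H\<^esub> y)" if d: "d \<in> D"
    using kernel_to_factor[OF fd N1(1) C D CD nN nC d] unfolding P Q_def by auto
qed

lemma zassenhaus:
  assumes fd: fin_dim and N1: "hs N1" "normalizes L1 N1" "N1 \<subseteq> L1" and L1: "hs L1"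
    and N2: "hs N2" "normalizes L2 N2" "N2 \<subseteq> L2" and L2: "hs L2"
  shows "hopf_isomorphic K (hopf_factor K (sub_hopf K H (ip N1 (L1 \<inter> L2))) (ip N1 (L1 \<inter> N2)))
    (hopf_factor K (sub_hopf K H (ip N2 (L2 \<inter> L1))) (ip N2 (L2 \<inter> N1)))"
proof -
  let ?D = "L1 \<inter> L2"
  note z1 = zassenhaus_factor[OF fd N1 L1 N2 L2]
  note z2 = zassenhaus_factor[OF fd N2 L2 N1 L1, unfolded Int_commute[of L2 L1]]
  have V: "smod (ip ?D (aug (L2 \<inter> N1)))" "smod (ip ?D (aug (L1 \<inter> N2)))"
    using hsD(1)[OF z1(2)] hsD(1)[OF hs_Int[OF fd L2 N1(1)]] hsD(1)[OF hs_Int[OF fd L1 N2(1)]]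
    by (simp_all add: ip_smod smod_aug)
  have c: "x \<oplus>\<^bsub>H\<^esub> y = y \<oplus>\<^bsub>H\<^esub> x" if "x \<in> ip ?D (aug (L2 \<inter> N1))" "y \<in> ip ?D (aug (L1 \<inter> N2))" for x y
    using that smodD(1)[OF V(1)] smodD(1)[OF V(2)] by (intro M.a_comm) auto
  show ?thesis
    unfolding Int_commute[of L2 L1]
  proof (rule hopf_isomorphic_factors[OF z1(2,1) z2(1) z1(3) z2(3) z1(4) z2(4)])
    fix d assume d: "d \<in> ?D"
    \<comment> \<open>The two kernel descriptions differ only in the order of the summands.\<close>
    show "d \<in> ip (ip N1 ?D) (aug (ip N1 (L1 \<inter> N2))) \<longleftrightarrow> d \<in> ip (ip N2 ?D) (aug (ip N2 (L2 \<inter> N1)))"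
      unfolding z1(5)[OF d] z2(5)[OF d] using c by metis
  qed
qed

end

subsection \<open>Schreier refinements\<close>

context hopf_algebra
begin

lemma ip_absorb:
  assumes N: "hs N" and L: "hs L" and NL: "N \<subseteq> L"
  shows "ip N L = L"
proof
  show "ip N L \<subseteq> L" by (rule ip_least[OF hsD(1)[OF L]]) (use NL hsD(3)[OF L] in auto)
  show "L \<subseteq> ip N L" using hsD(5)[OF L] hsD(2)[OF N] by (intro ip_right) auto
qed

lemma series_normalizes:
  assumes fd: fin_dim and A: "lower_subnormal_series K H n A" and i: "i < n"
  shows "normalizes (A i) (A (Suc i))"
  using A i normal_sub_hopf_iff[OF fd, of "A i" "A (Suc i)"] by (simp add: lower_subnormal_series_def)

lemma series_equivalent_refl:
  assumes fd: fin_dim and A: "lower_subnormal_series K H n A"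
  shows "series_equivalent K H n A n A"
  unfolding series_equivalent_def series_factor_def
proof (intro exI[of _ "\<lambda>i. i"] conjI allI impI)
  show "bij_betw (\<lambda>i. i) {..<n} {..<n}" by (simp add: bij_betw_def)
  show "hopf_isomorphic K (hopf_factor K (sub_hopf K H (A i)) (A (Suc i)))
      (hopf_factor K (sub_hopf K H (A i)) (A (Suc i)))" if i: "i < n" for i
  proof (rule hopf_isomorphic_factor_refl, intro hopf_quotient.intro hopf_quotient_axioms.intro)
    show "normalizes (A i) (A (Suc i))" by (rule series_normalizes[OF fd A i])
  qed (use A i fd hopf_algebra_axioms in \<open>auto simp: lower_subnormal_series_def\<close>)
qed

text \<open>The index \<open>k\<close> stands for the pair \<open>(k div m, k mod m)\<close>. The
  second coordinate stops before \<open>m\<close> because the term there coincides with the first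
  one of the next block; the default value \<open>A n\<close> supplies the final term at
  \<open>n * m\<close>.\<close>

definition schreier :: "(nat \<Rightarrow> 'h set) \<Rightarrow> nat \<Rightarrow> (nat \<Rightarrow> 'h set) \<Rightarrow> nat \<Rightarrow> nat \<Rightarrow> 'h set" where
  "schreier A n B m k =
     (if k < n * m then ip (A (Suc (k div m))) (A (k div m) \<inter> B (k mod m)) else A n)"

lemma mult_add_less:
  fixes i j m n :: nat
  assumes "i < n" "j < m"
  shows "i * m + j < n * m"
proof -
  have "i * m + j < Suc i * m" using assms by simp
  also have "\<dots> \<le> n * m" using assms by (intro mult_le_mono1) simp
  finally show ?thesis .
qed

text \<open>Allowing \<open>j = m\<close> lets every step be written with \<open>Suc j\<close>, also
  across the boundary between two blocks. There both expressions equal \<open>A (Suc i)\<close>,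
  since \<open>B m\<close> consists of scalars and \<open>B 0\<close> is everything.\<close>

lemma schreier_eq:
  assumes A: "lower_subnormal_series K H n A" and B: "lower_subnormal_series K H m B"
    and ij: "i < n" "j \<le> m" and m: "0 < m"
  shows "schreier A n B m (i * m + j) = ip (A (Suc i)) (A i \<inter> B j)"
proof (cases "j < m")
  case True
  then show ?thesis using mult_add_less[OF ij(1) True] by (simp add: schreier_def)
next
  case False
  then have j: "j = m" using ij by simp
  have hsA: "hs (A k)" if "k \<le> n" for k using A that by (simp add: lower_subnormal_series_def)
  have sub: "A (Suc k) \<subseteq> A k" if "k < n" for k using A that by (simp add: lower_subnormal_series_def)
  have Ac: "A k \<subseteq> carrier H" if "k \<le> n" for k using hsD(5)[OF hsA[OF that]] by auto
  have Bm: "B m = {c \<odot>\<^bsub>H\<^esub> \<one>\<^bsub>H\<^esub> | c. c \<in> carrier K}" and B0: "B 0 = carrier H"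
    using B by (simp_all add: lower_subnormal_series_def)
  have "ip (A (Suc i)) (A i \<inter> B m) = A (Suc i)"
  proof
    have W: "smod (A (Suc i))" using hsD(1)[OF hsA] ij by simp
    show "ip (A (Suc i)) (A i \<inter> B m) \<subseteq> A (Suc i)"
    proof (rule ip_least[OF W])
      fix x y assume x: "x \<in> A (Suc i)" and "y \<in> A i \<inter> B m"
      then obtain c where c: "c \<in> carrier K" "y = c \<odot>\<^bsub>H\<^esub> \<one>\<^bsub>H\<^esub>" by (auto simp: Bm)
      moreover have "x \<in> carrier H" using x Ac[of "Suc i"] ij by auto
      ultimately show "x \<otimes>\<^bsub>H\<^esub> y \<in> A (Suc i)"
        using smodD(4)[OF W c(1) x] by (simp add: smult_mult_right)
    qed
    have "\<one>\<^bsub>H\<^esub> \<in> B m" unfolding Bm using smult_one[of "\<one>\<^bsub>H\<^esub>"] by (auto intro!: exI[of _ "\<one>\<^bsub>K\<^esub>"])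
    then show "A (Suc i) \<subseteq> ip (A (Suc i)) (A i \<inter> B m)"
      using hsD(2)[OF hsA[of i]] Ac[of "Suc i"] ij by (intro ip_left) auto
  qed
  \<comment> \<open>The index either opens the block \<open>Suc i\<close>, or lies past the last
    block and takes the default value.\<close>
  moreover have "schreier A n B m (i * m + m) = A (Suc i)"
  proof (cases "Suc i < n")
    case True
    have "A (Suc i) \<inter> B 0 = A (Suc i)" using Ac[of "Suc i"] True B0 by auto
    moreover have "Suc i * m < n * m" by (rule mult_less_mono1[OF True m])
    ultimately have "schreier A n B m (Suc i * m) = ip (A (Suc (Suc i))) (A (Suc i))"
      using m by (simp add: schreier_def)
    also have "\<dots> = A (Suc i)"
      using True sub[OF True] by (intro ip_absorb hsA) auto
    finally show ?thesis by (simp add: add.commute)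
  next
    case False
    then have "n = Suc i" using ij by simp
    then show ?thesis by (simp add: schreier_def add.commute)
  qed
  ultimately show ?thesis by (simp add: j)
qed

lemma schreier_step:
  assumes fd: fin_dim and A: "lower_subnormal_series K H n A" and B: "lower_subnormal_series K H m B"
    and ij: "i < n" "j < m"
  shows "hopf_quotient K H (ip (A (Suc i)) (A i \<inter> B j)) (ip (A (Suc i)) (A i \<inter> B (Suc j)))"
  by (rule zassenhaus_factor(1)[OF fd])
    (use assms series_normalizes in \<open>auto simp: lower_subnormal_series_def\<close>)

lemma schreier_indices:
  fixes k m n :: nat
  assumes "k < n * m"
  obtains i j where "i < n" "j < m" "k = i * m + j"
proof -
  have "0 < m" using assms by (cases m) auto
  then have "k div m < n" "k mod m < m" using assms by (simp_all add: less_mult_imp_div_less)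
  then show thesis using that[of "k div m" "k mod m"] by simp
qed

text \<open>The terms of \<open>A\<close> sit at the block starts \<open>i * m\<close>, where
  intersecting with \<open>B 0\<close> is no restriction; normality of each step is contained in
  \<open>zassenhaus_factor\<close>.\<close>

lemma schreier_refinement:
  assumes fd: fin_dim and A: "lower_subnormal_series K H n A" and B: "lower_subnormal_series K H m B"
    and n: "0 < n" and m: "0 < m"
  shows "series_refinement K H n A (n * m) (schreier A n B m)"
proof -
  note eq = schreier_eq[OF A B _ _ m]
  have hsA: "hs (A k)" if "k \<le> n" for k using A that by (simp add: lower_subnormal_series_def)
  have Ac: "A k \<subseteq> carrier H" if "k \<le> n" for k using hsD(5)[OF hsA[OF that]] by auto
  have start: "schreier A n B m (i * m) = A i" if i: "i < n" for i
  proof -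
    have "A i \<inter> B 0 = A i" using Ac[of i] i B by (auto simp: lower_subnormal_series_def)
    then have "schreier A n B m (i * m) = ip (A (Suc i)) (A i)" using eq[of i 0] i by simp
    also have "\<dots> = A i"
      using A i by (intro ip_absorb) (auto simp: lower_subnormal_series_def)
    finally show ?thesis .
  qed
  have last: "schreier A n B m (n * m) = A n" by (simp add: schreier_def)
  have step: "hopf_quotient K H (schreier A n B m k) (schreier A n B m (Suc k))" if k: "k < n * m" for k
  proof -
    obtain i j where ij: "i < n" "j < m" "k = i * m + j" using k by (rule schreier_indices)
    then show ?thesis using schreier_step[OF fd A B ij(1,2)] eq[of i j] eq[of i "Suc j"] by simp
  qed
  have "lower_subnormal_series K H (n * m) (schreier A n B m)"
    unfolding lower_subnormal_series_def
  proof (intro conjI allI impI)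
    show "schreier A n B m 0 = carrier H"
      using start[of 0] n A by (simp add: lower_subnormal_series_def)
    show "schreier A n B m (n * m) = {c \<odot>\<^bsub>H\<^esub> \<one>\<^bsub>H\<^esub> | c. c \<in> carrier K}"
      using last A by (simp add: lower_subnormal_series_def)
    show "hs (schreier A n B m k)" if "k \<le> n * m" for k
    proof (cases "k < n * m")
      case True
      then show ?thesis using hopf_quotient.P[OF step] by simp
    next
      case False
      then show ?thesis using that last hsA[of n] by simp
    qed
    fix k assume "k < n * m"
    then interpret q: hopf_quotient K H "schreier A n B m k" "schreier A n B m (Suc k)" by (rule step)
    show "schreier A n B m (Suc k) \<subseteq> schreier A n B m k" by (rule q.QP)
    show "normal_hopf_subalgebra K (schreier A n B m (Suc k)) (sub_hopf K H (schreier A n B m k))"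
      using normal_sub_hopf_iff[OF fd q.P q.Q q.QP] q.norm by simp
  qed
  moreover have "strict_mono_on {0<..<n} (\<lambda>i. i * m)"
    using m by (intro strict_mono_onI) simp
  ultimately show ?thesis
    unfolding series_refinement_def using start m by (intro conjI exI[of _ "\<lambda>i. i * m"]) auto
qed

text \<open>The bijection transposes the grid of index pairs: the factor at \<open>(i, j)\<close> of
  one refinement is compared with the factor at \<open>(j, i)\<close> of the other.\<close>

lemma schreier_equivalent:
  assumes fd: fin_dim and A: "lower_subnormal_series K H n A" and B: "lower_subnormal_series K H m B"
    and n: "0 < n" and m: "0 < m"
  shows "series_equivalent K H (n * m) (schreier A n B m) (m * n) (schreier B m A n)"
  unfolding series_equivalent_def
proof (intro exI[of _ "\<lambda>k. (k mod m) * n + k div m"] conjI allI impI)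
  show "bij_betw (\<lambda>k. (k mod m) * n + k div m) {..<n * m} {..<m * n}"
  proof (rule bij_betw_byWitness[where f' = "\<lambda>k. (k mod n) * m + k div n"])
    show "\<forall>k\<in>{..<n * m}. ((k mod m) * n + k div m) mod n * m + ((k mod m) * n + k div m) div n = k"
      using m by (auto elim!: schreier_indices)
    show "\<forall>k\<in>{..<m * n}. ((k mod n) * m + k div n) mod m * n + ((k mod n) * m + k div n) div m = k"
      using n by (auto elim!: schreier_indices)
    show "(\<lambda>k. (k mod m) * n + k div m) ` {..<n * m} \<subseteq> {..<m * n}"
      by (auto elim!: schreier_indices simp: mult_add_less)
    show "(\<lambda>k. (k mod n) * m + k div n) ` {..<m * n} \<subseteq> {..<n * m}"
      by (auto elim!: schreier_indices simp: mult_add_less)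
  qed
  fix k assume "k < n * m"
  then obtain i j where ij: "i < n" "j < m" "k = i * m + j" by (rule schreier_indices)
  have k': "(k mod m) * n + k div m = j * n + i" using ij by simp
  have "hopf_isomorphic K
      (hopf_factor K (sub_hopf K H (ip (A (Suc i)) (A i \<inter> B j))) (ip (A (Suc i)) (A i \<inter> B (Suc j))))
      (hopf_factor K (sub_hopf K H (ip (B (Suc j)) (B j \<inter> A i))) (ip (B (Suc j)) (B j \<inter> A (Suc i))))"
    using A B ij series_normalizes[OF fd A ij(1)] series_normalizes[OF fd B ij(2)]
    by (intro zassenhaus[OF fd]) (auto simp: lower_subnormal_series_def)
  then show "hopf_isomorphic K (series_factor K H (schreier A n B m) k)
      (series_factor K H (schreier B m A n) ((k mod m) * n + k div m))"
    unfolding k' series_factor_def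
    using ij schreier_eq[OF A B ij(1) _ m, of j] schreier_eq[OF A B ij(1) _ m, of "Suc j"]
      schreier_eq[OF B A ij(2) _ n, of i] schreier_eq[OF B A ij(2) _ n, of "Suc i"] by simp
qed

text \<open>The second part is vacuous in the positions: a series of length 0 has no interior terms
  to be located.\<close>

lemma series_refinement_refl:
  "lower_subnormal_series K H n A \<Longrightarrow> series_refinement K H n A n A"
  "lower_subnormal_series K H n A \<Longrightarrow> series_refinement K H 0 B n A"
  unfolding series_refinement_def by (auto intro!: exI[of _ "\<lambda>i. i"] strict_mono_onI)

end

theorem theorem5p8:
  fixes K :: "('k, 'r) ring_scheme"
    and H :: "('k, 'h, 's) hopf_scheme"
    and n m :: nat
    and A B :: "nat \<Rightarrow> 'h set"
  assumes "hopf_algebra K H"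
    and "vectorspace.fin_dim K H"
    and "lower_subnormal_series K H n A"
    and "lower_subnormal_series K H m B"
  shows "\<exists>n' A' m' B'.
           series_refinement K H n A n' A' \<and>
           series_refinement K H m B m' B' \<and>
           series_equivalent K H n' A' m' B'"
proof -
  interpret hopf_algebra K H by fact
  note fd = assms(2) and A = assms(3) and B = assms(4)
  \<comment> \<open>If one length is 0, so are those of both Schreier series, and they cannot
    contain interior terms of the other series. In that case the other series itself refines
    both.\<close>
  consider "n = 0" | "m = 0" | "0 < n" "0 < m" by auto
  then show ?thesis
  proof cases
    case 1
    then show ?thesis using series_refinement_refl[OF B] series_equivalent_refl[OF fd B] by blast
  next
    case 2
    then show ?thesis using series_refinement_refl[OF A] series_equivalent_refl[OF fd A] by blast
  next
    case 3
    then show ?thesis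
      using schreier_refinement[OF fd A B] schreier_refinement[OF fd B A] schreier_equivalent[OF fd A B]
      by blast
  qed
qed

end
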